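(* Consider the quasi-static MIMO channel with transmitter CSI described in the context. Let $\Lambda_1\ge\dots\ge\Lambda_m$ be the $m$ largest eigenvalues of $\mathbb{H}\mathbb{H}^H$, let $\bar\gamma$ be the solution of $\sum_{j=1}^m[\bar\gamma-1/\Lambda_j]^+=\rho$, and let $v_j^*=[\bar\gamma-1/\Lambda_j]^+$, $j=1,\dots,m$. Let $n\ge t+r$. For every $0<\epsilon<1$ and every $0<\tau<\epsilon$ there exists an $(n,M,\epsilon)_{\mathrm{tx}}$ code satisfying $$\frac{\log M}{n}\ge\frac1n\log\frac{\tau}{\Pr\big[\prod_{j=1}^rB_j\le\gamma_n\big]},$$ where $B_j\sim\mathrm{Beta}(n-t-j+1,t)$, $j=1,\dots,r$, are independent, and $\gamma_n\in[0,1]$ is chosen so that $$\Pr\Big[\sin^2\big\{I_{n,t},\ \sqrt n\,I_{n,t}\,D+\mathbb{W}\big\}\le\gamma_n\Big]\ge1-\epsilon+\tau,$$ where $D\in\mathbb{C}^{t\times r}$ is the matrix with $D_{jj}=\sqrt{v_j^*\Lambda_j}$ for $j=1,\dots,m$ and all other entries zero.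
   Context: Fix integers $t,r\ge1$, $m=\min\{t,r\}$, $\rho>0$. For blocklength $n$, input $X\in\mathbb{C}^{n\times t}$ yields $\mathbb{Y}=X\mathbb{H}+\mathbb{W}$, where $\mathbb{H}\in\mathbb{C}^{t\times r}$ is random and constant over the block, and $\mathbb{W}\in\mathbb{C}^{n\times r}$ has i.i.d. $\mathcal{CN}(0,1)$ entries independent of $\mathbb{H}$ and the message. An $(n,M,\epsilon)_{\mathrm{tx}}$ code: encoder $f:\{1,\dots,M\}\times\mathbb{C}^{t\times r}\to\mathbb{C}^{n\times t}$ with $\|f(j,H)\|_F^2\le n\rho$ for all $j,H$ ($\|A\|_F^2=\operatorname{tr}(AA^H)$), and a decoder $g:\mathbb{C}^{n\times r}\to\{1,\dots,M\}$ (no knowledge of $\mathbb{H}$) with $\max_j\Pr[g(f(j,\mathbb{H})\mathbb{H}+\mathbb{W})\ne j]\le\epsilon$. $I_{n,t}$ is the $n\times t$ matrix consisting of the first $t$ columns of $I_n$. $[x]^+=\max\{x,0\}$. Principal angles: for subspaces $\mathcal{A},\mathcal{B}\subseteq\mathbb{C}^n$ with $a=\dim\mathcal{A}\le\dim\mathcal{B}$, define recursively $\cos\theta_k=\max|\langle\mathbf{a},\mathbf{b}\rangle|$ over unit vectors $\mathbf{a}\in\mathcal{A},\mathbf{b}\in\mathcal{B}$ orthogonal to $\mathbf{a}_1,\dots,\mathbf{a}_{k-1}$ and $\mathbf{b}_1,\dots,\mathbf{b}_{k-1}$ respectively, where $(\mathbf{a}_i,\mathbf{b}_i)$ are the maximizers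 at step $i$; $0\le\theta_1\le\dots\le\theta_a\le\pi/2$. Set $\sin\{\mathcal{A},\mathcal{B}\}=\prod_{k=1}^a\sin\theta_k$ (with the lower-dimensional subspace playing the role of $\mathcal{A}$). For matrices, $\sin\{A,B\}$ means $\sin\{\mathrm{span}(A),\mathrm{span}(B)\}$ (column spans). *)

theory Defs
  imports "HOL-Probability.Probability"
          "Jordan_Normal_Form.Schur_Decomposition"
begin

definition cinner :: "complex Matrix.vec \<Rightarrow> complex Matrix.vec \<Rightarrow> complex" where
  "cinner a b = (\<Sum>i<dim_vec a. vec_index a i * cnj (vec_index b i))"

definition unit_cvec :: "nat \<Rightarrow> complex Matrix.vec \<Rightarrow> bool" where
  "unit_cvec n a \<longleftrightarrow> a \<in> carrier_vec n \<and> cinner a a = 1"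

definition col_span :: "complex Matrix.mat \<Rightarrow> complex Matrix.vec set" where
  "col_span A = {A *\<^sub>v c | c. c \<in> carrier_vec (dim_col A)}"

definition cdim :: "nat \<Rightarrow> complex Matrix.vec set \<Rightarrow> nat" where
  "cdim n S = (LEAST k. \<exists>B \<in> carrier_mat n k. S = col_span B)"

definition principal_seq ::
  "nat \<Rightarrow> complex Matrix.vec set \<Rightarrow> complex Matrix.vec set \<Rightarrow> nat \<Rightarrow>
   (nat \<Rightarrow> complex Matrix.vec) \<Rightarrow> (nat \<Rightarrow> complex Matrix.vec) \<Rightarrow> (nat \<Rightarrow> real) \<Rightarrow> bool" where
  "principal_seq n A B a av bv cs \<longleftrightarrow>
     (\<forall>k<a. av k \<in> A \<and> bv k \<in> B \<and> unit_cvec n (av k) \<and> unit_cvec n (bv k) \<and>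
        (\<forall>i<k. cinner (av k) (av i) = 0 \<and> cinner (bv k) (bv i) = 0) \<and>
        cs k = cmod (cinner (av k) (bv k)) \<and>
        (\<forall>x\<in>A. \<forall>y\<in>B. unit_cvec n x \<and> unit_cvec n y \<and>
            (\<forall>i<k. cinner x (av i) = 0 \<and> cinner y (bv i) = 0)
            \<longrightarrow> cmod (cinner x y) \<le> cs k))"

text \<open>Product of the sines of the principal angles, A playing the role of the subspace
  of dimension a (the smaller one).\<close>
definition sin_prod_aux :: "nat \<Rightarrow> complex Matrix.vec set \<Rightarrow> complex Matrix.vec set \<Rightarrow> real" where
  "sin_prod_aux n A B =
     (let a = cdim n A;
          cs = (SOME cs. \<exists>av bv. principal_seq n A B a av bv cs)
      in \<Prod>k<a. sin (arccos (cs k)))"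

definition sin_subspaces :: "nat \<Rightarrow> complex Matrix.vec set \<Rightarrow> complex Matrix.vec set \<Rightarrow> real" where
  "sin_subspaces n A B =
     (if cdim n A \<le> cdim n B then sin_prod_aux n A B else sin_prod_aux n B A)"

definition sin_mat :: "nat \<Rightarrow> complex Matrix.mat \<Rightarrow> complex Matrix.mat \<Rightarrow> real" where
  "sin_mat n A B = sin_subspaces n (col_span A) (col_span B)"

definition Int_mat :: "nat \<Rightarrow> nat \<Rightarrow> complex Matrix.mat" where
  "Int_mat n t = Matrix.mat n t (\<lambda>(i,j). if i = j then 1 else 0)"

definition frob2 :: "complex Matrix.mat \<Rightarrow> real" where
  "frob2 A = Re (\<Sum>i<dim_row A. (A * mat_adjoint A) $$ (i, i))"

text \<open>Eigenvalues of a Hermitian matrix (counted with multiplicity) in non-increasing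
  order: the unique sorted real list whose linear factors give the characteristic polynomial.\<close>
definition eigs_desc :: "complex Matrix.mat \<Rightarrow> real list" where
  "eigs_desc A = (THE ls. length ls = dim_row A \<and> sorted_wrt (\<ge>) ls \<and>
      char_poly A = prod_list (map (\<lambda>l. [:- complex_of_real l, 1:]) ls))"

definition Lam :: "complex Matrix.mat \<Rightarrow> nat \<Rightarrow> real" where
  "Lam H j = eigs_desc (H * mat_adjoint H) ! (j - 1)"

text \<open>[g - 1/Lambda]^+ with the convention 1/0 = infinity.\<close>
definition wf_term :: "real \<Rightarrow> real \<Rightarrow> real" where
  "wf_term g l = (if l > 0 then max 0 (g - 1 / l) else 0)"

definition water_level :: "nat \<Rightarrow> real \<Rightarrow> complex Matrix.mat \<Rightarrow> real" where
  "water_level m \<rho> H = (THE g. (\<Sum>j=1..m. wf_term g (Lam H j)) = \<rho>)"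

definition vstar :: "nat \<Rightarrow> real \<Rightarrow> complex Matrix.mat \<Rightarrow> nat \<Rightarrow> real" where
  "vstar m \<rho> H j = wf_term (water_level m \<rho> H) (Lam H j)"

definition Dmat :: "nat \<Rightarrow> nat \<Rightarrow> real \<Rightarrow> complex Matrix.mat \<Rightarrow> complex Matrix.mat" where
  "Dmat t r \<rho> H = Matrix.mat t r (\<lambda>(i,j). if i = j \<and> i < min t r
      then complex_of_real (sqrt (vstar (min t r) \<rho> H (i+1) * Lam H (i+1))) else 0)"

text \<open>Random matrices are modelled as functions on the index set {..<a} x {..<b}.\<close>
definition mat_space :: "nat \<Rightarrow> nat \<Rightarrow> (nat \<times> nat \<Rightarrow> complex) measure" where
  "mat_space a b = PiM ({..<a} \<times> {..<b}) (\<lambda>_. borel)"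

definition to_mat :: "nat \<Rightarrow> nat \<Rightarrow> (nat \<times> nat \<Rightarrow> complex) \<Rightarrow> complex Matrix.mat" where
  "to_mat a b h = Matrix.mat a b h"

definition cgauss :: "complex measure" where
  "cgauss = density lborel (\<lambda>z. ennreal (exp (- (cmod z)\<^sup>2) / pi))"

definition noise :: "nat \<Rightarrow> nat \<Rightarrow> (nat \<times> nat \<Rightarrow> complex) measure" where
  "noise n r = PiM ({..<n} \<times> {..<r}) (\<lambda>_. cgauss)"

definition beta_measure :: "real \<Rightarrow> real \<Rightarrow> real measure" where
  "beta_measure a b = density lborel
     (\<lambda>x. ennreal (indicator {0<..<1} x * x powr (a - 1) * (1 - x) powr (b - 1) / Beta a b))"

definition beta_prod_prob :: "nat \<Rightarrow> nat \<Rightarrow> nat \<Rightarrow> real \<Rightarrow> real" where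
  "beta_prod_prob n t r g =
     (let P = PiM {1..r} (\<lambda>j. beta_measure (real n - real t - real j + 1) (real t))
      in measure P {x \<in> space P. (\<Prod>j\<in>{1..r}. x j) \<le> g})"

text \<open>(n,M,eps)_tx code for the channel Y = X H + W with H ~ muH (law on t x r matrices),
  W ~ noise n r independent of H: encoder f (message in {1..M}, channel H) with power
  constraint, decoder g without knowledge of H, maximal error probability <= eps.\<close>
definition tx_code ::
  "nat \<Rightarrow> nat \<Rightarrow> nat \<Rightarrow> real \<Rightarrow> (nat \<times> nat \<Rightarrow> complex) measure \<Rightarrow> nat \<Rightarrow> real \<Rightarrow>
   (nat \<Rightarrow> complex Matrix.mat \<Rightarrow> complex Matrix.mat) \<Rightarrow> (complex Matrix.mat \<Rightarrow> nat) \<Rightarrow> bool" where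
  "tx_code n t r \<rho> muH M \<epsilon> f g \<longleftrightarrow>
     M \<ge> 1 \<and>
     (\<forall>j\<in>{1..M}. \<forall>H\<in>carrier_mat t r. f j H \<in> carrier_mat n t \<and> frob2 (f j H) \<le> real n * \<rho>) \<and>
     (\<forall>Y\<in>carrier_mat n r. g Y \<in> {1..M}) \<and>
     (\<forall>j\<in>{1..M}.
        let P = muH \<Otimes>\<^sub>M noise n r;
            E = {(h, w) \<in> space P.
                   g (f j (to_mat t r h) * to_mat t r h + to_mat n r w) \<noteq> j}
        in E \<in> sets P \<and> measure P E \<le> \<epsilon>)"

end

theory Submission
  imports Defs
begin

text \<open>If \<open>P\<close> has orthonormal columns and \<open>Y\<close> has full column rank, the squared sine product of their
  principal angles equals \<open>det (Y\<^sup>H Y - (P\<^sup>H Y)\<^sup>H (P\<^sup>H Y)) / det (Y\<^sup>H Y)\<close>, which is invariant under unitary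
  maps applied to both arguments and under invertible column operations on \<open>Y\<close>.  A codeword is a frame
  \<open>P\<close> followed by a square root of the water-filling covariance, a measurable function of the
  channel matrix; by unitary invariance and the singular value decomposition the angles between
  \<open>P\<close> and its own output are distributed as in the diagonalised channel.  The decoder tests whether the
  angles between a frame and the received matrix are small.  For a random frame independent of the received
  matrix the test succeeds with the probability that a product of independent Beta variables is at
  most \<open>\<gamma>\<close>: appending Gaussian columns one by one multiplies the statistic by independent ratios of
  Gamma variables.  Hence, as long as \<open>M\<close> frames satisfy \<open>M * beta_prod_prob n t r \<gamma> < \<tau>\<close>, some further
  frame has an output that passes one of the earlier tests with probability less than \<open>\<tau>\<close>, and the
  greedy construction (as in Feinstein's lemma) continues.\<close>

section \<open>Matrices with orthonormal columns\<close>

text \<open>A code must have measurable error events, so the encoder may not pick singular vectors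
  of the channel: hence the Hermitian square root, which is a polynomial in
  \<open>H * H\<^sup>H\<close>. The unitary by which it differs from the diagonal power allocation
  only changes the basis of the span of the frame, to which the test is blind. The greedy step needs
  a fixed test and a random codeword, whereas the Beta law concerns a random frame and a fixed
  output. Rotating test, codeword and noise together changes no probability, so the fixed test may
  be replaced by an independent random frame, and then the output may be held fixed. Principal
  angles are defined by an arbitrary choice of maximizers; the determinant formula shows that their
  sine product does not depend on it. The formula needs full column rank, which a fixed matrix plus
  Gaussian noise has almost surely. The j-th codeword competes with j - 1 earlier tests only. So M
  codewords exist if (M - 1) times the Beta probability is below \<tau>, which leaves room for
  rounding up.\<close>

notation mat_adjoint (\<open>_\<^sup>H\<close> [1000] 999)
notation vec_index (infixl \<open>$v\<close> 100)

lemma adj_dim [simp]: "dim_row (A\<^sup>H) = dim_col A" "dim_col (A\<^sup>H) = dim_row A"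
  by (auto simp: mat_adjoint_def mat_of_rows_def)

lemma adj_carrier [simp]: "A\<^sup>H \<in> carrier_mat m n \<longleftrightarrow> A \<in> carrier_mat n m"
  unfolding carrier_mat_def by auto

lemma adj_index [simp]:
  fixes A :: "complex Matrix.mat"
  assumes "i < dim_col A" "j < dim_row A"
  shows "A\<^sup>H $$ (i, j) = cnj (A $$ (j, i))"
  using assms by (simp add: mat_adjoint_def mat_of_rows_index conjugate_vec_def)

lemma adj_adj [simp]: "(A\<^sup>H)\<^sup>H = (A :: complex Matrix.mat)"
  by (rule eq_matI) auto

lemma mult_index:
  assumes "A \<in> carrier_mat a b" "B \<in> carrier_mat b c" "i < a" "j < c"
  shows "(A * B) $$ (i, j) = (\<Sum>k<b. A $$ (i, k) * B $$ (k, j))"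
  using assms by (auto simp: scalar_prod_def lessThan_atLeast0 intro!: sum.cong)

lemma mult_vec_index:
  assumes "A \<in> carrier_mat a b" "v \<in> carrier_vec b" "i < a"
  shows "(A *\<^sub>v v) $v i = (\<Sum>k<b. A $$ (i, k) * v $v k)"
  using assms by (auto simp: scalar_prod_def lessThan_atLeast0 intro!: sum.cong)

lemma adj_mult:
  fixes A B :: "complex Matrix.mat"
  assumes "A \<in> carrier_mat a b" "B \<in> carrier_mat b c"
  shows "(A * B)\<^sup>H = B\<^sup>H * A\<^sup>H"
proof (rule eq_matI)
  fix i j assume "i < dim_row (B\<^sup>H * A\<^sup>H)" "j < dim_col (B\<^sup>H * A\<^sup>H)"
  then have ij: "i < c" "j < a" using assms by auto
  have "(A * B)\<^sup>H $$ (i, j) = cnj ((A * B) $$ (j, i))" using assms ij by auto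
  also have "\<dots> = (\<Sum>k<b. cnj (A $$ (j, k)) * cnj (B $$ (k, i)))"
    unfolding mult_index[OF assms ij(2,1)] by simp
  also have "\<dots> = (\<Sum>k<b. B\<^sup>H $$ (i, k) * A\<^sup>H $$ (k, j))"
    using assms ij by (auto intro!: sum.cong)
  also have "\<dots> = (B\<^sup>H * A\<^sup>H) $$ (i, j)"
    by (rule mult_index[symmetric, of _ c b _ a]) (use assms ij in auto)
  finally show "(A * B)\<^sup>H $$ (i, j) = (B\<^sup>H * A\<^sup>H) $$ (i, j)" .
qed (use assms in auto)

lemma adj_one [simp]: "(1\<^sub>m n :: complex Matrix.mat)\<^sup>H = 1\<^sub>m n"
  by (rule eq_matI) auto

lemma adj_eq_transpose: "A\<^sup>H = map_mat cnj (A\<^sup>T)" for A :: "complex Matrix.mat"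
  by (rule eq_matI) auto

lemma det_adj:
  fixes A :: "complex Matrix.mat"
  assumes "A \<in> carrier_mat n n"
  shows "Determinant.det (A\<^sup>H) = cnj (Determinant.det A)"
proof -
  have "Determinant.det (map_mat cnj (A\<^sup>T)) = cnj (Determinant.det (A\<^sup>T))"
    using assms by (auto simp: Determinant.det_def sign_def intro!: sum.cong prod.cong arg_cong2[of _ _ _ _ "(*)"])
  then show ?thesis using Determinant.det_transpose[OF assms] by (simp add: adj_eq_transpose)
qed

lemma adj_mult_self_index:
  fixes A B :: "complex Matrix.mat"
  assumes "A \<in> carrier_mat n a" "B \<in> carrier_mat n b" "i < a" "j < b"
  shows "(A\<^sup>H * B) $$ (i, j) = (\<Sum>k<n. cnj (A $$ (k, i)) * B $$ (k, j))"
  by (subst mult_index[of _ a n _ b]) (use assms in \<open>auto intro!: sum.cong\<close>)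

text \<open>Padding with zero rows yields a square matrix whose last row vanishes. Every term of the
  Leibniz formula contains an entry of that row, so the determinant is 0.\<close>

lemma exists_kernel_vec:
  fixes A :: "complex Matrix.mat"
  assumes A: "A \<in> carrier_mat a b" and ab: "a < b"
  obtains v where "v \<in> carrier_vec b" "v \<noteq> 0\<^sub>v b" "A *\<^sub>v v = 0\<^sub>v a"
proof -
  define B where "B = Matrix.mat b b (\<lambda>(i, j). if i < a then A $$ (i, j) else 0)"
  have B: "B \<in> carrier_mat b b" by (simp add: B_def)
  have "Determinant.det B = 0"
    unfolding det_def'[OF B]
  proof (rule sum.neutral, rule ballI)
    fix p assume p: "p \<in> {p. p permutes {0..<b}}"
    have "p (b - 1) < b" using p ab permutes_in_image[of p "{0..<b}" "b - 1"] by auto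
    then have "B $$ (b - 1, p (b - 1)) = 0" using ab by (auto simp: B_def)
    then have "(\<Prod>i = 0..<b. B $$ (i, p i)) = 0" using ab by (intro prod_zero) (auto intro!: bexI[of _ "b - 1"])
    then show "signof p * (\<Prod>i = 0..<b. B $$ (i, p i)) = 0" by simp
  qed
  then obtain v where v: "v \<in> carrier_vec b" "v \<noteq> 0\<^sub>v b" "B *\<^sub>v v = 0\<^sub>v b"
    using det_0_iff_vec_prod_zero[OF B] by auto
  have "A *\<^sub>v v = 0\<^sub>v a"
  proof (rule eq_vecI)
    fix i assume "i < dim_vec (0\<^sub>v a :: complex Matrix.vec)"
    then have i: "i < a" by simp
    have "(A *\<^sub>v v) $v i = (B *\<^sub>v v) $v i"
      unfolding mult_vec_index[OF A v(1) i] using mult_vec_index[OF B v(1), of i] i ab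
      by (auto simp: B_def intro!: sum.cong)
    then show "(A *\<^sub>v v) $v i = 0\<^sub>v a $v i" using v(3) i ab by simp
  qed (use A in auto)
  with v that show ?thesis by auto
qed

section \<open>Isometries and their completion to unitaries\<close>

definition orthocols :: "nat \<Rightarrow> nat \<Rightarrow> complex Matrix.mat \<Rightarrow> bool" where
  "orthocols n k Q \<longleftrightarrow> Q \<in> carrier_mat n k \<and> Q\<^sup>H * Q = 1\<^sub>m k"

lemma orthocols_carrier: "orthocols n k Q \<Longrightarrow> Q \<in> carrier_mat n k"
  by (simp add: orthocols_def)

lemma orthocolsD: "orthocols n k Q \<Longrightarrow> Q\<^sup>H * Q = 1\<^sub>m k"
  by (simp add: orthocols_def)

lemma unitary_right:
  assumes "orthocols n n U" shows "U * U\<^sup>H = 1\<^sub>m n"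
  using assms mat_mult_left_right_inverse[of "U\<^sup>H" n U] by (auto simp: orthocols_def)

lemma unitary_adj: "orthocols n n U \<Longrightarrow> orthocols n n (U\<^sup>H)"
  using unitary_right by (auto simp: orthocols_def)

lemma assoc_mult_mat4:
  assumes "A \<in> carrier_mat a b" "B \<in> carrier_mat b c" "C \<in> carrier_mat c d" "D \<in> carrier_mat d e"
  shows "(A * B) * (C * D) = A * ((B * C) * D)"
proof -
  have "(A * B) * (C * D) = A * (B * (C * D))"
    by (rule assoc_mult_mat[of _ a b _ c _ e]) (use assms in auto)
  also have "B * (C * D) = B * C * D"
    by (rule assoc_mult_mat[symmetric, of _ b c _ d _ e]) (use assms in auto)
  finally show ?thesis .
qed

lemma orthocols_mult:
  assumes "orthocols n k A" "orthocols k l B" shows "orthocols n l (A * B)"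
proof -
  have A: "A \<in> carrier_mat n k" and B: "B \<in> carrier_mat k l" using assms by (auto simp: orthocols_def)
  have "(A * B)\<^sup>H * (A * B) = B\<^sup>H * ((A\<^sup>H * A) * B)"
    unfolding adj_mult[OF A B] by (rule assoc_mult_mat4[of _ l k _ n _ k _ l]) (use A B in auto)
  also have "\<dots> = 1\<^sub>m l"
    unfolding orthocolsD[OF assms(1)] left_mult_one_mat[OF B] by (rule orthocolsD[OF assms(2)])
  finally show ?thesis using A B by (auto simp: orthocols_def)
qed

lemma orthocols_one [simp]: "orthocols n n (1\<^sub>m n)" by (auto simp: orthocols_def)

lemma cnj_mult_self: "cnj x * x = complex_of_real ((cmod x)\<^sup>2)"
  by (metis complex_norm_square mult.commute of_real_power)

definition nsq :: "complex Matrix.vec \<Rightarrow> real" where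
  "nsq v = (\<Sum>i<dim_vec v. (cmod (v $v i))\<^sup>2)"

lemma nsq_nonneg: "nsq v \<ge> 0" by (auto simp: nsq_def intro: sum_nonneg)

lemma nsq_eq_0_iff: assumes "v \<in> carrier_vec n" shows "nsq v = 0 \<longleftrightarrow> v = 0\<^sub>v n"
proof -
  have d: "dim_vec v = n" using assms by simp
  have "nsq v = 0 \<longleftrightarrow> (\<forall>i<n. v $v i = 0)"
    unfolding nsq_def d by (subst sum_nonneg_eq_0_iff) auto
  also have "\<dots> \<longleftrightarrow> v = 0\<^sub>v n" by (metis d eq_vecI index_zero_vec)
  finally show ?thesis .
qed

lemma nsq_smult: "nsq (c \<cdot>\<^sub>v v) = (cmod c)\<^sup>2 * nsq v"
  by (auto simp: nsq_def norm_mult power_mult_distrib sum_distrib_left)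

definition append_col :: "complex Matrix.mat \<Rightarrow> complex Matrix.vec \<Rightarrow> complex Matrix.mat" where
  "append_col Q q = Matrix.mat (dim_row Q) (Suc (dim_col Q)) (\<lambda>(i, j). if j < dim_col Q then Q $$ (i, j) else q $v i)"

lemma append_col_carrier: "Q \<in> carrier_mat n k \<Longrightarrow> append_col Q q \<in> carrier_mat n (Suc k)"
  by (auto simp: append_col_def)

lemma append_col_index:
  "Q \<in> carrier_mat n k \<Longrightarrow> i < n \<Longrightarrow> j < k \<Longrightarrow> append_col Q q $$ (i, j) = Q $$ (i, j)"
  "Q \<in> carrier_mat n k \<Longrightarrow> i < n \<Longrightarrow> append_col Q q $$ (i, k) = q $v i"
  by (auto simp: append_col_def)

lemma orthocols_append:
  assumes Q: "orthocols n k Q" and q: "q \<in> carrier_vec n" "nsq q = 1" "Q\<^sup>H *\<^sub>v q = 0\<^sub>v k"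
  shows "orthocols n (Suc k) (append_col Q q)"
proof -
  have Qc: "Q \<in> carrier_mat n k" and QQ: "Q\<^sup>H * Q = 1\<^sub>m k" using Q by (auto simp: orthocols_def)
  let ?R = "append_col Q q"
  have R: "?R \<in> carrier_mat n (Suc k)" using Qc by (rule append_col_carrier)
  have z: "(\<Sum>l<n. cnj (Q $$ (l, i)) * q $v l) = 0" if "i < k" for i
  proof -
    have "(\<Sum>l<n. cnj (Q $$ (l, i)) * q $v l) = (Q\<^sup>H *\<^sub>v q) $v i"
      by (subst mult_vec_index[of _ k n]) (use Qc q that in \<open>auto intro!: sum.cong\<close>)
    then show ?thesis using q that by simp
  qed
  have z': "(\<Sum>l<n. cnj (q $v l) * Q $$ (l, i)) = 0" if "i < k" for i
    using arg_cong[OF z[OF that], of cnj] by (simp add: mult.commute)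
  have o: "(\<Sum>l<n. cnj (q $v l) * q $v l) = 1"
  proof -
    have "(\<Sum>l<n. cnj (q $v l) * q $v l) = of_real (nsq q)"
      using q(1) by (auto simp: nsq_def cnj_mult_self intro!: sum.cong)
    then show ?thesis using q by simp
  qed
  have d: "(\<Sum>l<n. cnj (Q $$ (l, i)) * Q $$ (l, j)) = (if i = j then 1 else 0)" if "i < k" "j < k" for i j
    using adj_mult_self_index[OF Qc Qc that] QQ that by simp
  have "?R\<^sup>H * ?R = 1\<^sub>m (Suc k)"
  proof (rule eq_matI)
    fix i j assume "i < dim_row (1\<^sub>m (Suc k) :: complex Matrix.mat)" "j < dim_col (1\<^sub>m (Suc k) :: complex Matrix.mat)"
    then have ij: "i < Suc k" "j < Suc k" by auto
    have "(?R\<^sup>H * ?R) $$ (i, j) = (\<Sum>l<n. cnj (?R $$ (l, i)) * ?R $$ (l, j))"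
      by (rule adj_mult_self_index[OF R R ij])
    also have "\<dots> = (if i = j then 1 else 0)"
      using ij z z' o d Qc by (auto simp: append_col_index less_Suc_eq)
    finally show "(?R\<^sup>H * ?R) $$ (i, j) = 1\<^sub>m (Suc k) $$ (i, j)" using ij by simp
  qed (use R in auto)
  then show ?thesis using R by (simp add: orthocols_def)
qed

lemma exists_unit_orthogonal:
  assumes Q: "Q \<in> carrier_mat n k" and kn: "k < n"
  obtains q where "q \<in> carrier_vec n" "nsq q = 1" "Q\<^sup>H *\<^sub>v q = 0\<^sub>v k"
proof -
  have "Q\<^sup>H \<in> carrier_mat k n" using Q by simp
  from exists_kernel_vec[OF this kn] obtain v where
    v: "v \<in> carrier_vec n" "v \<noteq> 0\<^sub>v n" "Q\<^sup>H *\<^sub>v v = 0\<^sub>v k" by blast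
  have pos: "nsq v > 0" using nsq_nonneg[of v] nsq_eq_0_iff[OF v(1)] v(2) by simp
  define c where "c = complex_of_real (1 / sqrt (nsq v))"
  have "nsq (c \<cdot>\<^sub>v v) = 1" using pos by (simp add: nsq_smult c_def norm_divide power_divide)
  moreover have "Q\<^sup>H *\<^sub>v (c \<cdot>\<^sub>v v) = 0\<^sub>v k"
    using Q v mult_mat_vec[of "Q\<^sup>H" k n v c] by (auto intro!: eq_vecI)
  ultimately show ?thesis using that[of "c \<cdot>\<^sub>v v"] v by simp
qed

text \<open>Columns are added one at a time, each a normalized kernel vector of the adjoint of what
  is already there. This turns frames into unitaries, and later carries any frame to any
  other.\<close>

lemma orthocols_completion:
  assumes "orthocols n k Q" "k \<le> n"
  obtains U where "orthocols n n U" "\<And>i j. i < n \<Longrightarrow> j < k \<Longrightarrow> U $$ (i, j) = Q $$ (i, j)"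
proof -
  have "\<exists>U. orthocols n (k + d) U \<and> (\<forall>i<n. \<forall>j<k. U $$ (i, j) = Q $$ (i, j))" if "k + d \<le> n" for d
    using that
  proof (induction d)
    case 0
    then show ?case using assms by auto
  next
    case (Suc d)
    then obtain U where U: "orthocols n (k + d) U" "\<forall>i<n. \<forall>j<k. U $$ (i, j) = Q $$ (i, j)" by auto
    have Uc: "U \<in> carrier_mat n (k + d)" using U by (simp add: orthocols_def)
    obtain q where "q \<in> carrier_vec n" "nsq q = 1" "U\<^sup>H *\<^sub>v q = 0\<^sub>v (k + d)"
      using exists_unit_orthogonal[OF Uc] Suc.prems by auto
    from orthocols_append[OF U(1) this] show ?case
      using U Uc by (intro exI[of _ "append_col U q"]) (auto simp: append_col_index)
  qed
  from this[of "n - k"] assms that show ?thesis by auto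
qed

text \<open>An isometry has trivial kernel, whereas a matrix with more columns than rows annihilates
  some nonzero vector.\<close>

lemma orthocols_le:
  assumes "orthocols n k Q" shows "k \<le> n"
proof (rule ccontr)
  assume "\<not> k \<le> n"
  then obtain v where v: "v \<in> carrier_vec k" "v \<noteq> 0\<^sub>v k" "Q *\<^sub>v v = 0\<^sub>v n"
    using exists_kernel_vec[of Q n k] assms by (auto simp: orthocols_def)
  have Q: "Q \<in> carrier_mat n k" "Q\<^sup>H \<in> carrier_mat k n" and QQ: "Q\<^sup>H * Q = 1\<^sub>m k"
    using assms by (auto simp: orthocols_def)
  have "v = (Q\<^sup>H * Q) *\<^sub>v v" unfolding QQ using v(1) by simp
  also have "\<dots> = Q\<^sup>H *\<^sub>v (Q *\<^sub>v v)" by (rule assoc_mult_mat_vec[OF Q(2,1) v(1)])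
  also have "\<dots> = 0\<^sub>v k" unfolding v(3) using Q(2) by (intro eq_vecI) auto
  finally show False using v by simp
qed

section \<open>Spectral theorem for Hermitian matrices\<close>

lemma mult_minus_vec:
  fixes A :: "complex Matrix.mat"
  assumes "A \<in> carrier_mat a b" "x \<in> carrier_vec b" "y \<in> carrier_vec b"
  shows "A *\<^sub>v (x - y) = A *\<^sub>v x - A *\<^sub>v y"
  using assms by (intro eq_vecI) (auto simp: scalar_prod_minus_distrib[of _ b])

lemma exists_unit_eigenvector:
  fixes A :: "complex Matrix.mat"
  assumes A: "A \<in> carrier_mat m m" and m: "m > 0"
  obtains c l where "c \<in> carrier_vec m" "nsq c = 1" "A *\<^sub>v c = l \<cdot>\<^sub>v c"
proof -
  obtain as where as: "char_poly A = (\<Prod>a\<leftarrow>as. [:- a, 1:])" "length as = m"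
    using char_poly_factorized[OF A] by auto
  then obtain l where "l \<in> set as" using m by (cases as) auto
  then have "poly (char_poly A) l = 0" unfolding as(1) by (induction as) auto
  then have "eigenvalue A l" using eigenvalue_root_char_poly[OF A] by simp
  then obtain v where v: "v \<in> carrier_vec m" "v \<noteq> 0\<^sub>v m" "A *\<^sub>v v = l \<cdot>\<^sub>v v"
    using A by (auto simp: eigenvalue_def eigenvector_def)
  have pos: "nsq v > 0" using nsq_nonneg[of v] nsq_eq_0_iff[OF v(1)] v(2) by simp
  define s where "s = complex_of_real (1 / sqrt (nsq v))"
  have "nsq (s \<cdot>\<^sub>v v) = 1" using pos by (simp add: nsq_smult s_def norm_divide power_divide)
  moreover have "A *\<^sub>v (s \<cdot>\<^sub>v v) = l \<cdot>\<^sub>v (s \<cdot>\<^sub>v v)"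
    unfolding mult_mat_vec[OF A v(1)] v(3) by (simp add: smult_smult_assoc mult.commute)
  ultimately show ?thesis using that[of "s \<cdot>\<^sub>v v" l] v(1) by simp
qed

lemma nsq_orthocols:
  assumes Q: "orthocols n k Q" and c: "c \<in> carrier_vec k"
  shows "nsq (Q *\<^sub>v c) = nsq c"
proof -
  have Qc: "Q \<in> carrier_mat n k" using Q by (rule orthocols_carrier)
  have "complex_of_real (nsq (Q *\<^sub>v c)) = (\<Sum>l<n. cnj ((Q *\<^sub>v c) $v l) * (Q *\<^sub>v c) $v l)"
    using Qc c by (auto simp: nsq_def cnj_mult_self intro!: sum.cong)
  also have "\<dots> = (\<Sum>l<n. (\<Sum>i<k. cnj (Q $$ (l, i)) * cnj (c $v i)) * (\<Sum>j<k. Q $$ (l, j) * c $v j))"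
    by (intro sum.cong refl) (simp add: mult_vec_index[OF Qc c])
  also have "\<dots> = (\<Sum>l<n. \<Sum>i<k. \<Sum>j<k. cnj (c $v i) * c $v j * (cnj (Q $$ (l, i)) * Q $$ (l, j)))"
    unfolding sum_product by (intro sum.cong refl) simp
  also have "\<dots> = (\<Sum>i<k. \<Sum>j<k. cnj (c $v i) * c $v j * (\<Sum>l<n. cnj (Q $$ (l, i)) * Q $$ (l, j)))"
    by (rule trans[OF sum.swap], rule sum.cong[OF refl], rule trans[OF sum.swap]) (simp add: sum_distrib_left)
  also have "\<dots> = (\<Sum>i<k. \<Sum>j<k. cnj (c $v i) * c $v j * (if i = j then 1 else 0))"
    using orthocolsD[OF Q] by (intro sum.cong refl) (auto simp: adj_mult_self_index[OF Qc Qc, symmetric])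
  also have "\<dots> = (\<Sum>i<k. cnj (c $v i) * c $v i)"
    by (intro sum.cong refl) (simp add: if_distrib[of "\<lambda>x. _ * x"] sum.delta cong: if_cong)
  also have "\<dots> = complex_of_real (nsq c)"
    using c by (auto simp: nsq_def cnj_mult_self intro!: sum.cong)
  finally show ?thesis using of_real_eq_iff by blast
qed

lemma mat_diag_dims [simp]: "dim_row (mat_diag n f) = n" "dim_col (mat_diag n f) = n"
  by (simp_all add: mat_diag_def)

lemma mult_mat_vec_zero [simp]:
  "A \<in> carrier_mat a b \<Longrightarrow> A *\<^sub>v 0\<^sub>v b = (0\<^sub>v a :: complex Matrix.vec)"
  by (intro eq_vecI) auto

text \<open>Eigenvectors are collected one by one. The compression of \<open>A\<close> to the
  orthogonal complement of those already found has an eigenvector, and Hermitian symmetry makes that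
  complement invariant, so it is an eigenvector of \<open>A\<close> itself. The eigenvalues are
  still complex here.\<close>

lemma hermitian_eigenbasis_aux:
  fixes A :: "complex Matrix.mat"
  assumes A: "A \<in> carrier_mat n n" and h: "A\<^sup>H = A"
  shows "k \<le> n \<Longrightarrow> \<exists>Q d. orthocols n k Q \<and> A * Q = Q * mat_diag k d"
proof (induction k)
  case 0
  show ?case
    by (rule exI[of _ "0\<^sub>m n 0"], rule exI[of _ "\<lambda>_. 0"]) (use A in \<open>auto simp: orthocols_def intro!: eq_matI\<close>)
next
  case (Suc k)
  then obtain Q d where Q: "orthocols n k Q" and AQ: "A * Q = Q * mat_diag k d" by auto
  have Qc: "Q \<in> carrier_mat n k" using Q by (rule orthocols_carrier)
  obtain U where U: "orthocols n n U" "\<And>i j. i < n \<Longrightarrow> j < k \<Longrightarrow> U $$ (i, j) = Q $$ (i, j)"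
    using orthocols_completion[OF Q] Suc.prems by auto
  have Uc: "U \<in> carrier_mat n n" using U(1) by (rule orthocols_carrier)
  define m where "m = n - k"
  have m: "m > 0" "k + m = n" using Suc.prems by (auto simp: m_def)
  \<comment> \<open>The columns of \<open>U\<close> beyond the first \<open>k\<close> form an
    orthonormal basis of the complement of the columns of \<open>Q\<close>.\<close>
  define R where "R = Matrix.mat n m (\<lambda>(i, j). U $$ (i, k + j))"
  have Rc: "R \<in> carrier_mat n m" by (simp add: R_def)
  have UU: "(\<Sum>l<n. cnj (U $$ (l, i)) * U $$ (l, j)) = (if i = j then 1 else 0)" if "i < n" "j < n" for i j
    using adj_mult_self_index[OF Uc Uc that] orthocolsD[OF U(1)] that by simp
  have R: "orthocols n m R"
    unfolding orthocols_def
  proof (intro conjI Rc eq_matI)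
    fix i j assume "i < dim_row (1\<^sub>m m :: complex Matrix.mat)" "j < dim_col (1\<^sub>m m :: complex Matrix.mat)"
    then have ij: "i < m" "j < m" by auto
    have "(R\<^sup>H * R) $$ (i, j) = (\<Sum>l<n. cnj (U $$ (l, k + i)) * U $$ (l, k + j))"
      unfolding adj_mult_self_index[OF Rc Rc ij] using ij by (auto simp: R_def intro!: sum.cong)
    then show "(R\<^sup>H * R) $$ (i, j) = 1\<^sub>m m $$ (i, j)" using ij m UU[of "k + i" "k + j"] by simp
  qed (use Rc in auto)
  have QR: "Q\<^sup>H * R = 0\<^sub>m k m"
  proof (intro eq_matI)
    fix i j assume "i < dim_row (0\<^sub>m k m :: complex Matrix.mat)" "j < dim_col (0\<^sub>m k m :: complex Matrix.mat)"
    then have ij: "i < k" "j < m" by auto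
    have "(Q\<^sup>H * R) $$ (i, j) = (\<Sum>l<n. cnj (U $$ (l, i)) * U $$ (l, k + j))"
      unfolding adj_mult_self_index[OF Qc Rc ij] using ij U(2) by (auto simp: R_def intro!: sum.cong)
    then show "(Q\<^sup>H * R) $$ (i, j) = 0\<^sub>m k m $$ (i, j)" using ij m UU[of i "k + j"] by simp
  qed (use Rc Qc in auto)
  have "R\<^sup>H * (A * R) \<in> carrier_mat m m" using Rc A by (auto intro!: mult_carrier_mat)
  from exists_unit_eigenvector[OF this m(1)] obtain c l where
    c: "c \<in> carrier_vec m" "nsq c = 1" "(R\<^sup>H * (A * R)) *\<^sub>v c = l \<cdot>\<^sub>v c" by blast
  define q where "q = R *\<^sub>v c"
  have q: "q \<in> carrier_vec n" "nsq q = 1" using c Rc nsq_orthocols[OF R c(1)] by (auto simp: q_def)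
  have Qq: "Q\<^sup>H *\<^sub>v q = 0\<^sub>v k"
  proof -
    have "Q\<^sup>H *\<^sub>v q = (Q\<^sup>H * R) *\<^sub>v c" unfolding q_def
      by (rule assoc_mult_mat_vec[symmetric, of _ k n _ m]) (use Qc Rc c in auto)
    also have "\<dots> = 0\<^sub>v k" unfolding QR using c by (intro eq_vecI) auto
    finally show ?thesis .
  qed
  have Aq: "A *\<^sub>v q = l \<cdot>\<^sub>v q"
  proof -
    \<comment> \<open>The residual is orthogonal to \<open>Q\<close> because \<open>A\<close> is
      Hermitian and preserves the span of \<open>Q\<close>, and to \<open>R\<close> by the choice of
      \<open>c\<close>. Being orthogonal to the whole basis \<open>U\<close>, it vanishes.\<close>
    define z where "z = A *\<^sub>v q - l \<cdot>\<^sub>v q"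
    have z: "z \<in> carrier_vec n" using A q by (auto simp: z_def)
    have "Q\<^sup>H *\<^sub>v (A *\<^sub>v q) = (Q\<^sup>H * A) *\<^sub>v q"
      by (rule assoc_mult_mat_vec[symmetric, of _ k n _ n]) (use Qc A q in auto)
    also have "Q\<^sup>H * A = (A * Q)\<^sup>H" using adj_mult[OF A Qc] h by simp
    also have "\<dots> = (mat_diag k d)\<^sup>H * Q\<^sup>H" unfolding AQ by (rule adj_mult[OF Qc mat_diag_dim])
    also have "(mat_diag k d)\<^sup>H * Q\<^sup>H *\<^sub>v q = (mat_diag k d)\<^sup>H *\<^sub>v (Q\<^sup>H *\<^sub>v q)"
      by (rule assoc_mult_mat_vec[of _ k k _ n]) (use Qc q in auto)
    also have "\<dots> = 0\<^sub>v k" unfolding Qq by (rule mult_mat_vec_zero) simp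
    finally have 1: "Q\<^sup>H *\<^sub>v (A *\<^sub>v q) = 0\<^sub>v k" .
    have "Q\<^sup>H *\<^sub>v z = Q\<^sup>H *\<^sub>v (A *\<^sub>v q) - l \<cdot>\<^sub>v (Q\<^sup>H *\<^sub>v q)"
      unfolding z_def using Qc A q by (subst mult_minus_vec[of _ k n]) (auto simp: mult_mat_vec[of _ k n])
    also have "\<dots> = 0\<^sub>v k" unfolding 1 Qq by (intro eq_vecI) auto
    finally have Qz: "Q\<^sup>H *\<^sub>v z = 0\<^sub>v k" .
    have "R\<^sup>H *\<^sub>v q = (R\<^sup>H * R) *\<^sub>v c" unfolding q_def
      by (rule assoc_mult_mat_vec[symmetric, of _ m n _ m]) (use Rc c in auto)
    also have "\<dots> = c" unfolding orthocolsD[OF R] using c by simp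
    finally have 2: "R\<^sup>H *\<^sub>v q = c" .
    have "R\<^sup>H *\<^sub>v (A *\<^sub>v q) = R\<^sup>H *\<^sub>v ((A * R) *\<^sub>v c)" unfolding q_def
      by (subst assoc_mult_mat_vec[of _ n n _ m]) (use A Rc c in auto)
    also have "\<dots> = (R\<^sup>H * (A * R)) *\<^sub>v c"
      by (rule assoc_mult_mat_vec[symmetric, of _ m n _ m]) (use A Rc c in auto)
    finally have 3: "R\<^sup>H *\<^sub>v (A *\<^sub>v q) = l \<cdot>\<^sub>v c" unfolding c(3) .
    have "R\<^sup>H *\<^sub>v z = R\<^sup>H *\<^sub>v (A *\<^sub>v q) - l \<cdot>\<^sub>v (R\<^sup>H *\<^sub>v q)"
      unfolding z_def using Rc A q by (subst mult_minus_vec[of _ m n]) (auto simp: mult_mat_vec[of _ m n])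
    also have "\<dots> = 0\<^sub>v m"
      unfolding 2 3 using c(1) by (intro minus_cancel_vec) simp
    finally have Rz: "R\<^sup>H *\<^sub>v z = 0\<^sub>v m" .
    have "U\<^sup>H *\<^sub>v z = 0\<^sub>v n"
    proof (rule eq_vecI)
      fix i assume "i < dim_vec (0\<^sub>v n :: complex Matrix.vec)"
      then have i: "i < n" by simp
      have *: "(U\<^sup>H *\<^sub>v z) $v i = (\<Sum>l<n. cnj (U $$ (l, i)) * z $v l)"
        by (subst mult_vec_index[of _ n n]) (use Uc z i in auto)
      show "(U\<^sup>H *\<^sub>v z) $v i = 0\<^sub>v n $v i"
      proof (cases "i < k")
        case True
        have "(Q\<^sup>H *\<^sub>v z) $v i = (\<Sum>l<n. cnj (U $$ (l, i)) * z $v l)"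
          by (subst mult_vec_index[of _ k n]) (use Qc z True U(2) in auto)
        then show ?thesis unfolding * Qz using True i by simp
      next
        case False
        have "(R\<^sup>H *\<^sub>v z) $v (i - k) = (\<Sum>l<n. cnj (U $$ (l, i)) * z $v l)"
          by (subst mult_vec_index[of _ m n]) (use Rc z False i m in \<open>auto simp: R_def\<close>)
        then show ?thesis unfolding * Rz using False i m by simp
      qed
    qed (use Uc in auto)
    then have "U *\<^sub>v (U\<^sup>H *\<^sub>v z) = 0\<^sub>v n" using Uc by simp
    moreover have "U *\<^sub>v (U\<^sup>H *\<^sub>v z) = (U * U\<^sup>H) *\<^sub>v z"
      by (rule assoc_mult_mat_vec[symmetric, of _ n n _ n]) (use Uc z in auto)
    ultimately have z0: "z = 0\<^sub>v n" unfolding unitary_right[OF U(1)] using z by simp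
    show ?thesis
    proof (rule eq_vecI)
      fix i assume i: "i < dim_vec (l \<cdot>\<^sub>v q)"
      have "z $v i = 0" using z0 i q by simp
      then show "(A *\<^sub>v q) $v i = (l \<cdot>\<^sub>v q) $v i" using i q A by (simp add: z_def)
    qed (use A q in auto)
  qed
  let ?R = "append_col Q q"
  have R': "?R \<in> carrier_mat n (Suc k)" using Qc by (rule append_col_carrier)
  have "A * ?R = ?R * mat_diag (Suc k) (\<lambda>i. if i < k then d i else l)" (is "_ = _ * mat_diag _ ?d")
  proof (rule eq_matI)
    fix i j assume "i < dim_row (?R * mat_diag (Suc k) ?d)" "j < dim_col (?R * mat_diag (Suc k) ?d)"
    then have ij: "i < n" "j < Suc k" using R' by (auto simp: mat_diag_def)
    have r: "(?R * mat_diag (Suc k) ?d) $$ (i, j) = ?R $$ (i, j) * ?d j"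
      unfolding mat_diag_mult_right[OF R'] using ij by simp
    show "(A * ?R) $$ (i, j) = (?R * mat_diag (Suc k) ?d) $$ (i, j)"
    proof (cases "j < k")
      case True
      have "(A * ?R) $$ (i, j) = (A * Q) $$ (i, j)"
        unfolding mult_index[OF A R' ij] mult_index[OF A Qc ij(1) True]
        using True Qc by (auto simp: append_col_index intro!: sum.cong)
      also have "\<dots> = Q $$ (i, j) * d j"
        unfolding AQ mat_diag_mult_right[OF Qc] using True ij by simp
      finally show ?thesis unfolding r using True ij Qc by (simp add: append_col_index)
    next
      case False
      then have j: "j = k" using ij by simp
      have "(A * ?R) $$ (i, j) = (A *\<^sub>v q) $v i"
        unfolding mult_index[OF A R' ij] mult_vec_index[OF A q(1) ij(1)]
        using j Qc by (auto simp: append_col_index intro!: sum.cong)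
      then show ?thesis unfolding r Aq using j ij Qc q by (simp add: append_col_index)
    qed
  qed (use A R' in \<open>auto simp: mat_diag_def\<close>)
  then show ?case using orthocols_append[OF Q q Qq] by blast
qed

text \<open>The diagonal matrix obtained by conjugation is again Hermitian, which forces its entries
  to be real; permuting the columns then sorts them in decreasing order.\<close>

lemma hermitian_spectral:
  fixes A :: "complex Matrix.mat"
  assumes A: "A \<in> carrier_mat n n" and h: "A\<^sup>H = A"
  obtains U d where "orthocols n n U" "A * U = U * mat_diag n (\<lambda>i. complex_of_real (d i))"
    "\<And>i j. i \<le> j \<Longrightarrow> j < n \<Longrightarrow> d j \<le> d i"
proof -
  obtain U d where U: "orthocols n n U" and AU: "A * U = U * mat_diag n d"
    using hermitian_eigenbasis_aux[OF A h, of n] by auto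
  have Uc: "U \<in> carrier_mat n n" using U by (rule orthocols_carrier)
  have D: "U\<^sup>H * (A * U) = mat_diag n d"
  proof -
    have "U\<^sup>H * (A * U) = (U\<^sup>H * U) * mat_diag n d"
      unfolding AU by (rule assoc_mult_mat[symmetric, of _ n n _ n _ n]) (use Uc in auto)
    then show ?thesis unfolding orthocolsD[OF U] left_mult_one_mat[OF mat_diag_dim] .
  qed
  have "(mat_diag n d)\<^sup>H = mat_diag n d"
  proof -
    have "(U\<^sup>H * (A * U))\<^sup>H = (A * U)\<^sup>H * U" using adj_mult[of "U\<^sup>H" n n "A * U" n] Uc A by simp
    also have "\<dots> = U\<^sup>H * A * U" unfolding adj_mult[OF A Uc] h ..
    also have "\<dots> = U\<^sup>H * (A * U)" by (rule assoc_mult_mat[of _ n n _ n _ n]) (use Uc A in auto)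
    finally show ?thesis unfolding D .
  qed
  then have di: "(mat_diag n d)\<^sup>H $$ (i, i) = mat_diag n d $$ (i, i)" for i by simp
  have re: "d i = of_real (Re (d i))" if "i < n" for i
    using that di[of i] by (auto simp: mat_diag_def complex_eq_iff)
  \<comment> \<open>Sorting the list of diagonal entries supplies the permutation to be applied to
    the columns of \<open>U\<close>.\<close>
  define xs where "xs = map (\<lambda>i. Re (d i)) [0..<n]"
  define ys where "ys = rev (sort xs)"
  have "mset ys = mset xs" by (simp add: ys_def)
  from mset_eq_permutation[OF this] obtain p where
    p: "p permutes {..<length xs}" "permute_list p xs = ys" by metis
  have len: "length xs = n" "length ys = n" by (auto simp: xs_def ys_def)
  have pn: "p j < n" if "j < n" for j using p(1) permutes_in_image[of p "{..<n}" j] that len by auto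
  have inj: "p i = p j \<longleftrightarrow> i = j" for i j using p(1) permutes_inj[of p] by (auto dest: injD)
  have ys: "ys ! j = Re (d (p j))" if "j < n" for j
    using p that len pn[OF that] permute_list_nth[OF p(1), of j] by (auto simp: xs_def)
  have srt: "ys ! j \<le> ys ! i" if "i \<le> j" "j < n" for i j
    using sorted_nth_mono[OF sorted_sort, of "n - Suc j" "n - Suc i" xs] that len by (auto simp: ys_def rev_nth)
  define V where "V = Matrix.mat n n (\<lambda>(i, j). U $$ (i, p j))"
  have Vc: "V \<in> carrier_mat n n" by (simp add: V_def)
  have V: "orthocols n n V"
    unfolding orthocols_def
  proof (intro conjI Vc eq_matI)
    fix i j assume "i < dim_row (1\<^sub>m n :: complex Matrix.mat)" "j < dim_col (1\<^sub>m n :: complex Matrix.mat)"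
    then have ij: "i < n" "j < n" by auto
    have "(V\<^sup>H * V) $$ (i, j) = (U\<^sup>H * U) $$ (p i, p j)"
      unfolding adj_mult_self_index[OF Vc Vc ij] adj_mult_self_index[OF Uc Uc pn[OF ij(1)] pn[OF ij(2)]]
      using ij by (auto simp: V_def intro!: sum.cong)
    then show "(V\<^sup>H * V) $$ (i, j) = 1\<^sub>m n $$ (i, j)" unfolding orthocolsD[OF U] using ij pn inj by simp
  qed (use Vc in auto)
  have "A * V = V * mat_diag n (\<lambda>i. complex_of_real (ys ! i))"
  proof (rule eq_matI)
    fix i j assume "i < dim_row (V * mat_diag n (\<lambda>i. complex_of_real (ys ! i)))" "j < dim_col (V * mat_diag n (\<lambda>i. complex_of_real (ys ! i)))"
    then have ij: "i < n" "j < n" using Vc by (auto simp: mat_diag_def)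
    have "(A * V) $$ (i, j) = (A * U) $$ (i, p j)"
      unfolding mult_index[OF A Vc ij] mult_index[OF A Uc ij(1) pn[OF ij(2)]]
      using ij by (auto simp: V_def intro!: sum.cong)
    also have "\<dots> = U $$ (i, p j) * d (p j)"
      unfolding AU mat_diag_mult_right[OF Uc] using ij pn by simp
    also have "\<dots> = (V * mat_diag n (\<lambda>i. complex_of_real (ys ! i))) $$ (i, j)"
      unfolding mat_diag_mult_right[OF Vc] using ij ys[OF ij(2)] re[OF pn[OF ij(2)]] by (simp add: V_def)
    finally show "(A * V) $$ (i, j) = (V * mat_diag n (\<lambda>i. complex_of_real (ys ! i))) $$ (i, j)" .
  qed (use A Vc in \<open>auto simp: mat_diag_def\<close>)
  with V srt that show ?thesis by blast
qed

section \<open>Ordered eigenvalues and the singular value decomposition\<close>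

lemma sorted_linear_factors_unique:
  fixes xs ys :: "real list"
  assumes "sorted_wrt (\<ge>) xs" "sorted_wrt (\<ge>) ys"
    "prod_list (map (\<lambda>l. [:- complex_of_real l, 1:]) xs) = prod_list (map (\<lambda>l. [:- complex_of_real l, 1:]) ys)"
  shows "xs = ys"
  using assms
proof (induction xs arbitrary: ys)
  case Nil
  show ?case
  proof (cases ys)
    case (Cons y zs)
    have "poly (prod_list (map (\<lambda>l. [:- complex_of_real l, 1:]) [])) y = 0"
      unfolding Nil(3) Cons by simp
    then show ?thesis by simp
  qed simp
next
  case (Cons x xs)
  have root: "poly (prod_list (map (\<lambda>l. [:- complex_of_real l, 1:]) zs)) (complex_of_real a) = 0 \<longleftrightarrow> a \<in> set zs" for a zs
    by (induction zs) auto
  have s: "set (x # xs) = set ys" using root Cons.prems(3) by (metis subsetI subset_antisym)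
  then obtain y zs where ys: "ys = y # zs" by (cases ys) auto
  \<comment> \<open>Both heads are the largest root of the same polynomial, so they agree and their
    factor can be cancelled.\<close>
  have "x \<le> y" using s ys Cons.prems(2) by (metis list.set_intros(1) order_refl set_ConsD sorted_wrt.simps(2))
  moreover have "y \<le> x" using s ys Cons.prems(1) by (metis list.set_intros(1) order_refl set_ConsD sorted_wrt.simps(2))
  ultimately have xy: "x = y" by simp
  have "prod_list (map (\<lambda>l. [:- complex_of_real l, 1:]) xs) = prod_list (map (\<lambda>l. [:- complex_of_real l, 1:]) zs)"
    using Cons.prems(3) unfolding ys xy by (simp del: mult_pCons_left)
  then show ?case using Cons.IH[of zs] Cons.prems ys xy by auto
qed

text \<open>Any sorted unitary diagonalisation computes \<open>eigs_desc\<close>: similarity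
  preserves the characteristic polynomial, and uniqueness of its sorted factorisation resolves the
  definite description.\<close>

lemma eigs_desc_eq:
  assumes A: "A \<in> carrier_mat n n" and U: "orthocols n n U"
    and AU: "A * U = U * mat_diag n (\<lambda>i. complex_of_real (d i))"
    and d: "\<And>i j. i \<le> j \<Longrightarrow> j < n \<Longrightarrow> d j \<le> d i"
  shows "eigs_desc A = map d [0..<n]"
proof -
  let ?D = "mat_diag n (\<lambda>i. complex_of_real (d i))"
  have Uc: "U \<in> carrier_mat n n" using U by (rule orthocols_carrier)
  have Ac: "A = U * ?D * U\<^sup>H"
  proof -
    have "A * U * U\<^sup>H = A * (U * U\<^sup>H)" by (rule assoc_mult_mat[of _ n n _ n _ n]) (use Uc A in auto)
    then show ?thesis unfolding AU unitary_right[OF U] using A by simp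
  qed
  have "similar_mat A ?D"
    unfolding similar_mat_def similar_mat_wit_def Let_def
    by (rule exI[of _ U], rule exI[of _ "U\<^sup>H"])
       (use Ac A Uc unitary_right[OF U] orthocolsD[OF U] in auto)
  then have "char_poly A = char_poly ?D" by (rule char_poly_similar)
  also have "\<dots> = (\<Prod>a\<leftarrow>diag_mat ?D. [:- a, 1:])"
    by (rule char_poly_upper_triangular[of _ n]) (auto simp: mat_diag_def)
  also have "diag_mat ?D = map (\<lambda>i. complex_of_real (d i)) [0..<n]"
    by (auto simp: diag_mat_def mat_diag_def)
  finally have cp: "char_poly A = prod_list (map (\<lambda>l. [:- complex_of_real l, 1:]) (map d [0..<n]))"
    by (simp add: o_def)
  have srt: "sorted_wrt (\<ge>) (map d [0..<n])"
    using d by (auto simp: sorted_wrt_iff_nth_less)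
  show ?thesis
    unfolding eigs_desc_def
  proof (rule the_equality)
    show "length (map d [0..<n]) = dim_row A \<and> sorted_wrt (\<ge>) (map d [0..<n]) \<and>
      char_poly A = prod_list (map (\<lambda>l. [:- complex_of_real l, 1:]) (map d [0..<n]))"
      using cp srt A by auto
  next
    fix ls assume "length ls = dim_row A \<and> sorted_wrt (\<ge>) ls \<and>
      char_poly A = prod_list (map (\<lambda>l. [:- complex_of_real l, 1:]) ls)"
    then show "ls = map d [0..<n]"
      using sorted_linear_factors_unique[OF _ srt, of ls] cp by metis
  qed
qed

lemma orthocols_cancel:
  assumes U: "orthocols n k U" and A: "A \<in> carrier_mat k a" and B: "B \<in> carrier_mat k b"
  shows "(U * A)\<^sup>H * (U * B) = A\<^sup>H * B"
proof -
  have Uc: "U \<in> carrier_mat n k" using U by (rule orthocols_carrier)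
  have "(U * A)\<^sup>H * (U * B) = A\<^sup>H * ((U\<^sup>H * U) * B)"
    unfolding adj_mult[OF Uc A] by (rule assoc_mult_mat4[of _ a k _ n _ k _ b]) (use Uc A B in auto)
  then show ?thesis unfolding orthocolsD[OF U] left_mult_one_mat[OF B] .
qed

lemma gram_mult_right:
  fixes A S :: "complex Matrix.mat"
  assumes A: "A \<in> carrier_mat n k" and B: "B \<in> carrier_mat n l" and S: "S \<in> carrier_mat k a" and T: "T \<in> carrier_mat l b"
  shows "(A * S)\<^sup>H * (B * T) = S\<^sup>H * ((A\<^sup>H * B) * T)"
  unfolding adj_mult[OF A S] by (rule assoc_mult_mat4[of _ a k _ n _ l _ b]) (use A B S T in auto)

text \<open>\<open>d\<close> holds the eigenvalues of \<open>H * H\<^sup>H\<close>, that is, the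
  squared singular values, padded with zeros when \<open>p\<close> exceeds \<open>q\<close>. The
  eigenvector equation is kept alongside so that the same \<open>U\<close> serves the functional
  calculus.\<close>

definition is_svd :: "nat \<Rightarrow> nat \<Rightarrow> complex Matrix.mat \<Rightarrow> complex Matrix.mat \<Rightarrow> complex Matrix.mat \<Rightarrow> (nat \<Rightarrow> real) \<Rightarrow> bool" where
  "is_svd p q H U V d \<longleftrightarrow> orthocols p p U \<and> orthocols q q V \<and>
    H * V = U * Matrix.mat p q (\<lambda>(i, j). if i = j then complex_of_real (sqrt (d i)) else 0) \<and>
    (H * H\<^sup>H) * U = U * mat_diag p (\<lambda>i. complex_of_real (d i)) \<and>
    (\<forall>i j. i \<le> j \<longrightarrow> j < p \<longrightarrow> d j \<le> d i) \<and> (\<forall>i<p. 0 \<le> d i) \<and> (\<forall>i<p. q \<le> i \<longrightarrow> d i = 0)"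

text \<open>The rows of \<open>U\<^sup>H * H\<close> are orthogonal with squared lengths
  \<open>d i\<close>. Normalizing the nonzero ones gives part of \<open>V\<close>, and the rest
  comes from completion.\<close>

lemma exists_svd:
  fixes H :: "complex Matrix.mat"
  assumes H: "H \<in> carrier_mat p q"
  obtains U V d where "is_svd p q H U V d"
proof -
  have A: "H * H\<^sup>H \<in> carrier_mat p p" using H by auto
  have h: "(H * H\<^sup>H)\<^sup>H = H * H\<^sup>H" using adj_mult[of H p q "H\<^sup>H" p] H by simp
  obtain U d where U: "orthocols p p U" and AU: "(H * H\<^sup>H) * U = U * mat_diag p (\<lambda>i. complex_of_real (d i))"
    and dec: "\<And>i j. i \<le> j \<Longrightarrow> j < p \<Longrightarrow> d j \<le> d i"
    using hermitian_spectral[OF A h] by blast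
  have Uc: "U \<in> carrier_mat p p" using U by (rule orthocols_carrier)
  define B where "B = U\<^sup>H * H"
  have Bc: "B \<in> carrier_mat p q" using Uc H by (auto simp: B_def)
  have UB: "U * B = H"
  proof -
    have "U * B = (U * U\<^sup>H) * H" unfolding B_def
      by (rule assoc_mult_mat[symmetric, of _ p p _ p _ q]) (use Uc H in auto)
    then show ?thesis unfolding unitary_right[OF U] using H by simp
  qed
  have BB: "B * B\<^sup>H = mat_diag p (\<lambda>i. complex_of_real (d i))"
  proof -
    have "B * B\<^sup>H = (U\<^sup>H * H) * (H\<^sup>H * U)" unfolding B_def using adj_mult[of "U\<^sup>H" p p H q] Uc H by simp
    also have "\<dots> = U\<^sup>H * ((H * H\<^sup>H) * U)" by (rule assoc_mult_mat4[of _ p p _ q _ p _ p]) (use Uc H in auto)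
    also have "\<dots> = (U\<^sup>H * U) * mat_diag p (\<lambda>i. complex_of_real (d i))" unfolding AU
      by (rule assoc_mult_mat[symmetric, of _ p p _ p _ p]) (use Uc in auto)
    finally show ?thesis unfolding orthocolsD[OF U] left_mult_one_mat[OF mat_diag_dim] .
  qed
  have Bi: "(\<Sum>k<q. B $$ (i, k) * cnj (B $$ (j, k))) = (if i = j then complex_of_real (d i) else 0)"
    if "i < p" "j < p" for i j
  proof -
    have "(B * B\<^sup>H) $$ (i, j) = (\<Sum>k<q. B $$ (i, k) * cnj (B $$ (j, k)))"
      by (subst mult_index[of _ p q _ p]) (use Bc that in \<open>auto intro!: sum.cong\<close>)
    then show ?thesis unfolding BB using that by (auto simp: mat_diag_def)
  qed
  have dsum: "d i = (\<Sum>k<q. (cmod (B $$ (i, k)))\<^sup>2)" if "i < p" for i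
  proof -
    have "complex_of_real (d i) = complex_of_real (\<Sum>k<q. (cmod (B $$ (i, k)))\<^sup>2)"
      unfolding of_real_sum cnj_mult_self[symmetric] using Bi[OF that that] by (simp add: mult.commute)
    then show ?thesis using of_real_eq_iff by blast
  qed
  have d0: "0 \<le> d i" if "i < p" for i unfolding dsum[OF that] by (simp add: sum_nonneg)
  have Bz: "B $$ (i, k) = 0" if "i < p" "k < q" "d i = 0" for i k
    using that dsum[OF that(1)] by (simp add: sum_nonneg_eq_0_iff)
  define s where "s = card {i. i < p \<and> d i > 0}"
  \<comment> \<open>Since \<open>d\<close> decreases, the indices with positive \<open>d\<close>
    form an initial segment, so the normalized rows can serve as the first columns of
    \<open>V\<close>.\<close>
  have sset: "{i. i < p \<and> d i > 0} = {..<s}"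
  proof -
    have "\<exists>s. {i. i < p \<and> d i > 0} = {..<s}"
    proof (cases "\<exists>i<p. d i \<le> 0")
      case True
      define m where "m = (LEAST i. i < p \<and> d i \<le> 0)"
      have m: "m < p \<and> d m \<le> 0" unfolding m_def by (rule LeastI_ex) (use True in auto)
      have "{i. i < p \<and> d i > 0} = {..<m}"
      proof (intro Set.set_eqI iffI)
        fix i assume i: "i \<in> {i. i < p \<and> d i > 0}"
        show "i \<in> {..<m}" using dec[of m i] m i by (cases "m \<le> i") auto
      next
        fix i assume "i \<in> {..<m}"
        then show "i \<in> {i. i < p \<and> d i > 0}" using not_less_Least[of i "\<lambda>i. i < p \<and> d i \<le> 0"] m
          by (auto simp: m_def[symmetric])
      qed
      then show ?thesis by blast
    next
      case False
      then have "{i. i < p \<and> d i > 0} = {..<p}" by auto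
      then show ?thesis by blast
    qed
    then obtain s' where s': "{i. i < p \<and> d i > 0} = {..<s'}" by blast
    show ?thesis unfolding s_def s' by simp
  qed
  have sp: "i < p" "d i > 0" if "i < s" for i using sset that by auto
  have sp': "d i = 0" if "s \<le> i" "i < p" for i   proof (rule ccontr)
    assume "d i \<noteq> 0"
    then have "i \<in> {i. i < p \<and> d i > 0}" using d0[of i] that by auto
    then show False unfolding sset using that by simp
  qed
  define Q where "Q = Matrix.mat q s (\<lambda>(k, i). cnj (B $$ (i, k)) / complex_of_real (sqrt (d i)))"
  have Qc: "Q \<in> carrier_mat q s" by (simp add: Q_def)
  have Q: "orthocols q s Q"
    unfolding orthocols_def
  proof (intro conjI Qc eq_matI)
    fix i j assume "i < dim_row (1\<^sub>m s :: complex Matrix.mat)" "j < dim_col (1\<^sub>m s :: complex Matrix.mat)"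
    then have ij: "i < s" "j < s" by auto
    have sqd: "complex_of_real (sqrt (d i)) * complex_of_real (sqrt (d i)) = complex_of_real (d i)"
      using sp(2)[OF ij(1)] unfolding of_real_mult[symmetric] by simp
    have "(Q\<^sup>H * Q) $$ (i, j) = (\<Sum>k<q. B $$ (i, k) * cnj (B $$ (j, k)) / (complex_of_real (sqrt (d i)) * complex_of_real (sqrt (d j))))"
      unfolding adj_mult_self_index[OF Qc Qc ij] using ij by (auto simp: Q_def intro!: sum.cong)
    also have "\<dots> = (\<Sum>k<q. B $$ (i, k) * cnj (B $$ (j, k))) / (complex_of_real (sqrt (d i)) * complex_of_real (sqrt (d j)))"
      by (simp add: sum_divide_distrib)
    also have "(\<Sum>k<q. B $$ (i, k) * cnj (B $$ (j, k))) / (complex_of_real (sqrt (d i)) * complex_of_real (sqrt (d j)))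
        = (if i = j then 1 else 0)"
      using Bi[OF sp(1)[OF ij(1)] sp(1)[OF ij(2)]] sp(2)[OF ij(1)] sqd
      by (cases "i = j") auto
    finally show "(Q\<^sup>H * Q) $$ (i, j) = 1\<^sub>m s $$ (i, j)" using ij by simp
  qed (use Qc in auto)
  \<comment> \<open>Orthonormality bounds the number of nonzero singular values by \<open>q\<close>;
    this is where \<open>d i = 0\<close> for larger indices comes from.\<close>
  have sq: "s \<le> q" by (rule orthocols_le[OF Q])
  obtain V where V: "orthocols q q V" and VQ: "\<And>i j. i < q \<Longrightarrow> j < s \<Longrightarrow> V $$ (i, j) = Q $$ (i, j)"
    using orthocols_completion[OF Q sq] by auto
  have Vc: "V \<in> carrier_mat q q" using V by (rule orthocols_carrier)
  have BV: "B * V = Matrix.mat p q (\<lambda>(i, j). if i = j then complex_of_real (sqrt (d i)) else 0)" (is "_ = ?S")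
  proof (rule eq_matI)
    fix i j assume "i < dim_row ?S" "j < dim_col ?S"
    then have ij: "i < p" "j < q" by auto
    have *: "(B * V) $$ (i, j) = (\<Sum>k<q. B $$ (i, k) * V $$ (k, j))" by (rule mult_index[OF Bc Vc ij])
    show "(B * V) $$ (i, j) = ?S $$ (i, j)"
    proof (cases "i < s")
      case True
      have iq: "i < q" using True sq by simp
      have "(B * V) $$ (i, j) = (\<Sum>k<q. complex_of_real (sqrt (d i)) * (cnj (V $$ (k, i)) * V $$ (k, j)))"
        unfolding * using True sp[OF True] VQ by (intro sum.cong) (auto simp: Q_def)
      also have "\<dots> = complex_of_real (sqrt (d i)) * (V\<^sup>H * V) $$ (i, j)"
        unfolding adj_mult_self_index[OF Vc Vc iq ij(2)] by (simp add: sum_distrib_left)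
      finally show ?thesis unfolding orthocolsD[OF V] using ij iq by simp
    next
      case False
      then have "d i = 0" using sp' ij by simp
      then show ?thesis unfolding * using Bz[OF ij(1)] ij by auto
    qed
  qed (use Bc Vc in auto)
  have "H * V = U * ?S"
  proof -
    have "H * V = U * (B * V)" unfolding UB[symmetric]
      by (rule assoc_mult_mat[of _ p p _ q _ q]) (use Uc Bc Vc in auto)
    then show ?thesis unfolding BV .
  qed
  moreover have "d i = 0" if "q \<le> i" "i < p" for i using sp'[of i] sq that by simp
  ultimately have "is_svd p q H U V d" unfolding is_svd_def using U V AU dec d0 by blast
  then show ?thesis by (rule that)
qed

section \<open>Lagrange interpolation and functional calculus\<close>

definition interp :: "nat \<Rightarrow> (nat \<Rightarrow> real) \<Rightarrow> (nat \<Rightarrow> real) \<Rightarrow> real poly" where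
  "interp n d y = (\<Sum>k<n. if \<exists>l<k. d l = d k then 0 else
     Polynomial.smult (y k) (\<Prod>l<n. if d l = d k then 1 else Polynomial.smult (1 / (d k - d l)) [:- d l, 1:]))"

text \<open>A bound that does not depend on \<open>d\<close> gives \<open>hfun\<close> a fixed
  summation range, so that its measurability is a matter of finitely many coefficients.\<close>

lemma degree_interp: "degree (interp n d y) \<le> n"
proof -
  have "degree (\<Prod>l<n. if d l = d k then 1 else Polynomial.smult (1 / (d k - d l)) [:- d l, 1:]) \<le> n" for k
  proof -
    have "degree (\<Prod>l<n. if d l = d k then 1 else Polynomial.smult (1 / (d k - d l)) [:- d l, 1:])
      \<le> (\<Sum>l<n. degree (if d l = d k then 1 else Polynomial.smult (1 / (d k - d l)) [:- d l, 1:]))"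
      using degree_prod_sum_le[of "{..<n}"] by (simp add: o_def)
    also have "\<dots> \<le> (\<Sum>l<n. 1)" by (intro sum_mono) auto
    finally show ?thesis by simp
  qed
  then show ?thesis unfolding interp_def
    by (intro degree_sum_le) (auto intro: order_trans[OF degree_smult_le])
qed

text \<open>Nodes may repeat. Only the first occurrence of a value carries a Lagrange polynomial,
  and factors of equal nodes are replaced by 1. At \<open>d k\<close> the one surviving term is that
  of the first index with this value, whence the compatibility required of \<open>y\<close>.\<close>

lemma poly_interp:
  assumes y: "\<And>k l. k < n \<Longrightarrow> l < n \<Longrightarrow> d k = d l \<Longrightarrow> y k = y l" and k: "k < n"
  shows "poly (interp n d y) (d k) = y k"
proof -
  define m where "m = (LEAST l. d l = d k)"
  have m: "d m = d k" unfolding m_def by (rule LeastI) simp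
  have mk: "m \<le> k" unfolding m_def by (rule Least_le) simp
  have ml: "d l \<noteq> d m" if "l < m" for l using not_less_Least[of l "\<lambda>l. d l = d k"] that m by (auto simp: m_def)
  let ?t = "\<lambda>j. if \<exists>l<j. d l = d j then 0 else
     Polynomial.smult (y j) (\<Prod>l<n. if d l = d j then 1 else Polynomial.smult (1 / (d j - d l)) [:- d l, 1:])"
  have "poly (interp n d y) (d k) = (\<Sum>j<n. poly (?t j) (d m))"
    unfolding interp_def m by (simp add: poly_sum)
  also have "\<dots> = (\<Sum>j<n. if j = m then y k else 0)"
  proof (rule sum.cong[OF refl])
    fix j assume j: "j \<in> {..<n}"
    have *: "poly (if d l = d j then 1 else Polynomial.smult (1 / (d j - d l)) [:- d l, 1:]) (d m)
      = (if d l = d j then 1 else (d m - d l) / (d j - d l))" for l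
      by (auto simp: diff_divide_distrib)
    show "poly (?t j) (d m) = (if j = m then y k else 0)"
    proof (cases "j = m")
      case True
      have "poly (?t j) (d m) = y m * (\<Prod>l<n. if d l = d m then 1 else (d m - d l) / (d m - d l))"
      proof -
        have "\<not> (\<exists>l<m. d l = d m)" using ml by auto
        then show ?thesis unfolding True by (simp only: if_False poly_smult poly_prod *[unfolded True])
      qed
      also have "(\<Prod>l<n. if d l = d m then 1 else (d m - d l) / (d m - d l)) = 1"
        by (intro prod.neutral) auto
      finally show ?thesis using True y[of m k] m mk k by simp
    next
      case False
      show ?thesis
      proof (cases "d j = d m")
        case True
        then have "m < j" using False ml[of j] by (cases "j < m") auto
        then have "\<exists>l<j. d l = d j" using True by auto
        then show ?thesis using False by simp
      next
        case dj: False
        have "(\<Prod>l<n. if d l = d j then 1 else (d m - d l) / (d j - d l)) = 0"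
          using mk k dj by (intro prod_zero) (auto intro!: bexI[of _ m])
        then have "poly (\<Prod>l<n. if d l = d j then 1 else Polynomial.smult (1 / (d j - d l)) [:- d l, 1:]) (d m) = 0"
          unfolding poly_prod * .
        then show ?thesis using False by simp
      qed
    qed
  qed
  also have "\<dots> = y k" using mk k by simp
  finally show ?thesis .
qed

text \<open>The functional calculus sends \<open>A\<close> with eigenvalues \<open>d\<close> to the Hermitian matrix with the same
  eigenvectors and eigenvalues \<open>y\<close>; writing it as an interpolation polynomial in \<open>A\<close> avoids a choice
  of eigenvectors and makes its measurability evident.\<close>
definition hfun :: "nat \<Rightarrow> (nat \<Rightarrow> real) \<Rightarrow> (nat \<Rightarrow> real) \<Rightarrow> complex Matrix.mat \<Rightarrow> complex Matrix.mat" where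
  "hfun n d y A = Matrix.mat n n (\<lambda>(a, b). \<Sum>i\<le>n. complex_of_real (poly.coeff (interp n d y) i) * (A ^\<^sub>m i) $$ (a, b))"

lemma hfun_carrier [simp]: "hfun n d y A \<in> carrier_mat n n"
  by (simp add: hfun_def)

lemma power_spectral:
  assumes A: "A \<in> carrier_mat n n" and U: "orthocols n n U"
    and AU: "A * U = U * mat_diag n (\<lambda>i. complex_of_real (d i))"
  shows "(A ^\<^sub>m k) = U * (mat_diag n (\<lambda>i. complex_of_real (d i ^ k)) * U\<^sup>H)"
proof (induction k)
  case 0
  have "mat_diag n (\<lambda>i. complex_of_real (d i ^ 0)) = 1\<^sub>m n" by (simp add: mat_diag_def one_mat_def)
  then show ?case using A unitary_right[OF U] orthocols_carrier[OF U] by simp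
next
  case (Suc k)
  have Uc: "U \<in> carrier_mat n n" using U by (rule orthocols_carrier)
  let ?D = "mat_diag n (\<lambda>i. complex_of_real (d i))" and ?E = "\<lambda>k. mat_diag n (\<lambda>i. complex_of_real (d i ^ k))"
  have "A = U * ?D * U\<^sup>H"
  proof -
    have "A * U * U\<^sup>H = A * (U * U\<^sup>H)" by (rule assoc_mult_mat[of _ n n _ n _ n]) (use Uc A in auto)
    then show ?thesis unfolding AU unitary_right[OF U] using A by simp
  qed
  also have "\<dots> = U * (?D * U\<^sup>H)" by (rule assoc_mult_mat[of _ n n _ n _ n]) (use Uc in auto)
  finally have 1: "A = U * (?D * U\<^sup>H)" .
  have "A ^\<^sub>m Suc k = A ^\<^sub>m k * A" by simp
  also have "\<dots> = (U * (?E k * U\<^sup>H)) * (U * (?D * U\<^sup>H))"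
    by (rule arg_cong2[of _ _ _ _ "(*)", OF Suc.IH 1])
  also have "\<dots> = U * (((?E k * U\<^sup>H) * U) * (?D * U\<^sup>H))"
    by (rule assoc_mult_mat4[of _ n n _ n _ n _ n]) (use Uc in auto)
  also have "(?E k * U\<^sup>H) * U = ?E k * (U\<^sup>H * U)"
    by (rule assoc_mult_mat[of _ n n _ n _ n]) (use Uc in auto)
  also have "\<dots> = ?E k" unfolding orthocolsD[OF U] by (rule right_mult_one_mat[OF mat_diag_dim])
  also have "?E k * (?D * U\<^sup>H) = (?E k * ?D) * U\<^sup>H"
    by (rule assoc_mult_mat[symmetric, of _ n n _ n _ n]) (use Uc in auto)
  also have "?E k * ?D = ?E (Suc k)" by (simp add: mult.commute)
  finally show ?case .
qed

lemma spectral_index: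
  assumes Uc: "U \<in> carrier_mat n n" and ab: "a < n" "b < n"
  shows "(U * (mat_diag n f * U\<^sup>H)) $$ (a, b) = (\<Sum>j<n. U $$ (a, j) * f j * cnj (U $$ (b, j)))"
proof -
  have "(U * (mat_diag n f * U\<^sup>H)) $$ (a, b) = (\<Sum>j<n. U $$ (a, j) * (mat_diag n f * U\<^sup>H) $$ (j, b))"
    by (rule mult_index[of _ n n _ n]) (use Uc ab in auto)
  also have "\<dots> = (\<Sum>j<n. U $$ (a, j) * f j * cnj (U $$ (b, j)))"
    by (subst mat_diag_mult_left[of _ n n]) (use Uc ab in \<open>auto simp: mult.assoc\<close>)
  finally show ?thesis .
qed

text \<open>In an eigenbasis the polynomial acts on each eigenvalue separately, and there
  interpolation turns \<open>d j\<close> into \<open>y j\<close>.\<close>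

lemma hfun_spectral:
  assumes A: "A \<in> carrier_mat n n" and U: "orthocols n n U"
    and AU: "A * U = U * mat_diag n (\<lambda>i. complex_of_real (d i))"
    and y: "\<And>k l. k < n \<Longrightarrow> l < n \<Longrightarrow> d k = d l \<Longrightarrow> y k = y l"
  shows "hfun n d y A = U * (mat_diag n (\<lambda>i. complex_of_real (y i)) * U\<^sup>H)"
proof (rule eq_matI)
  have Uc: "U \<in> carrier_mat n n" using U by (rule orthocols_carrier)
  fix a b assume "a < dim_row (U * (mat_diag n (\<lambda>i. complex_of_real (y i)) * U\<^sup>H))"
    "b < dim_col (U * (mat_diag n (\<lambda>i. complex_of_real (y i)) * U\<^sup>H))"
  then have ab: "a < n" "b < n" using Uc by auto
  let ?c = "poly.coeff (interp n d y)"
  have yk: "y j = (\<Sum>i\<le>n. ?c i * d j ^ i)" if "j < n" for j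
  proof -
    have "y j = poly (interp n d y) (d j)" by (rule poly_interp[symmetric, OF y that])
    also have "\<dots> = (\<Sum>i\<le>n. ?c i * d j ^ i)"
      unfolding poly_altdef by (rule sum.mono_neutral_left) (use degree_interp[of n d y] in \<open>auto simp: coeff_eq_0\<close>)
    finally show ?thesis .
  qed
  have yk': "(\<Sum>i\<le>n. complex_of_real (?c i * d j ^ i)) = complex_of_real (y j)" if "j < n" for j
    by (subst yk[OF that]) (rule of_real_sum[symmetric])
  have "hfun n d y A $$ (a, b) = (\<Sum>i\<le>n. of_real (?c i) * (\<Sum>j<n. U $$ (a, j) * of_real (d j ^ i) * cnj (U $$ (b, j))))"
    using ab by (simp add: hfun_def power_spectral[OF A U AU] spectral_index[OF Uc ab] del: of_real_power)
  also have "\<dots> = (\<Sum>j<n. U $$ (a, j) * (\<Sum>i\<le>n. of_real (?c i * d j ^ i)) * cnj (U $$ (b, j)))"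
    unfolding sum_distrib_left of_real_sum sum_distrib_right
    by (rule trans[OF sum.swap]) (intro sum.cong refl, simp add: mult_ac)
  also have "\<dots> = (\<Sum>j<n. U $$ (a, j) * of_real (y j) * cnj (U $$ (b, j)))"
    using yk' by (intro sum.cong refl) (simp only: lessThan_iff)
  finally show "hfun n d y A $$ (a, b) = (U * (mat_diag n (\<lambda>i. complex_of_real (y i)) * U\<^sup>H)) $$ (a, b)"
    unfolding spectral_index[OF Uc ab] .
qed (use orthocols_carrier[OF U] in \<open>auto simp: hfun_def\<close>)

section \<open>The sine product as a ratio of determinants\<close>

text \<open>For \<open>P\<close> with orthonormal columns this is the determinant of Y^H (I - P P^H)
  Y over that of Y^H Y: the squared volume left after projecting away the span of \<open>P\<close>,
  relative to the original one. \<open>cmod\<close> only passes to the reals.\<close>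

definition sinsq :: "complex Matrix.mat \<Rightarrow> complex Matrix.mat \<Rightarrow> real" where
  "sinsq P Y = cmod (Determinant.det (Y\<^sup>H * Y - (P\<^sup>H * Y)\<^sup>H * (P\<^sup>H * Y))) / cmod (Determinant.det (Y\<^sup>H * Y))"

definition full_rank :: "complex Matrix.mat \<Rightarrow> bool" where
  "full_rank Y \<longleftrightarrow> Determinant.det (Y\<^sup>H * Y) \<noteq> 0"

lemma sinsq_unitary_left:
  assumes U: "orthocols n n U" and P: "P \<in> carrier_mat n t" and Y: "Y \<in> carrier_mat n r"
  shows "sinsq (U * P) (U * Y) = sinsq P Y"
  unfolding sinsq_def orthocols_cancel[OF U P Y] orthocols_cancel[OF U Y Y] ..

lemma sinsq_unitary_right:
  assumes V: "orthocols t t V" and P: "P \<in> carrier_mat n t" and Y: "Y \<in> carrier_mat n r"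
  shows "sinsq (P * V) Y = sinsq P Y"
proof -
  have Vc: "V \<in> carrier_mat t t" using V by (rule orthocols_carrier)
  have "(P * V)\<^sup>H * Y = V\<^sup>H * (P\<^sup>H * Y)"
    unfolding adj_mult[OF P Vc] by (rule assoc_mult_mat[of _ t t _ n _ r]) (use P Vc Y in auto)
  moreover have "(V\<^sup>H * (P\<^sup>H * Y))\<^sup>H * (V\<^sup>H * (P\<^sup>H * Y)) = (P\<^sup>H * Y)\<^sup>H * (P\<^sup>H * Y)"
    by (rule orthocols_cancel[OF unitary_adj[OF V], of _ r _ r]) (use P Y in auto)
  ultimately show ?thesis unfolding sinsq_def by simp
qed

text \<open>Numerator and denominator both acquire the factor |det S|^2.\<close>

lemma sinsq_invertible_right:
  assumes P: "P \<in> carrier_mat n t" and Y: "Y \<in> carrier_mat n r" and S: "S \<in> carrier_mat r r" and d: "Determinant.det S \<noteq> 0"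
  shows "sinsq P (Y * S) = sinsq P Y"
proof -
  let ?G = "Y\<^sup>H * Y" and ?N = "P\<^sup>H * Y"
  have c: "?G \<in> carrier_mat r r" "?N \<in> carrier_mat t r" "?N\<^sup>H * ?N \<in> carrier_mat r r" using P Y by auto
  have 1: "(Y * S)\<^sup>H * (Y * S) = S\<^sup>H * (?G * S)" by (rule gram_mult_right[OF Y Y S S])
  have 2: "P\<^sup>H * (Y * S) = ?N * S" by (rule assoc_mult_mat[symmetric, of _ t n _ r _ r]) (use P Y S in auto)
  have 3: "(?N * S)\<^sup>H * (?N * S) = S\<^sup>H * ((?N\<^sup>H * ?N) * S)" by (rule gram_mult_right[OF c(2,2) S S])
  have 4: "S\<^sup>H * (?G * S) - S\<^sup>H * ((?N\<^sup>H * ?N) * S) = S\<^sup>H * ((?G - ?N\<^sup>H * ?N) * S)"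
  proof -
    have "S\<^sup>H * ((?G - ?N\<^sup>H * ?N) * S) = S\<^sup>H * (?G * S - (?N\<^sup>H * ?N) * S)"
      using minus_mult_distrib_mat[of ?G r r "?N\<^sup>H * ?N" S r] c S by simp
    also have "\<dots> = S\<^sup>H * (?G * S) - S\<^sup>H * ((?N\<^sup>H * ?N) * S)"
      by (rule mult_minus_distrib_mat[of _ r r _ r]) (use c S in auto)
    finally show ?thesis ..
  qed
  have dt: "Determinant.det (S\<^sup>H * (X * S)) = cnj (Determinant.det S) * (Determinant.det X * Determinant.det S)"
    if "X \<in> carrier_mat r r" for X
    using that S by (subst det_mult[of _ r]) (auto simp: det_mult[of _ r] det_adj)
  have cm: "cmod (cnj (Determinant.det S) * (x * Determinant.det S)) = (cmod (Determinant.det S))\<^sup>2 * cmod x" for x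
    by (simp add: norm_mult power2_eq_square)
  have c5: "?G - ?N\<^sup>H * ?N \<in> carrier_mat r r" by (rule minus_carrier_mat[OF c(3)])
  show ?thesis unfolding sinsq_def 2 3 1 4 dt[OF c(1)] dt[OF c5] cm using d by simp
qed

section \<open>Functions of the Gram matrix and the polar factor\<close>

lemma mat_diag_cong: "(\<And>i. i < n \<Longrightarrow> f i = g i) \<Longrightarrow> mat_diag n f = mat_diag n g"
  by (auto simp: mat_diag_def intro!: eq_matI)

lemma spectral_mult:
  assumes U: "orthocols n n U"
  shows "(U * (mat_diag n f * U\<^sup>H)) * (U * (mat_diag n g * U\<^sup>H)) = U * (mat_diag n (\<lambda>i. f i * g i) * U\<^sup>H)"
proof -
  have Uc: "U \<in> carrier_mat n n" using U by (rule orthocols_carrier)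
  have "(U * (mat_diag n f * U\<^sup>H)) * (U * (mat_diag n g * U\<^sup>H)) = U * (((mat_diag n f * U\<^sup>H) * U) * (mat_diag n g * U\<^sup>H))"
    by (rule assoc_mult_mat4[of _ n n _ n _ n _ n]) (use Uc in auto)
  also have "(mat_diag n f * U\<^sup>H) * U = mat_diag n f * (U\<^sup>H * U)"
    by (rule assoc_mult_mat[of _ n n _ n _ n]) (use Uc in auto)
  also have "\<dots> = mat_diag n f" unfolding orthocolsD[OF U] by (rule right_mult_one_mat[OF mat_diag_dim])
  also have "mat_diag n f * (mat_diag n g * U\<^sup>H) = (mat_diag n f * mat_diag n g) * U\<^sup>H"
    by (rule assoc_mult_mat[symmetric, of _ n n _ n _ n]) (use Uc in auto)
  finally show ?thesis by simp
qed

lemma spectral_adj: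
  assumes Uc: "U \<in> carrier_mat n n"
  shows "(U * (mat_diag n (\<lambda>i. complex_of_real (f i)) * U\<^sup>H))\<^sup>H = U * (mat_diag n (\<lambda>i. complex_of_real (f i)) * U\<^sup>H)"
proof (rule eq_matI)
  fix i j assume "i < dim_row (U * (mat_diag n (\<lambda>i. complex_of_real (f i)) * U\<^sup>H))"
    "j < dim_col (U * (mat_diag n (\<lambda>i. complex_of_real (f i)) * U\<^sup>H))"
  then have ij: "i < n" "j < n" using Uc by auto
  let ?X = "U * (mat_diag n (\<lambda>i. complex_of_real (f i)) * U\<^sup>H)"
  have "?X\<^sup>H $$ (i, j) = cnj (?X $$ (j, i))" by (rule adj_index) (use Uc ij in auto)
  then show "?X\<^sup>H $$ (i, j) = ?X $$ (i, j)"
    unfolding spectral_index[OF Uc ij(1,2)] spectral_index[OF Uc ij(2,1)] by (simp add: mult_ac)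
qed (use Uc in auto)

lemma spectral_form:
  assumes A: "A \<in> carrier_mat n n" and U: "orthocols n n U" and AU: "A * U = U * mat_diag n d"
  shows "A = U * (mat_diag n d * U\<^sup>H)"
proof -
  have Uc: "U \<in> carrier_mat n n" using U by (rule orthocols_carrier)
  have "A = A * (U * U\<^sup>H)" unfolding unitary_right[OF U] using A by simp
  also have "\<dots> = A * U * U\<^sup>H" by (rule assoc_mult_mat[symmetric, of _ n n _ n _ n]) (use Uc A in auto)
  also have "\<dots> = U * (mat_diag n d * U\<^sup>H)" unfolding AU
    by (rule assoc_mult_mat[of _ n n _ n _ n]) (use Uc in auto)
  finally show ?thesis .
qed

definition eigs :: "complex Matrix.mat \<Rightarrow> nat \<Rightarrow> real" where
  "eigs A k = eigs_desc A ! k"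

definition inv_sqrt :: "nat \<Rightarrow> complex Matrix.mat \<Rightarrow> complex Matrix.mat" where
  "inv_sqrt t S = hfun t (eigs S) (\<lambda>k. 1 / sqrt (eigs S k)) S"

text \<open>The isometric factor of the polar decomposition, G (G^H G)^(-1/2). It involves no choice
  of eigenvectors, is measurable in \<open>G\<close> and commutes with left multiplication by
  unitaries.\<close>

definition orthonormalize :: "complex Matrix.mat \<Rightarrow> complex Matrix.mat" where
  "orthonormalize G = G * inv_sqrt (dim_col G) (G\<^sup>H * G)"

lemma hfun_eigs:
  assumes A: "A \<in> carrier_mat n n" and U: "orthocols n n U"
    and AU: "A * U = U * mat_diag n (\<lambda>i. complex_of_real (d i))"
    and dec: "\<And>i j. i \<le> j \<Longrightarrow> j < n \<Longrightarrow> d j \<le> d i"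
  shows "hfun n (eigs A) (\<lambda>k. f (eigs A k)) A = U * (mat_diag n (\<lambda>i. complex_of_real (f (d i))) * U\<^sup>H)"
proof -
  have e: "eigs A k = d k" if "k < n" for k
    using that by (simp add: eigs_def eigs_desc_eq[OF A U AU dec])
  have 1: "mat_diag n (\<lambda>i. complex_of_real (eigs A i)) = mat_diag n (\<lambda>i. complex_of_real (d i))"
    by (rule eq_matI) (auto simp: mat_diag_def e)
  have 2: "mat_diag n (\<lambda>i. complex_of_real (f (eigs A i))) = mat_diag n (\<lambda>i. complex_of_real (f (d i)))"
    by (rule eq_matI) (auto simp: mat_diag_def e)
  have "hfun n (eigs A) (\<lambda>k. f (eigs A k)) A = U * (mat_diag n (\<lambda>i. complex_of_real (f (eigs A i))) * U\<^sup>H)"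
    by (rule hfun_spectral[OF A U]) (use AU 1 in auto)
  then show ?thesis unfolding 2 .
qed

text \<open>The decomposition is taken of the adjoint of \<open>G\<close>, so that its left factor
  diagonalizes the Gram matrix and the eigenvalues come out nonnegative; the nonvanishing
  determinant then makes them positive.\<close>

lemma orthonormalize:
  assumes G: "G \<in> carrier_mat n t" and fr: "full_rank G"
  shows "orthocols n t (orthonormalize G)" "Determinant.det (inv_sqrt t (G\<^sup>H * G)) \<noteq> 0"
proof -
  have H: "G\<^sup>H \<in> carrier_mat t n" using G by simp
  obtain U V d where svd: "is_svd t n (G\<^sup>H) U V d" by (rule exists_svd[OF H])
  have U: "orthocols t t U" and AU: "(G\<^sup>H * G) * U = U * mat_diag t (\<lambda>i. complex_of_real (d i))"
    and dec: "\<And>i j. i \<le> j \<Longrightarrow> j < t \<Longrightarrow> d j \<le> d i" and nn: "\<And>i. i < t \<Longrightarrow> 0 \<le> d i"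
    using svd unfolding is_svd_def adj_adj by blast+
  have Uc: "U \<in> carrier_mat t t" using U by (rule orthocols_carrier)
  let ?S = "G\<^sup>H * G" and ?W = "\<lambda>f. U * (mat_diag t (\<lambda>i. complex_of_real (f i)) * U\<^sup>H)"
  have Sc: "?S \<in> carrier_mat t t" using G by auto
  have S: "?S = ?W d" by (rule spectral_form[OF Sc U AU])
  have T: "inv_sqrt t ?S = ?W (\<lambda>i. 1 / sqrt (d i))"
    unfolding inv_sqrt_def by (rule hfun_eigs[OF Sc U AU dec, where f = "\<lambda>x. 1 / sqrt x"])
  have detS: "Determinant.det ?S * Determinant.det U = Determinant.det U * (\<Prod>i<t. complex_of_real (d i))"
  proof -
    have "Determinant.det (mat_diag t (\<lambda>i. complex_of_real (d i))) = prod_list (diag_mat (mat_diag t (\<lambda>i. complex_of_real (d i))))"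
      by (rule det_upper_triangular[of _ t]) (auto simp: mat_diag_def)
    also have "\<dots> = (\<Prod>i<t. complex_of_real (d i))"
      by (simp add: diag_mat_def mat_diag_def prod.list_conv_set_nth lessThan_atLeast0)
    finally show ?thesis using arg_cong[OF AU, of Determinant.det] det_mult[OF Sc Uc] det_mult[OF Uc mat_diag_dim] by simp
  qed
  have "Determinant.det U \<noteq> 0"
  proof
    assume "Determinant.det U = 0"
    then have "Determinant.det (U\<^sup>H * U) = 0" using Uc by (subst det_mult[of _ t]) auto
    then show False unfolding orthocolsD[OF U] by simp
  qed
  then have "(\<Prod>i<t. complex_of_real (d i)) \<noteq> 0" using detS fr unfolding full_rank_def by auto
  then have pos: "0 < d i" if "i < t" for i using that nn[OF that] by (auto simp: order_less_le)
  have TST: "?W (\<lambda>i. 1 / sqrt (d i)) * (?W d * ?W (\<lambda>i. 1 / sqrt (d i))) = 1\<^sub>m t"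
  proof -
    have e: "complex_of_real (1 / sqrt (d i)) * (complex_of_real (d i) * complex_of_real (1 / sqrt (d i))) = 1" if "i < t" for i
    proof -
      have "1 / sqrt (d i) * (d i * (1 / sqrt (d i))) = 1" using pos[OF that] by (simp add: real_div_sqrt)
      then show ?thesis by (metis of_real_1 of_real_mult)
    qed
    have "mat_diag t (\<lambda>i. complex_of_real (1 / sqrt (d i)) * (complex_of_real (d i) * complex_of_real (1 / sqrt (d i)))) = 1\<^sub>m t"
      unfolding mat_diag_one[symmetric] by (rule mat_diag_cong) (rule e)
    then show ?thesis unfolding spectral_mult[OF U] using unitary_right[OF U] Uc by simp
  qed
  have o: "orthonormalize G = G * ?W (\<lambda>i. 1 / sqrt (d i))" using G by (simp add: orthonormalize_def T)
  have Wc: "?W (\<lambda>i. 1 / sqrt (d i)) \<in> carrier_mat t t" using Uc by auto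
  show "orthocols n t (orthonormalize G)"
    unfolding orthocols_def o gram_mult_right[OF G G Wc Wc] unfolding S spectral_adj[OF Uc]
    using TST G Wc by auto
  show "Determinant.det (inv_sqrt t ?S) \<noteq> 0"
  proof
    assume "Determinant.det (inv_sqrt t ?S) = 0"
    then have "Determinant.det (?W (\<lambda>i. 1 / sqrt (d i)) * (?W d * ?W (\<lambda>i. 1 / sqrt (d i)))) = 0"
      unfolding T using Uc by (subst det_mult[of _ t]) auto
    then show False unfolding TST by simp
  qed
qed

text \<open>A left unitary leaves the Gram matrix unchanged, so the same correcting factor
  applies.\<close>

lemma orthonormalize_unitary:
  assumes A: "orthocols n n A" and G: "G \<in> carrier_mat n t"
  shows "orthonormalize (A * G) = A * orthonormalize G"
proof -
  have Ac: "A \<in> carrier_mat n n" using A by (rule orthocols_carrier)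
  show ?thesis unfolding orthonormalize_def orthocols_cancel[OF A G G]
    using assoc_mult_mat[of A n n G t "inv_sqrt t (G\<^sup>H * G)" t] Ac G by (auto simp: inv_sqrt_def)
qed

section \<open>Inner products, column spans and dimension\<close>

lemma cinner_eq: "x \<in> carrier_vec n \<Longrightarrow> cinner x y = (\<Sum>i<n. x $v i * cnj (y $v i))"
  by (simp add: cinner_def)

lemma cinner_commute:
  assumes "x \<in> carrier_vec n" "y \<in> carrier_vec n" shows "cinner y x = cnj (cinner x y)"
  using assms by (simp add: cinner_eq[of _ n] mult.commute)

lemma cinner_lin:
  assumes "x \<in> carrier_vec n" "y \<in> carrier_vec n" "z \<in> carrier_vec n"
  shows "cinner x (c \<cdot>\<^sub>v y + d \<cdot>\<^sub>v z) = cnj c * cinner x y + cnj d * cinner x z"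
    "cinner (c \<cdot>\<^sub>v y + d \<cdot>\<^sub>v z) x = c * cinner y x + d * cinner z x"
  using assms by (simp_all add: cinner_eq[of _ n] sum.distrib sum_distrib_left algebra_simps)

lemma cinner_smult:
  assumes "x \<in> carrier_vec n" "y \<in> carrier_vec n"
  shows "cinner x (c \<cdot>\<^sub>v y) = cnj c * cinner x y" "cinner (c \<cdot>\<^sub>v y) x = c * cinner y x"
  using assms by (simp_all add: cinner_eq[of _ n] sum_distrib_left algebra_simps)

lemma cinner_self: "cinner x x = complex_of_real (nsq x)"
  unfolding cinner_def nsq_def of_real_sum cnj_mult_self[symmetric] by (simp add: mult.commute)

lemma unit_cvec_iff: "unit_cvec n x \<longleftrightarrow> x \<in> carrier_vec n \<and> nsq x = 1"
  unfolding unit_cvec_def cinner_self by auto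

lemma cinner_unit_le:
  assumes "unit_cvec n x" "unit_cvec n y" shows "cmod (cinner x y) \<le> 1"
proof -
  have x: "x \<in> carrier_vec n" "nsq x = 1" and y: "y \<in> carrier_vec n" "nsq y = 1"
    using assms by (auto simp: unit_cvec_iff)
  have "cmod (cinner x y) \<le> (\<Sum>i<n. cmod (x $v i) * cmod (y $v i))"
    unfolding cinner_eq[OF x(1)] by (rule order_trans[OF norm_sum]) (simp add: norm_mult)
  also have "\<dots> \<le> (\<Sum>i<n. ((cmod (x $v i))\<^sup>2 + (cmod (y $v i))\<^sup>2) / 2)"
  proof (rule sum_mono)
    fix i
    show "cmod (x $v i) * cmod (y $v i) \<le> ((cmod (x $v i))\<^sup>2 + (cmod (y $v i))\<^sup>2) / 2"
      using sum_squares_bound[of "cmod (x $v i)" "cmod (y $v i)"] by simp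
  qed
  also have "\<dots> = (nsq x + nsq y) / 2"
    using x y by (simp add: nsq_def sum_divide_distrib[symmetric] sum.distrib)
  finally show ?thesis using x y by simp
qed

lemma col_span_carrier: "P \<in> carrier_mat n a \<Longrightarrow> x \<in> col_span P \<Longrightarrow> x \<in> carrier_vec n"
  by (auto simp: col_span_def)

lemma col_span_lin:
  assumes P: "P \<in> carrier_mat n a" and x: "x \<in> col_span P" and y: "y \<in> col_span P"
  shows "c \<cdot>\<^sub>v x + d \<cdot>\<^sub>v y \<in> col_span P"
proof -
  obtain u v where u: "u \<in> carrier_vec a" "x = P *\<^sub>v u" and v: "v \<in> carrier_vec a" "y = P *\<^sub>v v"
    using x y P by (auto simp: col_span_def)
  have "c \<cdot>\<^sub>v x + d \<cdot>\<^sub>v y = P *\<^sub>v (c \<cdot>\<^sub>v u + d \<cdot>\<^sub>v v)"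
    using mult_add_distrib_mat_vec[OF P, of "c \<cdot>\<^sub>v u" "d \<cdot>\<^sub>v v"] mult_mat_vec[OF P u(1)] mult_mat_vec[OF P v(1)] u v by simp
  then show ?thesis using P u v by (auto simp: col_span_def)
qed

lemma col_span_invertible:
  assumes P: "P \<in> carrier_mat n a" and S: "S \<in> carrier_mat a a" and d: "Determinant.det S \<noteq> 0"
  shows "col_span (P * S) = col_span P"
proof -
  obtain T where T: "T \<in> carrier_mat a a" "S * T = 1\<^sub>m a"
    using det_non_zero_imp_unit[OF S d, of undefined] by (auto simp: Units_def ring_mat_def)
  show ?thesis
  proof (intro Set.set_eqI iffI)
    fix x assume "x \<in> col_span (P * S)"
    then obtain c where c: "c \<in> carrier_vec a" "x = (P * S) *\<^sub>v c" using P S by (auto simp: col_span_def)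
    have "x = P *\<^sub>v (S *\<^sub>v c)" unfolding c(2) by (rule assoc_mult_mat_vec[OF P S c(1)])
    then show "x \<in> col_span P" using P S c by (auto simp: col_span_def)
  next
    fix x assume "x \<in> col_span P"
    then obtain c where c: "c \<in> carrier_vec a" "x = P *\<^sub>v c" using P by (auto simp: col_span_def)
    have "(P * S) *\<^sub>v (T *\<^sub>v c) = P *\<^sub>v (S *\<^sub>v (T *\<^sub>v c))"
      by (rule assoc_mult_mat_vec[OF P S]) (use T c in auto)
    also have "S *\<^sub>v (T *\<^sub>v c) = (S * T) *\<^sub>v c" by (rule assoc_mult_mat_vec[symmetric, OF S T(1) c(1)])
    also have "\<dots> = c" unfolding T(2) using c by simp
    finally have "x = (P * S) *\<^sub>v (T *\<^sub>v c)" using c by simp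
    moreover have "T *\<^sub>v c \<in> carrier_vec (dim_col (P * S))" using T c S by auto
    ultimately show "x \<in> col_span (P * S)" unfolding col_span_def by blast
  qed
qed

lemma col_in_span:
  assumes P: "P \<in> carrier_mat n a" and j: "j < a"
  shows "col P j \<in> col_span P"
proof -
  have "col P j = P *\<^sub>v unit_vec a j" using P j by (intro eq_vecI) auto
  then show ?thesis using P by (auto simp: col_span_def)
qed

text \<open>Fewer than \<open>k\<close> spanning columns would factor \<open>Q\<close> through a
  matrix with a nonzero kernel vector, which the isometry \<open>Q\<close> cannot
  annihilate.\<close>

lemma cdim_orthocols:
  assumes Q: "orthocols n k Q" shows "cdim n (col_span Q) = k"
  unfolding cdim_def
proof (rule Least_equality)
  have Qc: "Q \<in> carrier_mat n k" using Q by (rule orthocols_carrier)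
  show "\<exists>B\<in>carrier_mat n k. col_span Q = col_span B" using Qc by blast
  fix j assume "\<exists>B\<in>carrier_mat n j. col_span Q = col_span B"
  then obtain B where B: "B \<in> carrier_mat n j" "col_span Q = col_span B" by blast
  have "\<exists>c. c \<in> carrier_vec j \<and> col Q i = B *\<^sub>v c" if "i < k" for i
    using col_in_span[OF Qc that] B by (auto simp: col_span_def)
  then obtain c where c: "\<And>i. i < k \<Longrightarrow> c i \<in> carrier_vec j \<and> col Q i = B *\<^sub>v c i" by metis
  define C where "C = Matrix.mat j k (\<lambda>(l, i). c i $v l)"
  have Cc: "C \<in> carrier_mat j k" by (simp add: C_def)
  have QBC: "Q = B * C"
  proof (rule eq_matI)
    fix l i assume "l < dim_row (B * C)" "i < dim_col (B * C)"
    then have li: "l < n" "i < k" using B Cc by auto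
    have "Q $$ (l, i) = (B *\<^sub>v c i) $v l" using c[OF li(2)] Qc li by (metis carrier_matD(1) carrier_matD(2) index_col)
    also have "\<dots> = (B * C) $$ (l, i)"
      unfolding mult_index[OF B(1) Cc li] using mult_vec_index[OF B(1) _ li(1), of "c i"] c[OF li(2)] li by (simp add: C_def)
    finally show "Q $$ (l, i) = (B * C) $$ (l, i)" .
  qed (use Qc B Cc in auto)
  show "k \<le> j"
  proof (rule ccontr)
    assume "\<not> k \<le> j"
    then obtain v where v: "v \<in> carrier_vec k" "v \<noteq> 0\<^sub>v k" "C *\<^sub>v v = 0\<^sub>v j"
      using exists_kernel_vec[OF Cc] by auto
    have "Q *\<^sub>v v = B *\<^sub>v (C *\<^sub>v v)" unfolding QBC by (rule assoc_mult_mat_vec[OF B(1) Cc v(1)])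
    also have "\<dots> = 0\<^sub>v n" unfolding v(3) by (rule mult_mat_vec_zero[OF B(1)])
    finally have "nsq (Q *\<^sub>v v) = 0" using nsq_eq_0_iff[of "0\<^sub>v n" n] by simp
    then show False unfolding nsq_orthocols[OF Q v(1)] using nsq_eq_0_iff[OF v(1)] v(2) by simp
  qed
qed

section \<open>Principal vectors and the determinant formula\<close>

lemma principal_seq_swap:
  assumes P: "P \<in> carrier_mat n p" and Q: "Q \<in> carrier_mat n q"
    and ps: "principal_seq n (col_span P) (col_span Q) a av bv cs"
  shows "principal_seq n (col_span Q) (col_span P) a bv av cs"
proof -
  have sw: "cmod (cinner y x) = cmod (cinner x y)" if "x \<in> col_span P" "y \<in> col_span Q" for x y
    using cinner_commute[of x n y] col_span_carrier[OF P that(1)] col_span_carrier[OF Q that(2)] by simp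
  show ?thesis unfolding principal_seq_def
  proof (intro allI impI)
    fix k assume k: "k < a"
    note h = ps[unfolded principal_seq_def, rule_format, OF k]
    have "cmod (cinner x y) \<le> cs k"
      if "x \<in> col_span Q" "y \<in> col_span P" "unit_cvec n x \<and> unit_cvec n y \<and> (\<forall>i<k. cinner x (bv i) = 0 \<and> cinner y (av i) = 0)" for x y
    proof -
      have "cmod (cinner y x) \<le> cs k" using h that by blast
      then show ?thesis using sw[OF that(2,1)] by simp
    qed
    moreover have "cs k = cmod (cinner (bv k) (av k))" using h sw[of "av k" "bv k"] by simp
    ultimately show "bv k \<in> col_span Q \<and> av k \<in> col_span P \<and> unit_cvec n (bv k) \<and> unit_cvec n (av k) \<and>
        (\<forall>i<k. cinner (bv k) (bv i) = 0 \<and> cinner (av k) (av i) = 0) \<and>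
        cs k = cmod (cinner (bv k) (av k)) \<and>
        (\<forall>x\<in>col_span Q. \<forall>y\<in>col_span P. unit_cvec n x \<and> unit_cvec n y \<and>
            (\<forall>i<k. cinner x (bv i) = 0 \<and> cinner y (av i) = 0) \<longrightarrow> cmod (cinner x y) \<le> cs k)"
      using h by blast
  qed
qed

text \<open>First-order optimality: otherwise tilting \<open>bv k\<close> towards \<open>y\<close> would increase the inner product.\<close>
lemma principal_seq_orthogonal:
  assumes P: "P \<in> carrier_mat n p" and Q: "Q \<in> carrier_mat n q"
    and ps: "principal_seq n (col_span P) (col_span Q) a av bv cs" and k: "k < a"
    and y: "y \<in> col_span Q" and yo: "\<And>i. i \<le> k \<Longrightarrow> cinner y (bv i) = 0"
  shows "cinner (av k) y = 0"
proof (rule ccontr)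
  assume nz: "cinner (av k) y \<noteq> 0"
  note psk = ps[unfolded principal_seq_def, rule_format, OF k]
  have a: "av k \<in> col_span P" "unit_cvec n (av k)" and b: "bv k \<in> col_span Q" "unit_cvec n (bv k)"
    and oa: "\<And>i. i < k \<Longrightarrow> cinner (av k) (av i) = 0" and ob: "\<And>i. i < k \<Longrightarrow> cinner (bv k) (bv i) = 0"
    and csk: "cs k = cmod (cinner (av k) (bv k))"
    and mx: "\<And>x y. x \<in> col_span P \<Longrightarrow> y \<in> col_span Q \<Longrightarrow> unit_cvec n x \<Longrightarrow> unit_cvec n y \<Longrightarrow>
      (\<And>i. i < k \<Longrightarrow> cinner x (av i) = 0) \<Longrightarrow> (\<And>i. i < k \<Longrightarrow> cinner y (bv i) = 0) \<Longrightarrow> cmod (cinner x y) \<le> cs k"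
    using psk by blast+
  have ac: "av k \<in> carrier_vec n" "nsq (av k) = 1" and bc: "bv k \<in> carrier_vec n" "nsq (bv k) = 1"
    using a b by (auto simp: unit_cvec_iff)
  have bic: "bv i \<in> carrier_vec n" if "i < k" for i
    using ps[unfolded principal_seq_def, rule_format, of i] that k by (auto simp: unit_cvec_iff)
  have yc: "y \<in> carrier_vec n" using col_span_carrier[OF Q y] .
  define c where "c = cinner (av k) (bv k)"
  define \<alpha> where "\<alpha> = cinner (av k) y"
  have yby: "cinner y (bv k) = 0" "cinner (bv k) y = 0"
    using yo[of k] cinner_commute[OF yc bc(1)] by auto
  have s: "nsq y > 0"
  proof -
    have "y \<noteq> 0\<^sub>v n" using nz cinner_smult(1)[OF ac(1) yc, of 0] ac(1) by (auto simp: cinner_eq[of _ n])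
    then show ?thesis using nsq_nonneg[of y] nsq_eq_0_iff[OF yc] by simp
  qed
  \<comment> \<open>\<open>z\<close> is the projection of \<open>av k\<close> onto the span of
    \<open>bv k\<close> and \<open>y\<close>, and \<open>N\<close> is its squared length.
    Normalized, it pairs with \<open>av k\<close> to sqrt N, which would exceed the maximum
    |c|.\<close>
  define d where "d = \<alpha> / complex_of_real (nsq y)"
  define N where "N = (cmod c)\<^sup>2 + (cmod \<alpha>)\<^sup>2 / nsq y"
  define z where "z = c \<cdot>\<^sub>v bv k + d \<cdot>\<^sub>v y"
  have zc: "z \<in> carrier_vec n" using bc yc by (auto simp: z_def)
  have zs: "z \<in> col_span Q" unfolding z_def by (rule col_span_lin[OF Q b(1) y])
  have Npos: "N > 0" using nz s by (auto simp: N_def \<alpha>_def intro!: add_nonneg_pos)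
  have "cinner (av k) z = cnj c * c + cnj d * \<alpha>"
    unfolding z_def cinner_lin(1)[OF ac(1) bc(1) yc] c_def \<alpha>_def ..
  also have "\<dots> = complex_of_real N"
    using s by (simp add: N_def d_def cnj_mult_self del: of_real_power)
  finally have az: "cinner (av k) z = complex_of_real N" .
  have "cinner z z = cnj c * cinner z (bv k) + cnj d * cinner z y"
    using cinner_lin(1)[OF zc bc(1) yc, of c d] by (simp add: z_def)
  also have "cinner z (bv k) = c" unfolding z_def cinner_lin(2)[OF bc(1) bc(1) yc] yby cinner_self bc by simp
  also have "cinner z y = \<alpha>" unfolding z_def cinner_lin(2)[OF yc bc(1) yc] yby cinner_self using s by (simp add: d_def)
  finally have "complex_of_real (nsq z) = complex_of_real N"
    unfolding cinner_self using s by (simp add: N_def d_def cnj_mult_self del: of_real_power)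
  then have nz': "nsq z = N" using of_real_eq_iff by blast
  define w where "w = complex_of_real (1 / sqrt N) \<cdot>\<^sub>v z"
  have w: "w = complex_of_real (1 / sqrt N) \<cdot>\<^sub>v z + 0 \<cdot>\<^sub>v z" using zc by (intro eq_vecI) (auto simp: w_def)
  have ws: "w \<in> col_span Q" unfolding w by (rule col_span_lin[OF Q zs zs])
  have wu: "unit_cvec n w" unfolding unit_cvec_iff w_def nsq_smult nz' using Npos zc
    by (simp add: norm_divide power_divide)
  have wo: "cinner w (bv i) = 0" if "i < k" for i
    unfolding w_def cinner_smult(2)[OF bic[OF that] zc] unfolding z_def cinner_lin(2)[OF bic[OF that] bc(1) yc]
    using ob[OF that] yo[of i] that by simp
  have "cmod (cinner (av k) w) \<le> cs k" by (rule mx[OF a(1) ws a(2) wu oa wo])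
  moreover have "cinner (av k) w = complex_of_real (sqrt N)"
    unfolding w_def cinner_smult(1)[OF ac(1) zc] az using Npos by (simp add: real_div_sqrt flip: of_real_mult of_real_divide)
  ultimately have "sqrt N \<le> cmod c" using Npos by (simp add: csk c_def)
  then have "(sqrt N)\<^sup>2 \<le> (cmod c)\<^sup>2" using Npos by (intro power_mono) auto
  then have "(cmod \<alpha>)\<^sup>2 / nsq y \<le> 0" using Npos by (simp add: N_def)
  then show False using s nz by (simp add: \<alpha>_def divide_le_0_iff)
qed

lemma det_unitary: assumes U: "orthocols n n U" shows "Determinant.det U \<noteq> 0"
proof
  assume "Determinant.det U = 0"
  then have "Determinant.det (U\<^sup>H * U) = 0" using orthocols_carrier[OF U] by (subst det_mult[of _ n]) auto
  then show False unfolding orthocolsD[OF U] by simp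
qed

lemma det_mat_diag: "Determinant.det (mat_diag n f) = (\<Prod>i<n. f i :: complex)"
proof -
  have "Determinant.det (mat_diag n f) = prod_list (diag_mat (mat_diag n f))"
    by (rule det_upper_triangular[of _ n]) (auto simp: mat_diag_def)
  also have "\<dots> = (\<Prod>i<n. f i)"
    by (simp add: diag_mat_def mat_diag_def prod.list_conv_set_nth lessThan_atLeast0)
  finally show ?thesis .
qed

lemma cinner_mult:
  assumes P: "P \<in> carrier_mat n a" and Q: "Q \<in> carrier_mat n b" and u: "u \<in> carrier_vec a" and w: "w \<in> carrier_vec b"
  shows "cinner (P *\<^sub>v u) (Q *\<^sub>v w) = (\<Sum>i<a. \<Sum>j<b. u $v i * cnj (w $v j) * cnj ((P\<^sup>H * Q) $$ (i, j)))"
proof -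
  have "cinner (P *\<^sub>v u) (Q *\<^sub>v w) = (\<Sum>l<n. (\<Sum>i<a. P $$ (l, i) * u $v i) * (\<Sum>j<b. cnj (Q $$ (l, j)) * cnj (w $v j)))"
    unfolding cinner_eq[OF mult_mat_vec_carrier[OF P u]]
    by (rule sum.cong[OF refl]) (simp add: mult_vec_index[OF P u] mult_vec_index[OF Q w] del: index_mult_mat_vec)
  also have "\<dots> = (\<Sum>l<n. \<Sum>i<a. \<Sum>j<b. u $v i * cnj (w $v j) * cnj (cnj (P $$ (l, i)) * Q $$ (l, j)))"
    unfolding sum_product by (intro sum.cong refl) simp
  also have "\<dots> = (\<Sum>i<a. \<Sum>j<b. u $v i * cnj (w $v j) * cnj (\<Sum>l<n. cnj (P $$ (l, i)) * Q $$ (l, j)))"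
    by (rule trans[OF sum.swap], rule sum.cong[OF refl], rule trans[OF sum.swap]) (simp add: sum_distrib_left)
  also have "\<dots> = (\<Sum>i<a. \<Sum>j<b. u $v i * cnj (w $v j) * cnj ((P\<^sup>H * Q) $$ (i, j)))"
    by (intro sum.cong refl) (simp add: adj_mult_self_index[OF P Q])
  finally show ?thesis .
qed

lemma cinner_isometry:
  assumes P: "orthocols n a P" and u: "u \<in> carrier_vec a" and w: "w \<in> carrier_vec a"
  shows "cinner (P *\<^sub>v u) (P *\<^sub>v w) = cinner u w"
  unfolding cinner_mult[OF orthocols_carrier[OF P] orthocols_carrier[OF P] u w] orthocolsD[OF P] cinner_eq[OF u]
  by (intro sum.cong refl) (simp add: if_distrib[of cnj] if_distrib[of "\<lambda>x. _ * x"] sum.delta cong: if_cong)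

lemma adj_mult_index_cinner:
  assumes P: "P \<in> carrier_mat n a" and Q: "Q \<in> carrier_mat n b" and ij: "i < a" "j < b"
  shows "(P\<^sup>H * Q) $$ (i, j) = cinner (col Q j) (col P i)"
  unfolding adj_mult_self_index[OF P Q ij] using P Q ij by (subst cinner_eq[of _ n]) (auto intro!: sum.cong)

lemma sinsq_diag:
  assumes P: "orthocols n p P" and Q: "orthocols n q Q"
    and N: "\<And>i j. i < p \<Longrightarrow> j < q \<Longrightarrow> (P\<^sup>H * Q) $$ (i, j) = (if i = j then z i else 0)"
    and z: "\<And>i. i < p \<Longrightarrow> i < q \<Longrightarrow> cmod (z i) \<le> 1"
  shows "sinsq P Q = (\<Prod>i<min p q. 1 - (cmod (z i))\<^sup>2)"
proof -
  have Pc: "P \<in> carrier_mat n p" and Qc: "Q \<in> carrier_mat n q" using P Q by (auto intro: orthocols_carrier)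
  let ?N = "P\<^sup>H * Q"
  have Nc: "?N \<in> carrier_mat p q" using Pc Qc by auto
  let ?f = "\<lambda>i. if i < p then 1 - complex_of_real ((cmod (z i))\<^sup>2) else 1"
  have "Q\<^sup>H * Q - ?N\<^sup>H * ?N = mat_diag q ?f"
  proof (rule eq_matI)
    fix i j assume "i < dim_row (mat_diag q ?f)" "j < dim_col (mat_diag q ?f)"
    then have ij: "i < q" "j < q" by auto
    have "(?N\<^sup>H * ?N) $$ (i, j) = (\<Sum>l<p. cnj (?N $$ (l, i)) * ?N $$ (l, j))"
      by (rule adj_mult_self_index[OF Nc Nc ij])
    also have "\<dots> = (\<Sum>l<p. if l = i then (if i = j then cnj (z i) * z i else 0) else 0)"
      by (intro sum.cong refl) (simp add: N ij)
    also have "\<dots> = (if i < p then (if i = j then cnj (z i) * z i else 0) else 0)" by simp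
    finally have 1: "(?N\<^sup>H * ?N) $$ (i, j) = (if i < p then (if i = j then cnj (z i) * z i else 0) else 0)" .
    have "(Q\<^sup>H * Q - ?N\<^sup>H * ?N) $$ (i, j) = (Q\<^sup>H * Q) $$ (i, j) - (?N\<^sup>H * ?N) $$ (i, j)"
      by (rule index_minus_mat(1)) (use ij Nc in auto)
    also have "\<dots> = mat_diag q ?f $$ (i, j)"
      unfolding 1 orthocolsD[OF Q] using ij by (simp add: mat_diag_def cnj_mult_self)
    finally show "(Q\<^sup>H * Q - ?N\<^sup>H * ?N) $$ (i, j) = mat_diag q ?f $$ (i, j)" .
  qed (use Nc Qc in auto)
  then have "sinsq P Q = cmod (\<Prod>i<q. ?f i)"
    unfolding sinsq_def orthocolsD[OF Q] by (simp add: det_mat_diag)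
  also have "\<dots> = (\<Prod>i<q. if i < p then 1 - (cmod (z i))\<^sup>2 else 1)"
  proof -
    have "cmod (?f i) = (if i < p then 1 - (cmod (z i))\<^sup>2 else 1)" if "i < q" for i
    proof (cases "i < p")
      case True
      have "(cmod (z i))\<^sup>2 \<le> 1" using z[OF True that] by (simp add: power_le_one)
      moreover have "?f i = complex_of_real (1 - (cmod (z i))\<^sup>2)" using True by simp
      ultimately show ?thesis using True by (simp only: norm_of_real if_True)
    qed simp
    then show ?thesis unfolding prod_norm[symmetric] by (intro prod.cong) auto
  qed
  also have "\<dots> = (\<Prod>i\<in>{..<q} \<inter> {i. i < p}. 1 - (cmod (z i))\<^sup>2)" by (simp add: prod.inter_restrict)
  also have "{..<q} \<inter> {i. i < p} = {..<min p q}" by auto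
  finally show ?thesis .
qed

lemma col_mult_vec:
  assumes "P \<in> carrier_mat n a" "W \<in> carrier_mat a b" "k < b"
  shows "col (P * W) k = P *\<^sub>v col W k"
  using assms by (intro eq_vecI) auto

text \<open>The coordinates of the family with respect to \<open>P\<close> inherit orthonormality
  because \<open>P\<close> preserves inner products.\<close>

lemma orthocols_of_family:
  assumes P: "orthocols n a P" and av: "\<And>k. k < m \<Longrightarrow> av k \<in> col_span P" "\<And>k. k < m \<Longrightarrow> nsq (av k) = 1"
    and o: "\<And>i k. i < k \<Longrightarrow> k < m \<Longrightarrow> cinner (av k) (av i) = 0"
  obtains W where "orthocols a m W" "\<forall>k<m. P *\<^sub>v col W k = av k"
proof -
  have Pc: "P \<in> carrier_mat n a" using P by (rule orthocols_carrier)
  have "\<forall>k. \<exists>c. k < m \<longrightarrow> c \<in> carrier_vec a \<and> av k = P *\<^sub>v c"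
    using av(1) Pc by (auto simp: col_span_def)
  then obtain u where u: "\<And>k. k < m \<Longrightarrow> u k \<in> carrier_vec a" "\<And>k. k < m \<Longrightarrow> av k = P *\<^sub>v u k" by metis
  define W where "W = Matrix.mat a m (\<lambda>(l, k). u k $v l)"
  have Wc: "W \<in> carrier_mat a m" by (simp add: W_def)
  have cW: "col W k = u k" if "k < m" for k using that u(1)[OF that] by (intro eq_vecI) (auto simp: W_def)
  have avc: "av k \<in> carrier_vec n" if "k < m" for k using av(1)[OF that] col_span_carrier[OF Pc] by blast
  have "W\<^sup>H * W = 1\<^sub>m m"
  proof (rule eq_matI)
    fix i j assume "i < dim_row (1\<^sub>m m :: complex Matrix.mat)" "j < dim_col (1\<^sub>m m :: complex Matrix.mat)"
    then have ij: "i < m" "j < m" by auto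
    have "(W\<^sup>H * W) $$ (i, j) = cinner (av j) (av i)"
      unfolding adj_mult_index_cinner[OF Wc Wc ij] cW[OF ij(1)] cW[OF ij(2)] u(2)[OF ij(1)] u(2)[OF ij(2)]
      by (rule cinner_isometry[symmetric, OF P u(1)[OF ij(2)] u(1)[OF ij(1)]])
    also have "\<dots> = (if i = j then 1 else 0)"
    proof -
      consider "i < j" | "i = j" | "j < i" by linarith
      then show ?thesis
      proof cases
        case 3
        then show ?thesis using o[of j i] ij cinner_commute[OF avc[OF ij(1)] avc[OF ij(2)]] by simp
      qed (use o ij av(2) in \<open>auto simp: cinner_self\<close>)
    qed
    finally show "(W\<^sup>H * W) $$ (i, j) = 1\<^sub>m m $$ (i, j)" using ij by simp
  qed (use Wc in auto)
  then show ?thesis using that[of W] Wc cW u(2) by (auto simp: orthocols_def)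
qed

text \<open>The principal vectors serve as bases, those of the larger space being completed.
  First-order optimality, applied from either side, makes all off-diagonal cross products vanish.
  Both argument orders are recorded because the lower-dimensional space may come from either
  matrix.\<close>

lemma principal_seq_sinsq:
  assumes P: "orthocols n a P" and Q: "orthocols n b Q" and ab: "a \<le> b"
    and ps: "principal_seq n (col_span P) (col_span Q) a av bv cs"
  shows "sinsq P Q = (\<Prod>k<a. 1 - (cs k)\<^sup>2)" "sinsq Q P = (\<Prod>k<a. 1 - (cs k)\<^sup>2)" "\<And>k. k < a \<Longrightarrow> cs k \<in> {0..1}"
proof -
  have Pc: "P \<in> carrier_mat n a" and Qc: "Q \<in> carrier_mat n b" using P Q by (auto intro: orthocols_carrier)
  note psk = ps[unfolded principal_seq_def, rule_format]
  have av: "av k \<in> col_span P" "nsq (av k) = 1" "unit_cvec n (av k)" and bv: "bv k \<in> col_span Q" "nsq (bv k) = 1" "unit_cvec n (bv k)"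
    and csk: "cs k = cmod (cinner (av k) (bv k))" if "k < a" for k
    using psk[OF that] by (auto simp: unit_cvec_iff)
  have oav: "cinner (av k) (av i) = 0" and obv: "cinner (bv k) (bv i) = 0" if "i < k" "k < a" for i k
    using psk[OF that(2)] that(1) by auto
  have avc: "av k \<in> carrier_vec n" and bvc: "bv k \<in> carrier_vec n" if "k < a" for k
    using av(3)[OF that] bv(3)[OF that] by (auto simp: unit_cvec_iff)
  show cs1: "cs k \<in> {0..1}" if "k < a" for k
    unfolding csk[OF that] using cinner_unit_le[OF av(3)[OF that] bv(3)[OF that]] by simp
  obtain W where W: "orthocols a a W" and PW: "\<forall>k<a. P *\<^sub>v col W k = av k"
    by (rule orthocols_of_family[OF P av(1,2) oav])
  obtain C0 where C0: "orthocols b a C0" and QC0: "\<forall>k<a. Q *\<^sub>v col C0 k = bv k"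
    by (rule orthocols_of_family[OF Q bv(1,2) obv])
  obtain C where C: "orthocols b b C" and CC0: "\<And>i j. i < b \<Longrightarrow> j < a \<Longrightarrow> C $$ (i, j) = C0 $$ (i, j)"
    using orthocols_completion[OF C0 ab] by auto
  have Wc: "W \<in> carrier_mat a a" and Cc: "C \<in> carrier_mat b b" using W C by (auto intro: orthocols_carrier)
  have cP: "col (P * W) k = av k" if "k < a" for k using col_mult_vec[OF Pc Wc that] PW that by simp
  have cQ: "col (Q * C) k = bv k" if "k < a" for k
  proof -
    have "col C k = col C0 k"
      using that ab Cc orthocols_carrier[OF C0] by (intro eq_vecI) (auto simp: CC0)
    then show ?thesis using col_mult_vec[OF Qc Cc, of k] QC0 that ab by simp
  qed
  have oP: "orthocols n a (P * W)" and oQ: "orthocols n b (Q * C)" using orthocols_mult P W Q C by blast+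
  have PWc: "P * W \<in> carrier_mat n a" and QCc: "Q * C \<in> carrier_mat n b" using oP oQ by (auto intro: orthocols_carrier)
  have ps': "principal_seq n (col_span Q) (col_span P) a bv av cs" by (rule principal_seq_swap[OF Pc Qc ps])
  have N: "((P * W)\<^sup>H * (Q * C)) $$ (i, j) = (if i = j then cinner (bv i) (av i) else 0)" if ij: "i < a" "j < b" for i j
  proof -
    have e: "((P * W)\<^sup>H * (Q * C)) $$ (i, j) = cinner (col (Q * C) j) (av i)"
      unfolding adj_mult_index_cinner[OF PWc QCc ij] cP[OF ij(1)] ..
    have cj: "col (Q * C) j \<in> col_span Q"
      using col_mult_vec[OF Qc Cc ij(2)] Qc Cc ij by (auto simp: col_span_def)
    have cjc: "col (Q * C) j \<in> carrier_vec n" by (rule col_span_carrier[OF Qc cj])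
    consider "i = j" | "j < i" | "i < j" by linarith
    then show ?thesis
    proof cases
      case 1
      then show ?thesis using e cQ ij by simp
    next
      case 2
      have ja: "j < a" using 2 ij by simp
      have "cinner (bv j) (av i) = 0"
      proof (rule principal_seq_orthogonal[OF Qc Pc ps' ja av(1)[OF ij(1)]])
        fix l assume "l \<le> j" then show "cinner (av i) (av l) = 0" using oav[of l i] 2 ij by simp
      qed
      then show ?thesis using e cQ[OF ja] 2 by simp
    next
      case 3
      \<comment> \<open>The j-th basis vector, which may stem from the completion, is orthogonal to
        \<open>bv 0\<close> up to \<open>bv i\<close>, so the optimality of step \<open>i\<close>
        applies to it.\<close>
      have "cinner (av i) (col (Q * C) j) = 0"
      proof (rule principal_seq_orthogonal[OF Pc Qc ps ij(1) cj])
        fix l assume l: "l \<le> i"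
        then have lb: "l < b" "l < a" "l \<noteq> j" using 3 ij ab by auto
        have "((Q * C)\<^sup>H * (Q * C)) $$ (l, j) = cinner (col (Q * C) j) (bv l)"
          unfolding adj_mult_index_cinner[OF QCc QCc lb(1) ij(2)] cQ[OF lb(2)] ..
        then show "cinner (col (Q * C) j) (bv l) = 0" unfolding orthocolsD[OF oQ] using lb ij by simp
      qed
      then show ?thesis using e 3 cinner_commute[OF avc[OF ij(1)] cjc] by simp
    qed
  qed
  have zc: "cmod (cinner (bv i) (av i)) = cs i" if "i < a" for i
    using csk[OF that] cinner_commute[OF avc[OF that] bvc[OF that]] by simp
  have "sinsq P Q = sinsq (P * W) (Q * C)"
    using sinsq_unitary_right[OF W Pc QCc] sinsq_invertible_right[OF Pc Qc Cc det_unitary[OF C]] by simp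
  also have "\<dots> = (\<Prod>i<min a b. 1 - (cmod (cinner (bv i) (av i)))\<^sup>2)"
    by (rule sinsq_diag[OF oP oQ N]) (use zc cs1 in auto)
  also have "\<dots> = (\<Prod>k<a. 1 - (cs k)\<^sup>2)" using ab zc by (intro prod.cong) auto
  finally show "sinsq P Q = (\<Prod>k<a. 1 - (cs k)\<^sup>2)" .
  have N': "((Q * C)\<^sup>H * (P * W)) $$ (j, i) = (if j = i then cnj (cinner (bv j) (av j)) else 0)" if "j < b" "i < a" for i j
  proof -
    have "((Q * C)\<^sup>H * (P * W)) $$ (j, i) = cnj (((P * W)\<^sup>H * (Q * C)) $$ (i, j))"
      unfolding adj_mult_self_index[OF QCc PWc that] adj_mult_self_index[OF PWc QCc that(2,1)] by (simp add: mult.commute)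
    then show ?thesis unfolding N[OF that(2,1)] by simp
  qed
  have "sinsq Q P = sinsq (Q * C) (P * W)"
    using sinsq_unitary_right[OF C Qc PWc] sinsq_invertible_right[OF Qc Pc Wc det_unitary[OF W]] by simp
  also have "\<dots> = (\<Prod>i<min b a. 1 - (cmod (cnj (cinner (bv i) (av i))))\<^sup>2)"
    by (rule sinsq_diag[OF oQ oP N']) (use zc cs1 in auto)
  also have "\<dots> = (\<Prod>k<a. 1 - (cs k)\<^sup>2)" using ab zc by (intro prod.cong) auto
  finally show "sinsq Q P = (\<Prod>k<a. 1 - (cs k)\<^sup>2)" .
qed

text \<open>Singular vectors of the cross Gram matrix, carried back by \<open>P\<close> and
  \<open>Q\<close>, are principal vectors, and the cosines are the singular values.\<close>

lemma principal_seq_exists: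
  assumes P: "orthocols n a P" and Q: "orthocols n b Q" and ab: "a \<le> b"
  shows "\<exists>cs av bv. principal_seq n (col_span P) (col_span Q) a av bv cs"
proof -
  have Pc: "P \<in> carrier_mat n a" and Qc: "Q \<in> carrier_mat n b" using P Q by (auto intro: orthocols_carrier)
  have Mc: "P\<^sup>H * Q \<in> carrier_mat a b" using Pc Qc by auto
  obtain U V d where svd: "is_svd a b (P\<^sup>H * Q) U V d" by (rule exists_svd[OF Mc])
  let ?S = "Matrix.mat a b (\<lambda>(i, j). if i = j then complex_of_real (sqrt (d i)) else 0)"
  have U: "orthocols a a U" and V: "orthocols b b V" and MV: "(P\<^sup>H * Q) * V = U * ?S"
    and dec: "\<And>i j. i \<le> j \<Longrightarrow> j < a \<Longrightarrow> d j \<le> d i" and nn: "\<And>i. i < a \<Longrightarrow> 0 \<le> d i"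
    using svd unfolding is_svd_def by blast+
  have Uc: "U \<in> carrier_mat a a" and Vc: "V \<in> carrier_mat b b" using U V by (auto intro: orthocols_carrier)
  define P' where "P' = P * U"
  define Q' where "Q' = Q * V"
  have oP: "orthocols n a P'" and oQ: "orthocols n b Q'" unfolding P'_def Q'_def using orthocols_mult P U Q V by blast+
  have Pc': "P' \<in> carrier_mat n a" and Qc': "Q' \<in> carrier_mat n b" using oP oQ by (auto intro: orthocols_carrier)
  have sP: "col_span P = col_span P'" and sQ: "col_span Q = col_span Q'"
    unfolding P'_def Q'_def using col_span_invertible Pc Uc Qc Vc det_unitary U V by blast+
  have "P'\<^sup>H * Q' = U\<^sup>H * ((P\<^sup>H * Q) * V)" unfolding P'_def Q'_def by (rule gram_mult_right[OF Pc Qc Uc Vc])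
  also have "\<dots> = (U\<^sup>H * U) * ?S" unfolding MV by (rule assoc_mult_mat[symmetric, of _ a a _ a _ b]) (use Uc in auto)
  finally have N: "P'\<^sup>H * Q' = ?S" unfolding orthocolsD[OF U] by simp
  have inner: "cinner (P' *\<^sub>v u) (Q' *\<^sub>v w) = (\<Sum>i<a. u $v i * cnj (w $v i) * complex_of_real (sqrt (d i)))"
    if "u \<in> carrier_vec a" "w \<in> carrier_vec b" for u w
  proof -
    have "cinner (P' *\<^sub>v u) (Q' *\<^sub>v w) = (\<Sum>i<a. \<Sum>j<b. if j = i then u $v i * cnj (w $v i) * complex_of_real (sqrt (d i)) else 0)"
      unfolding cinner_mult[OF Pc' Qc' that] N by (intro sum.cong refl) auto
    also have "\<dots> = (\<Sum>i<a. u $v i * cnj (w $v i) * complex_of_real (sqrt (d i)))"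
      using ab by (intro sum.cong refl) auto
    finally show ?thesis .
  qed
  have colP: "col P' k = P' *\<^sub>v unit_vec a k" if "k < a" for k using Pc' that by (intro eq_vecI) auto
  have colQ: "col Q' k = Q' *\<^sub>v unit_vec b k" if "k < b" for k using Qc' that by (intro eq_vecI) auto
  have coP: "cinner (P' *\<^sub>v u) (col P' i) = u $v i" if "u \<in> carrier_vec a" "i < a" for u i
    unfolding colP[OF that(2)] cinner_isometry[OF oP that(1) unit_vec_carrier] cinner_eq[OF that(1)]
    using that(2) by (simp add: if_distrib[of cnj] if_distrib[of "\<lambda>x. _ * x"] sum.delta cong: if_cong)
  have coQ: "cinner (Q' *\<^sub>v u) (col Q' i) = u $v i" if "u \<in> carrier_vec b" "i < b" for u i
    unfolding colQ[OF that(2)] cinner_isometry[OF oQ that(1) unit_vec_carrier] cinner_eq[OF that(1)]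
    using that(2) by (simp add: if_distrib[of cnj] if_distrib[of "\<lambda>x. _ * x"] sum.delta cong: if_cong)
  have ncol: "unit_cvec n (col R k)" if "orthocols n m R" "k < m" for R m k
  proof -
    have "nsq (R *\<^sub>v unit_vec m k) = 1"
      unfolding nsq_orthocols[OF that(1) unit_vec_carrier]
      using that(2) by (simp add: nsq_def if_distrib[of cmod] if_distrib[of "\<lambda>x. x\<^sup>2"] sum.delta cong: if_cong)
    moreover have "col R k = R *\<^sub>v unit_vec m k" using orthocols_carrier[OF that(1)] that(2) by (intro eq_vecI) auto
    ultimately show ?thesis using orthocols_carrier[OF that(1)] that(2) by (simp add: unit_cvec_iff)
  qed
  have "principal_seq n (col_span P') (col_span Q') a (col P') (col Q') (\<lambda>k. cmod (cinner (col P' k) (col Q' k)))"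
    unfolding principal_seq_def
  proof (intro allI impI conjI ballI)
    fix k assume k: "k < a"
    then have kb: "k < b" using ab by simp
    show "col P' k \<in> col_span P'" by (rule col_in_span[OF Pc' k])
    show "col Q' k \<in> col_span Q'" by (rule col_in_span[OF Qc' kb])
    show "unit_cvec n (col P' k)" by (rule ncol[OF oP k])
    show "unit_cvec n (col Q' k)" by (rule ncol[OF oQ kb])
    show "cinner (col P' k) (col P' i) = 0" if "i < k" for i
      unfolding colP[OF k] using coP[of "unit_vec a k" i] that k by simp
    show "cinner (col Q' k) (col Q' i) = 0" if "i < k" for i
      unfolding colQ[OF kb] using coQ[of "unit_vec b k" i] that kb by simp
    show "cmod (cinner (col P' k) (col Q' k)) = cmod (cinner (col P' k) (col Q' k))" ..
    fix x y assume x: "x \<in> col_span P'" and y: "y \<in> col_span Q'"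
      and h: "unit_cvec n x \<and> unit_cvec n y \<and> (\<forall>i<k. cinner x (col P' i) = 0 \<and> cinner y (col Q' i) = 0)"
    obtain u where u: "u \<in> carrier_vec a" "x = P' *\<^sub>v u" using x Pc' by (auto simp: col_span_def)
    obtain w where w: "w \<in> carrier_vec b" "y = Q' *\<^sub>v w" using y Qc' by (auto simp: col_span_def)
    have nu: "nsq u = 1" using h nsq_orthocols[OF oP u(1)] u by (simp add: unit_cvec_iff)
    have nw: "nsq w = 1" using h nsq_orthocols[OF oQ w(1)] w by (simp add: unit_cvec_iff)
    have u0: "u $v i = 0" if "i < k" for i using coP[OF u(1), of i] h that k u(2) by simp
    have ck: "cinner (col P' k) (col Q' k) = complex_of_real (sqrt (d k))"
      unfolding colP[OF k] colQ[OF kb] inner[OF unit_vec_carrier unit_vec_carrier]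
      using k kb ab by (simp add: if_distrib[of cnj] if_distrib[of "\<lambda>x. _ * x"] if_distrib[of "\<lambda>x. x * _"] sum.delta cong: if_cong)
    have "cmod (cinner x y) \<le> (\<Sum>i<a. cmod (u $v i * cnj (w $v i) * complex_of_real (sqrt (d i))))"
      unfolding u w inner[OF u(1) w(1)] by (rule norm_sum)
    \<comment> \<open>The constraints kill the coordinates of \<open>x\<close> below
      \<open>k\<close>, the remaining singular values are at most \<open>sqrt (d k)\<close>, and the
      arithmetic-geometric mean inequality handles each product, which is sharp enough for unit
      vectors.\<close>
    also have "\<dots> \<le> (\<Sum>i<a. sqrt (d k) * (((cmod (u $v i))\<^sup>2 + (cmod (w $v i))\<^sup>2) / 2))"
    proof (rule sum_mono)
      fix i assume "i \<in> {..<a}"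
      then have i: "i < a" by simp
      show "cmod (u $v i * cnj (w $v i) * complex_of_real (sqrt (d i))) \<le> sqrt (d k) * (((cmod (u $v i))\<^sup>2 + (cmod (w $v i))\<^sup>2) / 2)"
      proof (cases "i < k")
        case True
        then show ?thesis using u0[OF True] nn[OF k] by simp
      next
        case False
        have "cmod (u $v i * cnj (w $v i) * complex_of_real (sqrt (d i))) = sqrt (d i) * (cmod (u $v i) * cmod (w $v i))"
          using nn[OF i] by (simp add: norm_mult)
        also have "\<dots> \<le> sqrt (d k) * (((cmod (u $v i))\<^sup>2 + (cmod (w $v i))\<^sup>2) / 2)"
          using dec[of k i] False i nn[OF k] sum_squares_bound[of "cmod (u $v i)" "cmod (w $v i)"] by (intro mult_mono) auto
        finally show ?thesis .
      qed
    qed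
    also have "\<dots> = sqrt (d k) * ((\<Sum>i<a. (cmod (u $v i))\<^sup>2) + (\<Sum>i<a. (cmod (w $v i))\<^sup>2)) / 2"
      by (simp add: sum_distrib_left[symmetric] sum_divide_distrib[symmetric] sum.distrib)
    also have "\<dots> \<le> sqrt (d k) * (1 + 1) / 2"
    proof -
      have "(\<Sum>i<a. (cmod (w $v i))\<^sup>2) \<le> (\<Sum>i<b. (cmod (w $v i))\<^sup>2)" using ab by (intro sum_mono2) auto
      then show ?thesis using nu nw u(1) w(1) nn[OF k] by (intro divide_right_mono mult_left_mono add_mono) (auto simp: nsq_def)
    qed
    finally show "cmod (cinner x y) \<le> cmod (cinner (col P' k) (col Q' k))" unfolding ck using nn[OF k] by simp
  qed
  then show ?thesis unfolding sP sQ by blast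
qed

text \<open>The determinant formula holds for every principal sequence, hence for the one that the
  choice operator picks.\<close>

lemma sin_prod_aux_sq:
  assumes P: "orthocols n a P" and Q: "orthocols n b Q" and ab: "a \<le> b"
  shows "(sin_prod_aux n (col_span P) (col_span Q))\<^sup>2 = sinsq P Q" "(sin_prod_aux n (col_span P) (col_span Q))\<^sup>2 = sinsq Q P"
proof -
  define cs where "cs = (SOME cs. \<exists>av bv. principal_seq n (col_span P) (col_span Q) a av bv cs)"
  have "\<exists>av bv. principal_seq n (col_span P) (col_span Q) a av bv cs"
    using someI_ex[OF principal_seq_exists[OF P Q ab]] unfolding cs_def .
  then obtain av bv where ps: "principal_seq n (col_span P) (col_span Q) a av bv cs" by blast
  note * = principal_seq_sinsq[OF P Q ab ps]
  have "(sin_prod_aux n (col_span P) (col_span Q))\<^sup>2 = (\<Prod>k<a. (sin (arccos (cs k)))\<^sup>2)"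
    unfolding sin_prod_aux_def cdim_orthocols[OF P] Let_def cs_def[symmetric] prod_power_distrib ..
  also have "\<dots> = (\<Prod>k<a. 1 - (cs k)\<^sup>2)"
  proof (rule prod.cong[OF refl])
    fix k assume "k \<in> {..<a}"
    then have c: "0 \<le> cs k" "cs k \<le> 1" using *(3)[of k] by auto
    have "(cs k)\<^sup>2 \<le> 1" using c by (simp add: power_le_one)
    then show "(sin (arccos (cs k)))\<^sup>2 = 1 - (cs k)\<^sup>2" using sin_arccos[of "cs k"] c by simp
  qed
  finally show "(sin_prod_aux n (col_span P) (col_span Q))\<^sup>2 = sinsq P Q" "(sin_prod_aux n (col_span P) (col_span Q))\<^sup>2 = sinsq Q P"
    using *(1,2) by simp_all
qed

text \<open>\<open>Y\<close> is first replaced by its polar factor, which changes neither its span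
  nor \<open>sinsq\<close>. The two parts of the preceding lemma cover the cases in which
  \<open>P\<close> or \<open>Y\<close> spans the smaller space.\<close>

theorem sin_mat_sq:
  assumes P: "orthocols n t P" and Y: "Y \<in> carrier_mat n r" and fr: "full_rank Y"
  shows "(sin_mat n P Y)\<^sup>2 = sinsq P Y"
proof -
  define Q where "Q = orthonormalize Y"
  have Q: "orthocols n r Q" unfolding Q_def by (rule orthonormalize[OF Y fr])
  have QY: "Q = Y * inv_sqrt r (Y\<^sup>H * Y)" using Y by (simp add: Q_def orthonormalize_def)
  have ic: "inv_sqrt r (Y\<^sup>H * Y) \<in> carrier_mat r r" by (simp add: inv_sqrt_def)
  have s: "col_span Y = col_span Q"
    unfolding QY by (rule col_span_invertible[symmetric, OF Y ic orthonormalize(2)[OF Y fr]])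
  have q: "sinsq P Y = sinsq P Q"
    unfolding QY by (rule sinsq_invertible_right[symmetric, OF orthocols_carrier[OF P] Y ic orthonormalize(2)[OF Y fr]])
  show ?thesis
    unfolding sin_mat_def sin_subspaces_def s q cdim_orthocols[OF P] cdim_orthocols[OF Q]
    using sin_prod_aux_sq(1)[OF P Q] sin_prod_aux_sq(2)[OF Q P] by auto
qed

section \<open>Complex Gaussian measures\<close>

lemma sets_cgauss [measurable_cong, simp]: "sets cgauss = sets borel"
  by (simp add: cgauss_def)

lemma space_cgauss [simp]: "space cgauss = UNIV"
  by (simp add: cgauss_def)

lemma sets_borel_atMost: "sets (borel :: real measure) = sigma_sets UNIV (range atMost)"
  by (subst borel_eq_atMost) (simp add: sets_measure_of)

text \<open>A disc of radius sqrt s has area pi * s, and closed half-lines generate the Borel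
  sets.\<close>

lemma distr_cmod_square:
  "distr lborel borel (\<lambda>z::complex. (cmod z)\<^sup>2) = density lborel (\<lambda>x. ennreal (pi * indicator {0..} x))"
proof (rule measure_eqI_generator_eq[where E="range atMost" and A="\<lambda>n. {..real n}" and \<Omega>=UNIV])
  show "Int_stable (range atMost :: real set set)" by (auto simp: Int_stable_def)
  show "sets (distr lborel (borel :: real measure) (\<lambda>z::complex. (cmod z)\<^sup>2)) = sigma_sets UNIV (range atMost)"
    by (simp add: sets_borel_atMost)
  show "sets (density lborel (\<lambda>x::real. ennreal (pi * indicator {0..} x))) = sigma_sets UNIV (range atMost)"
    by (simp add: sets_borel_atMost)
  have e1: "emeasure (distr lborel borel (\<lambda>z::complex. (cmod z)\<^sup>2)) {..s} = ennreal (pi * max 0 s)" for s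
  proof (cases "s < 0")
    case True
    then have "(\<lambda>z::complex. (cmod z)\<^sup>2) -` {..s} = {}"
      by (auto dest: order_le_less_trans[of _ s 0])
    then show ?thesis using True by (simp add: emeasure_distr)
  next
    case False
    have "cmod z \<le> sqrt s \<longleftrightarrow> (cmod z)\<^sup>2 \<le> s" for z
      using False by (metis norm_ge_zero real_le_rsqrt real_sqrt_le_iff real_sqrt_unique)
    then have "(\<lambda>z::complex. (cmod z)\<^sup>2) -` {..s} = cball 0 (sqrt s)"
      by (auto simp: dist_norm)
    then show ?thesis using False emeasure_cball[of "sqrt s" "0::complex"]
      by (simp add: emeasure_distr unit_ball_vol_2)
  qed
  have e2: "emeasure (density lborel (\<lambda>x. ennreal (pi * indicator {0..} x))) {..s} = ennreal (pi * max 0 s)" for s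
  proof -
    have "emeasure (density lborel (\<lambda>x. ennreal (pi * indicator {0..} x))) {..s}
      = (\<integral>\<^sup>+x. ennreal pi * indicator {0..s} x \<partial>lborel)"
      by (subst emeasure_density) (auto intro!: nn_integral_cong split: split_indicator)
    also have "\<dots> = ennreal pi * emeasure lborel {0..s}" by (rule nn_integral_cmult_indicator) simp
    also have "\<dots> = ennreal (pi * max 0 s)"
      by (cases "0 \<le> s") (auto simp: ennreal_mult)
    finally show ?thesis .
  qed
  show "emeasure (distr lborel borel (\<lambda>z::complex. (cmod z)\<^sup>2)) X = emeasure (density lborel (\<lambda>x. ennreal (pi * indicator {0..} x))) X"
    if "X \<in> range atMost" for X using that e1 e2 by auto
  show "(\<Union>i. {..real i}) = UNIV" by (auto intro: real_arch_simple)
  show "emeasure (distr lborel borel (\<lambda>z::complex. (cmod z)\<^sup>2)) {..real i} \<noteq> \<infinity>" for i unfolding e1 by simp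
qed auto

text \<open>The squared modulus of a standard complex Gaussian is exponential with rate 1. It is
  written as an Erlang density so that sums can be treated by convolution.\<close>

lemma nn_integral_cgauss_radial:
  assumes [measurable]: "f \<in> borel_measurable borel"
  shows "(\<integral>\<^sup>+z. f ((cmod z)\<^sup>2) \<partial>cgauss) = (\<integral>\<^sup>+x. ennreal (erlang_density 0 1 x) * f x \<partial>lborel)"
proof -
  have "(\<integral>\<^sup>+z. f ((cmod z)\<^sup>2) \<partial>cgauss) = (\<integral>\<^sup>+z. ennreal (exp (- (cmod z)\<^sup>2) / pi) * f ((cmod z)\<^sup>2) \<partial>lborel)"
    unfolding cgauss_def by (subst nn_integral_density) auto
  also have "\<dots> = (\<integral>\<^sup>+x. ennreal (exp (- x) / pi) * f x \<partial>distr lborel borel (\<lambda>z::complex. (cmod z)\<^sup>2))"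
    by (subst nn_integral_distr) auto
  also have "\<dots> = (\<integral>\<^sup>+x. ennreal (pi * indicator {0..} x) * (ennreal (exp (- x) / pi) * f x) \<partial>lborel)"
    unfolding distr_cmod_square by (subst nn_integral_density) auto
  also have "\<dots> = (\<integral>\<^sup>+x. ennreal (erlang_density 0 1 x) * f x \<partial>lborel)"
    by (intro nn_integral_cong)
       (auto simp: erlang_density_def mult.assoc[symmetric] ennreal_mult[symmetric] split: split_indicator)
  finally show ?thesis .
qed

lemma prob_space_cgauss: "prob_space cgauss"
proof
  have "emeasure cgauss (space cgauss) = (\<integral>\<^sup>+z. (\<lambda>_. 1) ((cmod z)\<^sup>2) \<partial>cgauss)" by simp
  also have "\<dots> = (\<integral>\<^sup>+x. ennreal (erlang_density 0 1 x) \<partial>lborel)"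
    by (subst nn_integral_cgauss_radial) auto
  also have "\<dots> = 1" using nn_integral_erlang_ith_moment[of 1 0 0] by simp
  finally show "emeasure cgauss (space cgauss) = 1" .
qed

text \<open>Index sets are arbitrary, since single columns of a matrix and blocks of a rotated
  column will be integrated separately.\<close>

definition gauss :: "'i set \<Rightarrow> ('i \<Rightarrow> complex) measure" where
  "gauss I = PiM I (\<lambda>_. cgauss)"

definition leb :: "'i set \<Rightarrow> ('i \<Rightarrow> complex) measure" where
  "leb I = PiM I (\<lambda>_. lborel)"

lemma noise_eq: "noise n r = gauss ({..<n} \<times> {..<r})"
  by (simp add: noise_def gauss_def)

lemma product_prob_space_cgauss: "product_prob_space (\<lambda>_::'i. cgauss)"
  by (intro product_prob_spaceI prob_space_cgauss)

lemma product_sigma_finite_cgauss: "product_sigma_finite (\<lambda>_::'i. cgauss)"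
  using product_prob_space_cgauss by (rule product_prob_space.axioms)

lemma product_sigma_finite_lborel: "product_sigma_finite (\<lambda>_::'i. lborel :: complex measure)"
  by (simp add: product_sigma_finite_def lborel.sigma_finite_measure_axioms)

lemma prob_space_gauss: "prob_space (gauss I)"
  unfolding gauss_def by (intro prob_space_PiM prob_space_cgauss)

lemma sets_gauss: "sets (gauss I) = sets (PiM I (\<lambda>_. borel))"
  unfolding gauss_def by (intro sets_PiM_cong) auto

lemma sets_leb: "sets (leb I) = sets (PiM I (\<lambda>_. borel))"
  unfolding leb_def by (intro sets_PiM_cong) auto

lemma space_leb: "space (leb I) = (\<Pi>\<^sub>E i\<in>I. UNIV)"
  unfolding leb_def by (simp add: space_PiM)

lemma measurable_coord [measurable (raw)]: "i \<in> I \<Longrightarrow> (\<lambda>w. w i) \<in> borel_measurable (gauss I)" "i \<in> I \<Longrightarrow> (\<lambda>w. w i) \<in> borel_measurable (leb I)"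
  by (auto simp: measurable_cong_sets[OF sets_gauss refl] measurable_cong_sets[OF sets_leb refl])

lemma sigma_finite_leb: "finite I \<Longrightarrow> sigma_finite_measure (leb I)"
proof -
  assume "finite I"
  interpret product_sigma_finite "\<lambda>_::'a. lborel :: complex measure" by (rule product_sigma_finite_lborel)
  interpret finite_product_sigma_finite "\<lambda>_::'a. lborel :: complex measure" I by standard fact
  show ?thesis unfolding leb_def by (rule sigma_finite_measure_axioms)
qed

definition gdens :: "'i set \<Rightarrow> ('i \<Rightarrow> complex) \<Rightarrow> ennreal" where
  "gdens I w = (\<Prod>i\<in>I. ennreal (exp (- (cmod (w i))\<^sup>2) / pi))"

lemma measurable_gdens [measurable]: "gdens I \<in> borel_measurable (leb I)"
  unfolding gdens_def by measurable

lemma gauss_eq_density: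
  assumes "finite I" shows "gauss I = density (leb I) (gdens I)"
proof -
  interpret G: product_sigma_finite "\<lambda>_::'a. cgauss" by (rule product_sigma_finite_cgauss)
  interpret L: product_sigma_finite "\<lambda>_::'a. lborel :: complex measure" by (rule product_sigma_finite_lborel)
  show ?thesis unfolding gauss_def
  proof (rule G.PiM_eqI[symmetric, OF assms])
    show "sets (density (leb I) (gdens I)) = sets (PiM I (\<lambda>_. cgauss))"
      unfolding sets_density sets_leb by (intro sets_PiM_cong) auto
    fix A :: "'a \<Rightarrow> complex set" assume A: "\<And>i. i \<in> I \<Longrightarrow> A i \<in> sets cgauss"
    have Am[measurable]: "Pi\<^sub>E I A \<in> sets (leb I)"
      unfolding leb_def using A assms by (intro sets_PiM_I_finite) auto
    have "emeasure (density (leb I) (gdens I)) (Pi\<^sub>E I A) = (\<integral>\<^sup>+w. gdens I w * indicator (Pi\<^sub>E I A) w \<partial>leb I)"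
      by (subst emeasure_density) auto
    also have "\<dots> = (\<integral>\<^sup>+w. (\<Prod>i\<in>I. ennreal (exp (- (cmod (w i))\<^sup>2) / pi) * indicator (A i) (w i)) \<partial>leb I)"
    proof (rule nn_integral_cong)
      fix w assume "w \<in> space (leb I)"
      then have "(indicator (Pi\<^sub>E I A) w :: ennreal) = (\<Prod>i\<in>I. indicator (A i) (w i))"
        using assms by (auto simp: space_leb PiE_iff indicator_def prod_zero_iff)
      then show "gdens I w * indicator (Pi\<^sub>E I A) w = (\<Prod>i\<in>I. ennreal (exp (- (cmod (w i))\<^sup>2) / pi) * indicator (A i) (w i))"
        unfolding gdens_def prod.distrib by simp
    qed
    also have "\<dots> = (\<Prod>i\<in>I. \<integral>\<^sup>+z. ennreal (exp (- (cmod z)\<^sup>2) / pi) * indicator (A i) z \<partial>lborel)"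
      unfolding leb_def using A by (intro L.product_nn_integral_prod assms) auto
    also have "\<dots> = (\<Prod>i\<in>I. emeasure cgauss (A i))"
      using A by (intro prod.cong refl) (simp add: cgauss_def emeasure_density)
    finally show "emeasure (density (leb I) (gdens I)) (Pi\<^sub>E I A) = (\<Prod>i\<in>I. emeasure cgauss (A i))" .
  qed
qed

lemma nn_integral_gauss:
  assumes "finite I" "f \<in> borel_measurable (leb I)"
  shows "(\<integral>\<^sup>+w. f w \<partial>gauss I) = (\<integral>\<^sup>+w. gdens I w * f w \<partial>leb I)"
  unfolding gauss_eq_density[OF assms(1)] using assms by (intro nn_integral_density) auto

section \<open>Invariance under translations and isometries\<close>

definition vplus :: "'i set \<Rightarrow> ('i \<Rightarrow> complex) \<Rightarrow> ('i \<Rightarrow> complex) \<Rightarrow> ('i \<Rightarrow> complex)" where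
  "vplus I x y = (\<lambda>i\<in>I. x i + y i)"

definition vneg :: "'i set \<Rightarrow> ('i \<Rightarrow> complex) \<Rightarrow> ('i \<Rightarrow> complex)" where
  "vneg I x = (\<lambda>i\<in>I. - x i)"

lemma distr_leb_vplus:
  assumes I: "finite I"
  shows "distr (leb I) (leb I) (vplus I c) = leb I"
proof -
  interpret L: product_sigma_finite "\<lambda>_::'a. lborel :: complex measure" by (rule product_sigma_finite_lborel)
  have [measurable]: "vplus I c \<in> measurable (leb I) (leb I)"
    unfolding leb_def vplus_def by measurable
  show ?thesis unfolding leb_def
  proof (rule L.PiM_eqI[OF I])
    fix A :: "'a \<Rightarrow> complex set" assume A: "\<And>i. i \<in> I \<Longrightarrow> A i \<in> sets lborel"
    have Am: "Pi\<^sub>E I A \<in> sets (leb I)" unfolding leb_def using A I by (intro sets_PiM_I_finite) auto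
    have B: "(+) (c i) -` A i \<in> sets borel" if "i \<in> I" for i
      using A[OF that] measurable_sets[of "(+) (c i)" borel borel "A i"] by simp
    have "emeasure (distr (leb I) (leb I) (vplus I c)) (Pi\<^sub>E I A) = emeasure (leb I) (vplus I c -` Pi\<^sub>E I A \<inter> space (leb I))"
      by (rule emeasure_distr) (use Am in auto)
    also have "vplus I c -` Pi\<^sub>E I A \<inter> space (leb I) = Pi\<^sub>E I (\<lambda>i. (+) (c i) -` A i)"
      by (auto simp: space_leb vplus_def PiE_iff extensional_def)
    also have "emeasure (leb I) \<dots> = (\<Prod>i\<in>I. emeasure lborel ((+) (c i) -` A i))"
      unfolding leb_def using B by (intro L.emeasure_PiM I) auto
    also have "\<dots> = (\<Prod>i\<in>I. emeasure lborel (A i))"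
    proof (rule prod.cong[OF refl])
      fix i assume i: "i \<in> I"
      have "emeasure lborel (A i) = emeasure (distr lborel borel ((+) (c i))) (A i)" by (simp only: lborel_distr_plus)
      also have "\<dots> = emeasure lborel ((+) (c i) -` A i)" using A[OF i] by (subst emeasure_distr) auto
      finally show "emeasure lborel ((+) (c i) -` A i) = emeasure lborel (A i)" by simp
    qed
    finally show "emeasure (distr (PiM I (\<lambda>_. lborel)) (PiM I (\<lambda>_. lborel)) (vplus I c)) (Pi\<^sub>E I A) = (\<Prod>i\<in>I. emeasure lborel (A i))"
      unfolding leb_def .
  qed simp
qed

lemma measurable_vplus [measurable]:
  assumes "f \<in> measurable M (leb I)" "g \<in> measurable M (leb I)"
  shows "(\<lambda>x. vplus I (f x) (g x)) \<in> measurable M (leb I)"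
proof -
  have [measurable]: "(\<lambda>x. f x i) \<in> borel_measurable M" "(\<lambda>x. g x i) \<in> borel_measurable M" if "i \<in> I" for i
    using measurable_compose[OF assms(1) measurable_coord(2)[OF that]] measurable_compose[OF assms(2) measurable_coord(2)[OF that]] .
  show ?thesis unfolding leb_def vplus_def by (rule measurable_restrict) simp
qed

lemma nn_integral_leb_shift:
  assumes "finite I" and f: "f \<in> borel_measurable (leb I)" and c: "c \<in> space (leb I)"
  shows "(\<integral>\<^sup>+w. f (vplus I c w) \<partial>leb I) = (\<integral>\<^sup>+w. f w \<partial>leb I)"
proof -
  have [measurable]: "vplus I c \<in> measurable (leb I) (leb I)"
    unfolding leb_def vplus_def by measurable
  have "(\<integral>\<^sup>+w. f w \<partial>leb I) = (\<integral>\<^sup>+w. f w \<partial>distr (leb I) (leb I) (vplus I c))"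
    by (simp only: distr_leb_vplus[OF assms(1)])
  also have "\<dots> = (\<integral>\<^sup>+w. f (vplus I c w) \<partial>leb I)" by (rule nn_integral_distr) (use f in auto)
  finally show ?thesis ..
qed

lemma gdens_eq:
  assumes I: "finite I" shows "gdens I x = ennreal (exp (- (\<Sum>i\<in>I. (cmod (x i))\<^sup>2)) / pi ^ card I)"
  using I by (simp add: gdens_def prod_ennreal prod_dividef exp_sum[symmetric] sum_negf)

text \<open>Uniqueness of translation invariant measures, in the form in which it is needed: \<open>T\<close> turns the
  Lebesgue measure into a translation invariant one, and the rotation invariance of the Gaussian density
  fixes the constant.\<close>
lemma nn_integral_leb_isometry_neg:
  assumes I: "finite I" and Tm[measurable]: "T \<in> measurable (leb I) (leb I)"
    and add: "\<And>x y. x \<in> space (leb I) \<Longrightarrow> y \<in> space (leb I) \<Longrightarrow> T (vplus I x y) = vplus I (T x) (T y)"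
    and surj: "\<And>y. y \<in> space (leb I) \<Longrightarrow> \<exists>x\<in>space (leb I). T x = y"
    and iso: "\<And>x. x \<in> space (leb I) \<Longrightarrow> (\<Sum>i\<in>I. (cmod (T x i))\<^sup>2) = (\<Sum>i\<in>I. (cmod (x i))\<^sup>2)"
    and h[measurable]: "h \<in> borel_measurable (leb I)"
  shows "(\<integral>\<^sup>+x. h x \<partial>leb I) = (\<integral>\<^sup>+y. h (vneg I (T y)) \<partial>leb I)"
proof -
  interpret L: sigma_finite_measure "leb I" by (rule sigma_finite_leb[OF I])
  interpret P: pair_sigma_finite "leb I" "leb I" by standard
  have Tsp: "T y \<in> space (leb I)" if "y \<in> space (leb I)" for y using measurable_space[OF Tm that] .
  have nm[measurable]: "vneg I \<in> measurable (leb I) (leb I)" unfolding leb_def vneg_def by measurable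
  have gT: "gdens I (T x) = gdens I x" if "x \<in> space (leb I)" for x by (simp add: gdens_eq[OF I] iso[OF that])
  \<comment> \<open>Surjectivity writes the translation \<open>c\<close> as an image under
    \<open>T\<close>; by additivity it becomes a translation of the variable, to which Lebesgue
    measure is blind.\<close>
  have Tshift: "(\<integral>\<^sup>+y. h (vplus I c (T y)) \<partial>leb I) = (\<integral>\<^sup>+y. h (T y) \<partial>leb I)"
    if h[measurable]: "h \<in> borel_measurable (leb I)" and c: "c \<in> space (leb I)" for h c
  proof -
    obtain b where b: "b \<in> space (leb I)" "T b = c" using surj[OF c] by blast
    have "(\<integral>\<^sup>+y. h (T y) \<partial>leb I) = (\<integral>\<^sup>+y. h (T (vplus I b y)) \<partial>leb I)"
      by (rule nn_integral_leb_shift[symmetric, OF I _ b(1)]) measurable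
    also have "\<dots> = (\<integral>\<^sup>+y. h (vplus I c (T y)) \<partial>leb I)"
      by (intro nn_integral_cong) (simp add: add[OF b(1)] b(2))
    finally show ?thesis ..
  qed
  have one: "(\<integral>\<^sup>+x. gdens I x \<partial>leb I) = 1"
    using nn_integral_gauss[OF I, of "\<lambda>_. 1"] prob_space.emeasure_space_1[OF prob_space_gauss[of I]] by simp
  have c1: "vplus I (vneg I c) (vplus I x c) = x" if "x \<in> space (leb I)" for x c
    using that by (auto simp: vplus_def vneg_def space_leb PiE_iff extensional_def)
  have c2: "vplus I x (vneg I c) = vplus I (vneg I c) x" for x c by (auto simp: vplus_def)
  have [measurable]: "(\<lambda>p. T (snd p)) \<in> measurable (leb I \<Otimes>\<^sub>M leb I) (leb I)" by measurable
  have negsp: "vneg I x \<in> space (leb I)" for x by (simp add: vneg_def space_leb)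
  \<comment> \<open>The factor 1 is inserted as the integral of the Gaussian density, which
    \<open>T\<close> preserves; the double integral is then evaluated in the other order.\<close>
  have "(\<integral>\<^sup>+x. h x \<partial>leb I) = (\<integral>\<^sup>+x. h x * (\<integral>\<^sup>+y. gdens I (T y) \<partial>leb I) \<partial>leb I)"
  proof -
    have "(\<integral>\<^sup>+y. gdens I (T y) \<partial>leb I) = 1" using one gT by (simp cong: nn_integral_cong)
    then show ?thesis by simp
  qed
  also have "\<dots> = (\<integral>\<^sup>+x. h x * (\<integral>\<^sup>+y. gdens I (vplus I x (T y)) \<partial>leb I) \<partial>leb I)"
    by (intro nn_integral_cong) (simp add: Tshift)
  also have "\<dots> = (\<integral>\<^sup>+x. \<integral>\<^sup>+y. h x * gdens I (vplus I x (T y)) \<partial>leb I \<partial>leb I)"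
    by (intro nn_integral_cong nn_integral_cmult[symmetric]) measurable
  also have "\<dots> = (\<integral>\<^sup>+y. \<integral>\<^sup>+x. h x * gdens I (vplus I x (T y)) \<partial>leb I \<partial>leb I)"
    by (rule P.Fubini') measurable
  \<comment> \<open>Translating \<open>x\<close> by \<open>T y\<close> moves the dependence on
    \<open>T\<close> from the density to \<open>h\<close>, at the price of a sign.\<close>
  also have "\<dots> = (\<integral>\<^sup>+y. \<integral>\<^sup>+x. h (vplus I (vneg I (T y)) x) * gdens I x \<partial>leb I \<partial>leb I)"
  proof (rule nn_integral_cong)
    fix y assume y: "y \<in> space (leb I)"
    have Ty: "T y \<in> space (leb I)" by (rule Tsp[OF y])
    have "(\<integral>\<^sup>+x. h (vplus I (vneg I (T y)) x) * gdens I x \<partial>leb I)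
      = (\<integral>\<^sup>+x. h (vplus I (vneg I (T y)) (vplus I (T y) x)) * gdens I (vplus I (T y) x) \<partial>leb I)"
      by (rule nn_integral_leb_shift[symmetric, OF I _ Ty]) (use negsp in measurable)
    also have "\<dots> = (\<integral>\<^sup>+x. h x * gdens I (vplus I x (T y)) \<partial>leb I)"
    proof (rule nn_integral_cong)
      fix x assume x: "x \<in> space (leb I)"
      have "vplus I (T y) x = vplus I x (T y)" by (auto simp: vplus_def)
      then show "h (vplus I (vneg I (T y)) (vplus I (T y) x)) * gdens I (vplus I (T y) x) = h x * gdens I (vplus I x (T y))"
        using c1[OF x, of "T y"] by simp
    qed
    finally show "(\<integral>\<^sup>+x. h x * gdens I (vplus I x (T y)) \<partial>leb I) = (\<integral>\<^sup>+x. h (vplus I (vneg I (T y)) x) * gdens I x \<partial>leb I)" ..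
  qed
  also have "\<dots> = (\<integral>\<^sup>+x. \<integral>\<^sup>+y. h (vplus I (vneg I (T y)) x) * gdens I x \<partial>leb I \<partial>leb I)"
    by (rule P.Fubini') measurable
  also have "\<dots> = (\<integral>\<^sup>+x. (\<integral>\<^sup>+y. h (vplus I (vneg I (T y)) x) \<partial>leb I) * gdens I x \<partial>leb I)"
    by (intro nn_integral_cong nn_integral_multc) measurable
  also have "\<dots> = (\<integral>\<^sup>+x. (\<integral>\<^sup>+y. h (vneg I (T y)) \<partial>leb I) * gdens I x \<partial>leb I)"
  proof (rule nn_integral_cong)
    fix x assume x: "x \<in> space (leb I)"
    have e: "vplus I (vneg I w) x = vneg I (vplus I (vneg I x) w)" if "w \<in> space (leb I)" for w
      by (auto simp: vplus_def vneg_def)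
    have "(\<integral>\<^sup>+y. h (vplus I (vneg I (T y)) x) \<partial>leb I) = (\<integral>\<^sup>+y. (\<lambda>w. h (vneg I w)) (vplus I (vneg I x) (T y)) \<partial>leb I)"
      by (intro nn_integral_cong) (simp add: e Tsp)
    also have "\<dots> = (\<integral>\<^sup>+y. h (vneg I (T y)) \<partial>leb I)"
      by (rule Tshift) (use negsp in measurable)
    finally show "(\<integral>\<^sup>+y. h (vplus I (vneg I (T y)) x) \<partial>leb I) * gdens I x = (\<integral>\<^sup>+y. h (vneg I (T y)) \<partial>leb I) * gdens I x" by simp
  qed
  also have "\<dots> = (\<integral>\<^sup>+y. h (vneg I (T y)) \<partial>leb I)" by (simp add: nn_integral_cmult one)
  finally show ?thesis .
qed

text \<open>The previous result for the identity map; it serves to remove the sign that occurs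
  there.\<close>

lemma nn_integral_leb_neg:
  assumes I: "finite I" and h[measurable]: "h \<in> borel_measurable (leb I)"
  shows "(\<integral>\<^sup>+x. h (vneg I x) \<partial>leb I) = (\<integral>\<^sup>+x. h x \<partial>leb I)"
  by (rule nn_integral_leb_isometry_neg[OF I, of "\<lambda>x. x", symmetric]) (auto intro: h)

lemma nn_integral_gauss_isometry:
  assumes I: "finite I" and Tm[measurable]: "T \<in> measurable (leb I) (leb I)"
    and add: "\<And>x y. x \<in> space (leb I) \<Longrightarrow> y \<in> space (leb I) \<Longrightarrow> T (vplus I x y) = vplus I (T x) (T y)"
    and surj: "\<And>y. y \<in> space (leb I) \<Longrightarrow> \<exists>x\<in>space (leb I). T x = y"
    and iso: "\<And>x. x \<in> space (leb I) \<Longrightarrow> (\<Sum>i\<in>I. (cmod (T x i))\<^sup>2) = (\<Sum>i\<in>I. (cmod (x i))\<^sup>2)"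
    and f[measurable]: "f \<in> borel_measurable (leb I)"
  shows "(\<integral>\<^sup>+w. f (T w) \<partial>gauss I) = (\<integral>\<^sup>+w. f w \<partial>gauss I)"
proof -
  have [measurable]: "vneg I \<in> measurable (leb I) (leb I)" unfolding leb_def vneg_def by measurable
  have vv: "vneg I (vneg I x) = x" if "x \<in> space (leb I)" for x
    using that by (auto simp: vneg_def space_leb PiE_iff extensional_def)
  have "(\<integral>\<^sup>+w. f (T w) \<partial>gauss I) = (\<integral>\<^sup>+w. gdens I (T w) * f (T w) \<partial>leb I)"
    by (subst nn_integral_gauss[OF I]) (auto simp: gdens_eq[OF I] iso intro!: nn_integral_cong)
  \<comment> \<open>The double negation brings the integrand into the form of the signed identity;
    the one negation that remains is undone afterwards.\<close>
  also have "\<dots> = (\<integral>\<^sup>+w. gdens I (vneg I (vneg I (T w))) * f (vneg I (vneg I (T w))) \<partial>leb I)"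
    using measurable_space[OF Tm] by (intro nn_integral_cong) (simp add: vv)
  also have "\<dots> = (\<integral>\<^sup>+w. gdens I (vneg I w) * f (vneg I w) \<partial>leb I)"
    by (rule nn_integral_leb_isometry_neg[OF I Tm add surj iso, symmetric]) auto
  also have "\<dots> = (\<integral>\<^sup>+w. gdens I w * f w \<partial>leb I)"
    by (rule nn_integral_leb_neg[OF I, of "\<lambda>w. gdens I w * f w"]) measurable
  also have "\<dots> = (\<integral>\<^sup>+w. f w \<partial>gauss I)" by (rule nn_integral_gauss[OF I f, symmetric])
  finally show ?thesis .
qed

section \<open>Sums of squared moduli and Beta ratios\<close>

lemma nn_integral_lborel_shift:
  fixes f :: "real \<Rightarrow> ennreal"
  assumes [measurable]: "f \<in> borel_measurable borel"
  shows "(\<integral>\<^sup>+s. f (s + u) \<partial>lborel) = (\<integral>\<^sup>+v. f v \<partial>lborel)"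
  using nn_integral_real_affine[of f 1 u] by (simp add: add.commute)

lemma erlang_0_convolution:
  "(\<integral>\<^sup>+u. ennreal (erlang_density 0 1 (v - u)) * ennreal (erlang_density k 1 u) \<partial>lborel) = ennreal (erlang_density (Suc k) 1 v)"
  using fun_cong[OF convolution_erlang_density[of 1 0 k], of v] by simp

text \<open>\<open>erlang_density k\<close> has shape k + 1 and so belongs to k + 1 summands. The
  induction splits off one exponential variable and convolves.\<close>

lemma nn_integral_gauss_sum_squares:
  assumes "finite J" "card J = Suc k" and f[measurable]: "f \<in> borel_measurable borel"
  shows "(\<integral>\<^sup>+w. f (\<Sum>j\<in>J. (cmod (w j))\<^sup>2) \<partial>gauss J) = (\<integral>\<^sup>+x. ennreal (erlang_density k 1 x) * f x \<partial>lborel)"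
  using assms
proof (induction J arbitrary: k f rule: finite_induct)
  case empty
  then show ?case by simp
next
  case (insert a J)
  interpret G: product_sigma_finite "\<lambda>_::'a. cgauss" by (rule product_sigma_finite_cgauss)
  note [measurable] = insert.prems(2)
  show ?case
  proof (cases k)
    case 0
    then have J: "J = {}" using insert.hyps insert.prems(1) by simp
    have "(\<integral>\<^sup>+w. f (\<Sum>j\<in>{a}. (cmod (w j))\<^sup>2) \<partial>gauss {a}) = (\<integral>\<^sup>+z. f ((cmod z)\<^sup>2) \<partial>cgauss)"
    proof -
      have "(\<lambda>z. f ((cmod z)\<^sup>2)) \<in> borel_measurable cgauss" by measurable
      from G.product_nn_integral_singleton[OF this, of a] show ?thesis by (simp add: gauss_def)
    qed
    also have "\<dots> = (\<integral>\<^sup>+x. ennreal (erlang_density 0 1 x) * f x \<partial>lborel)"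
      by (rule nn_integral_cgauss_radial[OF insert.prems(2)])
    finally show ?thesis unfolding J 0 .
  next
    case (Suc k')
    then have cJ: "card J = Suc k'" using insert.hyps insert.prems(1) by simp
    have meas: "(\<lambda>w. f (\<Sum>j\<in>insert a J. (cmod (w j))\<^sup>2)) \<in> borel_measurable (PiM (insert a J) (\<lambda>_. cgauss))"
      unfolding gauss_def[symmetric] by measurable
    have "(\<integral>\<^sup>+w. f (\<Sum>j\<in>insert a J. (cmod (w j))\<^sup>2) \<partial>gauss (insert a J))
      = (\<integral>\<^sup>+w. \<integral>\<^sup>+z. f ((cmod z)\<^sup>2 + (\<Sum>j\<in>J. (cmod (w j))\<^sup>2)) \<partial>cgauss \<partial>gauss J)"
      unfolding gauss_def
    proof (subst G.product_nn_integral_insert[OF insert.hyps meas], intro nn_integral_cong arg_cong[of _ _ f])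
      fix w z
      have "(\<Sum>j\<in>J. (cmod ((w(a := z)) j))\<^sup>2) = (\<Sum>j\<in>J. (cmod (w j))\<^sup>2)"
        using insert.hyps by (intro sum.cong) auto
      then show "(\<Sum>j\<in>insert a J. (cmod ((w(a := z)) j))\<^sup>2) = (cmod z)\<^sup>2 + (\<Sum>j\<in>J. (cmod (w j))\<^sup>2)"
        using insert.hyps by simp
    qed
    also have "\<dots> = (\<integral>\<^sup>+w. (\<lambda>u. \<integral>\<^sup>+s. ennreal (erlang_density 0 1 s) * f (s + u) \<partial>lborel) (\<Sum>j\<in>J. (cmod (w j))\<^sup>2) \<partial>gauss J)"
    proof (intro nn_integral_cong)
      fix w :: "'a \<Rightarrow> complex"
      show "(\<integral>\<^sup>+z. f ((cmod z)\<^sup>2 + (\<Sum>j\<in>J. (cmod (w j))\<^sup>2)) \<partial>cgauss)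
        = (\<lambda>u. \<integral>\<^sup>+s. ennreal (erlang_density 0 1 s) * f (s + u) \<partial>lborel) (\<Sum>j\<in>J. (cmod (w j))\<^sup>2)"
        by (rule nn_integral_cgauss_radial[of "\<lambda>s. f (s + (\<Sum>j\<in>J. (cmod (w j))\<^sup>2))"]) measurable
    qed
    also have "\<dots> = (\<integral>\<^sup>+u. ennreal (erlang_density k' 1 u) * (\<integral>\<^sup>+s. ennreal (erlang_density 0 1 s) * f (s + u) \<partial>lborel) \<partial>lborel)"
      by (rule insert.IH[OF cJ]) measurable
    \<comment> \<open>\<open>s\<close> is written as \<open>s + u - u\<close> so that the shift v =
      s + u produces a convolution.\<close>
    also have "\<dots> = (\<integral>\<^sup>+u. \<integral>\<^sup>+s. ennreal (erlang_density k' 1 u) * (ennreal (erlang_density 0 1 (s + u - u)) * f (s + u)) \<partial>lborel \<partial>lborel)"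
      by (rule nn_integral_cong) (simp add: nn_integral_cmult)
    also have "\<dots> = (\<integral>\<^sup>+u. \<integral>\<^sup>+v. ennreal (erlang_density k' 1 u) * (ennreal (erlang_density 0 1 (v - u)) * f v) \<partial>lborel \<partial>lborel)"
      by (rule nn_integral_cong, rule nn_integral_lborel_shift[of "\<lambda>v. ennreal (erlang_density k' 1 u) * (ennreal (erlang_density 0 1 (v - u)) * f v)" u for u]) simp
    also have "\<dots> = (\<integral>\<^sup>+v. \<integral>\<^sup>+u. ennreal (erlang_density k' 1 u) * (ennreal (erlang_density 0 1 (v - u)) * f v) \<partial>lborel \<partial>lborel)"
      by (rule lborel_pair.Fubini') measurable
    also have "\<dots> = (\<integral>\<^sup>+v. (\<integral>\<^sup>+u. ennreal (erlang_density 0 1 (v - u)) * ennreal (erlang_density k' 1 u) \<partial>lborel) * f v \<partial>lborel)"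
      by (rule nn_integral_cong, subst nn_integral_multc[symmetric]) (simp_all add: mult_ac)
    also have "\<dots> = (\<integral>\<^sup>+v. ennreal (erlang_density k 1 v) * f v \<partial>lborel)"
      unfolding erlang_0_convolution Suc ..
    finally show ?thesis .
  qed
qed

lemma nn_integral_gauss_union:
  assumes "finite I" "finite J" "I \<inter> J = {}" and f[measurable]: "case_prod f \<in> borel_measurable (borel \<Otimes>\<^sub>M borel)"
  shows "(\<integral>\<^sup>+w. f (\<Sum>j\<in>I. (cmod (w j))\<^sup>2) (\<Sum>j\<in>J. (cmod (w j))\<^sup>2) \<partial>gauss (I \<union> J))
    = (\<integral>\<^sup>+v. \<integral>\<^sup>+w. f (\<Sum>j\<in>I. (cmod (v j))\<^sup>2) (\<Sum>j\<in>J. (cmod (w j))\<^sup>2) \<partial>gauss J \<partial>gauss I)"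
proof -
  interpret G: product_sigma_finite "\<lambda>_::'a. cgauss" by (rule product_sigma_finite_cgauss)
  have meas: "(\<lambda>w. f (\<Sum>j\<in>I. (cmod (w j))\<^sup>2) (\<Sum>j\<in>J. (cmod (w j))\<^sup>2)) \<in> borel_measurable (PiM (I \<union> J) (\<lambda>_. cgauss))"
    unfolding gauss_def[symmetric] by measurable
  show ?thesis unfolding gauss_def
  proof (subst G.product_nn_integral_fold[OF assms(3,1,2) meas], intro nn_integral_cong)
    fix v w
    have "(\<Sum>j\<in>I. (cmod (merge I J (v, w) j))\<^sup>2) = (\<Sum>j\<in>I. (cmod (v j))\<^sup>2)"
      "(\<Sum>j\<in>J. (cmod (merge I J (v, w) j))\<^sup>2) = (\<Sum>j\<in>J. (cmod (w j))\<^sup>2)"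
      using assms(3) by (auto simp: merge_def intro!: sum.cong)
    then show "f (\<Sum>j\<in>I. (cmod (merge I J (v, w) j))\<^sup>2) (\<Sum>j\<in>J. (cmod (merge I J (v, w) j))\<^sup>2)
      = f (\<Sum>j\<in>I. (cmod (v j))\<^sup>2) (\<Sum>j\<in>J. (cmod (w j))\<^sup>2)" by simp
  qed
qed

text \<open>With x = s * u and y = s - x, the Jacobian \<open>s\<close> completes the power of
  \<open>s\<close> to that of a Gamma density of shape p + q + 2; what remains is the Beta density
  in \<open>u\<close>.\<close>

lemma erlang_ratio_density:
  assumes s: "s > 0" and u: "0 < u" "u < 1"
  shows "s * (erlang_density p 1 (s * u) * erlang_density q 1 (s - s * u))
    = erlang_density (Suc (p + q)) 1 s * (u powr real p * (1 - u) powr real q / Beta (real (Suc p)) (real (Suc q)))"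
proof -
  have B: "Beta (real (Suc p)) (real (Suc q)) = fact p * fact q / fact (Suc (p + q))"
    using Gamma_fact[of p, where 'a = real] Gamma_fact[of q, where 'a = real] Gamma_fact[of "Suc (p + q)", where 'a = real]
    by (simp add: Beta_def add_ac)
  have ss: "s - s * u = s * (1 - u)" by (simp add: algebra_simps)
  have su: "0 \<le> s * u" "0 \<le> s * (1 - u)" using s u by auto
  have "s * (erlang_density p 1 (s * u) * erlang_density q 1 (s - s * u))
    = s * ((s * u) ^ p * (s * (1 - u)) ^ q / (fact p * fact q)) * (exp (- (s * u)) * exp (- (s * (1 - u))))"
    using su unfolding ss by (simp add: erlang_density_def)
  also have "exp (- (s * u)) * exp (- (s * (1 - u))) = exp (- s)" by (simp add: exp_add[symmetric] algebra_simps)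
  also have "s * ((s * u) ^ p * (s * (1 - u)) ^ q / (fact p * fact q)) * exp (- s)
    = s ^ (Suc (p + q)) * exp (- s) * (u ^ p * (1 - u) ^ q / (fact p * fact q))"
    by (simp add: power_mult_distrib power_add)
  also have "\<dots> = erlang_density (Suc (p + q)) 1 s * (u powr real p * (1 - u) powr real q / Beta (real (Suc p)) (real (Suc q)))"
    unfolding B using s u by (simp add: erlang_density_def powr_realpow del: fact_Suc)
  finally show ?thesis .
qed

text \<open>The sum and the ratio of two Gamma variables are independent: substituting first s = x +
  y and then x = s * u separates the double integral, and the part in \<open>s\<close> integrates to
  1.\<close>

lemma nn_integral_gauss_ratio:
  assumes I: "finite I" "card I = Suc p" and J: "finite J" "card J = Suc q" and IJ: "I \<inter> J = {}"
    and f[measurable]: "f \<in> borel_measurable borel"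
  shows "(\<integral>\<^sup>+w. f ((\<Sum>j\<in>I. (cmod (w j))\<^sup>2) / ((\<Sum>j\<in>I. (cmod (w j))\<^sup>2) + (\<Sum>j\<in>J. (cmod (w j))\<^sup>2))) \<partial>gauss (I \<union> J))
    = (\<integral>\<^sup>+u. f u \<partial>beta_measure (real (Suc p)) (real (Suc q)))"
proof -
  let ?e = "\<lambda>k x. ennreal (erlang_density k 1 x)"
  let ?b = "\<lambda>u::real. indicator {0<..<1} u * u powr real p * (1 - u) powr real q / Beta (real (Suc p)) (real (Suc q))"
  have bn: "0 \<le> ?b u" for u
    using Gamma_real_pos[of "real (Suc p)"] Gamma_real_pos[of "real (Suc q)"] Gamma_real_pos[of "real (Suc p) + real (Suc q)"]
    by (auto simp: Beta_def intro!: divide_nonneg_nonneg mult_nonneg_nonneg)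
  have "(\<integral>\<^sup>+w. f ((\<Sum>j\<in>I. (cmod (w j))\<^sup>2) / ((\<Sum>j\<in>I. (cmod (w j))\<^sup>2) + (\<Sum>j\<in>J. (cmod (w j))\<^sup>2))) \<partial>gauss (I \<union> J))
    = (\<integral>\<^sup>+v. \<integral>\<^sup>+w. f ((\<Sum>j\<in>I. (cmod (v j))\<^sup>2) / ((\<Sum>j\<in>I. (cmod (v j))\<^sup>2) + (\<Sum>j\<in>J. (cmod (w j))\<^sup>2))) \<partial>gauss J \<partial>gauss I)"
    using nn_integral_gauss_union[OF I(1) J(1) IJ, of "\<lambda>x y. f (x / (x + y))"] by simp
  also have "\<dots> = (\<integral>\<^sup>+v. (\<lambda>x. \<integral>\<^sup>+y. ?e q y * f (x / (x + y)) \<partial>lborel) (\<Sum>j\<in>I. (cmod (v j))\<^sup>2) \<partial>gauss I)"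
    by (rule nn_integral_cong, subst nn_integral_gauss_sum_squares[OF J, of "\<lambda>y. f (x / (x + y))" for x]) simp_all
  also have "\<dots> = (\<integral>\<^sup>+x. ?e p x * (\<integral>\<^sup>+y. ?e q y * f (x / (x + y)) \<partial>lborel) \<partial>lborel)"
    by (rule nn_integral_gauss_sum_squares[OF I]) measurable
  also have "\<dots> = (\<integral>\<^sup>+x. \<integral>\<^sup>+y. ?e p x * (?e q ((y + x) - x) * f (x / (y + x))) \<partial>lborel \<partial>lborel)"
    by (rule nn_integral_cong) (simp add: nn_integral_cmult add.commute)
  also have "\<dots> = (\<integral>\<^sup>+x. \<integral>\<^sup>+s. ?e p x * (?e q (s - x) * f (x / s)) \<partial>lborel \<partial>lborel)"
    by (rule nn_integral_cong, rule nn_integral_lborel_shift[of "\<lambda>s. ?e p x * (?e q (s - x) * f (x / s))" x for x]) simp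
  also have "\<dots> = (\<integral>\<^sup>+s. \<integral>\<^sup>+x. ?e p x * (?e q (s - x) * f (x / s)) \<partial>lborel \<partial>lborel)"
    by (rule lborel_pair.Fubini') measurable
  \<comment> \<open>The points s = 0, where the substitution degenerates, and u = 0 or 1, where the
    boundary conventions of the densities may differ, are null sets.\<close>
  also have "\<dots> = (\<integral>\<^sup>+s. \<integral>\<^sup>+u. ?e (Suc (p + q)) s * (ennreal (?b u) * f u) \<partial>lborel \<partial>lborel)"
  proof (rule nn_integral_cong_AE)
    have main: "(\<integral>\<^sup>+x. ?e p x * (?e q (s - x) * f (x / s)) \<partial>lborel) = (\<integral>\<^sup>+u. ?e (Suc (p + q)) s * (ennreal (?b u) * f u) \<partial>lborel)"
      if s: "s \<noteq> 0" for s
    proof (cases "s < 0")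
      case True
      have "?e p x * (?e q (s - x) * f (x / s)) = 0" for x using True by (auto simp: erlang_density_def)
      then have "(\<integral>\<^sup>+x. ?e p x * (?e q (s - x) * f (x / s)) \<partial>lborel) = (\<integral>\<^sup>+x. 0 \<partial>(lborel :: real measure))"
        by (intro nn_integral_cong)
      moreover have "?e (Suc (p + q)) s = 0" using True by (simp add: erlang_density_def)
      ultimately show ?thesis by simp
    next
      case False
      then have sp: "s > 0" using s by simp
      have pt: "ennreal s * (?e p (s * u) * (?e q (s - s * u) * f u)) = ?e (Suc (p + q)) s * (ennreal (?b u) * f u)"
        if u: "u \<noteq> 0" "u \<noteq> 1" for u
      proof -
        consider "u < 0" | "u > 1" | "0 < u" "u < 1" using u by linarith
        then show ?thesis
        proof cases
          case 1
          then have "s * u < 0" using sp by (simp add: mult_pos_neg)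
          then show ?thesis using 1 by (simp add: erlang_density_def)
        next
          case 2
          then have "s - s * u < 0" using sp by simp
          then show ?thesis using 2 by (simp add: erlang_density_def)
        next
          case 3
          have "ennreal s * (?e p (s * u) * (?e q (s - s * u) * f u))
            = ennreal (s * (erlang_density p 1 (s * u) * erlang_density q 1 (s - s * u))) * f u"
            using sp by (simp add: ennreal_mult mult.assoc)
          also have "s * (erlang_density p 1 (s * u) * erlang_density q 1 (s - s * u)) = erlang_density (Suc (p + q)) 1 s * ?b u"
            unfolding erlang_ratio_density[OF sp 3] using 3 by simp
          also have "ennreal (erlang_density (Suc (p + q)) 1 s * ?b u) = ?e (Suc (p + q)) s * ennreal (?b u)"
            by (rule ennreal_mult) (simp, rule bn)
          finally show ?thesis by (simp only: mult.assoc)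
        qed
      qed
      have "(\<integral>\<^sup>+x. ?e p x * (?e q (s - x) * f (x / s)) \<partial>lborel)
        = ennreal s * (\<integral>\<^sup>+u. ?e p (s * u) * (?e q (s - s * u) * f (s * u / s)) \<partial>lborel)"
        using sp by (subst nn_integral_real_affine[where c=s and t=0]) auto
      also have "\<dots> = (\<integral>\<^sup>+u. ennreal s * (?e p (s * u) * (?e q (s - s * u) * f u)) \<partial>lborel)"
        using sp by (simp add: nn_integral_cmult)
      also have "\<dots> = (\<integral>\<^sup>+u. ?e (Suc (p + q)) s * (ennreal (?b u) * f u) \<partial>lborel)"
      proof (rule nn_integral_cong_AE)
        show "AE u in lborel. ennreal s * (?e p (s * u) * (?e q (s - s * u) * f u)) = ?e (Suc (p + q)) s * (ennreal (?b u) * f u)"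
          using AE_lborel_singleton[of "0::real"] AE_lborel_singleton[of "1::real"] by eventually_elim (rule pt)
      qed
      finally show ?thesis .
    qed
    show "AE s in lborel. (\<integral>\<^sup>+x. ?e p x * (?e q (s - x) * f (x / s)) \<partial>lborel) = (\<integral>\<^sup>+u. ?e (Suc (p + q)) s * (ennreal (?b u) * f u) \<partial>lborel)"
      using AE_lborel_singleton[of "0::real"] by eventually_elim (rule main)
  qed
  also have "\<dots> = (\<integral>\<^sup>+s. ?e (Suc (p + q)) s * (\<integral>\<^sup>+u. ennreal (?b u) * f u \<partial>lborel) \<partial>lborel)"
    by (rule nn_integral_cong, rule nn_integral_cmult) simp
  also have "\<dots> = (\<integral>\<^sup>+s. ?e (Suc (p + q)) s \<partial>lborel) * (\<integral>\<^sup>+u. ennreal (?b u) * f u \<partial>lborel)"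
    by (rule nn_integral_multc) measurable
  also have "(\<integral>\<^sup>+s. ?e (Suc (p + q)) s \<partial>lborel) = 1"
    using nn_integral_erlang_ith_moment[of 1 "Suc (p + q)" 0] by simp
  also have "1 * (\<integral>\<^sup>+u. ennreal (?b u) * f u \<partial>lborel) = (\<integral>\<^sup>+u. f u \<partial>beta_measure (real (Suc p)) (real (Suc q)))"
    unfolding beta_measure_def by (subst nn_integral_density) auto
  finally show ?thesis .
qed

section \<open>Measurability of spectral functions\<close>

text \<open>Measurability entry by entry, with the dimensions required for all arguments, so that
  index formulas can be rewritten without side conditions on the space.\<close>

definition mmat :: "'w measure \<Rightarrow> nat \<Rightarrow> nat \<Rightarrow> ('w \<Rightarrow> complex Matrix.mat) \<Rightarrow> bool" where
  "mmat M a b X \<longleftrightarrow> (\<forall>w. X w \<in> carrier_mat a b) \<and> (\<forall>i<a. \<forall>j<b. (\<lambda>w. X w $$ (i, j)) \<in> borel_measurable M)"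

lemma mmatI:
  "(\<And>w. X w \<in> carrier_mat a b) \<Longrightarrow> (\<And>i j. i < a \<Longrightarrow> j < b \<Longrightarrow> (\<lambda>w. X w $$ (i, j)) \<in> borel_measurable M) \<Longrightarrow> mmat M a b X"
  by (simp add: mmat_def)

lemma mmat_carrier: "mmat M a b X \<Longrightarrow> X w \<in> carrier_mat a b"
  by (simp add: mmat_def)

lemma mmat_index: "mmat M a b X \<Longrightarrow> i < a \<Longrightarrow> j < b \<Longrightarrow> (\<lambda>w. X w $$ (i, j)) \<in> borel_measurable M"
  by (simp add: mmat_def)

lemma mmat_const: "A \<in> carrier_mat a b \<Longrightarrow> mmat M a b (\<lambda>_. A)"
  by (simp add: mmat_def)

lemma mmat_mult:
  assumes X: "mmat M a b X" and Y: "mmat M b c Y" shows "mmat M a c (\<lambda>w. X w * Y w)"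
proof (rule mmatI)
  show "X w * Y w \<in> carrier_mat a c" for w using mmat_carrier[OF X] mmat_carrier[OF Y] by (rule mult_carrier_mat)
  fix i j assume ij: "i < a" "j < c"
  have "(\<lambda>w. X w $$ (i, k) * Y w $$ (k, j)) \<in> borel_measurable M" if "k < b" for k
    using mmat_index[OF X ij(1) that] mmat_index[OF Y that ij(2)] by (rule borel_measurable_times)
  then show "(\<lambda>w. (X w * Y w) $$ (i, j)) \<in> borel_measurable M"
    unfolding mult_index[OF mmat_carrier[OF X] mmat_carrier[OF Y] ij] by (intro borel_measurable_sum) auto
qed

lemma mmat_add:
  assumes X: "mmat M a b X" and Y: "mmat M a b Y" shows "mmat M a b (\<lambda>w. X w + Y w)"
proof (rule mmatI)
  show "X w + Y w \<in> carrier_mat a b" for w using mmat_carrier[OF Y, of w] by simp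
  fix i j assume ij: "i < a" "j < b"
  have "(X w + Y w) $$ (i, j) = X w $$ (i, j) + Y w $$ (i, j)" for w
    using mmat_carrier[OF Y, of w] ij by simp
  then show "(\<lambda>w. (X w + Y w) $$ (i, j)) \<in> borel_measurable M"
    using mmat_index[OF X ij] mmat_index[OF Y ij] by simp
qed

lemma mmat_minus:
  assumes X: "mmat M a b X" and Y: "mmat M a b Y" shows "mmat M a b (\<lambda>w. X w - Y w)"
proof (rule mmatI)
  show "X w - Y w \<in> carrier_mat a b" for w by (rule minus_carrier_mat[OF mmat_carrier[OF Y]])
  fix i j assume ij: "i < a" "j < b"
  have "(X w - Y w) $$ (i, j) = X w $$ (i, j) - Y w $$ (i, j)" for w
    using mmat_carrier[OF Y, of w] ij by simp
  then show "(\<lambda>w. (X w - Y w) $$ (i, j)) \<in> borel_measurable M"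
    using mmat_index[OF X ij] mmat_index[OF Y ij] by simp
qed

lemma mmat_smult:
  assumes X: "mmat M a b X" shows "mmat M a b (\<lambda>w. c \<cdot>\<^sub>m X w)"
proof (rule mmatI)
  show "c \<cdot>\<^sub>m X w \<in> carrier_mat a b" for w using mmat_carrier[OF X, of w] by simp
  fix i j assume ij: "i < a" "j < b"
  have "(c \<cdot>\<^sub>m X w) $$ (i, j) = c * X w $$ (i, j)" for w
    using mmat_carrier[OF X, of w] ij by simp
  then show "(\<lambda>w. (c \<cdot>\<^sub>m X w) $$ (i, j)) \<in> borel_measurable M"
    using mmat_index[OF X ij] by simp
qed

lemma mmat_adj:
  assumes X: "mmat M a b X" shows "mmat M b a (\<lambda>w. (X w)\<^sup>H)"
proof (rule mmatI)
  show "(X w)\<^sup>H \<in> carrier_mat b a" for w using mmat_carrier[OF X, of w] by simp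
  fix i j assume ij: "i < b" "j < a"
  have "(X w)\<^sup>H $$ (i, j) = cnj (X w $$ (j, i))" for w
    using mmat_carrier[OF X, of w] ij by simp
  moreover have "(\<lambda>w. cnj (X w $$ (j, i))) \<in> borel_measurable M"
    using mmat_index[OF X ij(2,1)] by (intro borel_measurable_continuous_on[of cnj]) (auto intro!: continuous_intros)
  ultimately show "(\<lambda>w. (X w)\<^sup>H $$ (i, j)) \<in> borel_measurable M" by simp
qed

lemma mmat_power:
  assumes X: "mmat M a a X" shows "mmat M a a (\<lambda>w. X w ^\<^sub>m k)"
proof (induction k)
  case 0
  have "X w ^\<^sub>m 0 = 1\<^sub>m a" for w using mmat_carrier[OF X, of w] by simp
  then show ?case by (simp add: mmat_const)
next
  case (Suc k)
  show ?case using mmat_mult[OF Suc X] by simp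
qed

lemma measurable_det:
  assumes X: "mmat M a a X" shows "(\<lambda>w. Determinant.det (X w)) \<in> borel_measurable M"
proof -
  have "(\<lambda>w. X w $$ (i, p i)) \<in> borel_measurable M" if "p permutes {0..<a}" "i \<in> {0..<a}" for p i
    using mmat_index[OF X, of i "p i"] that permutes_in_image[OF that(1), of i] by simp
  then show ?thesis
    unfolding det_def'[OF mmat_carrier[OF X]]
    by (intro borel_measurable_sum borel_measurable_times borel_measurable_prod borel_measurable_const) auto
qed

lemma measurable_cmod_det:
  assumes X: "mmat M a a X" shows "(\<lambda>w. cmod (Determinant.det (X w))) \<in> borel_measurable M"
  using measurable_det[OF X] by measurable

lemma measurable_sinsq:
  assumes P: "mmat M n t P" and Y: "mmat M n r Y"
  shows "(\<lambda>w. sinsq (P w) (Y w)) \<in> borel_measurable M"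
proof -
  have G: "mmat M r r (\<lambda>w. (Y w)\<^sup>H * Y w)" by (rule mmat_mult[OF mmat_adj[OF Y] Y])
  have N: "mmat M t r (\<lambda>w. (P w)\<^sup>H * Y w)" by (rule mmat_mult[OF mmat_adj[OF P] Y])
  show ?thesis unfolding sinsq_def
    by (intro borel_measurable_divide measurable_cmod_det[OF G]
      measurable_cmod_det[OF mmat_minus[OF G mmat_mult[OF mmat_adj[OF N] N]]])
qed

lemma trace_power_spectral:
  assumes A: "A \<in> carrier_mat n n" and U: "orthocols n n U"
    and AU: "A * U = U * mat_diag n (\<lambda>i. complex_of_real (d i))"
  shows "(\<Sum>a<n. (A ^\<^sub>m k) $$ (a, a)) = complex_of_real (\<Sum>j<n. d j ^ k)"
proof -
  have Uc: "U \<in> carrier_mat n n" using U by (rule orthocols_carrier)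
  have "(\<Sum>a<n. (A ^\<^sub>m k) $$ (a, a)) = (\<Sum>a<n. \<Sum>j<n. complex_of_real (d j ^ k) * (cnj (U $$ (a, j)) * U $$ (a, j)))"
    unfolding power_spectral[OF A U AU] by (intro sum.cong refl) (simp add: spectral_index[OF Uc] mult_ac)
  also have "\<dots> = (\<Sum>j<n. complex_of_real (d j ^ k) * (\<Sum>a<n. cnj (U $$ (a, j)) * U $$ (a, j)))"
    by (rule trans[OF sum.swap]) (simp only: sum_distrib_left)
  also have "\<dots> = (\<Sum>j<n. complex_of_real (d j ^ k))"
  proof (rule sum.cong[OF refl])
    fix j assume j: "j \<in> {..<n}"
    have "(\<Sum>a<n. cnj (U $$ (a, j)) * U $$ (a, j)) = 1"
      using adj_mult_self_index[OF Uc Uc, of j j] orthocolsD[OF U] j by simp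
    then show "complex_of_real (d j ^ k) * (\<Sum>a<n. cnj (U $$ (a, j)) * U $$ (a, j)) = complex_of_real (d j ^ k)" by simp
  qed
  finally show ?thesis by simp
qed

text \<open>After subtraction of the first \<open>k\<close> terms the power sum lies between
  \<open>d k ^ N\<close> and \<open>real n * d k ^ N\<close>, and the N-th root of \<open>n\<close>
  tends to 1.\<close>

lemma root_power_sum_tendsto:
  fixes d :: "nat \<Rightarrow> real"
  assumes k: "k < n" and dec: "\<And>i j. i \<le> j \<Longrightarrow> j < n \<Longrightarrow> d j \<le> d i" and nn: "\<And>i. i < n \<Longrightarrow> 0 \<le> d i"
  shows "(\<lambda>N. root N ((\<Sum>j<n. d j ^ N) - (\<Sum>j<k. d j ^ N))) \<longlonglongrightarrow> d k"
proof -
  have e: "(\<Sum>j<n. d j ^ N) - (\<Sum>j<k. d j ^ N) = (\<Sum>j=k..<n. d j ^ N)" for N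
    using sum.atLeastLessThan_concat[of 0 k n "\<lambda>j. d j ^ N"] k by (simp add: lessThan_atLeast0)
  have lo: "d k \<le> root N (\<Sum>j=k..<n. d j ^ N)" if "N > 0" for N
  proof -
    have "d k ^ N \<le> (\<Sum>j=k..<n. d j ^ N)"
      by (rule member_le_sum[of k]) (use k nn in auto)
    then have "root N (d k ^ N) \<le> root N (\<Sum>j=k..<n. d j ^ N)" using that by simp
    then show ?thesis using that nn[OF k] by (simp add: real_root_power_cancel)
  qed
  have hi: "root N (\<Sum>j=k..<n. d j ^ N) \<le> root N (real n) * d k" if "N > 0" for N
  proof -
    have "(\<Sum>j=k..<n. d j ^ N) \<le> (\<Sum>j=k..<n. d k ^ N)"
    proof (rule sum_mono)
      fix j assume "j \<in> {k..<n}"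
      then show "d j ^ N \<le> d k ^ N" using dec[of k j] nn[of j] by (intro power_mono) auto
    qed
    also have "\<dots> \<le> real n * d k ^ N" using nn[OF k] by (simp add: mult_right_mono)
    finally have "root N (\<Sum>j=k..<n. d j ^ N) \<le> root N (real n * d k ^ N)" using that by simp
    then show ?thesis using that nn[OF k] by (simp add: real_root_mult real_root_power_cancel)
  qed
  have "(\<lambda>N. root N (real n) * d k) \<longlonglongrightarrow> 1 * d k"
    by (intro tendsto_mult tendsto_const LIMSEQ_root_const) (use k in simp)
  then have lim: "(\<lambda>N. root N (real n) * d k) \<longlonglongrightarrow> d k" by simp
  have 1: "\<forall>\<^sub>F N in sequentially. d k \<le> root N (\<Sum>j=k..<n. d j ^ N)"
    using eventually_gt_at_top[of "0::nat"] by eventually_elim (rule lo)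
  have 2: "\<forall>\<^sub>F N in sequentially. root N (\<Sum>j=k..<n. d j ^ N) \<le> root N (real n) * d k"
    using eventually_gt_at_top[of "0::nat"] by eventually_elim (rule hi)
  show ?thesis unfolding e by (rule tendsto_sandwich[OF 1 2 tendsto_const lim])
qed

text \<open>The eigenvalues are recovered successively from the traces of the powers, as limits of \<open>N\<close>-th roots
  of power sums.\<close>
lemma measurable_eigs_aux:
  assumes X: "mmat M n n X"
    and sp: "\<And>w. \<exists>U d. orthocols n n U \<and> X w * U = U * mat_diag n (\<lambda>i. complex_of_real (d i)) \<and>
      (\<forall>i j. i \<le> j \<longrightarrow> j < n \<longrightarrow> d j \<le> d i) \<and> (\<forall>i<n. 0 \<le> d i)"
  shows "k < n \<Longrightarrow> (\<lambda>w. eigs (X w) k) \<in> borel_measurable M"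
proof (induction k rule: less_induct)
  case (less k)
  have lim: "(\<lambda>N. root N (Re (\<Sum>a<n. (X w ^\<^sub>m N) $$ (a, a)) - (\<Sum>j<k. eigs (X w) j ^ N))) \<longlonglongrightarrow> eigs (X w) k" for w
  proof -
    obtain U d where U: "orthocols n n U" and XU: "X w * U = U * mat_diag n (\<lambda>i. complex_of_real (d i))"
      and dec: "\<forall>i j. i \<le> j \<longrightarrow> j < n \<longrightarrow> d j \<le> d i" and nn: "\<forall>i<n. 0 \<le> d i" using sp[of w] by blast
    have dec': "i \<le> j \<Longrightarrow> j < n \<Longrightarrow> d j \<le> d i" for i j using dec by blast
    have nn': "i < n \<Longrightarrow> 0 \<le> d i" for i using nn by blast
    have e: "eigs (X w) j = d j" if "j < n" for j
      using that by (simp add: eigs_def eigs_desc_eq[OF mmat_carrier[OF X] U XU dec'])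
    have "Re (\<Sum>a<n. (X w ^\<^sub>m N) $$ (a, a)) = (\<Sum>j<n. d j ^ N)" for N
      unfolding trace_power_spectral[OF mmat_carrier[OF X] U XU] by simp
    moreover have "(\<Sum>j<k. eigs (X w) j ^ N) = (\<Sum>j<k. d j ^ N)" for N
      using less.prems by (intro sum.cong refl) (simp add: e)
    ultimately show ?thesis unfolding e[OF less.prems] using root_power_sum_tendsto[OF less.prems dec' nn'] by simp
  qed
  show ?case
  proof (rule borel_measurable_LIMSEQ_real[OF lim])
    fix N
    have 1: "(\<lambda>w. (X w ^\<^sub>m N) $$ (a, a)) \<in> borel_measurable M" if "a < n" for a
      using mmat_index[OF mmat_power[OF X] that that] .
    have 2: "(\<lambda>w. eigs (X w) j) \<in> borel_measurable M" if "j < k" for j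
      using less.IH[OF that] that less.prems by simp
    have 3: "(\<lambda>w. Re (\<Sum>a<n. (X w ^\<^sub>m N) $$ (a, a)) - (\<Sum>j<k. eigs (X w) j ^ N)) \<in> borel_measurable M"
      using 1 2 by (intro borel_measurable_diff borel_measurable_sum borel_measurable_power measurable_compose[OF borel_measurable_sum, of _ _ _ Re]) auto
    show "(\<lambda>w. root N (Re (\<Sum>a<n. (X w ^\<^sub>m N) $$ (a, a)) - (\<Sum>j<k. eigs (X w) j ^ N))) \<in> borel_measurable M"
      by (rule borel_measurable_continuous_on[OF _ 3]) (intro continuous_intros)
  qed
qed

lemma measurable_eigs:
  assumes X: "mmat M p q X" and k: "k < p"
  shows "(\<lambda>w. eigs (X w * (X w)\<^sup>H) k) \<in> borel_measurable M"
proof (rule measurable_eigs_aux[OF mmat_mult[OF X mmat_adj[OF X]] _ k])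
  fix w
  obtain U V d where "is_svd p q (X w) U V d" by (rule exists_svd[OF mmat_carrier[OF X]])
  then have "orthocols p p U \<and> (X w * (X w)\<^sup>H) * U = U * mat_diag p (\<lambda>i. complex_of_real (d i)) \<and>
      (\<forall>i j. i \<le> j \<longrightarrow> j < p \<longrightarrow> d j \<le> d i) \<and> (\<forall>i<p. 0 \<le> d i)"
    unfolding is_svd_def by (elim conjE) (intro conjI)
  then show "\<exists>U d. orthocols p p U \<and> (X w * (X w)\<^sup>H) * U = U * mat_diag p (\<lambda>i. complex_of_real (d i)) \<and>
      (\<forall>i j. i \<le> j \<longrightarrow> j < p \<longrightarrow> d j \<le> d i) \<and> (\<forall>i<p. 0 \<le> d i)" by (intro exI)
qed

section \<open>Measurable polynomials and the functional calculus\<close>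

definition mpoly :: "'w measure \<Rightarrow> ('w \<Rightarrow> real poly) \<Rightarrow> bool" where
  "mpoly M P \<longleftrightarrow> (\<forall>i. (\<lambda>w. poly.coeff (P w) i) \<in> borel_measurable M)"

lemma mpoly_const: "mpoly M (\<lambda>_. p)" by (simp add: mpoly_def)

lemma mpoly_sum: "(\<And>i. i \<in> I \<Longrightarrow> mpoly M (P i)) \<Longrightarrow> mpoly M (\<lambda>w. \<Sum>i\<in>I. P i w)"
  unfolding mpoly_def coeff_sum by (rule allI, rule borel_measurable_sum) blast

lemma mpoly_mult: "mpoly M P \<Longrightarrow> mpoly M Q \<Longrightarrow> mpoly M (\<lambda>w. P w * Q w)"
  unfolding mpoly_def coeff_mult by (intro allI borel_measurable_sum borel_measurable_times) auto

lemma mpoly_prod: "(\<And>i. i \<in> I \<Longrightarrow> mpoly M (P i)) \<Longrightarrow> mpoly M (\<lambda>w. \<Prod>i\<in>I. P i w)"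
  by (induction I rule: infinite_finite_induct) (auto intro: mpoly_const mpoly_mult)

lemma mpoly_smult:
  assumes "f \<in> borel_measurable M" "mpoly M P" shows "mpoly M (\<lambda>w. Polynomial.smult (f w) (P w))"
  unfolding mpoly_def coeff_smult
proof
  fix i
  have "(\<lambda>w. poly.coeff (P w) i) \<in> borel_measurable M" using assms(2) unfolding mpoly_def by (rule spec)
  then show "(\<lambda>w. f w * poly.coeff (P w) i) \<in> borel_measurable M" by (rule borel_measurable_times[OF assms(1)])
qed

lemma mpoly_linear:
  assumes f: "f \<in> borel_measurable M" shows "mpoly M (\<lambda>w. [:- f w, 1:])"
  unfolding mpoly_def
proof
  fix i
  have "(\<lambda>w. poly.coeff [:- f w, 1:] i) = (\<lambda>w. if i = 0 then - f w else if i = 1 then 1 else 0)"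
    by (auto simp: fun_eq_iff coeff_pCons split: nat.split)
  then show "(\<lambda>w. poly.coeff [:- f w, 1:] i) \<in> borel_measurable M" using f by simp
qed

lemma mpoly_if:
  assumes "Measurable.pred M C" "mpoly M P" "mpoly M Q" shows "mpoly M (\<lambda>w. if C w then P w else Q w)"
  unfolding mpoly_def
proof
  fix i
  have P: "(\<lambda>w. poly.coeff (P w) i) \<in> borel_measurable M" using assms(2) unfolding mpoly_def by (rule spec)
  have Q: "(\<lambda>w. poly.coeff (Q w) i) \<in> borel_measurable M" using assms(3) unfolding mpoly_def by (rule spec)
  have "(\<lambda>w. poly.coeff (if C w then P w else Q w) i) = (\<lambda>w. if C w then poly.coeff (P w) i else poly.coeff (Q w) i)"
    by (rule ext) simp
  also have "\<dots> \<in> borel_measurable M"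
    by (rule measurable_If[OF P Q]) (use assms(1) in \<open>simp add: pred_def\<close>)
  finally show "(\<lambda>w. poly.coeff (if C w then P w else Q w) i) \<in> borel_measurable M" .
qed

text \<open>The interpolation polynomial may jump where eigenvalues coincide, but coincidence is a
  measurable event and each branch has measurable coefficients.\<close>

lemma mpoly_interp:
  assumes d: "\<And>i. i < n \<Longrightarrow> (\<lambda>w. d w i) \<in> borel_measurable M" and y: "\<And>i. i < n \<Longrightarrow> (\<lambda>w. y w i) \<in> borel_measurable M"
  shows "mpoly M (\<lambda>w. interp n (d w) (y w))"
proof -
  have eq: "Measurable.pred M (\<lambda>w. d w l = d w k)" if "l < n" "k < n" for l k
    unfolding pred_def by (rule borel_measurable_eq[OF d[OF that(1)] d[OF that(2)]])
  have ex: "Measurable.pred M (\<lambda>w. \<exists>l<k. d w l = d w k)" if "k < n" for k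
  proof -
    have "Measurable.pred M (\<lambda>w. \<exists>l\<in>{..<k}. d w l = d w k)"
    proof (rule pred_intros_finite(4))
      fix l assume "l \<in> {..<k}"
      then have "l < n" using that by simp
      then show "Measurable.pred M (\<lambda>w. d w l = d w k)" by (rule eq[OF _ that])
    qed simp
    moreover have "(\<lambda>w. \<exists>l<k. d w l = d w k) = (\<lambda>w. \<exists>l\<in>{..<k}. d w l = d w k)"
      by (rule ext) blast
    ultimately show ?thesis by (simp only:)
  qed
  have lin: "mpoly M (\<lambda>w. if d w l = d w k then 1 else Polynomial.smult (1 / (d w k - d w l)) [:- d w l, 1:])"
    if l: "l < n" and k: "k < n" for l k
  proof (rule mpoly_if[OF eq[OF l k] mpoly_const mpoly_smult[OF _ mpoly_linear[OF d[OF l]]]])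
    show "(\<lambda>w. 1 / (d w k - d w l)) \<in> borel_measurable M"
      by (rule borel_measurable_divide[OF borel_measurable_const borel_measurable_diff[OF d[OF k] d[OF l]]])
  qed
  show ?thesis unfolding interp_def
  proof (rule mpoly_sum)
    fix k assume "k \<in> {..<n}"
    then have k: "k < n" by simp
    have "mpoly M (\<lambda>w. \<Prod>l<n. if d w l = d w k then 1 else Polynomial.smult (1 / (d w k - d w l)) [:- d w l, 1:])"
      by (rule mpoly_prod) (use lin k in simp)
    from mpoly_if[OF ex[OF k] mpoly_const mpoly_smult[OF y[OF k] this]]
    show "mpoly M (\<lambda>w. if \<exists>l<k. d w l = d w k then 0 else Polynomial.smult (y w k)
      (\<Prod>l<n. if d w l = d w k then 1 else Polynomial.smult (1 / (d w k - d w l)) [:- d w l, 1:]))" .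
  qed
qed

lemma mmat_hfun:
  assumes X: "mmat M n n X" and d: "\<And>i. i < n \<Longrightarrow> (\<lambda>w. d w i) \<in> borel_measurable M" and y: "\<And>i. i < n \<Longrightarrow> (\<lambda>w. y w i) \<in> borel_measurable M"
  shows "mmat M n n (\<lambda>w. hfun n (d w) (y w) (X w))"
proof (rule mmatI)
  fix i j assume ij: "i < n" "j < n"
  have c: "(\<lambda>w. complex_of_real (poly.coeff (interp n (d w) (y w)) k)) \<in> borel_measurable M" for k
  proof -
    have "mpoly M (\<lambda>w. interp n (d w) (y w))" by (rule mpoly_interp[OF d y])
    then have [measurable]: "(\<lambda>w. poly.coeff (interp n (d w) (y w)) k) \<in> borel_measurable M" unfolding mpoly_def by blast
    show ?thesis by measurable
  qed
  have "(\<lambda>w. \<Sum>k\<le>n. complex_of_real (poly.coeff (interp n (d w) (y w)) k) * (X w ^\<^sub>m k) $$ (i, j)) \<in> borel_measurable M"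
    by (rule borel_measurable_sum, rule borel_measurable_times[OF c mmat_index[OF mmat_power[OF X] ij]])
  then show "(\<lambda>w. hfun n (d w) (y w) (X w) $$ (i, j)) \<in> borel_measurable M" using ij by (simp add: hfun_def)
qed simp

lemma mmat_orthonormalize:
  assumes X: "mmat M n t X" shows "mmat M n t (\<lambda>w. orthonormalize (X w))"
proof -
  have e: "(\<lambda>w. eigs ((X w)\<^sup>H * X w) k) \<in> borel_measurable M" if "k < t" for k
    using measurable_eigs[OF mmat_adj[OF X] that] by simp
  have d: "dim_col (X w) = t" for w using mmat_carrier[OF X, of w] by simp
  have s: "(\<lambda>w. 1 / sqrt (eigs ((X w)\<^sup>H * X w) k)) \<in> borel_measurable M" if "k < t" for k
    by (rule borel_measurable_divide[OF borel_measurable_const borel_measurable_continuous_on[OF _ e[OF that], of sqrt]])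
       (intro continuous_intros)
  show ?thesis unfolding orthonormalize_def inv_sqrt_def d
    by (rule mmat_mult[OF X mmat_hfun[OF mmat_mult[OF mmat_adj[OF X] X] e s]])
qed

section \<open>Water filling\<close>

lemma wf_term_mono: "g \<le> g' \<Longrightarrow> wf_term g l \<le> wf_term g' l"
  by (auto simp: wf_term_def)

lemma wf_term_nonneg: "0 \<le> wf_term g l"
  by (auto simp: wf_term_def)

text \<open>Only a term that is already positive is certain to grow strictly, hence the condition on
  the sum. Since the power is positive, this yields uniqueness of the water level.\<close>

lemma water_filling_strict:
  assumes "finite J" "0 < (\<Sum>j\<in>J. wf_term g (l j))" "g < g'"
  shows "(\<Sum>j\<in>J. wf_term g (l j)) < (\<Sum>j\<in>J. wf_term g' (l j))"
proof -
  obtain j where j: "j \<in> J" "wf_term g (l j) > 0"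
  proof -
    have "\<exists>j\<in>J. wf_term g (l j) > 0"
    proof (rule ccontr)
      assume "\<not> (\<exists>j\<in>J. wf_term g (l j) > 0)"
      then have "(\<Sum>j\<in>J. wf_term g (l j)) \<le> 0" by (intro sum_nonpos) (auto simp: not_less)
      then show False using assms(2) by simp
    qed
    then show ?thesis using that by blast
  qed
  have "wf_term g (l j) < wf_term g' (l j)" using j(2) assms(3) by (auto simp: wf_term_def split: if_splits)
  then show ?thesis using assms j(1) by (intro sum_strict_mono_ex1) (auto intro: wf_term_mono)
qed

lemma water_level_exists:
  assumes "finite J" "k \<in> J" "l k > 0" "\<rho> > 0"
  shows "\<exists>!g. (\<Sum>j\<in>J. wf_term g (l j)) = \<rho>"
proof -
  let ?S = "\<lambda>g. \<Sum>j\<in>J. wf_term g (l j)"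
  have c: "continuous_on A ?S" for A
  proof (rule continuous_on_sum)
    fix j
    show "continuous_on A (\<lambda>g. wf_term g (l j))"
      unfolding wf_term_def by (cases "l j > 0") (simp_all, intro continuous_intros)
  qed
  have S0: "?S 0 = 0"
    by (rule sum.neutral) (auto simp: wf_term_def)
  \<comment> \<open>At this level the k-th term alone already reaches \<rho>, which bounds the
    search interval for the intermediate value theorem.\<close>
  have Sb: "\<rho> \<le> ?S (1 / l k + \<rho>)"
  proof -
    have "\<rho> \<le> wf_term (1 / l k + \<rho>) (l k)" using assms(3) by (simp add: wf_term_def)
    also have "\<dots> \<le> ?S (1 / l k + \<rho>)" using assms by (intro member_le_sum) (auto intro: wf_term_nonneg)
    finally show ?thesis .
  qed
  have "\<exists>g. 0 \<le> g \<and> g \<le> 1 / l k + \<rho> \<and> ?S g = \<rho>"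
  proof (rule IVT'[of ?S 0 \<rho> "1 / l k + \<rho>"])
    show "?S 0 \<le> \<rho>" using S0 assms(4) by simp
    show "0 \<le> 1 / l k + \<rho>" using assms(3,4) by simp
  qed (fact Sb, rule c)
  then obtain g where g: "?S g = \<rho>" by blast
  show ?thesis
  proof (rule ex1I[of _ g])
    show "?S g = \<rho>" by (rule g)
    fix g' assume g': "?S g' = \<rho>"
    show "g' = g"
      using water_filling_strict[OF assms(1), of g l g'] water_filling_strict[OF assms(1), of g' l g] g g' assms(4)
      by (cases g g' rule: linorder_cases) auto
  qed
qed

lemma water_level_sum:
  assumes "k \<in> {1..m}" "Lam H k > 0" "\<rho> > 0"
  shows "(\<Sum>j=1..m. wf_term (water_level m \<rho> H) (Lam H j)) = \<rho>"
  unfolding water_level_def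
proof (rule theI')
  show "\<exists>!g. (\<Sum>j=1..m. wf_term g (Lam H j)) = \<rho>"
    by (rule water_level_exists[of "{1..m}" k "Lam H", OF _ assms]) simp
qed

text \<open>When no eigenvalue is positive, no water level exists and the definite description is
  arbitrary, but then all terms are zero. So an inequality holds for every channel, as the power
  constraint demands.\<close>

lemma water_level_sum_le:
  assumes "\<rho> > 0"
  shows "(\<Sum>j=1..m. wf_term (water_level m \<rho> H) (Lam H j)) \<le> \<rho>"
proof (cases "\<exists>k\<in>{1..m}. Lam H k > 0")
  case True
  then obtain k where "k \<in> {1..m}" "Lam H k > 0" by blast
  from water_level_sum[OF this assms] show ?thesis by simp
next
  case False
  then have "(\<Sum>j=1..m. wf_term (water_level m \<rho> H) (Lam H j)) = 0"
    by (intro sum.neutral) (auto simp: wf_term_def)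
  then show ?thesis using assms by simp
qed

text \<open>Sublevel sets of the water level become conditions on sums at the fixed level
  \<open>c\<close>, which keeps the definite description out of the measurability argument.\<close>

lemma water_level_le_iff:
  assumes k: "k \<in> {1..m}" "Lam H k > 0" and \<rho>: "\<rho> > 0"
  shows "water_level m \<rho> H \<le> c \<longleftrightarrow> \<rho> \<le> (\<Sum>j=1..m. wf_term c (Lam H j))"
proof
  note g = water_level_sum[OF k \<rho>]
  show "\<rho> \<le> (\<Sum>j=1..m. wf_term c (Lam H j))" if "water_level m \<rho> H \<le> c"
  proof -
    have "\<rho> = (\<Sum>j=1..m. wf_term (water_level m \<rho> H) (Lam H j))" by (rule g[symmetric])
    also have "\<dots> \<le> (\<Sum>j=1..m. wf_term c (Lam H j))" by (intro sum_mono wf_term_mono that)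
    finally show ?thesis .
  qed
  show "water_level m \<rho> H \<le> c" if "\<rho> \<le> (\<Sum>j=1..m. wf_term c (Lam H j))"
  proof (rule ccontr)
    assume "\<not> water_level m \<rho> H \<le> c"
    then have "c < water_level m \<rho> H" by simp
    have "0 < (\<Sum>j=1..m. wf_term c (Lam H j))" using that \<rho> by linarith
    from water_filling_strict[OF _ this \<open>c < water_level m \<rho> H\<close>] that show False unfolding g by simp
  qed
qed

lemma measurable_wf_term:
  assumes "g \<in> borel_measurable M" "l \<in> borel_measurable M"
  shows "(\<lambda>w. wf_term (g w) (l w)) \<in> borel_measurable M"
proof -
  note [measurable] = assms
  show ?thesis unfolding wf_term_def by measurable
qed

lemma measurable_water_level:
  assumes l: "\<And>j. j \<in> {1..m} \<Longrightarrow> (\<lambda>w. Lam (X w) j) \<in> borel_measurable M" and \<rho>: "\<rho> > 0"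
  shows "(\<lambda>w. water_level m \<rho> (X w)) \<in> borel_measurable M"
proof (rule borel_measurableI_le)
  fix c
  let ?P = "\<lambda>w. \<exists>k\<in>{1..m}. Lam (X w) k > 0"
  \<comment> \<open>On degenerate channels the defining equation has no solution, so the description
    denotes one fixed, unspecified real number.\<close>
  define c0 where "c0 = (THE g::real. False)"
  have deg: "water_level m \<rho> (X w) = c0" if "\<not> ?P w" for w
  proof -
    have "(\<Sum>j=1..m. wf_term g (Lam (X w) j)) = 0" for g
      using that by (intro sum.neutral) (auto simp: wf_term_def)
    then show ?thesis unfolding water_level_def c0_def using \<rho> by simp
  qed
  have P: "{w \<in> space M. ?P w} \<in> sets M"
  proof -
    have "{w \<in> space M. ?P w} = (\<Union>k\<in>{1..m}. {w \<in> space M. 0 < Lam (X w) k})" by blast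
    also have "\<dots> \<in> sets M"
    proof (rule sets.finite_UN)
      fix k assume "k \<in> {1..m}"
      then show "{w \<in> space M. 0 < Lam (X w) k} \<in> sets M"
        by (intro borel_measurable_less borel_measurable_const l)
    qed simp
    finally show ?thesis .
  qed
  have S: "{w \<in> space M. \<rho> \<le> (\<Sum>j=1..m. wf_term c (Lam (X w) j))} \<in> sets M"
  proof -
    have "(\<lambda>w. \<Sum>j=1..m. wf_term c (Lam (X w) j)) \<in> borel_measurable M"
    proof (rule borel_measurable_sum)
      fix j assume "j \<in> {1..m}"
      then show "(\<lambda>w. wf_term c (Lam (X w) j)) \<in> borel_measurable M"
        by (intro measurable_wf_term[of "\<lambda>_. c" M "\<lambda>w. Lam (X w) j"] borel_measurable_const l)
    qed
    then show ?thesis by (rule borel_measurable_le[OF borel_measurable_const])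
  qed
  have "{w \<in> space M. water_level m \<rho> (X w) \<le> c} =
    ({w \<in> space M. ?P w} \<inter> {w \<in> space M. \<rho> \<le> (\<Sum>j=1..m. wf_term c (Lam (X w) j))}) \<union>
    (if c0 \<le> c then space M - {w \<in> space M. ?P w} else {})"
  proof (intro Set.set_eqI iffI)
    fix w assume w: "w \<in> {w \<in> space M. water_level m \<rho> (X w) \<le> c}"
    show "w \<in> ({w \<in> space M. ?P w} \<inter> {w \<in> space M. \<rho> \<le> (\<Sum>j=1..m. wf_term c (Lam (X w) j))}) \<union>
      (if c0 \<le> c then space M - {w \<in> space M. ?P w} else {})"
    proof (cases "?P w")
      case True
      then obtain k where "k \<in> {1..m}" "Lam (X w) k > 0" by blast
      from water_level_le_iff[OF this \<rho>, of c] w True show ?thesis by simp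
    next
      case False
      from deg[OF this] w False show ?thesis by simp
    qed
  next
    fix w assume w: "w \<in> ({w \<in> space M. ?P w} \<inter> {w \<in> space M. \<rho> \<le> (\<Sum>j=1..m. wf_term c (Lam (X w) j))}) \<union>
      (if c0 \<le> c then space M - {w \<in> space M. ?P w} else {})"
    show "w \<in> {w \<in> space M. water_level m \<rho> (X w) \<le> c}"
    proof (cases "?P w")
      case True
      then obtain k where "k \<in> {1..m}" "Lam (X w) k > 0" by blast
      from water_level_le_iff[OF this \<rho>, of c] w True show ?thesis by (simp split: if_splits)
    next
      case False
      from deg[OF this] w False show ?thesis by (simp split: if_splits)
    qed
  qed
  also have "\<dots> \<in> sets M"
    by (intro sets.Un sets.Int P S) (simp only: sets.compl_sets[OF P] sets.empty_sets split: if_split, simp)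
  finally show "{w \<in> space M. water_level m \<rho> (X w) \<le> c} \<in> sets M" .
qed

section \<open>The encoder: power and effective channel\<close>

lemma Lam_eigs: "Lam H (Suc i) = eigs (H * H\<^sup>H) i"
  by (simp add: Lam_def eigs_def)

text \<open>The Hermitian square root of the water-filling covariance. It is a function of
  \<open>H\<close> alone; eigenvectors enter only in proofs about it.\<close>

definition enc :: "nat \<Rightarrow> nat \<Rightarrow> real \<Rightarrow> complex Matrix.mat \<Rightarrow> complex Matrix.mat" where
  "enc t m \<rho> H = hfun t (eigs (H * H\<^sup>H)) (\<lambda>k. sqrt (wf_term (water_level m \<rho> H) (eigs (H * H\<^sup>H) k))) (H * H\<^sup>H)"

lemma enc_carrier [simp]: "enc t m \<rho> H \<in> carrier_mat t t" by (simp add: enc_def)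

lemma mmat_enc:
  assumes X: "mmat M t r X" and m: "m \<le> t" and \<rho>: "\<rho> > 0"
  shows "mmat M t t (\<lambda>w. enc t m \<rho> (X w))"
proof -
  have e: "(\<lambda>w. eigs (X w * (X w)\<^sup>H) k) \<in> borel_measurable M" if "k < t" for k by (rule measurable_eigs[OF X that])
  have l: "(\<lambda>w. Lam (X w) j) \<in> borel_measurable M" if "j \<in> {1..m}" for j
  proof -
    have j: "j - 1 < t" "Suc (j - 1) = j" using that m by auto
    show ?thesis using e[OF j(1)] unfolding Lam_eigs[symmetric] j(2) .
  qed
  have s: "(\<lambda>w. sqrt (wf_term (water_level m \<rho> (X w)) (eigs (X w * (X w)\<^sup>H) k))) \<in> borel_measurable M" if "k < t" for k
    by (rule borel_measurable_continuous_on[OF _ measurable_wf_term[OF measurable_water_level[OF l \<rho>] e[OF that]], of sqrt])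
       (intro continuous_intros)
  show ?thesis unfolding enc_def by (rule mmat_hfun[OF mmat_mult[OF X mmat_adj[OF X]] e s])
qed

lemma is_svdD:
  assumes "is_svd p q H U V d"
  shows "orthocols p p U" "orthocols q q V"
    "H * V = U * Matrix.mat p q (\<lambda>(i, j). if i = j then complex_of_real (sqrt (d i)) else 0)"
    "(H * H\<^sup>H) * U = U * mat_diag p (\<lambda>i. complex_of_real (d i))"
    "\<And>i j. i \<le> j \<Longrightarrow> j < p \<Longrightarrow> d j \<le> d i" "\<And>i. i < p \<Longrightarrow> 0 \<le> d i" "\<And>i. i < p \<Longrightarrow> q \<le> i \<Longrightarrow> d i = 0"
  using assms unfolding is_svd_def by blast+

lemma eigs_svd:
  assumes H: "H \<in> carrier_mat p q" and svd: "is_svd p q H U V d" and i: "i < p"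
  shows "eigs (H * H\<^sup>H) i = d i"
proof -
  have "H * H\<^sup>H \<in> carrier_mat p p" using H by auto
  from eigs_desc_eq[OF this is_svdD(1)[OF svd] is_svdD(4)[OF svd] is_svdD(5)[OF svd]] i show ?thesis by (simp add: eigs_def)
qed

lemma enc_spectral:
  assumes H: "H \<in> carrier_mat t r" and svd: "is_svd t r H U V d"
  shows "enc t m \<rho> H = U * (mat_diag t (\<lambda>i. complex_of_real (sqrt (wf_term (water_level m \<rho> H) (d i)))) * U\<^sup>H)"
proof -
  have "H * H\<^sup>H \<in> carrier_mat t t" using H by auto
  from hfun_eigs[OF this is_svdD(1)[OF svd] is_svdD(4)[OF svd] is_svdD(5)[OF svd],
      where f = "\<lambda>x. sqrt (wf_term (water_level m \<rho> H) x)"]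
  show ?thesis unfolding enc_def .
qed

text \<open>In singular coordinates the encoder and the channel are both diagonal, so that the
  square roots of allocated power and eigenvalue multiply to the entries of
  \<open>Dmat\<close>.\<close>

lemma enc_channel:
  assumes H: "H \<in> carrier_mat t r" and svd: "is_svd t r H U V d"
  shows "enc t (min t r) \<rho> H * H * V = U * Dmat t r \<rho> H"
proof -
  let ?g = "water_level (min t r) \<rho> H"
  let ?E = "mat_diag t (\<lambda>i. complex_of_real (sqrt (wf_term ?g (d i))))"
  let ?S = "Matrix.mat t r (\<lambda>(i, j). if i = j then complex_of_real (sqrt (d i)) else 0)"
  note U = is_svdD(1)[OF svd] and V = is_svdD(2)[OF svd]
  have Uc: "U \<in> carrier_mat t t" and Vc: "V \<in> carrier_mat r r" using U V by (auto intro: orthocols_carrier)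
  have ES: "?E * ?S = Dmat t r \<rho> H"
  proof (rule eq_matI)
    fix i j assume "i < dim_row (Dmat t r \<rho> H)" "j < dim_col (Dmat t r \<rho> H)"
    then have ij: "i < t" "j < r" by (auto simp: Dmat_def)
    have "(?E * ?S) $$ (i, j) = complex_of_real (sqrt (wf_term ?g (d i))) * ?S $$ (i, j)"
      by (subst mat_diag_mult_left[of _ t r]) (use ij in auto)
    also have "\<dots> = Dmat t r \<rho> H $$ (i, j)"
    proof (cases "i = j")
      case True
      have "Lam H (i + 1) = d i" using eigs_svd[OF H svd ij(1)] Lam_eigs[of H i] by simp
      then show ?thesis using True ij by (simp add: Dmat_def vstar_def real_sqrt_mult)
    next
      case False
      then show ?thesis using ij by (simp add: Dmat_def)
    qed
    finally show "(?E * ?S) $$ (i, j) = Dmat t r \<rho> H $$ (i, j)" .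
  qed (auto simp: Dmat_def)
  have "enc t (min t r) \<rho> H * H * V = enc t (min t r) \<rho> H * (H * V)"
    by (rule assoc_mult_mat[of _ t t _ r _ r]) (use H Vc in auto)
  also have "\<dots> = U * (?E * U\<^sup>H) * (U * ?S)" unfolding enc_spectral[OF H svd] is_svdD(3)[OF svd] ..
  also have "\<dots> = U * (((?E * U\<^sup>H) * U) * ?S)" by (rule assoc_mult_mat4[of _ t t _ t _ t _ r]) (use Uc in auto)
  also have "(?E * U\<^sup>H) * U = ?E * (U\<^sup>H * U)" by (rule assoc_mult_mat[of _ t t _ t _ t]) (use Uc in auto)
  also have "\<dots> = ?E" unfolding orthocolsD[OF U] by (rule right_mult_one_mat[OF mat_diag_dim])
  finally show ?thesis unfolding ES .
qed

lemma frob2_eq: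
  assumes A: "A \<in> carrier_mat n t"
  shows "frob2 A = (\<Sum>i<n. \<Sum>j<t. (cmod (A $$ (i, j)))\<^sup>2)" "frob2 A = Re (\<Sum>j<t. (A\<^sup>H * A) $$ (j, j))"
proof -
  have "(A * A\<^sup>H) $$ (i, i) = complex_of_real (\<Sum>j<t. (cmod (A $$ (i, j)))\<^sup>2)" if "i < n" for i
  proof -
    have "(A * A\<^sup>H) $$ (i, i) = (\<Sum>j<t. A $$ (i, j) * A\<^sup>H $$ (j, i))" by (rule mult_index[of _ n t _ n]) (use A that in auto)
    also have "\<dots> = (\<Sum>j<t. cnj (A $$ (i, j)) * A $$ (i, j))" using A that by (intro sum.cong refl) auto
    finally show ?thesis unfolding cnj_mult_self by simp
  qed
  then have "(\<Sum>i<dim_row A. (A * A\<^sup>H) $$ (i, i)) = (\<Sum>i<n. complex_of_real (\<Sum>j<t. (cmod (A $$ (i, j)))\<^sup>2))"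
    using A by (intro sum.cong) auto
  then show 1: "frob2 A = (\<Sum>i<n. \<Sum>j<t. (cmod (A $$ (i, j)))\<^sup>2)"
    unfolding frob2_def by simp
  have "(A\<^sup>H * A) $$ (j, j) = complex_of_real (\<Sum>i<n. (cmod (A $$ (i, j)))\<^sup>2)" if "j < t" for j
    unfolding adj_mult_self_index[OF A A that that] cnj_mult_self by simp
  then have "(\<Sum>j<t. (A\<^sup>H * A) $$ (j, j)) = (\<Sum>j<t. complex_of_real (\<Sum>i<n. (cmod (A $$ (i, j)))\<^sup>2))"
    by (intro sum.cong refl) simp
  then show "frob2 A = Re (\<Sum>j<t. (A\<^sup>H * A) $$ (j, j))"
    unfolding 1 by (simp add: sum.swap[of _ "{..<n}"])
qed

lemma trace_spectral:
  assumes U: "orthocols n n U"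
  shows "(\<Sum>a<n. (U * (mat_diag n f * U\<^sup>H)) $$ (a, a)) = (\<Sum>j<n. f j)"
proof -
  have Uc: "U \<in> carrier_mat n n" using U by (rule orthocols_carrier)
  have "(\<Sum>a<n. (U * (mat_diag n f * U\<^sup>H)) $$ (a, a)) = (\<Sum>a<n. \<Sum>j<n. f j * (cnj (U $$ (a, j)) * U $$ (a, j)))"
    by (intro sum.cong refl) (simp add: spectral_index[OF Uc] mult_ac)
  also have "\<dots> = (\<Sum>j<n. f j * (\<Sum>a<n. cnj (U $$ (a, j)) * U $$ (a, j)))"
    by (rule trans[OF sum.swap]) (simp only: sum_distrib_left)
  also have "\<dots> = (\<Sum>j<n. f j)"
  proof (rule sum.cong[OF refl])
    fix j assume j: "j \<in> {..<n}"
    have "(\<Sum>a<n. cnj (U $$ (a, j)) * U $$ (a, j)) = 1"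
      using adj_mult_self_index[OF Uc Uc, of j j] orthocolsD[OF U] j by simp
    then show "f j * (\<Sum>a<n. cnj (U $$ (a, j)) * U $$ (a, j)) = f j" by simp
  qed
  finally show ?thesis .
qed

text \<open>The frame preserves energy, so what remains is the trace of the squared encoder, which
  is the sum of the allocated powers; the factor \<open>n\<close> comes from the scaling by sqrt
  n.\<close>

lemma enc_power:
  assumes H: "H \<in> carrier_mat t r" and P: "orthocols n t P" and \<rho>: "\<rho> > 0"
  shows "frob2 (complex_of_real (sqrt (real n)) \<cdot>\<^sub>m (P * enc t (min t r) \<rho> H)) \<le> real n * \<rho>"
proof -
  let ?g = "water_level (min t r) \<rho> H" and ?c = "complex_of_real (sqrt (real n))"
  let ?K = "enc t (min t r) \<rho> H"
  obtain U V d where svd: "is_svd t r H U V d" by (rule exists_svd[OF H])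
  note U = is_svdD(1)[OF svd]
  have Uc: "U \<in> carrier_mat t t" using U by (rule orthocols_carrier)
  have Pc: "P \<in> carrier_mat n t" using P by (rule orthocols_carrier)
  have PKc: "P * ?K \<in> carrier_mat n t" using Pc by auto
  have wn: "complex_of_real (sqrt (wf_term ?g (d i))) * complex_of_real (sqrt (wf_term ?g (d i))) = complex_of_real (wf_term ?g (d i))" for i
    unfolding of_real_mult[symmetric] using wf_term_nonneg by simp
  have "(P * ?K)\<^sup>H * (P * ?K) = ?K\<^sup>H * ?K" by (rule orthocols_cancel[OF P enc_carrier enc_carrier])
  also have "\<dots> = U * (mat_diag t (\<lambda>i. complex_of_real (wf_term ?g (d i))) * U\<^sup>H)"
    unfolding enc_spectral[OF H svd] spectral_adj[OF Uc] spectral_mult[OF U] wn ..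
  finally have G: "(P * ?K)\<^sup>H * (P * ?K) = U * (mat_diag t (\<lambda>i. complex_of_real (wf_term ?g (d i))) * U\<^sup>H)" .
  have "frob2 (?c \<cdot>\<^sub>m (P * ?K)) = real n * frob2 (P * ?K)"
  proof -
    have c: "?c \<cdot>\<^sub>m (P * ?K) \<in> carrier_mat n t" using PKc by simp
    have "(cmod ((?c \<cdot>\<^sub>m (P * ?K)) $$ (i, j)))\<^sup>2 = real n * (cmod ((P * ?K) $$ (i, j)))\<^sup>2" if "i < n" "j < t" for i j
    proof -
      have "(?c \<cdot>\<^sub>m (P * ?K)) $$ (i, j) = ?c * (P * ?K) $$ (i, j)"
        by (rule index_smult_mat(1)) (use that PKc in auto)
      then show ?thesis by (simp only: norm_mult power_mult_distrib norm_of_real) simp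
    qed
    then show ?thesis unfolding frob2_eq(1)[OF c] frob2_eq(1)[OF PKc] sum_distrib_left by (intro sum.cong refl) simp
  qed
  also have "frob2 (P * ?K) = (\<Sum>i<t. wf_term ?g (d i))"
    unfolding frob2_eq(2)[OF PKc] G trace_spectral[OF U] by simp
  \<comment> \<open>Eigenvalues of index at least \<open>r\<close> are zero and receive no
    power.\<close>
  also have "(\<Sum>i<t. wf_term ?g (d i)) = (\<Sum>i<min t r. wf_term ?g (d i))"
    by (rule sum.mono_neutral_right) (use is_svdD(7)[OF svd] in \<open>auto simp: wf_term_def\<close>)
  also have "\<dots> = (\<Sum>i<min t r. wf_term ?g (Lam H (Suc i)))"
    using eigs_svd[OF H svd] by (intro sum.cong refl) (simp add: Lam_eigs)
  also have "\<dots> = (\<Sum>j=1..min t r. wf_term ?g (Lam H j))"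
    by (rule sum.reindex_bij_witness[of _ "\<lambda>j. j - 1" Suc]) auto
  finally have "frob2 (?c \<cdot>\<^sub>m (P * ?K)) = real n * (\<Sum>j=1..min t r. wf_term ?g (Lam H j))" .
  then show ?thesis using water_level_sum_le[OF \<rho>, of "min t r" H] by (simp add: mult_left_mono)
qed

section \<open>The law of the sine product of a Gaussian matrix\<close>

definition from_mat :: "nat \<Rightarrow> nat \<Rightarrow> complex Matrix.mat \<Rightarrow> nat \<times> nat \<Rightarrow> complex" where
  "from_mat a b A = (\<lambda>p\<in>{..<a} \<times> {..<b}. A $$ p)"

lemma to_mat_carrier [simp]: "to_mat a b w \<in> carrier_mat a b"
  by (simp add: to_mat_def)

lemma to_mat_index: "i < a \<Longrightarrow> j < b \<Longrightarrow> to_mat a b w $$ (i, j) = w (i, j)"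
  by (simp add: to_mat_def)

lemma to_from_mat: "A \<in> carrier_mat a b \<Longrightarrow> to_mat a b (from_mat a b A) = A"
  by (rule eq_matI) (auto simp: to_mat_def from_mat_def)

lemma from_to_mat:
  assumes "w \<in> space (leb ({..<a} \<times> {..<b}))" shows "from_mat a b (to_mat a b w) = w"
proof
  fix p
  show "from_mat a b (to_mat a b w) p = w p"
    using assms by (cases p) (auto simp: from_mat_def to_mat_def space_leb PiE_iff extensional_def)
qed

lemma from_mat_space: "from_mat a b A \<in> space (leb ({..<a} \<times> {..<b}))"
  by (simp add: from_mat_def space_leb)

lemma to_mat_vplus: "to_mat a b (vplus ({..<a} \<times> {..<b}) x y) = to_mat a b x + to_mat a b y"
  by (rule eq_matI) (auto simp: to_mat_def vplus_def)

lemma mmat_to_mat: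
  assumes "\<And>p. p \<in> {..<a} \<times> {..<b} \<Longrightarrow> (\<lambda>w. w p) \<in> borel_measurable M"
  shows "mmat M a b (to_mat a b)"
  using assms by (intro mmatI) (simp_all add: to_mat_index)

lemma mmat_to_mat_leb: "mmat (leb ({..<a} \<times> {..<b})) a b (to_mat a b)"
  by (rule mmat_to_mat) (rule measurable_coord(2))

lemma mmat_to_mat_gauss: "mmat (gauss ({..<a} \<times> {..<b})) a b (to_mat a b)"
  by (rule mmat_to_mat) (rule measurable_coord(1))

lemma measurable_from_mat:
  assumes X: "mmat M a b X" shows "(\<lambda>w. from_mat a b (X w)) \<in> measurable M (leb ({..<a} \<times> {..<b}))"
  unfolding leb_def from_mat_def
proof (rule measurable_restrict)
  fix p assume "p \<in> {..<a} \<times> {..<b}"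
  then obtain i j where "p = (i, j)" "i < a" "j < b" by auto
  then show "(\<lambda>w. X w $$ p) \<in> measurable M lborel" using mmat_index[OF X, of i j] by simp
qed

lemma measurable_leb_gauss: "borel_measurable (gauss I) = borel_measurable (leb I)"
  by (rule measurable_cong_sets) (simp_all add: sets_gauss sets_leb)

text \<open>The squared Frobenius norm through the Gram matrix of the columns, in which left
  unitaries cancel; right ones follow by passing to the adjoint.\<close>

definition msq :: "complex Matrix.mat \<Rightarrow> real" where
  "msq A = Re (\<Sum>j<dim_col A. (A\<^sup>H * A) $$ (j, j))"

lemma msq_eq:
  assumes A: "A \<in> carrier_mat n t"
  shows "msq A = (\<Sum>j<t. \<Sum>i<n. (cmod (A $$ (i, j)))\<^sup>2)"
proof -
  have "(A\<^sup>H * A) $$ (j, j) = complex_of_real (\<Sum>i<n. (cmod (A $$ (i, j)))\<^sup>2)" if "j < t" for j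
    unfolding adj_mult_self_index[OF A A that that] cnj_mult_self by simp
  then have "(\<Sum>j<dim_col A. (A\<^sup>H * A) $$ (j, j)) = (\<Sum>j<t. complex_of_real (\<Sum>i<n. (cmod (A $$ (i, j)))\<^sup>2))"
    using A by (intro sum.cong) auto
  then show ?thesis unfolding msq_def by simp
qed

lemma msq_adj:
  assumes A: "A \<in> carrier_mat n t" shows "msq (A\<^sup>H) = msq A"
proof -
  have A': "A\<^sup>H \<in> carrier_mat t n" using A by simp
  have "msq (A\<^sup>H) = (\<Sum>i<n. \<Sum>j<t. (cmod (A $$ (i, j)))\<^sup>2)"
    unfolding msq_eq[OF A'] using A by (intro sum.cong refl) auto
  then show ?thesis unfolding msq_eq[OF A] by (simp add: sum.swap[of _ "{..<n}"])
qed

lemma msq_unitary: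
  assumes A: "A \<in> carrier_mat n t" and U: "orthocols n n U" and V: "orthocols t t V"
  shows "msq (U * A * V) = msq A"
proof -
  have l: "msq (W * B) = msq B" if "orthocols m m W" "B \<in> carrier_mat m k" for W B m k
    using orthocols_cancel[OF that(1) that(2) that(2)] that(2) by (simp add: msq_def)
  have Uc: "U \<in> carrier_mat n n" and Vc: "V \<in> carrier_mat t t" using U V by (auto intro: orthocols_carrier)
  have UA: "U * A \<in> carrier_mat n t" using Uc A by auto
  have "msq (U * A * V) = msq ((U * A * V)\<^sup>H)" using msq_adj[of "U * A * V" n t] UA Vc by auto
  also have "\<dots> = msq (V\<^sup>H * (U * A)\<^sup>H)" unfolding adj_mult[OF UA Vc] ..
  also have "\<dots> = msq ((U * A)\<^sup>H)" by (rule l[OF unitary_adj[OF V]]) (use UA in simp)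
  also have "\<dots> = msq A" unfolding msq_adj[OF UA] by (rule l[OF U A])
  finally show ?thesis .
qed

text \<open>Two-sided unitary multiplication is a linear isometry of the array of entries, and it is
  onto because the adjoints undo it.\<close>

lemma nn_integral_noise_unitary:
  assumes U: "orthocols n n U" and V: "orthocols r r V"
    and f: "(\<lambda>w. f (to_mat n r w)) \<in> borel_measurable (noise n r)"
  shows "(\<integral>\<^sup>+w. f (U * to_mat n r w * V) \<partial>noise n r) = (\<integral>\<^sup>+w. f (to_mat n r w) \<partial>noise n r)"
proof -
  let ?I = "{..<n} \<times> {..<r}"
  let ?T = "\<lambda>w. from_mat n r (U * to_mat n r w * V)"
  have Uc: "U \<in> carrier_mat n n" and Vc: "V \<in> carrier_mat r r" using U V by (auto intro: orthocols_carrier)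
  have c: "U * X * V \<in> carrier_mat n r" if "X \<in> carrier_mat n r" for X
    using that Uc Vc by auto
  have tf: "to_mat n r (?T w) = U * to_mat n r w * V" for w by (rule to_from_mat[OF c]) simp
  have s: "(\<Sum>p\<in>?I. (cmod (x p))\<^sup>2) = msq (to_mat n r x)" for x
  proof -
    have "(\<Sum>p\<in>?I. (cmod (x p))\<^sup>2) = (\<Sum>i<n. \<Sum>j<r. (cmod (x (i, j)))\<^sup>2)"
      by (subst sum.cartesian_product) (auto intro!: sum.cong)
    also have "\<dots> = (\<Sum>j<r. \<Sum>i<n. (cmod (x (i, j)))\<^sup>2)" by (rule sum.swap)
    finally show ?thesis unfolding msq_eq[OF to_mat_carrier] by (simp add: to_mat_index)
  qed
  have "(\<integral>\<^sup>+w. f (to_mat n r (?T w)) \<partial>gauss ?I) = (\<integral>\<^sup>+w. f (to_mat n r w) \<partial>gauss ?I)"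
  proof (rule nn_integral_gauss_isometry)
    show "?T \<in> measurable (leb ?I) (leb ?I)"
      by (rule measurable_from_mat, rule mmat_mult[OF mmat_mult[OF mmat_const[OF Uc] mmat_to_mat_leb] mmat_const[OF Vc]])
    show "?T (vplus ?I x y) = vplus ?I (?T x) (?T y)" for x y
    proof -
      have "U * (to_mat n r x + to_mat n r y) * V = U * to_mat n r x * V + U * to_mat n r y * V"
        using mult_add_distrib_mat[OF Uc, of "to_mat n r x" r "to_mat n r y"]
          add_mult_distrib_mat[of "U * to_mat n r x" n r "U * to_mat n r y" V r] Uc Vc by auto
      then have "U * to_mat n r (vplus ?I x y) * V = to_mat n r (vplus ?I (?T x) (?T y))"
        unfolding to_mat_vplus tf by simp
      then have "?T (vplus ?I x y) = from_mat n r (to_mat n r (vplus ?I (?T x) (?T y)))" by simp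
      also have "\<dots> = vplus ?I (?T x) (?T y)" by (rule from_to_mat) (simp add: vplus_def space_leb)
      finally show ?thesis .
    qed
    show "\<exists>x\<in>space (leb ?I). ?T x = y" if y: "y \<in> space (leb ?I)" for y
    proof (rule bexI[of _ "from_mat n r (U\<^sup>H * to_mat n r y * V\<^sup>H)"])
      let ?Y = "to_mat n r y"
      have Yc: "?Y \<in> carrier_mat n r" by simp
      have c1: "U\<^sup>H * ?Y \<in> carrier_mat n r" using Uc by auto
      have c2: "U\<^sup>H * ?Y * V\<^sup>H \<in> carrier_mat n r" using c1 Vc by auto
      have "U * (U\<^sup>H * ?Y * V\<^sup>H) * V = U * ((U\<^sup>H * ?Y * V\<^sup>H) * V)"
        by (rule assoc_mult_mat[OF Uc c2 Vc])
      also have "(U\<^sup>H * ?Y * V\<^sup>H) * V = (U\<^sup>H * ?Y) * (V\<^sup>H * V)"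
        by (rule assoc_mult_mat[OF c1, of _ r _ r]) (use Vc in auto)
      also have "\<dots> = U\<^sup>H * ?Y" unfolding orthocolsD[OF V] by (rule right_mult_one_mat[OF c1])
      also have "U * (U\<^sup>H * ?Y) = (U * U\<^sup>H) * ?Y"
        by (rule assoc_mult_mat[symmetric, OF Uc, of _ n _ r]) (use Uc in auto)
      also have "\<dots> = ?Y" unfolding unitary_right[OF U] by (rule left_mult_one_mat[OF Yc])
      finally show "?T (from_mat n r (U\<^sup>H * ?Y * V\<^sup>H)) = y"
        unfolding to_from_mat[OF c2] using from_to_mat[OF y] by simp
    qed (rule from_mat_space)
    show "(\<Sum>p\<in>?I. (cmod (?T x p))\<^sup>2) = (\<Sum>p\<in>?I. (cmod (x p))\<^sup>2)" for x
      unfolding s tf by (rule msq_unitary[OF to_mat_carrier U V])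
    show "(\<lambda>w. f (to_mat n r w)) \<in> borel_measurable (leb ?I)"
      using f unfolding noise_eq measurable_leb_gauss .
  qed simp
  then show ?thesis unfolding tf noise_eq .
qed

section \<open>Full column rank almost surely\<close>

lemma full_rankI:
  assumes Y: "Y \<in> carrier_mat n r" and k: "\<And>v. v \<in> carrier_vec r \<Longrightarrow> Y *\<^sub>v v = 0\<^sub>v n \<Longrightarrow> v = 0\<^sub>v r"
  shows "full_rank Y"
  unfolding full_rank_def
proof
  let ?G = "Y\<^sup>H * Y"
  assume d: "Determinant.det ?G = 0"
  have G: "?G \<in> carrier_mat r r" using Y by auto
  obtain v where v: "v \<in> carrier_vec r" "v \<noteq> 0\<^sub>v r" "?G *\<^sub>v v = 0\<^sub>v r"
    using d unfolding det_0_iff_vec_prod_zero[OF G] by blast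
  \<comment> \<open>The quadratic form of the Gram matrix at \<open>v\<close> is the squared norm of
    its image under \<open>Y\<close>, so a kernel vector of the Gram matrix is one of
    \<open>Y\<close>.\<close>
  have "cinner (Y *\<^sub>v v) (Y *\<^sub>v v) = (\<Sum>i<r. \<Sum>j<r. v $v i * cnj (v $v j) * cnj (?G $$ (i, j)))"
    by (rule cinner_mult[OF Y Y v(1) v(1)])
  also have "\<dots> = (\<Sum>i<r. v $v i * cnj ((?G *\<^sub>v v) $v i))"
    by (intro sum.cong refl) (simp add: mult_vec_index[OF G v(1)] sum_distrib_left mult_ac del: index_mult_mat_vec)
  also have "\<dots> = 0" unfolding v(3) by simp
  finally have "nsq (Y *\<^sub>v v) = 0" unfolding cinner_self by simp
  then have "Y *\<^sub>v v = 0\<^sub>v n" using nsq_eq_0_iff[OF mult_mat_vec_carrier[OF Y v(1)]] by simp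
  then show False using k v by simp
qed

definition top_block :: "nat \<Rightarrow> complex Matrix.mat \<Rightarrow> complex Matrix.mat" where
  "top_block r Y = Matrix.mat r r (\<lambda>p. Y $$ p)"

text \<open>Reduces full rank to the nonvanishing of a single square determinant in the
  entries.\<close>

lemma full_rank_top_block:
  assumes Y: "Y \<in> carrier_mat n r" and rn: "r \<le> n" and d: "Determinant.det (top_block r Y) \<noteq> 0"
  shows "full_rank Y"
proof (rule full_rankI[OF Y])
  fix v assume v: "v \<in> carrier_vec r" and 0: "Y *\<^sub>v v = 0\<^sub>v n"
  have T: "top_block r Y \<in> carrier_mat r r" by (simp add: top_block_def)
  have "top_block r Y *\<^sub>v v = 0\<^sub>v r"
  proof (rule eq_vecI)
    fix i assume "i < dim_vec (0\<^sub>v r :: complex Matrix.vec)"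
    then have i: "i < r" by simp
    have "(top_block r Y *\<^sub>v v) $v i = (Y *\<^sub>v v) $v i"
      unfolding mult_vec_index[OF T v i] using mult_vec_index[OF Y v, of i] i rn
      by (simp add: top_block_def del: index_mult_mat_vec)
    then show "(top_block r Y *\<^sub>v v) $v i = 0\<^sub>v r $v i" unfolding 0 using i rn by simp
  qed (simp add: top_block_def)
  then show "v = 0\<^sub>v r" using d v det_0_iff_vec_prod_zero[OF T] by blast
qed

text \<open>The zeros are the negatives of eigenvalues, of which there are finitely many.\<close>

lemma finite_det_shift_zeros:
  fixes A :: "complex Matrix.mat"
  assumes A: "A \<in> carrier_mat r r"
  shows "finite {z. Determinant.det (A + z \<cdot>\<^sub>m 1\<^sub>m r) = 0}"
proof -
  have "char_poly A \<noteq> 0" using degree_monic_char_poly[OF A] by auto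
  then have "finite {z. poly (char_poly A) z = 0}" by (rule poly_roots_finite)
  then have "finite (uminus ` {z. poly (char_poly A) z = 0})" by (rule finite_imageI)
  moreover have "{z. Determinant.det (A + z \<cdot>\<^sub>m 1\<^sub>m r) = 0} \<subseteq> uminus ` {z. poly (char_poly A) z = 0}"
  proof
    fix z assume z: "z \<in> {z. Determinant.det (A + z \<cdot>\<^sub>m 1\<^sub>m r) = 0}"
    have "char_matrix A (- z) = A + z \<cdot>\<^sub>m 1\<^sub>m r" using A by (simp add: char_matrix_def)
    then have "eigenvalue A (- z)" using z unfolding eigenvalue_det[OF A] by simp
    then have "poly (char_poly A) (- z) = 0" unfolding eigenvalue_root_char_poly[OF A] .
    then show "z \<in> uminus ` {z. poly (char_poly A) z = 0}" by (intro image_eqI[of _ _ "- z"]) auto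
  qed
  ultimately show ?thesis by (rule rev_finite_subset)
qed

text \<open>Shifting by multiples of the identity, along which the determinant is a nonzero polynomial.\<close>
lemma AE_leb_top_block:
  assumes rn: "r \<le> n"
  shows "AE w in leb ({..<n} \<times> {..<r}). Determinant.det (top_block r (to_mat n r w)) \<noteq> 0"
proof -
  let ?I = "{..<n} \<times> {..<r}"
  let ?g = "\<lambda>w. indicator {0} (Determinant.det (top_block r (to_mat n r w))) :: ennreal"
  define e where "e z = (\<lambda>p\<in>?I. if fst p = snd p then z else 0 :: complex)" for z
  interpret L: sigma_finite_measure "leb ?I" by (rule sigma_finite_leb) simp
  interpret P: pair_sigma_finite "lborel :: complex measure" "leb ?I" by standard
  have m1: "mmat (leb ?I) r r (\<lambda>w. top_block r (to_mat n r w))"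
  proof (rule mmatI)
    fix i j assume ij: "i < r" "j < r"
    then have "(\<lambda>w. top_block r (to_mat n r w) $$ (i, j)) = (\<lambda>w. w (i, j))"
      using rn by (simp add: top_block_def to_mat_index)
    then show "(\<lambda>w. top_block r (to_mat n r w) $$ (i, j)) \<in> borel_measurable (leb ?I)"
      using measurable_coord(2)[of "(i, j)" ?I] ij rn by simp
  qed (simp add: top_block_def)
  have ind: "(\<lambda>x. indicator {0::complex} x :: ennreal) \<in> borel_measurable borel" by measurable
  have gm: "?g \<in> borel_measurable (leb ?I)"
    by (rule measurable_compose[OF measurable_det[OF m1] ind])
  have te: "top_block r (to_mat n r (vplus ?I (e z) w)) = top_block r (to_mat n r w) + z \<cdot>\<^sub>m 1\<^sub>m r" for z w
    by (rule eq_matI) (use rn in \<open>auto simp: top_block_def to_mat_index vplus_def e_def\<close>)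
  have m2: "mmat (lborel \<Otimes>\<^sub>M leb ?I) r r (\<lambda>q. top_block r (to_mat n r (snd q)) + fst q \<cdot>\<^sub>m 1\<^sub>m r)"
  proof (rule mmatI)
    fix i j assume ij: "i < r" "j < r"
    have 1: "(\<lambda>q. snd q (i, j)) \<in> borel_measurable (lborel \<Otimes>\<^sub>M leb ?I)"
      by (rule measurable_compose[OF measurable_snd measurable_coord(2)]) (use ij rn in auto)
    have 2: "(\<lambda>q. fst q * (if i = j then 1 else 0)) \<in> borel_measurable ((lborel :: complex measure) \<Otimes>\<^sub>M leb ?I)"
      by (rule borel_measurable_times[OF measurable_compose[OF measurable_fst]]) auto
    have "(\<lambda>q. (top_block r (to_mat n r (snd q)) + fst q \<cdot>\<^sub>m 1\<^sub>m r) $$ (i, j)) = (\<lambda>q. snd q (i, j) + fst q * (if i = j then 1 else 0))"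
      using ij rn by (auto simp: top_block_def to_mat_index fun_eq_iff)
    then show "(\<lambda>q. (top_block r (to_mat n r (snd q)) + fst q \<cdot>\<^sub>m 1\<^sub>m r) $$ (i, j)) \<in> borel_measurable (lborel \<Otimes>\<^sub>M leb ?I)"
      using borel_measurable_add[OF 1 2] by simp
  qed (simp add: top_block_def)
  have jm: "(\<lambda>(z, w). ?g (vplus ?I (e z) w)) \<in> borel_measurable (lborel \<Otimes>\<^sub>M leb ?I)"
    unfolding te case_prod_beta by (rule measurable_compose[OF measurable_det[OF m2] ind])
  \<comment> \<open>For each \<open>w\<close> only finitely many shifts \<open>z\<close> are bad, so
    the double integral vanishes. Translation invariance makes the inner integral over
    \<open>w\<close> the same for all \<open>z\<close>, and a constant whose integral over the plane
    is 0 must be 0.\<close>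
  have "(\<integral>\<^sup>+z. \<integral>\<^sup>+w. ?g (vplus ?I (e z) w) \<partial>leb ?I \<partial>lborel) = (\<integral>\<^sup>+w. \<integral>\<^sup>+z. ?g (vplus ?I (e z) w) \<partial>lborel \<partial>leb ?I)"
    by (rule P.Fubini'[symmetric, OF jm])
  also have "\<dots> = (\<integral>\<^sup>+w. 0 \<partial>leb ?I)"
  proof (rule nn_integral_cong)
    fix w
    let ?Z = "{z. Determinant.det (top_block r (to_mat n r w) + z \<cdot>\<^sub>m 1\<^sub>m r) = 0}"
    have "finite ?Z" by (rule finite_det_shift_zeros) (simp add: top_block_def)
    then have Z: "?Z \<in> null_sets lborel" by (rule finite_imp_null_set_lborel)
    have "(\<integral>\<^sup>+z. ?g (vplus ?I (e z) w) \<partial>lborel) = (\<integral>\<^sup>+z. indicator ?Z z \<partial>lborel)"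
      unfolding te by (intro nn_integral_cong) (simp add: indicator_def)
    also have "\<dots> = 0" using Z by (simp add: null_sets_def)
    finally show "(\<integral>\<^sup>+z. ?g (vplus ?I (e z) w) \<partial>lborel) = 0" .
  qed
  finally have 0: "(\<integral>\<^sup>+z. \<integral>\<^sup>+w. ?g (vplus ?I (e z) w) \<partial>leb ?I \<partial>lborel) = 0" by simp
  have "(\<integral>\<^sup>+w. ?g (vplus ?I (e z) w) \<partial>leb ?I) = (\<integral>\<^sup>+w. ?g w \<partial>leb ?I)" for z
    by (rule nn_integral_leb_shift[OF _ gm]) (auto simp: e_def space_leb)
  then have "(\<integral>\<^sup>+z. (\<integral>\<^sup>+w. ?g w \<partial>leb ?I) \<partial>(lborel :: complex measure)) = 0" using 0 by simp
  then have "(\<integral>\<^sup>+w. ?g w \<partial>leb ?I) = 0" by simp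
  then have "AE w in leb ?I. ?g w = 0" using nn_integral_0_iff_AE[OF gm] by simp
  then show ?thesis by (rule AE_mp) (auto simp: indicator_def)
qed

lemma AE_noise_of_leb:
  assumes "AE w in leb ({..<n} \<times> {..<r}). Q w" shows "AE w in noise n r. Q w"
  unfolding noise_eq
  by (subst gauss_eq_density) (auto simp: AE_density intro: AE_mp[OF assms])

text \<open>Translation by a fixed matrix preserves Lebesgue measure, and the noise is absolutely
  continuous with respect to it.\<close>

lemma AE_full_rank:
  assumes rn: "r \<le> n" and C: "C \<in> carrier_mat n r"
  shows "AE w in noise n r. full_rank (C + to_mat n r w)"
proof (rule AE_noise_of_leb)
  let ?I = "{..<n} \<times> {..<r}"
  have m: "vplus ?I (from_mat n r C) \<in> measurable (leb ?I) (leb ?I)"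
    using measurable_vplus[OF measurable_const[OF from_mat_space] measurable_ident] by simp
  have "AE w in distr (leb ?I) (leb ?I) (vplus ?I (from_mat n r C)). Determinant.det (top_block r (to_mat n r w)) \<noteq> 0"
  proof -
    have d: "distr (leb ?I) (leb ?I) (vplus ?I (from_mat n r C)) = leb ?I" by (rule distr_leb_vplus) simp
    show ?thesis unfolding d by (rule AE_leb_top_block[OF rn])
  qed
  from AE_distrD[OF m this]
  have "AE w in leb ?I. Determinant.det (top_block r (C + to_mat n r w)) \<noteq> 0"
    unfolding to_mat_vplus to_from_mat[OF C] .
  then show "AE w in leb ?I. full_rank (C + to_mat n r w)"
  proof (rule AE_mp, intro AE_I2 impI)
    fix w assume "Determinant.det (top_block r (C + to_mat n r w)) \<noteq> 0"
    then show "full_rank (C + to_mat n r w)" by (rule full_rank_top_block[OF _ rn, rotated]) (use C in simp)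
  qed
qed

section \<open>Gram determinants when a column is appended\<close>

definition gramdet :: "complex Matrix.mat \<Rightarrow> real" where
  "gramdet Y = cmod (Determinant.det (Y\<^sup>H * Y))"

lemma gramdet_mult_right:
  assumes Y: "Y \<in> carrier_mat n r" and S: "S \<in> carrier_mat r r"
  shows "gramdet (Y * S) = gramdet Y * (cmod (Determinant.det S))\<^sup>2"
proof -
  have G: "Y\<^sup>H * Y \<in> carrier_mat r r" using Y by auto
  have "Determinant.det ((Y * S)\<^sup>H * (Y * S)) = cnj (Determinant.det S) * (Determinant.det (Y\<^sup>H * Y) * Determinant.det S)"
    unfolding gram_mult_right[OF Y Y S S] using G S by (subst det_mult[of _ r]) (auto simp: det_mult[of _ r] det_adj)
  then show ?thesis unfolding gramdet_def by (simp add: norm_mult power2_eq_square)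
qed

text \<open>For an orthogonal new column the Gram matrix is block diagonal.\<close>

lemma gramdet_append_orthogonal:
  assumes G: "G \<in> carrier_mat n k" and h: "h \<in> carrier_vec n" and o: "G\<^sup>H *\<^sub>v h = 0\<^sub>v k"
  shows "gramdet (append_col G h) = gramdet G * nsq h"
proof -
  let ?R = "append_col G h"
  let ?D = "Matrix.mat 1 1 (\<lambda>_. complex_of_real (nsq h))"
  have R: "?R \<in> carrier_mat n (Suc k)" using G by (rule append_col_carrier)
  have GG: "G\<^sup>H * G \<in> carrier_mat k k" using G by auto
  have z: "(\<Sum>l<n. cnj (G $$ (l, i)) * h $v l) = 0" if "i < k" for i
  proof -
    have "(\<Sum>l<n. cnj (G $$ (l, i)) * h $v l) = (G\<^sup>H *\<^sub>v h) $v i"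
      by (subst mult_vec_index[of _ k n]) (use G h that in \<open>auto intro!: sum.cong\<close>)
    then show ?thesis using o that by simp
  qed
  have z': "(\<Sum>l<n. cnj (h $v l) * G $$ (l, i)) = 0" if "i < k" for i
    using arg_cong[OF z[OF that], of cnj] by (simp add: mult.commute)
  have hh: "(\<Sum>l<n. cnj (h $v l) * h $v l) = complex_of_real (nsq h)"
    using h by (simp add: nsq_def cnj_mult_self)
  have "?R\<^sup>H * ?R = four_block_mat (G\<^sup>H * G) (0\<^sub>m k 1) (0\<^sub>m 1 k) ?D"
  proof (rule eq_matI)
    fix i j assume "i < dim_row (four_block_mat (G\<^sup>H * G) (0\<^sub>m k 1) (0\<^sub>m 1 k) ?D)"
      "j < dim_col (four_block_mat (G\<^sup>H * G) (0\<^sub>m k 1) (0\<^sub>m 1 k) ?D)"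
    then have ij: "i < Suc k" "j < Suc k" using G by auto
    have "(?R\<^sup>H * ?R) $$ (i, j) = (\<Sum>l<n. cnj (?R $$ (l, i)) * ?R $$ (l, j))"
      by (rule adj_mult_self_index[OF R R ij])
    also have "\<dots> = (if i < k then (if j < k then (G\<^sup>H * G) $$ (i, j) else 0) else (if j < k then 0 else complex_of_real (nsq h)))"
    proof -
      have ii: "i = k" if "\<not> i < k" using that ij by simp
      have jj: "j = k" if "\<not> j < k" using that ij by simp
      show ?thesis
        using z[of i] z'[of j] hh ii jj G adj_mult_self_index[OF G G, of i j]
        by (cases "i < k"; cases "j < k") (simp_all add: append_col_index del: index_mult_mat)
    qed
    also have "\<dots> = four_block_mat (G\<^sup>H * G) (0\<^sub>m k 1) (0\<^sub>m 1 k) ?D $$ (i, j)"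
      using ij G by (auto simp del: index_mult_mat(1))
    finally show "(?R\<^sup>H * ?R) $$ (i, j) = four_block_mat (G\<^sup>H * G) (0\<^sub>m k 1) (0\<^sub>m 1 k) ?D $$ (i, j)" .
  qed (use R G in auto)
  then have "Determinant.det (?R\<^sup>H * ?R) = Determinant.det (G\<^sup>H * G) * Determinant.det ?D"
    using det_four_block_mat_lower_left_zero[OF GG, of "0\<^sub>m k 1" 1 "0\<^sub>m 1 k" ?D] by simp
  also have "Determinant.det ?D = complex_of_real (nsq h)" by (subst det_single) auto
  finally show ?thesis using nsq_nonneg[of h] by (simp add: gramdet_def norm_mult)
qed

text \<open>The new column multiplies the squared volume by its squared distance from the span of
  \<open>G\<close>, read off from the coordinates beyond the first \<open>k\<close> in a basis
  \<open>U\<close> that extends the polar factor of \<open>G\<close>.\<close>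

lemma gramdet_append_col:
  assumes G: "G \<in> carrier_mat n k" and fr: "full_rank G" and g: "g \<in> carrier_vec n"
    and U: "orthocols n n U" and UG: "\<And>i j. i < n \<Longrightarrow> j < k \<Longrightarrow> U $$ (i, j) = orthonormalize G $$ (i, j)"
  shows "gramdet (append_col G g) = gramdet G * (\<Sum>i\<in>{k..<n}. (cmod ((U\<^sup>H *\<^sub>v g) $v i))\<^sup>2)"
proof -
  let ?T = "inv_sqrt k (G\<^sup>H * G)"
  have Uc: "U \<in> carrier_mat n n" using U by (rule orthocols_carrier)
  have GG: "G\<^sup>H * G \<in> carrier_mat k k" using G by auto
  have Gh: "G\<^sup>H \<in> carrier_mat k n" using G by simp
  obtain B where B: "B \<in> carrier_mat k k" "(G\<^sup>H * G) * B = 1\<^sub>m k"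
    using det_non_zero_imp_unit[OF GG, of undefined] fr by (auto simp: Units_def ring_mat_def full_rank_def)
  \<comment> \<open>\<open>c\<close> solves the normal equations, so \<open>G *\<^sub>v c\<close> is
    the projection of \<open>g\<close> onto the span of \<open>G\<close>.\<close>
  define c where "c = B *\<^sub>v (G\<^sup>H *\<^sub>v g)"
  have Ghg: "G\<^sup>H *\<^sub>v g \<in> carrier_vec k" using Gh g by simp
  have c: "c \<in> carrier_vec k" using B Ghg by (simp add: c_def)
  have Gc: "G *\<^sub>v c \<in> carrier_vec n" using G c by simp
  define h where "h = g - G *\<^sub>v c"
  have h: "h \<in> carrier_vec n" using g Gc by (simp add: h_def)
  have o: "G\<^sup>H *\<^sub>v h = 0\<^sub>v k"
  proof -
    have "G\<^sup>H *\<^sub>v (G *\<^sub>v c) = (G\<^sup>H * G) *\<^sub>v c" by (rule assoc_mult_mat_vec[symmetric, OF Gh G c])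
    also have "\<dots> = ((G\<^sup>H * G) * B) *\<^sub>v (G\<^sup>H *\<^sub>v g)"
      unfolding c_def by (rule assoc_mult_mat_vec[symmetric, OF GG B(1) Ghg])
    also have "\<dots> = G\<^sup>H *\<^sub>v g" unfolding B(2) by (rule one_mult_mat_vec[OF Ghg])
    finally have "G\<^sup>H *\<^sub>v (G *\<^sub>v c) = G\<^sup>H *\<^sub>v g" .
    then show ?thesis unfolding h_def mult_minus_vec[OF Gh g Gc] using minus_cancel_vec[OF Ghg] by simp
  qed
  \<comment> \<open>Subtracting the projection is a column operation with a unit upper triangular
    matrix.\<close>
  define S where "S = Matrix.mat (Suc k) (Suc k) (\<lambda>(i, j). if i = j then 1 else if j = k then - c $v i else (0 :: complex))"
  have S: "S \<in> carrier_mat (Suc k) (Suc k)" by (simp add: S_def)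
  have dS: "Determinant.det S = 1"
  proof -
    have "Determinant.det S = prod_list (diag_mat S)"
      by (rule det_upper_triangular[of _ "Suc k"]) (auto simp: S_def)
    also have "diag_mat S = map (\<lambda>i. 1) [0..<Suc k]" by (auto simp: diag_mat_def S_def)
    finally show ?thesis by (simp add: prod_list_replicate map_replicate_const)
  qed
  have Ag: "append_col G g \<in> carrier_mat n (Suc k)" using G by (rule append_col_carrier)
  have "append_col G h = append_col G g * S"
  proof (rule eq_matI)
    fix i j assume "i < dim_row (append_col G g * S)" "j < dim_col (append_col G g * S)"
    then have ij: "i < n" "j < Suc k" using Ag S by auto
    have "(append_col G g * S) $$ (i, j) = (\<Sum>l<Suc k. append_col G g $$ (i, l) * S $$ (l, j))"
      by (rule mult_index[OF Ag S ij])
    also have "\<dots> = (\<Sum>l<k. G $$ (i, l) * S $$ (l, j)) + g $v i * S $$ (k, j)"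
      using G ij by (simp add: append_col_index)
    also have "\<dots> = append_col G h $$ (i, j)"
    proof (cases "j < k")
      case True
      have "(\<Sum>l<k. G $$ (i, l) * S $$ (l, j)) = (\<Sum>l<k. if l = j then G $$ (i, j) else 0)"
        by (rule sum.cong[OF refl]) (use True in \<open>auto simp: S_def\<close>)
      also have "\<dots> = G $$ (i, j)" using True by simp
      finally show ?thesis using True ij G by (simp add: append_col_index S_def)
    next
      case False
      then have j: "j = k" using ij by simp
      have "(\<Sum>l<k. G $$ (i, l) * S $$ (l, j)) = (\<Sum>l<k. - (G $$ (i, l) * c $v l))"
        by (rule sum.cong[OF refl]) (auto simp: S_def j)
      also have "\<dots> = - (G *\<^sub>v c) $v i" unfolding mult_vec_index[OF G c ij(1)] by (rule sum_negf)
      finally have "(\<Sum>l<k. G $$ (i, l) * S $$ (l, j)) = - (G *\<^sub>v c) $v i" .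
      moreover have "S $$ (k, j) = 1" by (simp add: S_def j)
      moreover have "append_col G h $$ (i, j) = g $v i - (G *\<^sub>v c) $v i"
        unfolding j append_col_index(2)[OF G ij(1)] h_def using ij G by (intro index_minus_vec(1)) simp
      ultimately show ?thesis by simp
    qed
    finally show "append_col G h $$ (i, j) = (append_col G g * S) $$ (i, j)" by simp
  qed (use Ag S append_col_carrier[OF G, of h] in auto)
  then have "gramdet (append_col G g) = gramdet (append_col G h)"
    using gramdet_mult_right[OF Ag S] dS by simp
  also have "\<dots> = gramdet G * nsq h" by (rule gramdet_append_orthogonal[OF G h o])
  also have "nsq h = nsq (U\<^sup>H *\<^sub>v h)" by (rule nsq_orthocols[symmetric, OF unitary_adj[OF U] h])
  also have "\<dots> = (\<Sum>i<n. (cmod ((U\<^sup>H *\<^sub>v h) $v i))\<^sup>2)" using Uc by (simp add: nsq_def)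
  \<comment> \<open>The residual has no components along the first \<open>k\<close> basis vectors,
    and the subtracted projection has none along the others.\<close>
  also have "\<dots> = (\<Sum>i\<in>{k..<n}. (cmod ((U\<^sup>H *\<^sub>v g) $v i))\<^sup>2)"
  proof -
    have Uh: "U\<^sup>H \<in> carrier_mat n n" using Uc by simp
    let ?Q = "orthonormalize G"
    have Tc: "?T \<in> carrier_mat k k" by (simp add: inv_sqrt_def)
    have Q: "?Q = G * ?T" using G by (simp add: orthonormalize_def)
    have Qc: "?Q \<in> carrier_mat n k" unfolding Q using G Tc by auto
    have kn: "k \<le> n" by (rule orthocols_le[OF orthonormalize(1)[OF G fr]])
    have top: "(U\<^sup>H *\<^sub>v h) $v i = 0" if i: "i < k" for i
    proof -
      have "?Q\<^sup>H *\<^sub>v h = ?T\<^sup>H *\<^sub>v (G\<^sup>H *\<^sub>v h)"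
        unfolding Q adj_mult[OF G Tc] by (rule assoc_mult_mat_vec[of _ k k _ n]) (use G Tc h in auto)
      also have "\<dots> = 0\<^sub>v k" unfolding o by (rule mult_mat_vec_zero) (use Tc in simp)
      finally have q: "?Q\<^sup>H *\<^sub>v h = 0\<^sub>v k" .
      have "(U\<^sup>H *\<^sub>v h) $v i = (\<Sum>l<n. cnj (U $$ (l, i)) * h $v l)"
        by (subst mult_vec_index[OF Uh h]) (use Uc i kn in auto)
      also have "\<dots> = (\<Sum>l<n. cnj (?Q $$ (l, i)) * h $v l)" using UG i by (intro sum.cong) auto
      also have "\<dots> = (?Q\<^sup>H *\<^sub>v h) $v i"
        by (subst mult_vec_index[of _ k n]) (use Qc h i in \<open>auto intro!: sum.cong\<close>)
      finally show ?thesis unfolding q using i by simp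
    qed
    have bot: "(U\<^sup>H *\<^sub>v h) $v i = (U\<^sup>H *\<^sub>v g) $v i" if i: "k \<le> i" "i < n" for i
    proof -
      obtain T' where T': "T' \<in> carrier_mat k k" "?T * T' = 1\<^sub>m k"
        using det_non_zero_imp_unit[OF Tc orthonormalize(2)[OF G fr], of undefined] by (auto simp: Units_def ring_mat_def)
      have "?Q * T' = G * (?T * T')" unfolding Q by (rule assoc_mult_mat[OF G Tc T'(1)])
      then have GQ: "G = ?Q * T'" unfolding T'(2) using G by simp
      have T'c: "T' *\<^sub>v c \<in> carrier_vec k" using T' c by simp
      have Gc': "G *\<^sub>v c = ?Q *\<^sub>v (T' *\<^sub>v c)" unfolding arg_cong[OF GQ, of "\<lambda>X. X *\<^sub>v c"]
        by (rule assoc_mult_mat_vec[OF Qc T'(1) c])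
      have "(U\<^sup>H *\<^sub>v (G *\<^sub>v c)) $v i = ((U\<^sup>H * ?Q) *\<^sub>v (T' *\<^sub>v c)) $v i"
        unfolding Gc' by (subst assoc_mult_mat_vec[OF Uh Qc T'c]) simp
      also have "\<dots> = (\<Sum>j<k. (U\<^sup>H * ?Q) $$ (i, j) * (T' *\<^sub>v c) $v j)"
        by (rule mult_vec_index[OF _ T'c i(2)]) (use Uh Qc in auto)
      also have "\<dots> = 0"
      proof (rule sum.neutral, rule ballI)
        fix j assume j: "j \<in> {..<k}"
        have "(U\<^sup>H * ?Q) $$ (i, j) = (\<Sum>l<n. cnj (U $$ (l, i)) * ?Q $$ (l, j))"
          by (rule adj_mult_self_index[OF Uc Qc i(2)]) (use j in simp)
        also have "\<dots> = (\<Sum>l<n. cnj (U $$ (l, i)) * U $$ (l, j))" using UG j by (intro sum.cong) auto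
        also have "\<dots> = (U\<^sup>H * U) $$ (i, j)" by (rule adj_mult_self_index[symmetric, OF Uc Uc i(2)]) (use j kn in simp)
        also have "\<dots> = 0" unfolding orthocolsD[OF U] using i j kn by simp
        finally show "(U\<^sup>H * ?Q) $$ (i, j) * (T' *\<^sub>v c) $v j = 0" by simp
      qed
      finally have 0: "(U\<^sup>H *\<^sub>v (G *\<^sub>v c)) $v i = 0" .
      have "(U\<^sup>H *\<^sub>v h) $v i = (U\<^sup>H *\<^sub>v g) $v i - (U\<^sup>H *\<^sub>v (G *\<^sub>v c)) $v i"
        unfolding h_def mult_minus_vec[OF Uh g Gc] using i Uc by (intro index_minus_vec(1)) simp
      then show ?thesis unfolding 0 by simp
    qed
    have "(\<Sum>i<n. (cmod ((U\<^sup>H *\<^sub>v h) $v i))\<^sup>2) = (\<Sum>i\<in>{k..<n}. (cmod ((U\<^sup>H *\<^sub>v h) $v i))\<^sup>2)"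
      by (rule sum.mono_neutral_right) (auto simp: top simp del: index_mult_mat_vec)
    also have "\<dots> = (\<Sum>i\<in>{k..<n}. (cmod ((U\<^sup>H *\<^sub>v g) $v i))\<^sup>2)"
      by (rule sum.cong[OF refl]) (simp add: bot del: index_mult_mat_vec)
    finally show ?thesis .
  qed
  finally show ?thesis .
qed

text \<open>The last coordinates are taken because the complementary projection then simply keeps
  the first n - t rows; unitary invariance carries the result to all frames.\<close>

definition last_cols :: "nat \<Rightarrow> nat \<Rightarrow> complex Matrix.mat" where
  "last_cols n t = Matrix.mat n t (\<lambda>(i, j). if i = j + (n - t) then 1 else 0)"

definition upper_rows :: "nat \<Rightarrow> complex Matrix.mat \<Rightarrow> complex Matrix.mat" where
  "upper_rows m Y = Matrix.mat m (dim_col Y) (\<lambda>p. Y $$ p)"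

lemma orthocols_last_cols: assumes "t \<le> n" shows "orthocols n t (last_cols n t)"
  unfolding orthocols_def
proof (intro conjI eq_matI)
  show c: "last_cols n t \<in> carrier_mat n t" by (simp add: last_cols_def)
  fix i j assume "i < dim_row (1\<^sub>m t :: complex Matrix.mat)" "j < dim_col (1\<^sub>m t :: complex Matrix.mat)"
  then have ij: "i < t" "j < t" by auto
  have "((last_cols n t)\<^sup>H * last_cols n t) $$ (i, j) = (\<Sum>l<n. if l = i + (n - t) then (if i = j then 1 else 0) else 0)"
    unfolding adj_mult_self_index[OF c c ij] by (rule sum.cong[OF refl]) (use ij in \<open>auto simp: last_cols_def\<close>)
  also have "\<dots> = (if i = j then 1 else 0)"
  proof -
    have "i + (n - t) < n" using ij assms by linarith
    then show ?thesis by simp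
  qed
  finally show "((last_cols n t)\<^sup>H * last_cols n t) $$ (i, j) = 1\<^sub>m t $$ (i, j)" using ij by simp
qed (simp_all add: last_cols_def)

text \<open>Removing the Gram matrix of the last \<open>t\<close> rows leaves that of the upper
  rows.\<close>

lemma sinsq_last_cols:
  assumes Y: "Y \<in> carrier_mat n r" and tn: "t \<le> n"
  shows "sinsq (last_cols n t) Y = gramdet (upper_rows (n - t) Y) / gramdet Y"
proof -
  let ?P = "last_cols n t" and ?Z = "upper_rows (n - t) Y"
  have P: "?P \<in> carrier_mat n t" by (simp add: last_cols_def)
  have Z: "?Z \<in> carrier_mat (n - t) r" using Y by (simp add: upper_rows_def)
  have N: "?P\<^sup>H * Y \<in> carrier_mat t r" using P Y by auto
  have NN: "(?P\<^sup>H * Y)\<^sup>H * (?P\<^sup>H * Y) \<in> carrier_mat r r" using N by auto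
  have Ni: "(?P\<^sup>H * Y) $$ (l, j) = Y $$ (l + (n - t), j)" if "l < t" "j < r" for l j
  proof -
    have "(?P\<^sup>H * Y) $$ (l, j) = (\<Sum>i<n. if i = l + (n - t) then Y $$ (l + (n - t), j) else 0)"
      unfolding adj_mult_self_index[OF P Y that] by (rule sum.cong[OF refl]) (use that in \<open>auto simp: last_cols_def\<close>)
    then show ?thesis using that tn by simp
  qed
  have "Y\<^sup>H * Y - (?P\<^sup>H * Y)\<^sup>H * (?P\<^sup>H * Y) = ?Z\<^sup>H * ?Z"
  proof (rule eq_matI)
    fix i j assume "i < dim_row (?Z\<^sup>H * ?Z)" "j < dim_col (?Z\<^sup>H * ?Z)"
    then have ij: "i < r" "j < r" using Z by auto
    let ?f = "\<lambda>l. cnj (Y $$ (l, i)) * Y $$ (l, j)"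
    have "(Y\<^sup>H * Y) $$ (i, j) = (\<Sum>l<n. ?f l)" by (rule adj_mult_self_index[OF Y Y ij])
    also have "\<dots> = (\<Sum>l<n - t. ?f l) + (\<Sum>l\<in>{n - t..<n}. ?f l)"
      using sum.atLeastLessThan_concat[of 0 "n - t" n ?f] by (simp add: lessThan_atLeast0)
    also have "(\<Sum>l\<in>{n - t..<n}. ?f l) = (\<Sum>l<t. ?f (l + (n - t)))"
      using sum.shift_bounds_nat_ivl[of ?f 0 "n - t" t] tn by (simp add: lessThan_atLeast0)
    also have "\<dots> = ((?P\<^sup>H * Y)\<^sup>H * (?P\<^sup>H * Y)) $$ (i, j)"
      unfolding adj_mult_self_index[OF N N ij] by (rule sum.cong[OF refl]) (use ij Ni in simp)
    also have "(\<Sum>l<n - t. ?f l) = (?Z\<^sup>H * ?Z) $$ (i, j)"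
      unfolding adj_mult_self_index[OF Z Z ij] by (rule sum.cong[OF refl]) (use ij Y in \<open>auto simp: upper_rows_def\<close>)
    finally have e: "(Y\<^sup>H * Y) $$ (i, j) = (?Z\<^sup>H * ?Z) $$ (i, j) + ((?P\<^sup>H * Y)\<^sup>H * (?P\<^sup>H * Y)) $$ (i, j)" .
    have "(Y\<^sup>H * Y - (?P\<^sup>H * Y)\<^sup>H * (?P\<^sup>H * Y)) $$ (i, j) = (Y\<^sup>H * Y) $$ (i, j) - ((?P\<^sup>H * Y)\<^sup>H * (?P\<^sup>H * Y)) $$ (i, j)"
      by (rule index_minus_mat(1)) (use ij carrier_matD[OF NN] in auto)
    then show "(Y\<^sup>H * Y - (?P\<^sup>H * Y)\<^sup>H * (?P\<^sup>H * Y)) $$ (i, j) = (?Z\<^sup>H * ?Z) $$ (i, j)" unfolding e by simp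
  qed (use Z Y P in auto)
  then show ?thesis unfolding sinsq_def gramdet_def by simp
qed

lemma upper_rows_append_col:
  assumes G: "G \<in> carrier_mat n k" and m: "m \<le> n" and g: "g \<in> carrier_vec n"
  shows "upper_rows m (append_col G g) = append_col (upper_rows m G) (Matrix.vec m (\<lambda>i. g $v i))"
  using G m g by (intro eq_matI) (auto simp: upper_rows_def append_col_def)

text \<open>In a suitable orthonormal basis the factor by which \<open>sinsq\<close> changes when a column is appended
  is a ratio of coordinate sums: the first \<open>k\<close> basis vectors span the columns of \<open>G\<close>, the next ones
  complement the columns of its upper rows.\<close>
lemma sinsq_append_col:
  assumes G: "G \<in> carrier_mat n k" and fr: "full_rank G" and fr': "full_rank (upper_rows (n - t) G)" and n: "t + k \<le> n"
  obtains A where "orthocols n n A"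
    "\<forall>g\<in>carrier_vec n. sinsq (last_cols n t) (append_col G g) = sinsq (last_cols n t) G *
      ((\<Sum>i\<in>{k..<n - t}. (cmod ((A *\<^sub>v g) $v i))\<^sup>2) /
       ((\<Sum>i\<in>{k..<n - t}. (cmod ((A *\<^sub>v g) $v i))\<^sup>2) + (\<Sum>i\<in>{n - t..<n}. (cmod ((A *\<^sub>v g) $v i))\<^sup>2)))"
proof -
  let ?m = "n - t" and ?Z = "upper_rows (n - t) G"
  have tn: "t \<le> n" "k \<le> n - t" using n by auto
  have Z: "?Z \<in> carrier_mat ?m k" using G by (simp add: upper_rows_def)
  have Q: "orthocols n k (orthonormalize G)" by (rule orthonormalize(1)[OF G fr])
  have Q2: "orthocols ?m k (orthonormalize ?Z)" by (rule orthonormalize(1)[OF Z fr'])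
  have Qc: "orthonormalize G \<in> carrier_mat n k" using Q by (rule orthocols_carrier)
  have Q2c: "orthonormalize ?Z \<in> carrier_mat ?m k" using Q2 by (rule orthocols_carrier)
  obtain U2 where U2: "orthocols ?m ?m U2" and U2Z: "\<And>i j. i < ?m \<Longrightarrow> j < k \<Longrightarrow> U2 $$ (i, j) = orthonormalize ?Z $$ (i, j)"
    using orthocols_completion[OF Q2 tn(2)] by auto
  have U2c: "U2 \<in> carrier_mat ?m ?m" using U2 by (rule orthocols_carrier)
  \<comment> \<open>Beyond the first \<open>k\<close> columns, \<open>W\<close> holds complement
    vectors of the upper rows, padded with zeros. They are orthogonal to the columns of
    \<open>G\<close> because the padding lets them meet only the upper rows.\<close>
  define W where "W = Matrix.mat n ?m (\<lambda>(l, i). if i < k then orthonormalize G $$ (l, i) else if l < ?m then U2 $$ (l, i) else 0)"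
  have Wc: "W \<in> carrier_mat n ?m" by (simp add: W_def)
  have QQ: "(\<Sum>l<n. cnj (orthonormalize G $$ (l, i)) * orthonormalize G $$ (l, j)) = (if i = j then 1 else 0)" if "i < k" "j < k" for i j
    using adj_mult_self_index[OF Qc Qc that] orthocolsD[OF Q] that by simp
  have UU: "(\<Sum>l<?m. cnj (U2 $$ (l, i)) * U2 $$ (l, j)) = (if i = j then 1 else 0)" if "i < ?m" "j < ?m" for i j
    using adj_mult_self_index[OF U2c U2c that] orthocolsD[OF U2] that by simp
  have cross: "(\<Sum>l<?m. cnj (U2 $$ (l, i)) * orthonormalize G $$ (l, j)) = 0" if i: "k \<le> i" "i < ?m" and j: "j < k" for i j
  proof -
    let ?T = "inv_sqrt k (G\<^sup>H * G)" and ?T2 = "inv_sqrt k (?Z\<^sup>H * ?Z)"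
    have Tc: "?T \<in> carrier_mat k k" "?T2 \<in> carrier_mat k k" by (simp_all add: inv_sqrt_def)
    have Qe: "orthonormalize G = G * ?T" using G by (simp add: orthonormalize_def)
    have Q2e: "orthonormalize ?Z = ?Z * ?T2" using carrier_matD(2)[OF Z] by (simp add: orthonormalize_def)
    obtain T' where T': "T' \<in> carrier_mat k k" "?T2 * T' = 1\<^sub>m k"
      using det_non_zero_imp_unit[OF Tc(2) orthonormalize(2)[OF Z fr'], of undefined] by (auto simp: Units_def ring_mat_def)
    have "orthonormalize ?Z * T' = ?Z * (?T2 * T')" unfolding Q2e by (rule assoc_mult_mat[OF Z Tc(2) T'(1)])
    then have ZQ: "?Z = orthonormalize ?Z * T'" unfolding T'(2) using Z by simp
    have UQ2: "(U2\<^sup>H * orthonormalize ?Z) $$ (i, l) = 0" if "l < k" for l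
    proof -
      have "(U2\<^sup>H * orthonormalize ?Z) $$ (i, l) = (\<Sum>a<?m. cnj (U2 $$ (a, i)) * U2 $$ (a, l))"
        unfolding adj_mult_self_index[OF U2c Q2c i(2) that] using U2Z that by (intro sum.cong) auto
      then show ?thesis using UU[OF i(2), of l] that i tn by simp
    qed
    have UZ: "(\<Sum>a<?m. cnj (U2 $$ (a, i)) * G $$ (a, l)) = 0" if "l < k" for l
    proof -
      have UQc: "U2\<^sup>H * orthonormalize ?Z \<in> carrier_mat ?m k" using U2c Q2c by auto
      have "(\<Sum>a<?m. cnj (U2 $$ (a, i)) * G $$ (a, l)) = (U2\<^sup>H * ?Z) $$ (i, l)"
        unfolding adj_mult_self_index[OF U2c Z i(2) that] using G that by (intro sum.cong) (auto simp: upper_rows_def)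
      also have "U2\<^sup>H * ?Z = (U2\<^sup>H * orthonormalize ?Z) * T'"
        by (subst arg_cong[OF ZQ, of "\<lambda>X. U2\<^sup>H * X"]) (rule assoc_mult_mat[symmetric, of _ ?m ?m _ k _ k], use U2c Q2c T' in auto)
      also have "\<dots> $$ (i, l) = (\<Sum>b<k. (U2\<^sup>H * orthonormalize ?Z) $$ (i, b) * T' $$ (b, l))"
        by (rule mult_index[OF UQc T'(1) i(2) that])
      also have "\<dots> = 0" using UQ2 by (intro sum.neutral) (auto simp del: index_mult_mat)
      finally show ?thesis .
    qed
    have "(\<Sum>l<?m. cnj (U2 $$ (l, i)) * orthonormalize G $$ (l, j)) = (\<Sum>l<?m. \<Sum>b<k. cnj (U2 $$ (l, i)) * G $$ (l, b) * ?T $$ (b, j))"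
    proof (rule sum.cong[OF refl])
      fix l assume "l \<in> {..<?m}"
      then have "l < n" by auto
      from mult_index[OF G Tc(1) this j]
      show "cnj (U2 $$ (l, i)) * orthonormalize G $$ (l, j) = (\<Sum>b<k. cnj (U2 $$ (l, i)) * G $$ (l, b) * ?T $$ (b, j))"
        unfolding Qe by (simp add: sum_distrib_left mult.assoc del: index_mult_mat)
    qed
    also have "\<dots> = (\<Sum>b<k. (\<Sum>l<?m. cnj (U2 $$ (l, i)) * G $$ (l, b)) * ?T $$ (b, j))"
      by (rule trans[OF sum.swap]) (simp add: sum_distrib_right)
    also have "\<dots> = 0" using UZ by (intro sum.neutral) auto
    finally show ?thesis .
  qed
  have cross': "(\<Sum>l<?m. cnj (orthonormalize G $$ (l, j)) * U2 $$ (l, i)) = 0" if "k \<le> i" "i < ?m" "j < k" for i j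
    using arg_cong[OF cross[OF that], of cnj] by (simp add: mult.commute)
  have split: "(\<Sum>l<n. if l < ?m then f l else 0) = (\<Sum>l<?m. f l)" for f :: "nat \<Rightarrow> complex"
  proof -
    have "(\<Sum>l<n. if l < ?m then f l else 0) = sum f ({..<n} \<inter> {l. l < ?m})" by (simp add: sum.inter_restrict)
    also have "{..<n} \<inter> {l. l < ?m} = {..<?m}" by auto
    finally show ?thesis .
  qed
  have W: "orthocols n ?m W"
    unfolding orthocols_def
  proof (intro conjI Wc eq_matI)
    fix i j assume "i < dim_row (1\<^sub>m ?m :: complex Matrix.mat)" "j < dim_col (1\<^sub>m ?m :: complex Matrix.mat)"
    then have ij: "i < ?m" "j < ?m" by auto
    have e: "(W\<^sup>H * W) $$ (i, j) = (\<Sum>l<n. cnj (W $$ (l, i)) * W $$ (l, j))" by (rule adj_mult_self_index[OF Wc Wc ij])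
    consider "i < k" "j < k" | "i < k" "k \<le> j" | "k \<le> i" "j < k" | "k \<le> i" "k \<le> j" by linarith
    then have "(\<Sum>l<n. cnj (W $$ (l, i)) * W $$ (l, j)) = (if i = j then 1 else 0)"
    proof cases
      case 1
      then show ?thesis using QQ[OF 1] ij by (simp add: W_def)
    next
      case 2
      have "(\<Sum>l<n. cnj (W $$ (l, i)) * W $$ (l, j)) = (\<Sum>l<n. if l < ?m then cnj (orthonormalize G $$ (l, i)) * U2 $$ (l, j) else 0)"
        by (rule sum.cong[OF refl]) (use 2 ij in \<open>auto simp: W_def\<close>)
      then show ?thesis unfolding split using cross'[OF 2(2) ij(2) 2(1)] 2 by simp
    next
      case 3
      have "(\<Sum>l<n. cnj (W $$ (l, i)) * W $$ (l, j)) = (\<Sum>l<n. if l < ?m then cnj (U2 $$ (l, i)) * orthonormalize G $$ (l, j) else 0)"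
        by (rule sum.cong[OF refl]) (use 3 ij in \<open>auto simp: W_def\<close>)
      then show ?thesis unfolding split using cross[OF 3(1) ij(1) 3(2)] 3 by simp
    next
      case 4
      have "(\<Sum>l<n. cnj (W $$ (l, i)) * W $$ (l, j)) = (\<Sum>l<n. if l < ?m then cnj (U2 $$ (l, i)) * U2 $$ (l, j) else 0)"
        by (rule sum.cong[OF refl]) (use 4 ij in \<open>auto simp: W_def\<close>)
      then show ?thesis unfolding split using UU[OF ij] by simp
    qed
    then show "(W\<^sup>H * W) $$ (i, j) = 1\<^sub>m ?m $$ (i, j)" unfolding e using ij by simp
  qed (use Wc in auto)
  obtain A0 where A0: "orthocols n n A0" and A0W: "\<And>i j. i < n \<Longrightarrow> j < ?m \<Longrightarrow> A0 $$ (i, j) = W $$ (i, j)"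
    using orthocols_completion[OF W] by auto
  have A0c: "A0 \<in> carrier_mat n n" using A0 by (rule orthocols_carrier)
  have A0G: "A0 $$ (i, j) = orthonormalize G $$ (i, j)" if "i < n" "j < k" for i j
  proof -
    have "j < ?m" using that tn by simp
    from A0W[OF that(1) this] show ?thesis using that \<open>j < ?m\<close> by (simp add: W_def)
  qed
  show ?thesis
  proof (rule that[OF unitary_adj[OF A0]], rule ballI)
    fix g :: "complex Matrix.vec" assume g: "g \<in> carrier_vec n"
    let ?g2 = "Matrix.vec ?m (\<lambda>i. g $v i)"
    have 1: "gramdet (append_col G g) = gramdet G * (\<Sum>i\<in>{k..<n}. (cmod ((A0\<^sup>H *\<^sub>v g) $v i))\<^sup>2)"
      by (rule gramdet_append_col[OF G fr g A0 A0G])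
    have 2: "gramdet (append_col ?Z ?g2) = gramdet ?Z * (\<Sum>i\<in>{k..<?m}. (cmod ((U2\<^sup>H *\<^sub>v ?g2) $v i))\<^sup>2)"
      by (rule gramdet_append_col[OF Z fr' _ U2 U2Z]) auto
    \<comment> \<open>The padding discards the lower entries of \<open>g\<close>, so these
      coordinates of \<open>g\<close> are those of its upper part, and numerator and denominator
      share them.\<close>
    have eq: "(U2\<^sup>H *\<^sub>v ?g2) $v i = (A0\<^sup>H *\<^sub>v g) $v i" if i: "i \<in> {k..<?m}" for i
    proof -
      have "(A0\<^sup>H *\<^sub>v g) $v i = (\<Sum>l<n. cnj (A0 $$ (l, i)) * g $v l)"
        by (subst mult_vec_index[of _ n n]) (use A0c g i in auto)
      also have "\<dots> = (\<Sum>l<n. if l < ?m then cnj (U2 $$ (l, i)) * g $v l else 0)"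
        by (rule sum.cong[OF refl]) (use A0W i in \<open>auto simp: W_def\<close>)
      also have "\<dots> = (\<Sum>l<?m. cnj (U2 $$ (l, i)) * ?g2 $v l)" unfolding split by simp
      also have "\<dots> = (U2\<^sup>H *\<^sub>v ?g2) $v i"
        by (subst mult_vec_index[of _ ?m ?m]) (use U2c i in auto)
      finally show ?thesis by simp
    qed
    have 3: "gramdet (append_col ?Z ?g2) = gramdet ?Z * (\<Sum>i\<in>{k..<?m}. (cmod ((A0\<^sup>H *\<^sub>v g) $v i))\<^sup>2)"
      unfolding 2 by (rule arg_cong[of _ _ "\<lambda>x. gramdet ?Z * x"], rule sum.cong[OF refl]) (simp only: eq)
    have sp: "(\<Sum>i\<in>{k..<n}. (cmod ((A0\<^sup>H *\<^sub>v g) $v i))\<^sup>2) = (\<Sum>i\<in>{k..<?m}. (cmod ((A0\<^sup>H *\<^sub>v g) $v i))\<^sup>2) + (\<Sum>i\<in>{?m..<n}. (cmod ((A0\<^sup>H *\<^sub>v g) $v i))\<^sup>2)"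
      by (rule sum.atLeastLessThan_concat[symmetric]) (use tn in auto)
    show "sinsq (last_cols n t) (append_col G g) = sinsq (last_cols n t) G *
      ((\<Sum>i\<in>{k..<n - t}. (cmod ((A0\<^sup>H *\<^sub>v g) $v i))\<^sup>2) /
       ((\<Sum>i\<in>{k..<n - t}. (cmod ((A0\<^sup>H *\<^sub>v g) $v i))\<^sup>2) + (\<Sum>i\<in>{n - t..<n}. (cmod ((A0\<^sup>H *\<^sub>v g) $v i))\<^sup>2)))"
      unfolding sinsq_last_cols[OF append_col_carrier[OF G] tn(1)] sinsq_last_cols[OF G tn(1)]
        upper_rows_append_col[OF G diff_le_self g] 1 3 sp by simp
  qed
qed

section \<open>The law of the sine product, column by column\<close>

definition colv :: "nat \<Rightarrow> nat \<Rightarrow> (nat \<times> nat \<Rightarrow> complex) \<Rightarrow> complex Matrix.vec" where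
  "colv n k y = Matrix.vec n (\<lambda>i. y (i, k))"

lemma colv_carrier [simp]: "colv n k y \<in> carrier_vec n" by (simp add: colv_def)

lemma mult_add_vec_index:
  assumes U: "U \<in> carrier_mat n n" and x: "x \<in> carrier_vec n" and y: "y \<in> carrier_vec n" and i: "i < n"
  shows "(U *\<^sub>v (x + y)) $v i = (U *\<^sub>v x) $v i + (U *\<^sub>v y) $v i"
proof -
  have c: "x + y \<in> carrier_vec n" using x y by simp
  show ?thesis unfolding mult_vec_index[OF U c i] mult_vec_index[OF U x i] mult_vec_index[OF U y i]
    using y by (simp add: algebra_simps sum.distrib)
qed

text \<open>The column keeps its index \<open>k\<close> in the index set so that it can be merged
  with the columns before it.\<close>

lemma nn_integral_gauss_col_unitary:
  assumes U: "orthocols n n U" and f: "(\<lambda>y. f (colv n k y)) \<in> borel_measurable (gauss ({..<n} \<times> {k}))"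
  shows "(\<integral>\<^sup>+y. f (U *\<^sub>v colv n k y) \<partial>gauss ({..<n} \<times> {k})) = (\<integral>\<^sup>+y. f (colv n k y) \<partial>gauss ({..<n} \<times> {k}))"
proof -
  let ?I = "{..<n} \<times> {k}"
  let ?T = "\<lambda>y. \<lambda>p\<in>?I. (U *\<^sub>v colv n k y) $v fst p"
  have Uc: "U \<in> carrier_mat n n" using U by (rule orthocols_carrier)
  have cT: "colv n k (?T y) = U *\<^sub>v colv n k y" for y
    by (rule eq_vecI) (use Uc in \<open>auto simp: colv_def simp del: index_mult_mat_vec\<close>)
  have s: "(\<Sum>p\<in>?I. (cmod (x p))\<^sup>2) = nsq (colv n k x)" for x
  proof -
    have "(\<Sum>p\<in>?I. (cmod (x p))\<^sup>2) = (\<Sum>i<n. (cmod (x (i, k)))\<^sup>2)"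
      by (rule sum.reindex_bij_witness[of _ "\<lambda>i. (i, k)" fst]) auto
    then show ?thesis by (simp add: nsq_def colv_def)
  qed
  have eqI: "x = y" if "x \<in> space (leb ?I)" "y \<in> space (leb ?I)" "colv n k x = colv n k y" for x y
  proof
    fix p
    show "x p = y p"
    proof (cases "p \<in> ?I")
      case True
      then have "x p = colv n k x $v fst p" "y p = colv n k y $v fst p" by (auto simp: colv_def)
      then show ?thesis using that(3) by simp
    next
      case False
      then show ?thesis using that by (cases p) (auto simp: space_leb PiE_iff extensional_def)
    qed
  qed
  have "(\<integral>\<^sup>+y. f (colv n k (?T y)) \<partial>gauss ?I) = (\<integral>\<^sup>+y. f (colv n k y) \<partial>gauss ?I)"
  proof (rule nn_integral_gauss_isometry)
    show "?T \<in> measurable (leb ?I) (leb ?I)"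
    proof (subst (2) leb_def, rule measurable_restrict)
      fix p assume p: "p \<in> ?I"
      then have i: "fst p < n" by auto
      have m: "(\<lambda>y. y (l, k)) \<in> borel_measurable (leb ?I)" if "l < n" for l
        by (rule measurable_coord(2)) (use that in simp)
      have "(\<lambda>y. (U *\<^sub>v colv n k y) $v fst p) = (\<lambda>y. \<Sum>l<n. U $$ (fst p, l) * y (l, k))"
        unfolding mult_vec_index[OF Uc colv_carrier i] by (simp add: colv_def)
      also have "\<dots> \<in> borel_measurable (leb ?I)"
        by (intro borel_measurable_sum borel_measurable_times borel_measurable_const m) simp
      finally show "(\<lambda>y. (U *\<^sub>v colv n k y) $v fst p) \<in> measurable (leb ?I) lborel" by simp
    qed
    show "?T (vplus ?I x y) = vplus ?I (?T x) (?T y)" for x y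
    proof (rule ext)
      fix p
      have cv: "colv n k (vplus ?I x y) = colv n k x + colv n k y" by (rule eq_vecI) (auto simp: colv_def vplus_def)
      show "?T (vplus ?I x y) p = vplus ?I (?T x) (?T y) p"
      proof (cases "p \<in> ?I")
        case True
        then have "fst p < n" by auto
        from mult_add_vec_index[OF Uc colv_carrier colv_carrier this, of k x k y] True
        show ?thesis unfolding cv by (simp add: vplus_def del: index_mult_mat_vec)
      qed (simp add: vplus_def)
    qed
    show "\<exists>x\<in>space (leb ?I). ?T x = y" if y: "y \<in> space (leb ?I)" for y
    proof
      let ?x = "\<lambda>p\<in>?I. (U\<^sup>H *\<^sub>v colv n k y) $v fst p"
      show xs: "?x \<in> space (leb ?I)" by (simp add: space_leb)
      have Uh: "U\<^sup>H \<in> carrier_mat n n" using Uc by simp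
      have cx: "colv n k ?x = U\<^sup>H *\<^sub>v colv n k y"
        by (rule eq_vecI) (use Uc in \<open>auto simp: colv_def simp del: index_mult_mat_vec\<close>)
      show "?T ?x = y"
      proof (rule eqI[OF _ y])
        show "?T ?x \<in> space (leb ?I)" by (simp add: space_leb)
        have "colv n k (?T ?x) = U *\<^sub>v colv n k ?x" by (rule cT)
        also have "\<dots> = U *\<^sub>v (U\<^sup>H *\<^sub>v colv n k y)" by (simp only: cx)
        also have "\<dots> = (U * U\<^sup>H) *\<^sub>v colv n k y" by (rule assoc_mult_mat_vec[symmetric, OF Uc Uh colv_carrier])
        also have "\<dots> = colv n k y" unfolding unitary_right[OF U] by (rule one_mult_mat_vec[OF colv_carrier])
        finally show "colv n k (?T ?x) = colv n k y" .
      qed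
    qed
    show "(\<Sum>p\<in>?I. (cmod (?T x p))\<^sup>2) = (\<Sum>p\<in>?I. (cmod (x p))\<^sup>2)" for x
      unfolding s cT by (rule nsq_orthocols[OF U colv_carrier])
    show "(\<lambda>y. f (colv n k y)) \<in> borel_measurable (leb ?I)" using f unfolding measurable_leb_gauss .
  qed simp
  then show ?thesis unfolding cT .
qed

text \<open>Coordinates on which the integrand does not depend integrate to 1.\<close>

lemma nn_integral_gauss_restrict:
  assumes I: "finite I" and J: "finite J" and d: "I \<inter> J = {}" and f: "f \<in> borel_measurable (gauss I)"
    and f': "f \<in> borel_measurable (gauss (I \<union> J))" and e: "\<And>x y. (\<And>i. i \<in> I \<Longrightarrow> x i = y i) \<Longrightarrow> f x = f y"
  shows "(\<integral>\<^sup>+w. f w \<partial>gauss (I \<union> J)) = (\<integral>\<^sup>+w. f w \<partial>gauss I)"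
proof -
  interpret G: product_sigma_finite "\<lambda>_::'a. cgauss" by (rule product_sigma_finite_cgauss)
  have "(\<integral>\<^sup>+w. f w \<partial>gauss (I \<union> J)) = (\<integral>\<^sup>+x. \<integral>\<^sup>+y. f (merge I J (x, y)) \<partial>gauss J \<partial>gauss I)"
    unfolding gauss_def by (rule G.product_nn_integral_fold[OF d I J f'[unfolded gauss_def]])
  also have "\<dots> = (\<integral>\<^sup>+x. \<integral>\<^sup>+y. f x \<partial>gauss J \<partial>gauss I)"
    using d by (intro nn_integral_cong e) (auto simp: merge_def)
  also have "\<dots> = (\<integral>\<^sup>+x. f x \<partial>gauss I)"
    using prob_space.emeasure_space_1[OF prob_space_gauss[of J]] by (intro nn_integral_cong) simp
  finally show ?thesis .
qed

text \<open>A density with finite values over Lebesgue measure gives sigma-finiteness, which is what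
  the product construction asks for.\<close>

lemma sigma_finite_beta_measure: "sigma_finite_measure (beta_measure a b)"
  unfolding beta_measure_def
  by (subst sigma_finite_measure.sigma_finite_iff_density_finite[OF lborel.sigma_finite_measure_axioms]) auto

lemma sets_beta_measure [simp]: "sets (beta_measure a b) = sets borel"
  by (simp add: beta_measure_def)

text \<open>Both matrices contain the same top k x k block, so one determinant serves for
  both.\<close>

lemma AE_upper_rows_full_rank:
  assumes "k \<le> m" "m \<le> n"
  shows "AE w in noise n k. full_rank (upper_rows m (to_mat n k w))" "AE w in noise n k. full_rank (to_mat n k w)"
proof -
  have *: "AE w in noise n k. Determinant.det (top_block k (to_mat n k w)) \<noteq> 0"
    by (rule AE_noise_of_leb[OF AE_leb_top_block]) (use assms in simp)
  have e: "top_block k (upper_rows m Y) = top_block k Y" if "Y \<in> carrier_mat n k" for Y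
    using that assms by (intro eq_matI) (auto simp: top_block_def upper_rows_def)
  show "AE w in noise n k. full_rank (upper_rows m (to_mat n k w))"
    using *
  proof (rule AE_mp, intro AE_I2 impI)
    fix w assume "Determinant.det (top_block k (to_mat n k w)) \<noteq> 0"
    then have "Determinant.det (top_block k (upper_rows m (to_mat n k w))) \<noteq> 0" unfolding e[OF to_mat_carrier] .
    then show "full_rank (upper_rows m (to_mat n k w))"
      by (rule full_rank_top_block[OF _ assms(1), rotated]) (simp add: upper_rows_def to_mat_def)
  qed
  show "AE w in noise n k. full_rank (to_mat n k w)"
    using *
  proof (rule AE_mp, intro AE_I2 impI)
    fix w assume "Determinant.det (top_block k (to_mat n k w)) \<noteq> 0"
    then show "full_rank (to_mat n k w)"
      by (rule full_rank_top_block[OF to_mat_carrier, rotated]) (use assms in simp)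
  qed
qed

lemma measurable_sinsq_gauss:
  assumes P: "P \<in> carrier_mat n t" shows "(\<lambda>w. sinsq P (to_mat n k w)) \<in> borel_measurable (gauss ({..<n} \<times> {..<k}))"
  by (rule measurable_sinsq[OF mmat_const[OF P] mmat_to_mat_gauss])

text \<open>With the earlier columns fixed, a new Gaussian column has Gaussian coordinates in the
  adapted basis. Of these, n - t - k enter the numerator and \<open>t\<close> more the denominator,
  whence Beta(n - t - k, t). As \<open>k\<close> counts from 0, this is the factor of index k +
  1.\<close>

lemma col_ratio_law:
  assumes G: "G \<in> carrier_mat n k" and fr: "full_rank G" "full_rank (upper_rows (n - t) G)" and n: "t + k < n" and t: "t \<ge> 1"
    and f[measurable]: "f \<in> borel_measurable borel"
  shows "(\<integral>\<^sup>+y. f (sinsq (last_cols n t) (append_col G (colv n k y))) \<partial>gauss ({..<n} \<times> {k}))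
    = (\<integral>\<^sup>+b. f (sinsq (last_cols n t) G * b) \<partial>beta_measure (real n - real t - real (Suc k) + 1) (real t))"
proof -
  let ?R = "sinsq (last_cols n t) G"
  let ?I = "{k..<n - t} \<times> {k}" and ?J = "{n - t..<n} \<times> {k}" and ?K = "{..<k} \<times> {k}"
  let ?F = "\<lambda>v. f (?R * ((\<Sum>i\<in>{k..<n - t}. (cmod (v $v i))\<^sup>2) /
       ((\<Sum>i\<in>{k..<n - t}. (cmod (v $v i))\<^sup>2) + (\<Sum>i\<in>{n - t..<n}. (cmod (v $v i))\<^sup>2))))"
  let ?H = "\<lambda>y. f (?R * ((\<Sum>p\<in>?I. (cmod (y p))\<^sup>2) / ((\<Sum>p\<in>?I. (cmod (y p))\<^sup>2) + (\<Sum>p\<in>?J. (cmod (y p))\<^sup>2))))"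
  obtain A where A: "orthocols n n A" and Ag: "\<forall>g\<in>carrier_vec n. sinsq (last_cols n t) (append_col G g) = ?R *
      ((\<Sum>i\<in>{k..<n - t}. (cmod ((A *\<^sub>v g) $v i))\<^sup>2) /
       ((\<Sum>i\<in>{k..<n - t}. (cmod ((A *\<^sub>v g) $v i))\<^sup>2) + (\<Sum>i\<in>{n - t..<n}. (cmod ((A *\<^sub>v g) $v i))\<^sup>2)))"
    by (rule sinsq_append_col[OF G fr]) (use n in simp)
  have FH: "?F (colv n k y) = ?H y" for y
  proof -
    have "(\<Sum>p\<in>S \<times> {k}. (cmod (y p))\<^sup>2) = (\<Sum>i\<in>S. (cmod (colv n k y $v i))\<^sup>2)" if "S \<subseteq> {..<n}" for S
      using that by (intro sum.reindex_bij_witness[of _ "\<lambda>i. (i, k)" fst]) (auto simp: colv_def subset_iff)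
    moreover have "{k..<n - t} \<subseteq> {..<n}" "{n - t..<n} \<subseteq> {..<n}" by auto
    ultimately show ?thesis by simp
  qed
  have ms: "(\<lambda>y. \<Sum>p\<in>S. (cmod (y p))\<^sup>2) \<in> borel_measurable (gauss T)" if "S \<subseteq> T" for S T :: "(nat \<times> nat) set"
  proof (rule borel_measurable_sum)
    fix p assume "p \<in> S"
    then have [measurable]: "(\<lambda>y. y p) \<in> borel_measurable (gauss T)" using that by (intro measurable_coord(1)) auto
    show "(\<lambda>y. (cmod (y p))\<^sup>2) \<in> borel_measurable (gauss T)" by measurable
  qed
  have mH: "?H \<in> borel_measurable (gauss T)" if "?I \<union> ?J \<subseteq> T" for T
  proof -
    have [measurable]: "(\<lambda>y. \<Sum>p\<in>?I. (cmod (y p))\<^sup>2) \<in> borel_measurable (gauss T)" "(\<lambda>y. \<Sum>p\<in>?J. (cmod (y p))\<^sup>2) \<in> borel_measurable (gauss T)"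
      using that by (auto intro!: ms)
    show ?thesis by measurable
  qed
  have U: "{..<n} \<times> {k} = (?I \<union> ?J) \<union> ?K" using n by auto
  have "(\<integral>\<^sup>+y. f (sinsq (last_cols n t) (append_col G (colv n k y))) \<partial>gauss ({..<n} \<times> {k}))
    = (\<integral>\<^sup>+y. ?F (A *\<^sub>v colv n k y) \<partial>gauss ({..<n} \<times> {k}))"
    by (intro nn_integral_cong arg_cong[of _ _ f] bspec[OF Ag] colv_carrier)
  also have "\<dots> = (\<integral>\<^sup>+y. ?F (colv n k y) \<partial>gauss ({..<n} \<times> {k}))"
    by (rule nn_integral_gauss_col_unitary[OF A, of ?F]) (unfold FH, rule mH, use n in auto)
  also have "\<dots> = (\<integral>\<^sup>+y. ?H y \<partial>gauss ((?I \<union> ?J) \<union> ?K))" unfolding FH U ..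
  \<comment> \<open>The first \<open>k\<close> coordinates, along the span of \<open>G\<close>, do
    not occur in the ratio and are integrated out.\<close>
  also have "\<dots> = (\<integral>\<^sup>+y. ?H y \<partial>gauss (?I \<union> ?J))"
  proof (rule nn_integral_gauss_restrict)
    show "?H \<in> borel_measurable (gauss (?I \<union> ?J))" by (rule mH) simp
    show "?H \<in> borel_measurable (gauss ((?I \<union> ?J) \<union> ?K))" by (rule mH) auto
    fix x y :: "nat \<times> nat \<Rightarrow> complex" assume xy: "\<And>i. i \<in> ?I \<union> ?J \<Longrightarrow> x i = y i"
    have "(\<Sum>p\<in>?I. (cmod (x p))\<^sup>2) = (\<Sum>p\<in>?I. (cmod (y p))\<^sup>2)" "(\<Sum>p\<in>?J. (cmod (x p))\<^sup>2) = (\<Sum>p\<in>?J. (cmod (y p))\<^sup>2)"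
      by (rule sum.cong[OF refl], subst xy; simp)+
    then show "?H x = ?H y" by simp
  qed (use n in auto)
  also have "\<dots> = (\<integral>\<^sup>+u. f (?R * u) \<partial>beta_measure (real (Suc (n - t - k - 1))) (real (Suc (t - 1))))"
    by (rule nn_integral_gauss_ratio[of ?I _ ?J _ "\<lambda>u. f (?R * u)"]) (use n t in auto)
  also have "real (Suc (n - t - k - 1)) = real n - real t - real (Suc k) + 1" using n by simp
  also have "real (Suc (t - 1)) = real t" using t by simp
  finally show ?thesis .
qed

lemma append_col_merge:
  "to_mat n (Suc k) (merge ({..<n} \<times> {..<k}) ({..<n} \<times> {k}) (x, y)) = append_col (to_mat n k x) (colv n k y)"
  by (rule eq_matI) (auto simp: to_mat_def append_col_def colv_def merge_def less_Suc_eq)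

text \<open>The law of the new factor does not depend on the earlier columns, so the factors are
  independent. The null set on which the earlier columns or their upper rows are rank deficient is
  discarded before the integrals are exchanged.\<close>

lemma sinsq_last_cols_law:
  assumes t: "t \<ge> 1" and n: "t + r \<le> n" and f: "f \<in> borel_measurable borel"
  shows "(\<integral>\<^sup>+w. f (sinsq (last_cols n t) (to_mat n r w)) \<partial>noise n r)
    = (\<integral>\<^sup>+x. f (\<Prod>j\<in>{1..r}. x j) \<partial>PiM {1..r} (\<lambda>j. beta_measure (real n - real t - real j + 1) (real t)))"
  using n f
proof (induction r arbitrary: f)
  case 0
  \<comment> \<open>Without columns both determinants have size 0 and equal 1, which matches the
    empty product.\<close>
  have "\<And>w. sinsq (last_cols n t) (to_mat n 0 w) = 1" 
  proof -
    fix w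
    have Y: "to_mat n 0 w \<in> carrier_mat n 0" and L: "last_cols n t \<in> carrier_mat n t"
      using orthocols_carrier[OF orthocols_last_cols[of t n]] 0 by auto
    have "(to_mat n 0 w)\<^sup>H * to_mat n 0 w \<in> carrier_mat 0 0" by (rule carrier_matI) (simp_all add: to_mat_def)
    moreover have "(to_mat n 0 w)\<^sup>H * to_mat n 0 w - ((last_cols n t)\<^sup>H * to_mat n 0 w)\<^sup>H * ((last_cols n t)\<^sup>H * to_mat n 0 w)
      \<in> carrier_mat 0 0" by (rule carrier_matI) (simp_all add: to_mat_def)
    ultimately show "sinsq (last_cols n t) (to_mat n 0 w) = 1"
      unfolding sinsq_def by (simp only: det_dim_zero) simp
  qed
  then have "(\<integral>\<^sup>+w. f (sinsq (last_cols n t) (to_mat n 0 w)) \<partial>noise n 0) = f 1"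
    using prob_space.emeasure_space_1[OF prob_space_gauss[of "{} :: (nat \<times> nat) set"]] by (simp add: noise_eq)
  moreover interpret B: product_sigma_finite "\<lambda>j. beta_measure (real n - real t - real j + 1) (real t)" for j :: nat
    by (simp add: product_sigma_finite_def sigma_finite_beta_measure)
  have "(\<integral>\<^sup>+x. f (\<Prod>j\<in>{1..0::nat}. x j) \<partial>PiM {1..0} (\<lambda>j. beta_measure (real n - real t - real j + 1) (real t))) = f 1"
    by (simp add: PiM_empty)
  ultimately show ?case by simp
next
  case (Suc k)
  note f = Suc.prems(2)
  note IH = Suc.IH
  let ?b = "\<lambda>j::nat. beta_measure (real n - real t - real j + 1) (real t)" and ?L = "last_cols n t"
  let ?I = "{..<n} \<times> {..<k}" and ?J = "{..<n} \<times> {k}"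
  interpret G: product_sigma_finite "\<lambda>_::nat \<times> nat. cgauss" by (rule product_sigma_finite_cgauss)
  interpret B: product_sigma_finite ?b by (simp add: product_sigma_finite_def sigma_finite_beta_measure)
  have Lc: "?L \<in> carrier_mat n t" by (simp add: last_cols_def)
  have IJ: "{..<n} \<times> {..<Suc k} = ?I \<union> ?J" by auto
  have m: "(\<lambda>w. f (sinsq ?L (to_mat n (Suc k) w))) \<in> borel_measurable (PiM (?I \<union> ?J) (\<lambda>_. cgauss))"
    using measurable_compose[OF measurable_sinsq_gauss[OF Lc, of "Suc k"] f] unfolding IJ gauss_def .
  have "(\<integral>\<^sup>+w. f (sinsq ?L (to_mat n (Suc k) w)) \<partial>noise n (Suc k))
    = (\<integral>\<^sup>+x. \<integral>\<^sup>+y. f (sinsq ?L (append_col (to_mat n k x) (colv n k y))) \<partial>gauss ?J \<partial>gauss ?I)"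
    unfolding noise_eq IJ append_col_merge[symmetric] unfolding gauss_def
    by (rule G.product_nn_integral_fold[OF _ _ _ m]) auto
  also have "\<dots> = (\<integral>\<^sup>+x. \<integral>\<^sup>+b. f (sinsq ?L (to_mat n k x) * b) \<partial>?b (Suc k) \<partial>gauss ?I)"
  proof (rule nn_integral_cong_AE)
    have a: "AE w in gauss ?I. full_rank (upper_rows (n - t) (to_mat n k w))" "AE w in gauss ?I. full_rank (to_mat n k w)"
      using AE_upper_rows_full_rank[of k "n - t" n] Suc.prems(1) unfolding noise_eq by auto
    show "AE x in gauss ?I. (\<integral>\<^sup>+y. f (sinsq ?L (append_col (to_mat n k x) (colv n k y))) \<partial>gauss ?J)
      = (\<integral>\<^sup>+b. f (sinsq ?L (to_mat n k x) * b) \<partial>?b (Suc k))"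
      using a
    proof eventually_elim
      case (elim x)
      show ?case by (rule col_ratio_law[OF to_mat_carrier elim(2,1) _ t f]) (use Suc.prems(1) in simp)
    qed
  qed
  also have "\<dots> = (\<integral>\<^sup>+b. \<integral>\<^sup>+x. f (sinsq ?L (to_mat n k x) * b) \<partial>gauss ?I \<partial>?b (Suc k))"
  proof -
    interpret g: prob_space "gauss ?I" by (rule prob_space_gauss)
    interpret b: sigma_finite_measure "?b (Suc k)" by (rule sigma_finite_beta_measure)
    interpret P: pair_sigma_finite "?b (Suc k)" "gauss ?I" ..
    have "(\<lambda>q. sinsq ?L (to_mat n k (snd q)) * fst q) \<in> borel_measurable (?b (Suc k) \<Otimes>\<^sub>M gauss ?I)"
      by (intro borel_measurable_times measurable_compose[OF measurable_snd measurable_sinsq_gauss[OF Lc]]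
        measurable_compose[OF measurable_fst]) (simp add: measurable_def sets_eq_imp_space_eq[OF sets_beta_measure])
    from measurable_compose[OF this f]
    show ?thesis by (intro P.Fubini') (simp add: case_prod_beta)
  qed
  also have "\<dots> = (\<integral>\<^sup>+b. \<integral>\<^sup>+x. f ((\<Prod>j\<in>{1..k}. x j) * b) \<partial>PiM {1..k} ?b \<partial>?b (Suc k))"
  proof (rule nn_integral_cong)
    fix b
    have "(\<lambda>z. f (z * b)) \<in> borel_measurable borel" by (rule measurable_compose[OF _ f]) simp
    from IH[OF _ this] Suc.prems(1)
    show "(\<integral>\<^sup>+x. f (sinsq ?L (to_mat n k x) * b) \<partial>gauss ?I) = (\<integral>\<^sup>+x. f ((\<Prod>j\<in>{1..k}. x j) * b) \<partial>PiM {1..k} ?b)"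
      unfolding noise_eq by simp
  qed
  also have "\<dots> = (\<integral>\<^sup>+x. f (\<Prod>j\<in>{1..Suc k}. x j) \<partial>PiM {1..Suc k} ?b)"
  proof -
    have ins: "{1..Suc k} = insert (Suc k) {1..k}" by auto
    have mp: "(\<lambda>x. f (\<Prod>j\<in>{1..Suc k}. x j)) \<in> borel_measurable (PiM (insert (Suc k) {1..k}) ?b)"
    proof (rule measurable_compose[OF _ f], rule borel_measurable_prod)
      fix j assume "j \<in> {1..Suc k}"
      then have "(\<lambda>x. x j) \<in> measurable (PiM (insert (Suc k) {1..k}) ?b) (?b j)"
        by (intro measurable_component_singleton) auto
      then show "(\<lambda>x. x j) \<in> borel_measurable (PiM (insert (Suc k) {1..k}) ?b)"
        by (simp cong: measurable_cong_sets)
    qed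
    have "(\<integral>\<^sup>+x. f (\<Prod>j\<in>{1..Suc k}. x j) \<partial>PiM {1..Suc k} ?b)
      = (\<integral>\<^sup>+b. \<integral>\<^sup>+x. f (\<Prod>j\<in>{1..Suc k}. (x(Suc k := b)) j) \<partial>PiM {1..k} ?b \<partial>?b (Suc k))"
      using B.product_nn_integral_insert_rev[OF _ _ mp] unfolding ins by simp
    also have "\<dots> = (\<integral>\<^sup>+b. \<integral>\<^sup>+x. f ((\<Prod>j\<in>{1..k}. x j) * b) \<partial>PiM {1..k} ?b \<partial>?b (Suc k))"
    proof (intro nn_integral_cong arg_cong[of _ _ f])
      fix b x
      have "(\<Prod>j\<in>{1..k}. (x(Suc k := b)) j) = (\<Prod>j\<in>{1..k}. x j)" by (rule prod.cong) auto
      then show "(\<Prod>j\<in>{1..Suc k}. (x(Suc k := b)) j) = (\<Prod>j\<in>{1..k}. x j) * b" by simp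
    qed
    finally show ?thesis ..
  qed
  finally show ?case .
qed

text \<open>The unitary group acts transitively on frames: both are unitary images of the standard
  frame.\<close>

lemma orthocols_eq_unitary_mult:
  assumes P: "orthocols n t P" and Q: "orthocols n t Q" and tn: "t \<le> n"
  obtains A where "orthocols n n A" "A * P = Q"
proof -
  have Int: "\<exists>U. orthocols n n U \<and> X = U * Int_mat n t" if X: "orthocols n t X" for X
  proof -
    have Xc: "X \<in> carrier_mat n t" using X by (rule orthocols_carrier)
    obtain U where U: "orthocols n n U" and UX: "\<And>i j. i < n \<Longrightarrow> j < t \<Longrightarrow> U $$ (i, j) = X $$ (i, j)"
      using orthocols_completion[OF X tn] by auto
    have Uc: "U \<in> carrier_mat n n" using U by (rule orthocols_carrier)
    have Ic: "Int_mat n t \<in> carrier_mat n t" by (simp add: Int_mat_def)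
    have "X = U * Int_mat n t"
    proof (rule eq_matI)
      fix i j assume "i < dim_row (U * Int_mat n t)" "j < dim_col (U * Int_mat n t)"
      then have ij: "i < n" "j < t" using Uc Ic by auto
      have "(U * Int_mat n t) $$ (i, j) = (\<Sum>l<n. if l = j then U $$ (i, j) else 0)"
        unfolding mult_index[OF Uc Ic ij] by (rule sum.cong[OF refl]) (use ij in \<open>auto simp: Int_mat_def\<close>)
      also have "\<dots> = U $$ (i, j)" using ij tn by simp
      finally show "X $$ (i, j) = (U * Int_mat n t) $$ (i, j)" unfolding UX[OF ij] by simp
    qed (use Xc Uc Ic in auto)
    then show ?thesis using U by blast
  qed
  obtain U where U: "orthocols n n U" "P = U * Int_mat n t" using Int[OF P] by blast
  obtain V where V: "orthocols n n V" "Q = V * Int_mat n t" using Int[OF Q] by blast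
  have c: "U \<in> carrier_mat n n" "V \<in> carrier_mat n n" "Int_mat n t \<in> carrier_mat n t"
    using U V by (auto intro: orthocols_carrier simp: Int_mat_def)
  have "(V * U\<^sup>H) * P = V * ((U\<^sup>H * U) * Int_mat n t)"
    unfolding U(2) by (rule assoc_mult_mat4[of _ n n _ n _ n _ t]) (use c in auto)
  also have "\<dots> = Q" unfolding orthocolsD[OF U(1)] V(2) using left_mult_one_mat[OF c(3)] by simp
  finally have "(V * U\<^sup>H) * P = Q" .
  then show ?thesis using that orthocols_mult[OF V(1) unitary_adj[OF U(1)]] by blast
qed

lemma orthocols_Int_mat: "t \<le> n \<Longrightarrow> orthocols n t (Int_mat n t)"
  unfolding orthocols_def
proof (intro conjI eq_matI)
  assume tn: "t \<le> n"
  show c: "Int_mat n t \<in> carrier_mat n t" by (simp add: Int_mat_def)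
  fix i j assume "i < dim_row (1\<^sub>m t :: complex Matrix.mat)" "j < dim_col (1\<^sub>m t :: complex Matrix.mat)"
  then have ij: "i < t" "j < t" by auto
  have "((Int_mat n t)\<^sup>H * Int_mat n t) $$ (i, j) = (\<Sum>l<n. if l = i then (if i = j then 1 else 0) else 0)"
    unfolding adj_mult_self_index[OF c c ij] by (rule sum.cong[OF refl]) (use ij tn in \<open>auto simp: Int_mat_def\<close>)
  also have "\<dots> = (if i = j then 1 else 0)" using ij tn by simp
  finally show "((Int_mat n t)\<^sup>H * Int_mat n t) $$ (i, j) = 1\<^sub>m t $$ (i, j)" using ij by simp
qed (simp_all add: Int_mat_def)

lemma nn_integral_sinsq_unitary:
  assumes A: "orthocols n n A" and P: "orthocols n t P" and f: "f \<in> borel_measurable borel"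
  shows "(\<integral>\<^sup>+w. f (sinsq (A * P) (to_mat n r w)) \<partial>noise n r) = (\<integral>\<^sup>+w. f (sinsq P (to_mat n r w)) \<partial>noise n r)"
proof -
  have Pc: "P \<in> carrier_mat n t" using P by (rule orthocols_carrier)
  have APc: "A * P \<in> carrier_mat n t" using orthocols_carrier[OF A] Pc by auto
  let ?f = "\<lambda>X. f (sinsq (A * P) X)"
  have m: "(\<lambda>w. ?f (to_mat n r w)) \<in> borel_measurable (noise n r)"
    unfolding noise_eq by (rule measurable_compose[OF measurable_sinsq_gauss[OF APc] f])
  have "(\<integral>\<^sup>+w. ?f (to_mat n r w) \<partial>noise n r) = (\<integral>\<^sup>+w. ?f (A * to_mat n r w * 1\<^sub>m r) \<partial>noise n r)"
    by (rule nn_integral_noise_unitary[symmetric, OF A orthocols_one, of ?f, OF m])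
  also have "\<dots> = (\<integral>\<^sup>+w. f (sinsq P (to_mat n r w)) \<partial>noise n r)"
  proof (rule nn_integral_cong)
    fix w
    have "A * to_mat n r w \<in> carrier_mat n r" using orthocols_carrier[OF A] by auto
    then have "A * to_mat n r w * 1\<^sub>m r = A * to_mat n r w" by (rule right_mult_one_mat)
    then show "?f (A * to_mat n r w * 1\<^sub>m r) = f (sinsq P (to_mat n r w))"
      using sinsq_unitary_left[OF A Pc to_mat_carrier] by simp
  qed
  finally show ?thesis .
qed

lemma sinsq_law:
  assumes t: "t \<ge> 1" and n: "t + r \<le> n" and P: "orthocols n t P"
  shows "emeasure (noise n r) {w \<in> space (noise n r). sinsq P (to_mat n r w) \<le> g} = ennreal (beta_prod_prob n t r g)"
proof -
  let ?b = "\<lambda>j::nat. beta_measure (real n - real t - real j + 1) (real t)"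
  let ?f = "\<lambda>x::real. indicator {..g} x :: ennreal"
  have f: "?f \<in> borel_measurable borel" by measurable
  have tn: "t \<le> n" using n by simp
  have Pc: "P \<in> carrier_mat n t" using P by (rule orthocols_carrier)
  obtain A where A: "orthocols n n A" "A * last_cols n t = P"
    by (rule orthocols_eq_unitary_mult[OF orthocols_last_cols[OF tn] P tn])
  have s1: "{w \<in> space (noise n r). sinsq P (to_mat n r w) \<le> g} \<in> sets (noise n r)"
    unfolding noise_eq by (rule borel_measurable_le[OF measurable_sinsq_gauss[OF Pc] borel_measurable_const])
  have mp: "(\<lambda>x. \<Prod>j\<in>{1..r}. x j) \<in> borel_measurable (PiM {1..r} ?b)"
  proof (rule borel_measurable_prod)
    fix j assume "j \<in> {1..r}"
    then have "(\<lambda>x. x j) \<in> measurable (PiM {1..r} ?b) (?b j)" by (rule measurable_component_singleton)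
    then show "(\<lambda>x. x j) \<in> borel_measurable (PiM {1..r} ?b)" by (simp cong: measurable_cong_sets)
  qed
  have s2: "{x \<in> space (PiM {1..r} ?b). (\<Prod>j\<in>{1..r}. x j) \<le> g} \<in> sets (PiM {1..r} ?b)"
    by (rule borel_measurable_le[OF mp borel_measurable_const])
  have "emeasure (noise n r) {w \<in> space (noise n r). sinsq P (to_mat n r w) \<le> g} = (\<integral>\<^sup>+w. ?f (sinsq P (to_mat n r w)) \<partial>noise n r)"
    unfolding nn_integral_indicator[OF s1, symmetric] by (intro nn_integral_cong) (simp add: indicator_def)
  also have "\<dots> = (\<integral>\<^sup>+w. ?f (sinsq (last_cols n t) (to_mat n r w)) \<partial>noise n r)"
    unfolding A(2)[symmetric] by (rule nn_integral_sinsq_unitary[OF A(1) orthocols_last_cols[OF tn] f])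
  also have "\<dots> = (\<integral>\<^sup>+x. ?f (\<Prod>j\<in>{1..r}. x j) \<partial>PiM {1..r} ?b)" by (rule sinsq_last_cols_law[OF t n f])
  also have "\<dots> = emeasure (PiM {1..r} ?b) {x \<in> space (PiM {1..r} ?b). (\<Prod>j\<in>{1..r}. x j) \<le> g}"
    unfolding nn_integral_indicator[OF s2, symmetric] by (intro nn_integral_cong) (simp add: indicator_def)
  finally have e: "emeasure (noise n r) {w \<in> space (noise n r). sinsq P (to_mat n r w) \<le> g}
    = emeasure (PiM {1..r} ?b) {x \<in> space (PiM {1..r} ?b). (\<Prod>j\<in>{1..r}. x j) \<le> g}" .
  \<comment> \<open>Finiteness is inherited from the Gaussian side through the equality just proved;
    it permits passing to the real-valued \<open>measure\<close> in
    \<open>beta_prod_prob\<close>.\<close>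
  have "emeasure (PiM {1..r} ?b) {x \<in> space (PiM {1..r} ?b). (\<Prod>j\<in>{1..r}. x j) \<le> g} \<noteq> \<infinity>"
    unfolding e[symmetric] using finite_measure.emeasure_finite[OF prob_space.finite_measure[OF prob_space_gauss]]
    unfolding noise_eq by simp
  then show ?thesis unfolding e beta_prod_prob_def Let_def by (simp add: emeasure_eq_ennreal_measure top.not_eq_extremum)
qed

section \<open>Random coding\<close>

lemma mmat_compose:
  assumes "mmat M a b X" "g \<in> measurable N M" shows "mmat N a b (\<lambda>x. X (g x))"
  by (rule mmatI[OF mmat_carrier[OF assms(1)] measurable_compose[OF assms(2) mmat_index[OF assms(1)]]])

lemma prob_space_noise: "prob_space (noise n r)" unfolding noise_eq by (rule prob_space_gauss)

lemma mmat_noise: "mmat (noise n r) n r (to_mat n r)" unfolding noise_eq by (rule mmat_to_mat_gauss)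

lemma nn_integral_prob_const:
  assumes "prob_space M" "AE x in M. f x = c" shows "(\<integral>\<^sup>+x. f x \<partial>M) = c"
proof -
  have "(\<integral>\<^sup>+x. f x \<partial>M) = (\<integral>\<^sup>+x. c \<partial>M)" by (rule nn_integral_cong_AE[OF assms(2)])
  then show ?thesis using prob_space.emeasure_space_1[OF assms(1)] by simp
qed

abbreviation ind :: "real \<Rightarrow> real \<Rightarrow> ennreal" where "ind g x \<equiv> indicator {..g} x"

lemma measurable_ind: "ind g \<in> borel_measurable borel" by measurable

lemma nn_integral_sinsq_law:
  assumes "t \<ge> 1" "t + r \<le> n" and P: "orthocols n t P"
  shows "(\<integral>\<^sup>+w. ind g (sinsq P (to_mat n r w)) \<partial>noise n r) = ennreal (beta_prod_prob n t r g)"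
proof -
  have s: "{w \<in> space (noise n r). sinsq P (to_mat n r w) \<le> g} \<in> sets (noise n r)"
    unfolding noise_eq by (rule borel_measurable_le[OF measurable_sinsq_gauss[OF orthocols_carrier[OF P]] borel_measurable_const])
  show ?thesis unfolding sinsq_law[OF assms, symmetric] nn_integral_indicator[OF s, symmetric]
    by (intro nn_integral_cong) (simp add: indicator_def)
qed

text \<open>Unitary invariance makes the left-hand side independent of \<open>Y\<close>, so \<open>Y\<close> may be replaced by a
  Gaussian matrix; exchanging the integrals then lets \<open>sinsq_law\<close> apply to each fixed frame.\<close>
lemma random_frame_law:
  assumes t: "t \<ge> 1" and n: "t + r \<le> n" and Y: "Y \<in> carrier_mat n r" and fr: "full_rank Y"
  shows "(\<integral>\<^sup>+G. ind g (sinsq (orthonormalize (to_mat n t G)) Y) \<partial>noise n t) = ennreal (beta_prod_prob n t r g)"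
proof -
  let ?o = "\<lambda>G. orthonormalize (to_mat n t G)"
  let ?L = "\<lambda>Y. \<integral>\<^sup>+G. ind g (sinsq (?o G) Y) \<partial>noise n t"
  have rn: "r \<le> n" and tn: "t \<le> n" using n by auto
  have oc: "?o G \<in> carrier_mat n t" for G by (rule mmat_carrier[OF mmat_orthonormalize[OF mmat_noise]])
  have unit: "?L (A * Z) = ?L Z" if A: "orthocols n n A" and Z: "Z \<in> carrier_mat n r" for A Z
  proof -
    have Ac: "A \<in> carrier_mat n n" using A by (rule orthocols_carrier)
    have AZ: "A * Z \<in> carrier_mat n r" using Ac Z by auto
    let ?f = "\<lambda>X. ind g (sinsq (orthonormalize X) (A * Z))"
    have m: "(\<lambda>G. ?f (to_mat n t G)) \<in> borel_measurable (noise n t)"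
      by (rule measurable_compose[OF measurable_sinsq[OF mmat_orthonormalize[OF mmat_noise] mmat_const[OF AZ]] measurable_ind])
    have "?L (A * Z) = (\<integral>\<^sup>+G. ?f (A * to_mat n t G * 1\<^sub>m t) \<partial>noise n t)"
      by (rule nn_integral_noise_unitary[symmetric, OF A orthocols_one, of ?f, OF m])
    also have "\<dots> = ?L Z"
    proof (rule nn_integral_cong)
      fix G
      have "A * to_mat n t G \<in> carrier_mat n t" using Ac by auto
      then have "A * to_mat n t G * 1\<^sub>m t = A * to_mat n t G" by (rule right_mult_one_mat)
      then show "?f (A * to_mat n t G * 1\<^sub>m t) = ind g (sinsq (?o G) Z)"
        by (simp only: orthonormalize_unitary[OF A to_mat_carrier] sinsq_unitary_left[OF A oc Z])
    qed
    finally show ?thesis .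
  qed
  have orth: "?L Z = ?L (orthonormalize Z)" if Z: "Z \<in> carrier_mat n r" "full_rank Z" for Z
  proof -
    have S: "inv_sqrt r (Z\<^sup>H * Z) \<in> carrier_mat r r" by (simp add: inv_sqrt_def)
    have e: "orthonormalize Z = Z * inv_sqrt r (Z\<^sup>H * Z)" using Z(1) by (simp add: orthonormalize_def)
    show ?thesis unfolding e sinsq_invertible_right[OF oc Z(1) S orthonormalize(2)[OF Z]] ..
  qed
  \<comment> \<open>The polar factors of two full-rank matrices are related by a unitary, so the
    left-hand side takes the same value at both.\<close>
  have const: "?L Z = ?L Y" if Z: "Z \<in> carrier_mat n r" "full_rank Z" for Z
  proof -
    obtain A where A: "orthocols n n A" "A * orthonormalize Y = orthonormalize Z"
      by (rule orthocols_eq_unitary_mult[OF orthonormalize(1)[OF Y fr] orthonormalize(1)[OF Z] rn])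
    show ?thesis unfolding orth[OF Z] orth[OF Y fr] A(2)[symmetric]
      by (rule unit[OF A(1) orthocols_carrier[OF orthonormalize(1)[OF Y fr]]])
  qed
  interpret N: prob_space "noise n r" by (rule prob_space_noise)
  interpret T: prob_space "noise n t" by (rule prob_space_noise)
  interpret P: pair_sigma_finite "noise n r" "noise n t" ..
  have "?L Y = (\<integral>\<^sup>+w. ?L (to_mat n r w) \<partial>noise n r)"
  proof (rule nn_integral_prob_const[symmetric, OF prob_space_noise])
    show "AE w in noise n r. ?L (to_mat n r w) = ?L Y"
      using AE_upper_rows_full_rank(2)[OF rn order_refl]
      by eventually_elim (rule const[OF to_mat_carrier])
  qed
  also have "\<dots> = (\<integral>\<^sup>+G. \<integral>\<^sup>+w. ind g (sinsq (?o G) (to_mat n r w)) \<partial>noise n r \<partial>noise n t)"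
  proof -
    have "(\<lambda>q. ind g (sinsq (?o (snd q)) (to_mat n r (fst q)))) \<in> borel_measurable (noise n r \<Otimes>\<^sub>M noise n t)"
      by (rule measurable_compose[OF measurable_sinsq[OF mmat_compose[OF mmat_orthonormalize[OF mmat_noise] measurable_snd]
        mmat_compose[OF mmat_noise measurable_fst]] measurable_ind])
    then show ?thesis by (intro P.Fubini'[symmetric]) (simp add: case_prod_beta)
  qed
  also have "\<dots> = ennreal (beta_prod_prob n t r g)"
  proof (rule nn_integral_prob_const[OF prob_space_noise])
    show "AE G in noise n t. (\<integral>\<^sup>+w. ind g (sinsq (?o G) (to_mat n r w)) \<partial>noise n r) = ennreal (beta_prod_prob n t r g)"
      using AE_upper_rows_full_rank(2)[OF tn order_refl]
      by eventually_elim (rule nn_integral_sinsq_law[OF t n orthonormalize(1)[OF to_mat_carrier]])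
  qed
  finally show ?thesis .
qed

section \<open>Frames sent through a channel of given law\<close>

context
  fixes n t r :: nat and \<rho> \<gamma> :: real and muH :: "(nat \<times> nat \<Rightarrow> complex) measure"
  assumes t: "t \<ge> 1" and n: "t + r \<le> n" and \<rho>: "\<rho> > 0"
    and prob_muH: "prob_space muH" and sets_muH: "sets muH = sets (mat_space t r)"
begin

abbreviation c :: complex where "c \<equiv> complex_of_real (sqrt (real n))"

text \<open>The precoded channel is grouped apart from the frame, so that a left rotation acts on
  the frame and the noise only.\<close>

definition out :: "complex Matrix.mat \<Rightarrow> complex Matrix.mat \<Rightarrow> complex Matrix.mat \<Rightarrow> complex Matrix.mat" where
  "out Q H W = c \<cdot>\<^sub>m (Q * (enc t (min t r) \<rho> H * H)) + W"

lemma tn: "t \<le> n" and rn: "r \<le> n" using n by auto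

lemma enc_mult_carrier: "H \<in> carrier_mat t r \<Longrightarrow> enc t (min t r) \<rho> H * H \<in> carrier_mat t r"
  by (rule mult_carrier_mat[OF enc_carrier])

lemma out_carrier: "W \<in> carrier_mat n r \<Longrightarrow> out Q H W \<in> carrier_mat n r"
  by (auto simp: out_def)

lemma mmat_out:
  assumes "mmat M n t Q" "mmat M t r H" "mmat M n r W"
  shows "mmat M n r (\<lambda>x. out (Q x) (H x) (W x))"
  unfolding out_def
  by (intro mmat_add mmat_smult mmat_mult[OF assms(1)] mmat_mult[OF mmat_enc[OF assms(2) _ \<rho>] assms(2)] assms(3)) simp

lemma measurable_sinsq_out:
  assumes "mmat M n t P" "mmat M n t Q" "mmat M t r H" "mmat M n r W"
  shows "(\<lambda>x. ind \<gamma> (sinsq (P x) (out (Q x) (H x) (W x)))) \<in> borel_measurable M"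
  by (rule measurable_compose[OF measurable_sinsq[OF assms(1) mmat_out[OF assms(2-4)]] measurable_ind])

lemma mmat_muH: "mmat muH t r (to_mat t r)"
proof (rule mmat_to_mat)
  fix p assume "p \<in> {..<t} \<times> {..<r}"
  then have "(\<lambda>w. w p) \<in> borel_measurable (mat_space t r)"
    unfolding mat_space_def by (rule measurable_component_singleton)
  then show "(\<lambda>w. w p) \<in> borel_measurable muH" unfolding measurable_cong_sets[OF sets_muH refl] .
qed

lemma unitary_out:
  assumes A: "orthocols n n A" and Q: "Q \<in> carrier_mat n t" and H: "H \<in> carrier_mat t r" and W: "W \<in> carrier_mat n r"
  shows "A * out Q H W = out (A * Q) H (A * W)"
proof -
  let ?K = "enc t (min t r) \<rho> H * H"
  have Ac: "A \<in> carrier_mat n n" using A by (rule orthocols_carrier)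
  have K: "?K \<in> carrier_mat t r" by (rule enc_mult_carrier[OF H])
  have QK: "Q * ?K \<in> carrier_mat n r" using Q K by auto
  have "A * out Q H W = A * (c \<cdot>\<^sub>m (Q * ?K)) + A * W"
    unfolding out_def by (rule mult_add_distrib_mat[OF Ac]) (use QK W in auto)
  also have "A * (c \<cdot>\<^sub>m (Q * ?K)) = c \<cdot>\<^sub>m (A * (Q * ?K))" by (rule mult_smult_distrib[OF Ac QK])
  also have "A * (Q * ?K) = (A * Q) * ?K" by (rule assoc_mult_mat[symmetric, OF Ac Q K])
  finally show ?thesis unfolding out_def .
qed

lemma nn_integral_out_unitary:
  assumes A: "orthocols n n A" and P: "P \<in> carrier_mat n t" and Q: "Q \<in> carrier_mat n t" and H: "H \<in> carrier_mat t r"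
  shows "(\<integral>\<^sup>+w. ind \<gamma> (sinsq (A * P) (out (A * Q) H (to_mat n r w))) \<partial>noise n r)
    = (\<integral>\<^sup>+w. ind \<gamma> (sinsq P (out Q H (to_mat n r w))) \<partial>noise n r)"
proof -
  have Ac: "A \<in> carrier_mat n n" using A by (rule orthocols_carrier)
  have AP: "A * P \<in> carrier_mat n t" "A * Q \<in> carrier_mat n t" using Ac P Q by auto
  let ?f = "\<lambda>X. ind \<gamma> (sinsq (A * P) (out (A * Q) H X))"
  have m: "(\<lambda>w. ?f (to_mat n r w)) \<in> borel_measurable (noise n r)"
    by (rule measurable_sinsq_out[OF mmat_const[OF AP(1)] mmat_const[OF AP(2)] mmat_const[OF H] mmat_noise])
  have "(\<integral>\<^sup>+w. ?f (to_mat n r w) \<partial>noise n r) = (\<integral>\<^sup>+w. ?f (A * to_mat n r w * 1\<^sub>m r) \<partial>noise n r)"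
    by (rule nn_integral_noise_unitary[symmetric, OF A orthocols_one, of ?f, OF m])
  also have "\<dots> = (\<integral>\<^sup>+w. ind \<gamma> (sinsq P (out Q H (to_mat n r w))) \<partial>noise n r)"
  proof (rule nn_integral_cong)
    fix w
    have "A * to_mat n r w \<in> carrier_mat n r" using Ac by auto
    then have "A * to_mat n r w * 1\<^sub>m r = A * to_mat n r w" by (rule right_mult_one_mat)
    then show "?f (A * to_mat n r w * 1\<^sub>m r) = ind \<gamma> (sinsq P (out Q H (to_mat n r w)))"
      by (simp only: unitary_out[OF A Q H to_mat_carrier, symmetric] sinsq_unitary_left[OF A P out_carrier[OF to_mat_carrier]])
  qed
  finally show ?thesis .
qed

text \<open>Here the test is fixed and the codeword random, the reverse of
  \<open>random_frame_law\<close>. Rotating test, codeword and noise together shows that all fixed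
  tests give the same value, so the test may be averaged over an independent random frame.\<close>

lemma random_codeword_law:
  assumes P: "orthocols n t P" and H: "H \<in> carrier_mat t r"
  shows "(\<integral>\<^sup>+G. \<integral>\<^sup>+w. ind \<gamma> (sinsq P (out (orthonormalize (to_mat n t G)) H (to_mat n r w))) \<partial>noise n r \<partial>noise n t)
    = ennreal (beta_prod_prob n t r \<gamma>)"
proof -
  let ?o = "\<lambda>G. orthonormalize (to_mat n t G)"
  let ?I = "\<lambda>P Q. \<integral>\<^sup>+w. ind \<gamma> (sinsq P (out Q H (to_mat n r w))) \<partial>noise n r"
  let ?J = "\<lambda>P. \<integral>\<^sup>+G. ?I P (?o G) \<partial>noise n t"
  interpret N: prob_space "noise n r" by (rule prob_space_noise)
  interpret T: prob_space "noise n t" by (rule prob_space_noise)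
  interpret TT: pair_sigma_finite "noise n t" "noise n t" ..
  interpret TN: pair_sigma_finite "noise n t" "noise n r" ..
  note mo = mmat_orthonormalize[OF mmat_noise]
  have oc: "?o G \<in> carrier_mat n t" for G by (rule mmat_carrier[OF mo])
  have unit: "?J (A * P) = ?J P" if A: "orthocols n n A" and Pc: "P \<in> carrier_mat n t" for A P
  proof -
    have Ac: "A \<in> carrier_mat n n" using A by (rule orthocols_carrier)
    have AP: "A * P \<in> carrier_mat n t" using Ac Pc by auto
    let ?f = "\<lambda>X. ?I (A * P) (orthonormalize X)"
    have m: "(\<lambda>G. ?f (to_mat n t G)) \<in> borel_measurable (noise n t)"
      by (rule N.borel_measurable_nn_integral, unfold case_prod_beta, rule measurable_sinsq_out[OF mmat_const[OF AP]
        mmat_compose[OF mo measurable_fst] mmat_const[OF H] mmat_compose[OF mmat_noise measurable_snd]])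
    have "?J (A * P) = (\<integral>\<^sup>+G. ?f (A * to_mat n t G * 1\<^sub>m t) \<partial>noise n t)"
      by (rule nn_integral_noise_unitary[symmetric, OF A orthocols_one, of ?f, OF m])
    also have "\<dots> = ?J P"
    proof (rule nn_integral_cong)
      fix G
      have "A * to_mat n t G \<in> carrier_mat n t" using Ac by auto
      then have "A * to_mat n t G * 1\<^sub>m t = A * to_mat n t G" by (rule right_mult_one_mat)
      then show "?f (A * to_mat n t G * 1\<^sub>m t) = ?I P (?o G)"
        by (simp only: orthonormalize_unitary[OF A to_mat_carrier] nn_integral_out_unitary[OF A Pc oc H])
    qed
    finally show ?thesis .
  qed
  have const: "?J Q = ?J P" if Q: "orthocols n t Q" for Q
  proof -
    obtain A where A: "orthocols n n A" "A * P = Q" by (rule orthocols_eq_unitary_mult[OF P Q tn])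
    show ?thesis unfolding A(2)[symmetric] by (rule unit[OF A(1) orthocols_carrier[OF P]])
  qed
  have "?J P = (\<integral>\<^sup>+G'. ?J (?o G') \<partial>noise n t)"
  proof (rule nn_integral_prob_const[symmetric, OF prob_space_noise])
    show "AE G' in noise n t. ?J (?o G') = ?J P"
      using AE_upper_rows_full_rank(2)[OF tn order_refl]
      by eventually_elim (rule const[OF orthonormalize(1)[OF to_mat_carrier]])
  qed
  also have "\<dots> = (\<integral>\<^sup>+G. \<integral>\<^sup>+G'. ?I (?o G') (?o G) \<partial>noise n t \<partial>noise n t)"
  proof -
    have "(\<lambda>q. ?I (?o (snd q)) (?o (fst q))) \<in> borel_measurable (noise n t \<Otimes>\<^sub>M noise n t)"
      by (rule N.borel_measurable_nn_integral, unfold case_prod_beta, rule measurable_sinsq_out[OF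
        mmat_compose[OF mo measurable_compose[OF measurable_fst measurable_snd]]
        mmat_compose[OF mo measurable_compose[OF measurable_fst measurable_fst]]
        mmat_const[OF H] mmat_compose[OF mmat_noise measurable_snd]])
    then show ?thesis by (intro TT.Fubini') (simp add: case_prod_beta)
  qed
  \<comment> \<open>The test frame is now integrated innermost, with codeword and noise held fixed,
    so that the output is a constant matrix.\<close>
  also have "\<dots> = (\<integral>\<^sup>+G. \<integral>\<^sup>+w. \<integral>\<^sup>+G'. ind \<gamma> (sinsq (?o G') (out (?o G) H (to_mat n r w))) \<partial>noise n t \<partial>noise n r \<partial>noise n t)"
  proof (rule nn_integral_cong)
    fix G
    have "(\<lambda>q. ind \<gamma> (sinsq (?o (fst q)) (out (?o G) H (to_mat n r (snd q))))) \<in> borel_measurable (noise n t \<Otimes>\<^sub>M noise n r)"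
      by (rule measurable_sinsq_out[OF mmat_compose[OF mo measurable_fst] mmat_const[OF oc] mmat_const[OF H]
        mmat_compose[OF mmat_noise measurable_snd]])
    then show "(\<integral>\<^sup>+G'. ?I (?o G') (?o G) \<partial>noise n t)
      = (\<integral>\<^sup>+w. \<integral>\<^sup>+G'. ind \<gamma> (sinsq (?o G') (out (?o G) H (to_mat n r w))) \<partial>noise n t \<partial>noise n r)"
      by (intro TN.Fubini'[symmetric]) (simp add: case_prod_beta)
  qed
  also have "\<dots> = ennreal (beta_prod_prob n t r \<gamma>)"
  proof (rule nn_integral_prob_const[OF prob_space_noise], rule AE_I2)
    fix G
    let ?C = "c \<cdot>\<^sub>m (?o G * (enc t (min t r) \<rho> H * H))"
    have C: "?C \<in> carrier_mat n r" using mult_carrier_mat[OF oc enc_mult_carrier[OF H]] by simp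
    show "(\<integral>\<^sup>+w. \<integral>\<^sup>+G'. ind \<gamma> (sinsq (?o G') (out (?o G) H (to_mat n r w))) \<partial>noise n t \<partial>noise n r) = ennreal (beta_prod_prob n t r \<gamma>)"
    proof (rule nn_integral_prob_const[OF prob_space_noise])
      show "AE w in noise n r. (\<integral>\<^sup>+G'. ind \<gamma> (sinsq (?o G') (out (?o G) H (to_mat n r w))) \<partial>noise n t) = ennreal (beta_prod_prob n t r \<gamma>)"
        using AE_full_rank[OF rn C] unfolding out_def[symmetric]
        by eventually_elim (rule random_frame_law[OF t n out_carrier[OF to_mat_carrier]])
    qed
  qed
  finally show ?thesis .
qed

text \<open>The frame \<open>P\<close>, multiplied by the left singular vectors, is rotated to the
  standard frame, and the right singular vectors are applied to the output. Both leave
  \<open>sinsq\<close> unchanged and turn the noise into noise of the same law. The passage to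
  \<open>sin_mat\<close> relies on full rank and so holds almost everywhere.\<close>

lemma channel_law:
  assumes P: "orthocols n t P" and H: "H \<in> carrier_mat t r"
  shows "(\<integral>\<^sup>+w. ind \<gamma> (sinsq P (out P H (to_mat n r w))) \<partial>noise n r)
    = (\<integral>\<^sup>+w. ind \<gamma> ((sin_mat n (Int_mat n t) (c \<cdot>\<^sub>m (Int_mat n t * Dmat t r \<rho> H) + to_mat n r w))\<^sup>2) \<partial>noise n r)"
proof -
  let ?D = "Dmat t r \<rho> H" and ?K = "enc t (min t r) \<rho> H * H" and ?In = "Int_mat n t"
  obtain U V d where svd: "is_svd t r H U V d" by (rule exists_svd[OF H])
  note U = is_svdD(1)[OF svd] and V = is_svdD(2)[OF svd]
  have Pc: "P \<in> carrier_mat n t" and Uc: "U \<in> carrier_mat t t" and Vc: "V \<in> carrier_mat r r" and Ic: "?In \<in> carrier_mat n t"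
    using P U V orthocols_Int_mat[OF tn] by (auto intro: orthocols_carrier)
  have Dc: "?D \<in> carrier_mat t r" by (simp add: Dmat_def)
  have PU: "orthocols n t (P * U)" by (rule orthocols_mult[OF P U])
  obtain A where A: "orthocols n n A" "A * (P * U) = ?In"
    by (rule orthocols_eq_unitary_mult[OF PU orthocols_Int_mat[OF tn] tn])
  have Ac: "A \<in> carrier_mat n n" using A(1) by (rule orthocols_carrier)
  have K: "?K \<in> carrier_mat t r" by (rule enc_mult_carrier[OF H])
  have PK: "P * ?K \<in> carrier_mat n r" by (rule mult_carrier_mat[OF Pc K])
  let ?C = "c \<cdot>\<^sub>m (?In * ?D)"
  have C: "?C \<in> carrier_mat n r" using mult_carrier_mat[OF Ic Dc] by simp
  have AoV: "A * out P H W * V = ?C + A * W * V" if W: "W \<in> carrier_mat n r" for W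
  proof -
    have AW: "A * W \<in> carrier_mat n r" using Ac W by auto
    have APK: "A * (P * ?K) \<in> carrier_mat n r" using Ac PK by auto
    have "A * out P H W = c \<cdot>\<^sub>m (A * (P * ?K)) + A * W"
      unfolding unitary_out[OF A(1) Pc H W] unfolding out_def assoc_mult_mat[OF Ac Pc K] ..
    then have "A * out P H W * V = (c \<cdot>\<^sub>m (A * (P * ?K))) * V + A * W * V"
      using add_mult_distrib_mat[OF _ AW Vc, of "c \<cdot>\<^sub>m (A * (P * ?K))"] APK by simp
    also have "(c \<cdot>\<^sub>m (A * (P * ?K))) * V = c \<cdot>\<^sub>m (A * (P * ?K) * V)" by (rule mult_smult_assoc_mat[OF APK Vc])
    also have "A * (P * ?K) * V = A * (P * (?K * V))"
      unfolding assoc_mult_mat[OF Ac PK Vc] assoc_mult_mat[OF Pc K Vc] ..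
    also have "\<dots> = A * (P * (U * ?D))" unfolding enc_channel[OF H svd] ..
    also have "\<dots> = A * ((P * U) * ?D)" unfolding assoc_mult_mat[OF Pc Uc Dc] ..
    also have "\<dots> = (A * (P * U)) * ?D" by (rule assoc_mult_mat[symmetric, OF Ac orthocols_carrier[OF PU] Dc])
    finally show ?thesis unfolding A(2) .
  qed
  have V0: "Determinant.det V \<noteq> 0" by (rule det_unitary[OF V])
  let ?f = "\<lambda>X. ind \<gamma> (sinsq ?In (?C + X))"
  have m: "(\<lambda>w. ?f (to_mat n r w)) \<in> borel_measurable (noise n r)"
    by (rule measurable_compose[OF measurable_sinsq[OF mmat_const[OF Ic] mmat_add[OF mmat_const[OF C] mmat_noise]] measurable_ind])
  have "(\<integral>\<^sup>+w. ind \<gamma> (sinsq P (out P H (to_mat n r w))) \<partial>noise n r) = (\<integral>\<^sup>+w. ?f (A * to_mat n r w * V) \<partial>noise n r)"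
  proof (intro nn_integral_cong arg_cong[of _ _ "ind \<gamma>"])
    fix w
    let ?Y = "out P H (to_mat n r w)"
    have Y: "?Y \<in> carrier_mat n r" by (rule out_carrier[OF to_mat_carrier])
    have AY: "A * ?Y \<in> carrier_mat n r" using Ac Y by auto
    have "sinsq P ?Y = sinsq (P * U) ?Y" by (rule sinsq_unitary_right[symmetric, OF U Pc Y])
    also have "\<dots> = sinsq ?In (A * ?Y)" unfolding A(2)[symmetric]
      by (rule sinsq_unitary_left[symmetric, OF A(1) orthocols_carrier[OF PU] Y])
    also have "\<dots> = sinsq ?In (A * ?Y * V)" by (rule sinsq_invertible_right[symmetric, OF Ic AY Vc V0])
    finally show "sinsq P ?Y = sinsq ?In (?C + A * to_mat n r w * V)" unfolding AoV[OF to_mat_carrier] .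
  qed
  also have "\<dots> = (\<integral>\<^sup>+w. ?f (to_mat n r w) \<partial>noise n r)"
    by (rule nn_integral_noise_unitary[OF A(1) V, of ?f, OF m])
  also have "\<dots> = (\<integral>\<^sup>+w. ind \<gamma> ((sin_mat n ?In (?C + to_mat n r w))\<^sup>2) \<partial>noise n r)"
  proof (rule nn_integral_cong_AE)
    show "AE w in noise n r. ?f (to_mat n r w) = ind \<gamma> ((sin_mat n ?In (?C + to_mat n r w))\<^sup>2)"
      using AE_full_rank[OF rn C]
    proof eventually_elim
      case (elim w)
      have "?C + to_mat n r w \<in> carrier_mat n r" using C by simp
      then show ?case by (simp only: sin_mat_sq[OF orthocols_Int_mat[OF tn] _ elim])
    qed
  qed
  finally show ?thesis .
qed

abbreviation PP where "PP \<equiv> muH \<Otimes>\<^sub>M noise n r"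

text \<open>The first frame is the one tested, the second the one transmitted; the last argument
  pairs channel and noise.\<close>

definition hit :: "complex Matrix.mat \<Rightarrow> complex Matrix.mat \<Rightarrow> (nat \<times> nat \<Rightarrow> complex) \<times> (nat \<times> nat \<Rightarrow> complex) \<Rightarrow> bool" where
  "hit P Q q \<longleftrightarrow> sinsq P (out Q (to_mat t r (fst q)) (to_mat n r (snd q))) \<le> \<gamma>"

lemma prob_PP: "prob_space PP"
proof -
  interpret N: prob_space "noise n r" by (rule prob_space_noise)
  interpret H: prob_space muH by (rule prob_muH)
  interpret P: pair_prob_space muH "noise n r" ..
  show ?thesis by (rule P.prob_space_axioms)
qed

lemma sets_hit:
  assumes P: "P \<in> carrier_mat n t" and Q: "Q \<in> carrier_mat n t"
  shows "{q \<in> space PP. hit P Q q} \<in> sets PP"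
  unfolding hit_def
  by (rule borel_measurable_le[OF measurable_sinsq[OF mmat_const[OF P] mmat_out[OF mmat_const[OF Q]
      mmat_compose[OF mmat_muH measurable_fst] mmat_compose[OF mmat_noise measurable_snd]]] borel_measurable_const])

lemma emeasure_hit:
  assumes P: "P \<in> carrier_mat n t" and Q: "Q \<in> carrier_mat n t"
  shows "emeasure PP {q \<in> space PP. hit P Q q}
    = (\<integral>\<^sup>+h. \<integral>\<^sup>+w. ind \<gamma> (sinsq P (out Q (to_mat t r h) (to_mat n r w))) \<partial>noise n r \<partial>muH)"
proof -
  interpret N: prob_space "noise n r" by (rule prob_space_noise)
  have "(\<lambda>q. ind \<gamma> (sinsq P (out Q (to_mat t r (fst q)) (to_mat n r (snd q))))) \<in> borel_measurable PP"
    by (rule measurable_sinsq_out[OF mmat_const[OF P] mmat_const[OF Q]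
      mmat_compose[OF mmat_muH measurable_fst] mmat_compose[OF mmat_noise measurable_snd]])
  from N.nn_integral_fst[OF this]
  have "(\<integral>\<^sup>+h. \<integral>\<^sup>+w. ind \<gamma> (sinsq P (out Q (to_mat t r h) (to_mat n r w))) \<partial>noise n r \<partial>muH)
    = (\<integral>\<^sup>+q. ind \<gamma> (sinsq P (out Q (to_mat t r (fst q)) (to_mat n r (snd q)))) \<partial>PP)" by simp
  also have "\<dots> = emeasure PP {q \<in> space PP. hit P Q q}"
    unfolding nn_integral_indicator[OF sets_hit[OF P Q], symmetric]
    by (rule nn_integral_cong) (simp add: hit_def indicator_def)
  finally show ?thesis ..
qed

text \<open>For each channel matrix the probability is the same Beta value, so averaging over the
  channel changes nothing.\<close>

lemma emeasure_random_hit: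
  assumes P: "orthocols n t P"
  shows "(\<integral>\<^sup>+G. emeasure PP {q \<in> space PP. hit P (orthonormalize (to_mat n t G)) q} \<partial>noise n t)
    = ennreal (beta_prod_prob n t r \<gamma>)"
proof -
  let ?o = "\<lambda>G. orthonormalize (to_mat n t G)"
  interpret N: prob_space "noise n r" by (rule prob_space_noise)
  interpret T: prob_space "noise n t" by (rule prob_space_noise)
  interpret H: prob_space muH by (rule prob_muH)
  interpret P: pair_sigma_finite "noise n t" muH ..
  note mo = mmat_orthonormalize[OF mmat_noise]
  have Pc: "P \<in> carrier_mat n t" using P by (rule orthocols_carrier)
  have oc: "?o G \<in> carrier_mat n t" for G by (rule mmat_carrier[OF mo])
  have "(\<integral>\<^sup>+G. emeasure PP {q \<in> space PP. hit P (?o G) q} \<partial>noise n t)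
    = (\<integral>\<^sup>+G. \<integral>\<^sup>+h. \<integral>\<^sup>+w. ind \<gamma> (sinsq P (out (?o G) (to_mat t r h) (to_mat n r w))) \<partial>noise n r \<partial>muH \<partial>noise n t)"
    unfolding emeasure_hit[OF Pc oc] ..
  also have "\<dots> = (\<integral>\<^sup>+h. \<integral>\<^sup>+G. \<integral>\<^sup>+w. ind \<gamma> (sinsq P (out (?o G) (to_mat t r h) (to_mat n r w))) \<partial>noise n r \<partial>noise n t \<partial>muH)"
  proof -
    have "(\<lambda>q. \<integral>\<^sup>+w. ind \<gamma> (sinsq P (out (?o (fst q)) (to_mat t r (snd q)) (to_mat n r w))) \<partial>noise n r)
      \<in> borel_measurable (noise n t \<Otimes>\<^sub>M muH)"
      by (rule N.borel_measurable_nn_integral, unfold case_prod_beta, rule measurable_sinsq_out[OF mmat_const[OF Pc]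
        mmat_compose[OF mo measurable_compose[OF measurable_fst measurable_fst]]
        mmat_compose[OF mmat_muH measurable_compose[OF measurable_fst measurable_snd]]
        mmat_compose[OF mmat_noise measurable_snd]])
    then show ?thesis by (intro P.Fubini'[symmetric]) (simp add: case_prod_beta)
  qed
  also have "\<dots> = ennreal (beta_prod_prob n t r \<gamma>)"
    by (rule nn_integral_prob_const[OF prob_muH], rule AE_I2, rule random_codeword_law[OF P to_mat_carrier])
  finally show ?thesis .
qed

text \<open>The hypothesis concerns the diagonalised channel; integrating \<open>channel_law\<close>
  over the channel transfers it to every frame.\<close>

lemma prob_hit_self:
  assumes P: "orthocols n t P" and c0: "0 < c0"
    and hyp: "measure PP {(h, w) \<in> space PP. (sin_mat n (Int_mat n t)
        (c \<cdot>\<^sub>m (Int_mat n t * Dmat t r \<rho> (to_mat t r h)) + to_mat n r w))\<^sup>2 \<le> \<gamma>} \<ge> c0"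
  shows "measure PP {q \<in> space PP. hit P P q} \<ge> c0"
proof -
  interpret N: prob_space "noise n r" by (rule prob_space_noise)
  have Pc: "P \<in> carrier_mat n t" using P by (rule orthocols_carrier)
  let ?Y = "\<lambda>h w. c \<cdot>\<^sub>m (Int_mat n t * Dmat t r \<rho> (to_mat t r h)) + to_mat n r w"
  let ?E = "{(h, w) \<in> space PP. (sin_mat n (Int_mat n t) (?Y h w))\<^sup>2 \<le> \<gamma>}"
  \<comment> \<open>A set that is not measurable has \<open>measure\<close> 0, so the positive lower
    bound forces this event to be measurable.\<close>
  have E: "?E \<in> sets PP" using measure_notin_sets[of ?E PP] hyp c0 by linarith
  have "emeasure PP ?E = (\<integral>\<^sup>+h. \<integral>\<^sup>+w. indicator ?E (h, w) \<partial>noise n r \<partial>muH)" by (rule N.emeasure_pair_measure[OF E])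
  also have "\<dots> = (\<integral>\<^sup>+h. \<integral>\<^sup>+w. ind \<gamma> ((sin_mat n (Int_mat n t) (?Y h w))\<^sup>2) \<partial>noise n r \<partial>muH)"
    by (intro nn_integral_cong) (simp add: indicator_def space_pair_measure)
  also have "\<dots> = emeasure PP {q \<in> space PP. hit P P q}"
    unfolding emeasure_hit[OF Pc Pc] channel_law[OF P to_mat_carrier] ..
  finally show ?thesis using hyp by (simp add: measure_def)
qed

lemma measurable_prob_random_hit:
  assumes P: "P \<in> carrier_mat n t"
  shows "(\<lambda>G. emeasure PP {q \<in> space PP. hit P (orthonormalize (to_mat n t G)) q}) \<in> borel_measurable (noise n t)"
proof -
  interpret N: prob_space "noise n r" by (rule prob_space_noise)
  interpret H: prob_space muH by (rule prob_muH)
  note mo = mmat_orthonormalize[OF mmat_noise]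
  have oc: "orthonormalize (to_mat n t G) \<in> carrier_mat n t" for G by (rule mmat_carrier[OF mo])
  show ?thesis unfolding emeasure_hit[OF P oc]
    by (rule H.borel_measurable_nn_integral, unfold case_prod_beta, rule N.borel_measurable_nn_integral, unfold case_prod_beta,
      rule measurable_sinsq_out[OF mmat_const[OF P]
        mmat_compose[OF mo measurable_compose[OF measurable_fst measurable_fst]]
        mmat_compose[OF mmat_muH measurable_compose[OF measurable_fst measurable_snd]]
        mmat_compose[OF mmat_noise measurable_snd]])
qed

lemma beta_prod_prob_nonneg: "0 \<le> beta_prod_prob n t r \<gamma>"
  by (simp add: beta_prod_prob_def Let_def)

text \<open>Union bound and first moment: the expected sum of the probabilities of passing an
  earlier test is below \<tau>, hence so is the sum at some realization of full rank.\<close>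

lemma exists_new_codeword:
  assumes P: "\<And>i. i \<in> {1..M} \<Longrightarrow> orthocols n t (P i)" and M: "real M * beta_prod_prob n t r \<gamma> < \<tau>"
  obtains Q where "orthocols n t Q" "measure PP {q \<in> space PP. \<exists>i\<in>{1..M}. hit (P i) Q q} < \<tau>"
proof -
  let ?o = "\<lambda>G. orthonormalize (to_mat n t G)"
  let ?p = "\<lambda>i G. emeasure PP {q \<in> space PP. hit (P i) (?o G) q}"
  interpret T: prob_space "noise n t" by (rule prob_space_noise)
  interpret PP: prob_space PP by (rule prob_PP)
  have oc: "?o G \<in> carrier_mat n t" for G by (rule mmat_carrier[OF mmat_orthonormalize[OF mmat_noise]])
  have Pc: "P i \<in> carrier_mat n t" if "i \<in> {1..M}" for i by (rule orthocols_carrier[OF P[OF that]])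
  have "(\<integral>\<^sup>+G. (\<Sum>i\<in>{1..M}. ?p i G) \<partial>noise n t) = (\<Sum>i\<in>{1..M}. \<integral>\<^sup>+G. ?p i G \<partial>noise n t)"
    by (rule nn_integral_sum[OF measurable_prob_random_hit[OF Pc]])
  also have "\<dots> = (\<Sum>i\<in>{1..M}. ennreal (beta_prod_prob n t r \<gamma>))"
    by (rule sum.cong[OF refl], rule emeasure_random_hit[OF P])
  also have "\<dots> = ennreal (real M * beta_prod_prob n t r \<gamma>)"
    using beta_prod_prob_nonneg by (simp add: ennreal_mult ennreal_of_nat_eq_real_of_nat)
  also have "\<dots> < ennreal \<tau>"
    using M beta_prod_prob_nonneg by (intro ennreal_lessI) (auto intro: le_less_trans[rotated])
  finally have less: "(\<integral>\<^sup>+G. (\<Sum>i\<in>{1..M}. ?p i G) \<partial>noise n t) < ennreal \<tau>" .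
  \<comment> \<open>Failure at all full-rank realizations would bound the integrand from below by
    \<tau> almost everywhere.\<close>
  have "\<exists>G. full_rank (to_mat n t G) \<and> (\<Sum>i\<in>{1..M}. ?p i G) < ennreal \<tau>"
  proof (rule ccontr)
    assume a: "\<not> ?thesis"
    have "AE G in noise n t. ennreal \<tau> \<le> (\<Sum>i\<in>{1..M}. ?p i G)"
      using AE_upper_rows_full_rank(2)[OF tn order_refl]
    proof eventually_elim
      case (elim G)
      with a show ?case unfolding not_less[symmetric] by blast
    qed
    then have "(\<integral>\<^sup>+G. ennreal \<tau> \<partial>noise n t) \<le> (\<integral>\<^sup>+G. (\<Sum>i\<in>{1..M}. ?p i G) \<partial>noise n t)"
      by (rule nn_integral_mono_AE)
    with less show False using T.emeasure_space_1 by simp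
  qed
  then obtain G where G: "full_rank (to_mat n t G)" "(\<Sum>i\<in>{1..M}. ?p i G) < ennreal \<tau>" by auto
  have U: "{q \<in> space PP. \<exists>i\<in>{1..M}. hit (P i) (?o G) q} = (\<Union>i\<in>{1..M}. {q \<in> space PP. hit (P i) (?o G) q})" by auto
  have "emeasure PP {q \<in> space PP. \<exists>i\<in>{1..M}. hit (P i) (?o G) q} \<le> (\<Sum>i\<in>{1..M}. ?p i G)"
    unfolding U by (rule emeasure_subadditive_finite) (use sets_hit[OF Pc oc] in auto)
  with G(2) have "ennreal (measure PP {q \<in> space PP. \<exists>i\<in>{1..M}. hit (P i) (?o G) q}) < ennreal \<tau>"
    unfolding PP.emeasure_eq_measure[symmetric] by (rule le_less_trans[rotated])
  then have "measure PP {q \<in> space PP. \<exists>i\<in>{1..M}. hit (P i) (?o G) q} < \<tau>"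
    by (simp add: ennreal_less_iff)
  then show ?thesis by (rule that[OF orthonormalize(1)[OF to_mat_carrier G(1)]])
qed

section \<open>The greedy construction and the decoder\<close>

lemma exists_codewords:
  assumes hyp: "\<And>Q. orthocols n t Q \<Longrightarrow> measure PP {q \<in> space PP. hit Q Q q} \<ge> 1 - \<epsilon> + \<tau>"
    and \<tau>: "0 < \<tau>" and M: "(real M - 1) * beta_prod_prob n t r \<gamma> < \<tau>"
  shows "\<exists>P. \<forall>j\<in>{1..M}. orthocols n t (P j) \<and>
    measure PP {q \<in> space PP. hit (P j) (P j) q \<and> (\<forall>i\<in>{1..<j}. \<not> hit (P i) (P j) q)} \<ge> 1 - \<epsilon>"
  using M
proof (induction M)
  case (Suc M)
  interpret PP: prob_space PP by (rule prob_PP)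
  have M: "real M * beta_prod_prob n t r \<gamma> < \<tau>" using Suc.prems by simp
  then have "(real M - 1) * beta_prod_prob n t r \<gamma> < \<tau>"
    using beta_prod_prob_nonneg by (simp add: left_diff_distrib)
  from Suc.IH[OF this] obtain P where P: "\<forall>j\<in>{1..M}. orthocols n t (P j) \<and>
    measure PP {q \<in> space PP. hit (P j) (P j) q \<and> (\<forall>i\<in>{1..<j}. \<not> hit (P i) (P j) q)} \<ge> 1 - \<epsilon>" ..
  then have Po: "orthocols n t (P i)" if "i \<in> {1..M}" for i using that by auto
  obtain Q where Q: "orthocols n t Q" and Qm: "measure PP {q \<in> space PP. \<exists>i\<in>{1..M}. hit (P i) Q q} < \<tau>"
    by (rule exists_new_codeword[OF Po M])
  let ?A = "{q \<in> space PP. hit Q Q q}" and ?B = "{q \<in> space PP. \<exists>i\<in>{1..M}. hit (P i) Q q}"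
  have Qc: "Q \<in> carrier_mat n t" using Q by (rule orthocols_carrier)
  have A: "?A \<in> sets PP" by (rule sets_hit[OF Qc Qc])
  have "?B = (\<Union>i\<in>{1..M}. {q \<in> space PP. hit (P i) Q q})" by auto
  also have "\<dots> \<in> sets PP" by (intro sets.finite_UN sets_hit[OF orthocols_carrier[OF Po] Qc]) auto
  finally have B: "?B \<in> sets PP" .
  \<comment> \<open>Less than \<tau> of the probability of passing its own test is lost to outputs
    that pass an earlier one; the margin \<tau> pays for this.\<close>
  have "1 - \<epsilon> + \<tau> \<le> measure PP ?A" by (rule hyp[OF Q])
  also have "\<dots> \<le> measure PP ((?A - ?B) \<union> ?B)" using A B by (intro PP.finite_measure_mono) auto
  also have "\<dots> \<le> measure PP (?A - ?B) + measure PP ?B" using A B by (intro measure_Un_le) auto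
  finally have "1 - \<epsilon> \<le> measure PP (?A - ?B)" using Qm by simp
  also have "?A - ?B = {q \<in> space PP. hit Q Q q \<and> (\<forall>i\<in>{1..<Suc M}. \<not> hit (P i) Q q)}" by auto
  finally have new: "1 - \<epsilon> \<le> measure PP {q \<in> space PP. hit Q Q q \<and> (\<forall>i\<in>{1..<Suc M}. \<not> hit (P i) Q q)}" .
  \<comment> \<open>The event attached to an index involves frames of at most that index, so
    assigning a frame to \<open>Suc M\<close> does not disturb the earlier ones.\<close>
  let ?P = "P(Suc M := Q)"
  have "orthocols n t (?P j) \<and> measure PP {q \<in> space PP. hit (?P j) (?P j) q \<and> (\<forall>i\<in>{1..<j}. \<not> hit (?P i) (?P j) q)} \<ge> 1 - \<epsilon>"
    if j: "j \<in> {1..Suc M}" for j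
  proof -
    have pre: "?P i = P i" if "i \<in> {1..<j}" for i using that j by auto
    have e: "(\<forall>i\<in>{1..<j}. \<not> hit (?P i) X q) \<longleftrightarrow> (\<forall>i\<in>{1..<j}. \<not> hit (P i) X q)" for X q
      by (rule ball_cong[OF refl]) (simp only: pre)
    show ?thesis
    proof (cases "j = Suc M")
      case True
      then have "?P j = Q" by simp
      then show ?thesis unfolding e using Q new unfolding True by simp
    next
      case False
      then have "?P j = P j" "j \<in> {1..M}" using j by auto
      then show ?thesis unfolding e using P by simp
    qed
  qed
  then show ?case by blast
qed simp

text \<open>Choosing the least passing index matches the construction, which controls earlier tests
  only. The default 1, taken when no test passes, keeps the value among the messages.\<close>

definition dec :: "nat \<Rightarrow> (nat \<Rightarrow> complex Matrix.mat) \<Rightarrow> complex Matrix.mat \<Rightarrow> nat" where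
  "dec M P Y = (if \<exists>i\<in>{1..M}. sinsq (P i) Y \<le> \<gamma> then LEAST i. i \<in> {1..M} \<and> sinsq (P i) Y \<le> \<gamma> else 1)"

lemma dec_range: "1 \<le> M \<Longrightarrow> dec M P Y \<in> {1..M}"
proof (cases "\<exists>i\<in>{1..M}. sinsq (P i) Y \<le> \<gamma>")
  case True
  then have "\<exists>i. i \<in> {1..M} \<and> sinsq (P i) Y \<le> \<gamma>" by blast
  from LeastI_ex[OF this] True show ?thesis unfolding dec_def by simp
qed (auto simp: dec_def)

text \<open>The second alternative is the default value, which happens to be right when message 1
  was sent. It is kept so that error events can be described exactly.\<close>

lemma dec_eq_iff:
  assumes j: "j \<in> {1..M}"
  shows "dec M P Y = j \<longleftrightarrow> sinsq (P j) Y \<le> \<gamma> \<and> (\<forall>i\<in>{1..<j}. \<not> sinsq (P i) Y \<le> \<gamma>)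
    \<or> j = 1 \<and> (\<forall>i\<in>{1..M}. \<not> sinsq (P i) Y \<le> \<gamma>)"
proof (cases "\<exists>i\<in>{1..M}. sinsq (P i) Y \<le> \<gamma>")
  case True
  let ?Q = "\<lambda>i. i \<in> {1..M} \<and> sinsq (P i) Y \<le> \<gamma>"
  have d: "dec M P Y = (LEAST i. ?Q i)" using True by (simp add: dec_def)
  have "(LEAST i. ?Q i) = j \<longleftrightarrow> ?Q j \<and> (\<forall>i<j. \<not> ?Q i)"
  proof
    assume e: "(LEAST i. ?Q i) = j"
    have "\<exists>i. ?Q i" using True by blast
    from LeastI_ex[OF this] show "?Q j \<and> (\<forall>i<j. \<not> ?Q i)" unfolding e using not_less_Least[of _ ?Q, unfolded e] by blast
  next
    assume a: "?Q j \<and> (\<forall>i<j. \<not> ?Q i)"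
    show "(LEAST i. ?Q i) = j" by (rule Least_equality) (use a not_le in blast)+
  qed
  also have "\<dots> \<longleftrightarrow> sinsq (P j) Y \<le> \<gamma> \<and> (\<forall>i\<in>{1..<j}. \<not> sinsq (P i) Y \<le> \<gamma>)" using j by auto
  finally show ?thesis using True unfolding d by blast
next
  case False
  then have "dec M P Y = 1" by (simp add: dec_def)
  with False j show ?thesis by auto
qed

lemma exists_code:
  assumes hyp: "\<And>Q. orthocols n t Q \<Longrightarrow> measure PP {q \<in> space PP. hit Q Q q} \<ge> 1 - \<epsilon> + \<tau>"
    and \<tau>: "0 < \<tau>" and M1: "M \<ge> 1" and M: "(real M - 1) * beta_prod_prob n t r \<gamma> < \<tau>"
  shows "\<exists>f g. tx_code n t r \<rho> muH M \<epsilon> f g"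
proof -
  interpret PP: prob_space PP by (rule prob_PP)
  obtain P where P: "\<forall>j\<in>{1..M}. orthocols n t (P j) \<and>
    measure PP {q \<in> space PP. hit (P j) (P j) q \<and> (\<forall>i\<in>{1..<j}. \<not> hit (P i) (P j) q)} \<ge> 1 - \<epsilon>"
    using exists_codewords[OF hyp \<tau> M] by blast
  let ?f = "\<lambda>j H. c \<cdot>\<^sub>m (P j * enc t (min t r) \<rho> H)"
  have Po: "orthocols n t (P j)" if "j \<in> {1..M}" for j using P that by blast
  have Pc: "P j \<in> carrier_mat n t" if "j \<in> {1..M}" for j by (rule orthocols_carrier[OF Po[OF that]])
  have fout: "?f j H * H + W = out (P j) H W" if j: "j \<in> {1..M}" and H: "H \<in> carrier_mat t r" for j H W
  proof -
    have PE: "P j * enc t (min t r) \<rho> H \<in> carrier_mat n t" by (rule mult_carrier_mat[OF Pc[OF j] enc_carrier])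
    show ?thesis unfolding out_def mult_smult_assoc_mat[OF PE H] assoc_mult_mat[OF Pc[OF j] enc_carrier H] ..
  qed
  have "tx_code n t r \<rho> muH M \<epsilon> ?f (dec M P)"
    unfolding tx_code_def Let_def
  proof (intro conjI ballI)
    show "1 \<le> M" by (rule M1)
    show "dec M P Y \<in> {1..M}" for Y by (rule dec_range[OF M1])
    fix j assume j: "j \<in> {1..M}"
    show "?f j H \<in> carrier_mat n t" for H using mult_carrier_mat[OF Pc[OF j] enc_carrier] by simp
    show "frob2 (?f j H) \<le> real n * \<rho>" if "H \<in> carrier_mat t r" for H by (rule enc_power[OF that Po[OF j] \<rho>])
    let ?h = "\<lambda>i. {q \<in> space PP. hit (P i) (P j) q}"
    let ?G = "{q \<in> space PP. hit (P j) (P j) q \<and> (\<forall>i\<in>{1..<j}. \<not> hit (P i) (P j) q)}"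
    let ?E = "{(h, w) \<in> space PP. dec M P (?f j (to_mat t r h) * to_mat t r h + to_mat n r w) \<noteq> j}"
    have h: "?h i \<in> sets PP" if "i \<in> {1..M}" for i by (rule sets_hit[OF Pc[OF that] Pc[OF j]])
    have U: "(\<Union>i\<in>I. ?h i) \<in> sets PP" if "I \<subseteq> {1..M}" for I
      by (rule sets.finite_UN) (use that h finite_subset in auto)
    have Gs: "?G = ?h j - (\<Union>i\<in>{1..<j}. ?h i)" by auto
    have G: "?G \<in> sets PP" unfolding Gs by (intro sets.Diff h[OF j] U) (use j in auto)
    have C: "dec M P (?f j (to_mat t r h) * to_mat t r h + to_mat n r w) = j \<longleftrightarrow>
        hit (P j) (P j) (h, w) \<and> (\<forall>i\<in>{1..<j}. \<not> hit (P i) (P j) (h, w)) \<or> j = 1 \<and> (\<forall>i\<in>{1..M}. \<not> hit (P i) (P j) (h, w))" for h w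
      unfolding fout[OF j to_mat_carrier] dec_eq_iff[OF j] hit_def fst_conv snd_conv ..
    \<comment> \<open>The error event is computed exactly because its measurability is part of the
      claim; the estimate afterwards only uses that it avoids \<open>?G\<close>.\<close>
    have Es: "?E = space PP - (?G \<union> (if j = 1 then space PP - (\<Union>i\<in>{1..M}. ?h i) else {}))"
      unfolding C by (auto split: if_splits)
    show E: "?E \<in> sets PP" unfolding Es
      using G sets.compl_sets[OF U[OF order_refl]] by auto
    have "measure PP ?E \<le> measure PP (space PP - ?G)"
      by (rule PP.finite_measure_mono) (use Es sets.compl_sets[OF G] in auto)
    also have "\<dots> = 1 - measure PP ?G" by (rule PP.prob_compl[OF G])
    also have "\<dots> \<le> \<epsilon>" using P j by force
    finally show "measure PP ?E \<le> \<epsilon>" .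
  qed
  then show ?thesis by blast
qed

lemma achievability:
  assumes \<epsilon>: "\<epsilon> < 1" and \<tau>: "0 < \<tau>"
    and hit: "measure PP {(h, w) \<in> space PP. (sin_mat n (Int_mat n t)
        (c \<cdot>\<^sub>m (Int_mat n t * Dmat t r \<rho> (to_mat t r h)) + to_mat n r w))\<^sup>2 \<le> \<gamma>} \<ge> 1 - \<epsilon> + \<tau>"
  shows "\<exists>M f g. tx_code n t r \<rho> muH M \<epsilon> f g \<and> ln (\<tau> / beta_prod_prob n t r \<gamma>) / real n \<le> ln (real M) / real n"
proof -
  let ?b = "beta_prod_prob n t r \<gamma>"
  have hyp: "measure PP {q \<in> space PP. hit Q Q q} \<ge> 1 - \<epsilon> + \<tau>" if "orthocols n t Q" for Q
    by (rule prob_hit_self[OF that _ hit]) (use \<epsilon> \<tau> in simp)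
  \<comment> \<open>The least integer that reaches the quotient, so that M - 1 falls short of it,
    but at least 1 because a code needs a message. A vanishing Beta probability makes the quotient 0
    and gives M = 1.\<close>
  define M where "M = max 1 (nat \<lceil>\<tau> / ?b\<rceil>)"
  have b0: "0 \<le> ?b" by (rule beta_prod_prob_nonneg)
  have "\<tau> / ?b \<ge> 0" using b0 \<tau> by simp
  have M1: "M \<ge> 1" by (simp add: M_def)
  have Mge: "\<tau> / ?b \<le> real M" unfolding M_def using real_nat_ceiling_ge[of "\<tau> / ?b"] by linarith
  have less: "(real M - 1) * ?b < \<tau>"
  proof (cases "nat \<lceil>\<tau> / ?b\<rceil> \<le> 1")
    case True
    then show ?thesis using \<tau> by (simp add: M_def)
  next
    case False
    then have b: "?b > 0" using b0 by (cases "?b = 0") auto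
    have "real M - 1 < \<tau> / ?b" using False \<open>\<tau> / ?b \<ge> 0\<close> unfolding M_def by linarith
    then show ?thesis using b by (simp add: pos_less_divide_eq)
  qed
  obtain f g where code: "tx_code n t r \<rho> muH M \<epsilon> f g" using exists_code[OF hyp \<tau> M1 less] by blast
  have "ln (\<tau> / ?b) \<le> ln (real M)"
  \<comment> \<open>Both \<open>\<tau> / 0\<close> and \<open>ln 0\<close> are 0, so for a vanishing
    Beta probability the bound only asserts that \<open>ln (real M)\<close> is nonnegative.\<close>
  proof (cases "?b = 0")
    case False
    then have "0 < \<tau> / ?b" using b0 \<tau> by simp
    then show ?thesis using Mge M1 by (subst ln_le_cancel_iff) auto
  qed (use M1 in simp)
  then have "ln (\<tau> / ?b) / real n \<le> ln (real M) / real n" by (rule divide_right_mono) simp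
  with code show ?thesis by blast
qed

end

theorem theorem1:
  fixes n t r :: nat and \<rho> \<epsilon> \<tau> \<gamma> :: real
    and muH :: "(nat \<times> nat \<Rightarrow> complex) measure"
  assumes "t \<ge> 1" "r \<ge> 1" "\<rho> > 0"
    and "prob_space muH" "sets muH = sets (mat_space t r)"
    and "n \<ge> t + r"
    and "0 < \<epsilon>" "\<epsilon> < 1" "0 < \<tau>" "\<tau> < \<epsilon>"
    and "0 \<le> \<gamma>" "\<gamma> \<le> 1"
    and "measure (muH \<Otimes>\<^sub>M noise n r)
           {(h, w) \<in> space (muH \<Otimes>\<^sub>M noise n r).
              (sin_mat n (Int_mat n t)
                 (complex_of_real (sqrt (real n)) \<cdot>\<^sub>m (Int_mat n t * Dmat t r \<rho> (to_mat t r h))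
                  + to_mat n r w))\<^sup>2 \<le> \<gamma>}
         \<ge> 1 - \<epsilon> + \<tau>"
  shows "\<exists>M f g. tx_code n t r \<rho> muH M \<epsilon> f g \<and>
           ln (real M) / real n \<ge> ln (\<tau> / beta_prod_prob n t r \<gamma>) / real n"
  by (rule achievability[OF assms(1,6,3,4,5,8,9,13)])

end
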